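(* Let $\mathcal{M}$ be a cofibrantly generated simplicial model category such that the canonical model structure exists on the category $s\mathcal{M}$ of simplicial objects in $\mathcal{M}$. Let $L$ be an endofunctor of $\mathcal{M}$ equipped with a natural transformation $\eta\colon\mathrm{Id}\to L$. Suppose that $L$ preserves weak equivalences and is idempotent in the homotopy category $\mathrm{Ho}\,\mathcal{M}$. Then $L$ is equivalent to homotopy localization with respect to some (possibly proper) class of maps. That is, there is a class of maps $\mathcal{S}$ in $\mathcal{M}$ such that, for every object $X$, the map $\eta_X\colon X\to LX$ is in $(\mathcal{S}^{\mathrm{h}\bot})^{\mathrm{h}\bot}$ and every fibrant object weakly equivalent to $LX$ is $\mathcal{S}$-local, and every $\mathcal{S}$-local object is weakly equivalent to $LY$ for some $Y$.
   Context: Model categories are assumed complete, cocomplete, and equipped with functorial factorizations. Canonical model structure: the canonical model structure on $s\mathcal{M}$, if it exists, is the (unique) model structure in which every level equivalence is a weak equivalence, the cofibrations are the Reedy cofibrations, and the fibrant objects are the homotopically constant Reedy fibrant objects (homotopically constant means that all simplicial structure maps are weak equivalences in $\mathcal{M}$). Idempotent: since $L$ preserves weak equivalences, $L$ and $\eta$ induce an endofunctor of $\mathrm{Ho}\,\mathcal{M}$ with a natural transformation from the identity. $L$ is idempotent in $\mathrm{Ho}\,\mathcal{M}$ if, in $\mathrm{Ho}\,\mathcal{M}$, $\eta L=L\eta$ and $L\eta\colon L\to LL$ is an isomorphism. Homotopy function complexes: fix a functorial choice of a fibrant simplicial set $\mathrm{map}(X,Y)$ for all $X,Y$ in $\mathcal{M}$,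 having the homotopy type of the diagonal of $\mathcal{M}(X^*,Y_* )$, where $X^*\to X$ is a cosimplicial resolution and $Y\to Y_*$ a simplicial resolution. For simplicial $\mathcal{M}$ one may take $\mathrm{map}(X,Y)=\mathrm{Map}(QX,RY)$, with $Q$ and $R$ functorial cofibrant and fibrant approximations and $\mathrm{Map}$ the simplicial mapping space. An object $X$ and a map $f\colon A\to B$ are homotopy orthogonal if $f^*\colon \mathrm{map}(B,X)\to\mathrm{map}(A,X)$ is a weak equivalence of simplicial sets. For a class of maps $\mathcal{S}$, $\mathcal{S}^{\mathrm{h}\bot}$ is the class of fibrant objects homotopy orthogonal to all maps in $\mathcal{S}$; these objects are called $\mathcal{S}$-local. For a class of objects $\mathcal{D}$, $\mathcal{D}^{\mathrm{h}\bot}$ is the class of maps homotopy orthogonal to all objects in $\mathcal{D}$. *)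

theory Defs
  imports "HOL-Homology.Simplices" "HOL-Library.Equipollence"
begin

section \<open>Universe of small sets\<close>

text \<open>The type \<open>'u\<close> plays the role of a Grothendieck universe: a set (of any type) is small if its
  cardinality is strictly below that of \<open>'u\<close>, and \<open>'u\<close> has strongly inaccessible cardinality
  (uncountable, strong limit, regular). Categories have arbitrary types of objects and arrows, so
  possibly proper classes are just sets of objects or arrows.\<close>

definition small :: "'u itself \<Rightarrow> 'x set \<Rightarrow> bool" where
  "small U A \<longleftrightarrow> A \<prec> (UNIV :: 'u set)"

definition universe :: "'u itself \<Rightarrow> bool" where
  "universe U \<longleftrightarrow>
     small U (UNIV :: nat set) \<and>
     (\<forall>A :: 'u set. small U A \<longrightarrow> small U (Pow A)) \<and>
     (\<forall>F :: 'u set set. small U F \<longrightarrow> (\<forall>A\<in>F. small U A) \<longrightarrow> small U (\<Union>F))"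


section \<open>Categories\<close>

record ('o, 'a) category =
  Obj :: "'o set"
  Arr :: "'a set"
  Dom :: "'a \<Rightarrow> 'o"
  Cod :: "'a \<Rightarrow> 'o"
  Idt :: "'o \<Rightarrow> 'a"
  Cmp :: "'a \<Rightarrow> 'a \<Rightarrow> 'a"

abbreviation cat_comp :: "'a \<Rightarrow> ('o, 'a) category \<Rightarrow> 'a \<Rightarrow> 'a"
    (\<open>(_ \<cdot>\<^bsub>_\<^esub> _)\<close> [66, 0, 65] 65) where
  "g \<cdot>\<^bsub>C\<^esub> f \<equiv> Cmp C g f"

definition Hom :: "('o, 'a) category \<Rightarrow> 'o \<Rightarrow> 'o \<Rightarrow> 'a set" where
  "Hom C X Y = {f \<in> Arr C. Dom C f = X \<and> Cod C f = Y}"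

definition is_category :: "('o, 'a) category \<Rightarrow> bool" where
  "is_category C \<longleftrightarrow>
     (\<forall>f\<in>Arr C. Dom C f \<in> Obj C \<and> Cod C f \<in> Obj C) \<and>
     (\<forall>X\<in>Obj C. Idt C X \<in> Hom C X X) \<and>
     (\<forall>X Y Z f g. f \<in> Hom C X Y \<and> g \<in> Hom C Y Z \<longrightarrow> g \<cdot>\<^bsub>C\<^esub> f \<in> Hom C X Z) \<and>
     (\<forall>X Y f. f \<in> Hom C X Y \<longrightarrow> f \<cdot>\<^bsub>C\<^esub> Idt C X = f \<and> Idt C Y \<cdot>\<^bsub>C\<^esub> f = f) \<and>
     (\<forall>X Y Z V f g h. f \<in> Hom C X Y \<and> g \<in> Hom C Y Z \<and> h \<in> Hom C Z V \<longrightarrow>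
        h \<cdot>\<^bsub>C\<^esub> (g \<cdot>\<^bsub>C\<^esub> f) = (h \<cdot>\<^bsub>C\<^esub> g) \<cdot>\<^bsub>C\<^esub> f)"

definition locally_small :: "'u itself \<Rightarrow> ('o, 'a) category \<Rightarrow> bool" where
  "locally_small U C \<longleftrightarrow> (\<forall>X\<in>Obj C. \<forall>Y\<in>Obj C. small U (Hom C X Y))"

definition op_cat :: "('o, 'a) category \<Rightarrow> ('o, 'a) category" where
  "op_cat C = \<lparr>Obj = Obj C, Arr = Arr C, Dom = Cod C, Cod = Dom C, Idt = Idt C,
               Cmp = (\<lambda>g f. f \<cdot>\<^bsub>C\<^esub> g)\<rparr>"

definition is_iso :: "('o, 'a) category \<Rightarrow> 'a \<Rightarrow> bool" where
  "is_iso C f \<longleftrightarrow> f \<in> Arr C \<and>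
     (\<exists>g\<in>Hom C (Cod C f) (Dom C f). g \<cdot>\<^bsub>C\<^esub> f = Idt C (Dom C f) \<and> f \<cdot>\<^bsub>C\<^esub> g = Idt C (Cod C f))"

record ('o1, 'a1, 'o2, 'a2) cfunctor =
  Fo :: "'o1 \<Rightarrow> 'o2"
  Fa :: "'a1 \<Rightarrow> 'a2"

definition is_functor ::
    "('o1, 'a1) category \<Rightarrow> ('o2, 'a2) category \<Rightarrow> ('o1, 'a1, 'o2, 'a2) cfunctor \<Rightarrow> bool" where
  "is_functor C D F \<longleftrightarrow>
     (\<forall>X\<in>Obj C. Fo F X \<in> Obj D) \<and>
     (\<forall>X Y f. f \<in> Hom C X Y \<longrightarrow> Fa F f \<in> Hom D (Fo F X) (Fo F Y)) \<and>
     (\<forall>X\<in>Obj C. Fa F (Idt C X) = Idt D (Fo F X)) \<and>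
     (\<forall>X Y Z f g. f \<in> Hom C X Y \<and> g \<in> Hom C Y Z \<longrightarrow>
        Fa F (g \<cdot>\<^bsub>C\<^esub> f) = Fa F g \<cdot>\<^bsub>D\<^esub> Fa F f)"

definition id_functor :: "('o, 'a, 'o, 'a) cfunctor" where
  "id_functor = \<lparr>Fo = (\<lambda>X. X), Fa = (\<lambda>f. f)\<rparr>"

definition nat_trans ::
    "('o1, 'a1) category \<Rightarrow> ('o2, 'a2) category \<Rightarrow> ('o1, 'a1, 'o2, 'a2) cfunctor \<Rightarrow>
     ('o1, 'a1, 'o2, 'a2) cfunctor \<Rightarrow> ('o1 \<Rightarrow> 'a2) \<Rightarrow> bool" where
  "nat_trans C D F G \<tau> \<longleftrightarrow>
     (\<forall>X\<in>Obj C. \<tau> X \<in> Hom D (Fo F X) (Fo G X)) \<and>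
     (\<forall>X Y f. f \<in> Hom C X Y \<longrightarrow> \<tau> Y \<cdot>\<^bsub>D\<^esub> Fa F f = Fa G f \<cdot>\<^bsub>D\<^esub> \<tau> X)"

text \<open>Functors and transformations are made extensional outside \<open>C\<close>, so that equality in HOL is
  equality of functors and of transformations.\<close>

definition functor_cat ::
    "('o1, 'a1) category \<Rightarrow> ('o2, 'a2) category \<Rightarrow>
     (('o1, 'a1, 'o2, 'a2) cfunctor,
      ('o1, 'a1, 'o2, 'a2) cfunctor \<times> ('o1 \<Rightarrow> 'a2) \<times> ('o1, 'a1, 'o2, 'a2) cfunctor) category" where
  "functor_cat C D =
     (let Ob = {F. is_functor C D F \<and> Fo F \<in> extensional (Obj C) \<and> Fa F \<in> extensional (Arr C)}
      in \<lparr>Obj = Ob,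
          Arr = {(F, \<tau>, G). F \<in> Ob \<and> G \<in> Ob \<and> nat_trans C D F G \<tau> \<and> \<tau> \<in> extensional (Obj C)},
          Dom = (\<lambda>(F, \<tau>, G). F),
          Cod = (\<lambda>(F, \<tau>, G). G),
          Idt = (\<lambda>F. (F, \<lambda>X\<in>Obj C. Idt D (Fo F X), F)),
          Cmp = (\<lambda>(G', \<sigma>, H) (F, \<tau>, G). (F, \<lambda>X\<in>Obj C. \<sigma> X \<cdot>\<^bsub>D\<^esub> \<tau> X, H))\<rparr>)"


subsection \<open>Limits and colimits\<close>

definition is_cocone ::
    "('i, 'j) category \<Rightarrow> ('o, 'a) category \<Rightarrow> ('i, 'j, 'o, 'a) cfunctor \<Rightarrow> 'o \<Rightarrow> ('i \<Rightarrow> 'a) \<Rightarrow> bool" where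
  "is_cocone J C F c \<iota> \<longleftrightarrow> c \<in> Obj C \<and>
     (\<forall>j\<in>Obj J. \<iota> j \<in> Hom C (Fo F j) c) \<and>
     (\<forall>i j a. a \<in> Hom J i j \<longrightarrow> \<iota> j \<cdot>\<^bsub>C\<^esub> Fa F a = \<iota> i)"

definition is_colimit ::
    "('i, 'j) category \<Rightarrow> ('o, 'a) category \<Rightarrow> ('i, 'j, 'o, 'a) cfunctor \<Rightarrow> 'o \<Rightarrow> ('i \<Rightarrow> 'a) \<Rightarrow> bool" where
  "is_colimit J C F c \<iota> \<longleftrightarrow> is_cocone J C F c \<iota> \<and>
     (\<forall>d \<kappa>. is_cocone J C F d \<kappa> \<longrightarrow>
        (\<exists>!h. h \<in> Hom C c d \<and> (\<forall>j\<in>Obj J. h \<cdot>\<^bsub>C\<^esub> \<iota> j = \<kappa> j)))"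

text \<open>Every small category is isomorphic to one whose objects and arrows lie in \<open>'u\<close>.\<close>

definition cocomplete :: "'u itself \<Rightarrow> ('o, 'a) category \<Rightarrow> bool" where
  "cocomplete U C \<longleftrightarrow>
     (\<forall>(J :: ('u, 'u) category) F.
        is_category J \<and> small U (Obj J) \<and> small U (Arr J) \<and> is_functor J C F \<longrightarrow>
        (\<exists>c \<iota>. is_colimit J C F c \<iota>))"

definition complete_cat :: "'u itself \<Rightarrow> ('o, 'a) category \<Rightarrow> bool" where
  "complete_cat U C \<longleftrightarrow> cocomplete U (op_cat C)"

definition terminal :: "('o, 'a) category \<Rightarrow> 'o \<Rightarrow> bool" where
  "terminal C t \<longleftrightarrow> t \<in> Obj C \<and> (\<forall>X\<in>Obj C. \<exists>!f. f \<in> Hom C X t)"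

definition initial :: "('o, 'a) category \<Rightarrow> 'o \<Rightarrow> bool" where
  "initial C i \<longleftrightarrow> i \<in> Obj C \<and> (\<forall>X\<in>Obj C. \<exists>!f. f \<in> Hom C i X)"

text \<open>\<open>is_pushout C f g i j\<close>: the square with \<open>i \<cdot> f = j \<cdot> g\<close> is a pushout.\<close>

definition is_pushout :: "('o, 'a) category \<Rightarrow> 'a \<Rightarrow> 'a \<Rightarrow> 'a \<Rightarrow> 'a \<Rightarrow> bool" where
  "is_pushout C f g i j \<longleftrightarrow>
     f \<in> Arr C \<and> g \<in> Arr C \<and> Dom C f = Dom C g \<and>
     i \<in> Hom C (Cod C f) (Cod C i) \<and> j \<in> Hom C (Cod C g) (Cod C i) \<and>
     i \<cdot>\<^bsub>C\<^esub> f = j \<cdot>\<^bsub>C\<^esub> g \<and>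
     (\<forall>Z u v. u \<in> Hom C (Cod C f) Z \<and> v \<in> Hom C (Cod C g) Z \<and> u \<cdot>\<^bsub>C\<^esub> f = v \<cdot>\<^bsub>C\<^esub> g \<longrightarrow>
        (\<exists>!h. h \<in> Hom C (Cod C i) Z \<and> h \<cdot>\<^bsub>C\<^esub> i = u \<and> h \<cdot>\<^bsub>C\<^esub> j = v))"


section \<open>Model categories\<close>

record 'a model_structure =
  Weq :: "'a set"
  Cof :: "'a set"
  Fib :: "'a set"

definition lifts :: "('o, 'a) category \<Rightarrow> 'a \<Rightarrow> 'a \<Rightarrow> bool" where
  "lifts C i p \<longleftrightarrow>
     (\<forall>u v. u \<in> Hom C (Dom C i) (Dom C p) \<and> v \<in> Hom C (Cod C i) (Cod C p) \<and>
            p \<cdot>\<^bsub>C\<^esub> u = v \<cdot>\<^bsub>C\<^esub> i \<longrightarrow>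
        (\<exists>h\<in>Hom C (Cod C i) (Dom C p). h \<cdot>\<^bsub>C\<^esub> i = u \<and> p \<cdot>\<^bsub>C\<^esub> h = v))"

definition rlp :: "('o, 'a) category \<Rightarrow> 'a set \<Rightarrow> 'a set" where
  "rlp C S = {p \<in> Arr C. \<forall>i\<in>S. lifts C i p}"

definition is_retract :: "('o, 'a) category \<Rightarrow> 'a \<Rightarrow> 'a \<Rightarrow> bool" where
  "is_retract C f g \<longleftrightarrow> f \<in> Arr C \<and> g \<in> Arr C \<and>
     (\<exists>s t r q. s \<in> Hom C (Dom C f) (Dom C g) \<and> r \<in> Hom C (Dom C g) (Dom C f) \<and>
                t \<in> Hom C (Cod C f) (Cod C g) \<and> q \<in> Hom C (Cod C g) (Cod C f) \<and>
                g \<cdot>\<^bsub>C\<^esub> s = t \<cdot>\<^bsub>C\<^esub> f \<and> f \<cdot>\<^bsub>C\<^esub> r = q \<cdot>\<^bsub>C\<^esub> g \<and>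
                r \<cdot>\<^bsub>C\<^esub> s = Idt C (Dom C f) \<and> q \<cdot>\<^bsub>C\<^esub> t = Idt C (Cod C f))"

definition retract_closed :: "('o, 'a) category \<Rightarrow> 'a set \<Rightarrow> bool" where
  "retract_closed C S \<longleftrightarrow> (\<forall>f g. g \<in> S \<and> is_retract C f g \<longrightarrow> f \<in> S)"

definition two_of_three :: "('o, 'a) category \<Rightarrow> 'a set \<Rightarrow> bool" where
  "two_of_three C W \<longleftrightarrow>
     (\<forall>X Y Z f g. f \<in> Hom C X Y \<and> g \<in> Hom C Y Z \<longrightarrow>
        (f \<in> W \<and> g \<in> W \<longrightarrow> g \<cdot>\<^bsub>C\<^esub> f \<in> W) \<and>
        (f \<in> W \<and> g \<cdot>\<^bsub>C\<^esub> f \<in> W \<longrightarrow> g \<in> W) \<and>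
        (g \<in> W \<and> g \<cdot>\<^bsub>C\<^esub> f \<in> W \<longrightarrow> f \<in> W))"

text \<open>\<open>arrow_square C f g u v\<close>: the pair \<open>(u, v)\<close> is a morphism from \<open>f\<close> to \<open>g\<close> in the category of arrows.\<close>

definition arrow_square :: "('o, 'a) category \<Rightarrow> 'a \<Rightarrow> 'a \<Rightarrow> 'a \<Rightarrow> 'a \<Rightarrow> bool" where
  "arrow_square C f g u v \<longleftrightarrow> f \<in> Arr C \<and> g \<in> Arr C \<and>
     u \<in> Hom C (Dom C f) (Dom C g) \<and> v \<in> Hom C (Cod C f) (Cod C g) \<and> g \<cdot>\<^bsub>C\<^esub> u = v \<cdot>\<^bsub>C\<^esub> f"

text \<open>The middle object \<open>E f\<close> of the factorization \<open>f = p f \<cdot> i f\<close> is functorial in \<open>f\<close>, with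
  action \<open>m f g u v : E f \<rightarrow> E g\<close> on squares, compatibly with \<open>i\<close> and \<open>p\<close>.\<close>

definition functorial_factorization :: "('o, 'a) category \<Rightarrow> 'a set \<Rightarrow> 'a set \<Rightarrow> bool" where
  "functorial_factorization C A B \<longleftrightarrow>
     (\<exists>(E :: 'a \<Rightarrow> 'o) i p m.
        (\<forall>f\<in>Arr C. i f \<in> A \<inter> Hom C (Dom C f) (E f) \<and> p f \<in> B \<inter> Hom C (E f) (Cod C f) \<and>
                    p f \<cdot>\<^bsub>C\<^esub> i f = f) \<and>
        (\<forall>f g u v. arrow_square C f g u v \<longrightarrow>
           m f g u v \<in> Hom C (E f) (E g) \<and>
           m f g u v \<cdot>\<^bsub>C\<^esub> i f = i g \<cdot>\<^bsub>C\<^esub> u \<and> p g \<cdot>\<^bsub>C\<^esub> m f g u v = v \<cdot>\<^bsub>C\<^esub> p f) \<and>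
        (\<forall>f\<in>Arr C. m f f (Idt C (Dom C f)) (Idt C (Cod C f)) = Idt C (E f)) \<and>
        (\<forall>f g h u v u' v'. arrow_square C f g u v \<and> arrow_square C g h u' v' \<longrightarrow>
           m f h (u' \<cdot>\<^bsub>C\<^esub> u) (v' \<cdot>\<^bsub>C\<^esub> v) = m g h u' v' \<cdot>\<^bsub>C\<^esub> m f g u v))"

definition model_category ::
    "'u itself \<Rightarrow> ('o, 'a) category \<Rightarrow> 'a model_structure \<Rightarrow> bool" where
  "model_category U C T \<longleftrightarrow>
     is_category C \<and> locally_small U C \<and> complete_cat U C \<and> cocomplete U C \<and>
     Weq T \<subseteq> Arr C \<and> Cof T \<subseteq> Arr C \<and> Fib T \<subseteq> Arr C \<and>
     two_of_three C (Weq T) \<and>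
     retract_closed C (Weq T) \<and> retract_closed C (Cof T) \<and> retract_closed C (Fib T) \<and>
     (\<forall>i\<in>Cof T. \<forall>p\<in>Fib T. i \<in> Weq T \<or> p \<in> Weq T \<longrightarrow> lifts C i p) \<and>
     functorial_factorization C (Cof T) (Fib T \<inter> Weq T) \<and>
     functorial_factorization C (Cof T \<inter> Weq T) (Fib T)"

definition cofibrant :: "('o, 'a) category \<Rightarrow> 'a set \<Rightarrow> 'o \<Rightarrow> bool" where
  "cofibrant C Cofs X \<longleftrightarrow> X \<in> Obj C \<and> (\<exists>i. initial C i \<and> (\<exists>f\<in>Hom C i X. f \<in> Cofs))"

definition fibrant :: "('o, 'a) category \<Rightarrow> 'a set \<Rightarrow> 'o \<Rightarrow> bool" where
  "fibrant C Fibs X \<longleftrightarrow> X \<in> Obj C \<and> (\<exists>t. terminal C t \<and> (\<exists>f\<in>Hom C X t. f \<in> Fibs))"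

text \<open>Connected by a zigzag of weak equivalences.\<close>

definition weakly_equivalent ::
    "('o, 'a) category \<Rightarrow> 'a model_structure \<Rightarrow> 'o \<Rightarrow> 'o \<Rightarrow> bool" where
  "weakly_equivalent C T X Y \<longleftrightarrow>
     X \<in> Obj C \<and> Y \<in> Obj C \<and> equivclp (\<lambda>A B. \<exists>w\<in>Weq T. w \<in> Hom C A B) X Y"

definition functorial_cofibrant_approximation ::
    "('o, 'a) category \<Rightarrow> 'a model_structure \<Rightarrow> ('o, 'a, 'o, 'a) cfunctor \<Rightarrow> ('o \<Rightarrow> 'a) \<Rightarrow> bool" where
  "functorial_cofibrant_approximation C T Q q \<longleftrightarrow>
     is_functor C C Q \<and> nat_trans C C Q id_functor q \<and>
     (\<forall>X\<in>Obj C. cofibrant C (Cof T) (Fo Q X) \<and> q X \<in> Weq T)"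

definition functorial_fibrant_approximation ::
    "('o, 'a) category \<Rightarrow> 'a model_structure \<Rightarrow> ('o, 'a, 'o, 'a) cfunctor \<Rightarrow> ('o \<Rightarrow> 'a) \<Rightarrow> bool" where
  "functorial_fibrant_approximation C T R r \<longleftrightarrow>
     is_functor C C R \<and> nat_trans C C id_functor R r \<and>
     (\<forall>X\<in>Obj C. fibrant C (Fib T) (Fo R X) \<and> r X \<in> Weq T)"


subsection \<open>Cofibrant generation\<close>

text \<open>Ordinals are small well-orders on subsets of \<open>'u\<close>.\<close>

definition ord_cat :: "'u rel \<Rightarrow> ('u, 'u \<times> 'u) category" where
  "ord_cat r = \<lparr>Obj = Field r, Arr = r, Dom = fst, Cod = snd, Idt = (\<lambda>a. (a, a)),
                Cmp = (\<lambda>(b', c) (a, b). (a, c))\<rparr>"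

definition ord_min :: "'u rel \<Rightarrow> 'u \<Rightarrow> bool" where
  "ord_min r a \<longleftrightarrow> a \<in> Field r \<and> (\<forall>b\<in>Field r. (a, b) \<in> r)"

definition ord_succ :: "'u rel \<Rightarrow> 'u \<Rightarrow> 'u \<Rightarrow> bool" where
  "ord_succ r a b \<longleftrightarrow> (a, b) \<in> r \<and> a \<noteq> b \<and>
     (\<forall>c. (a, c) \<in> r \<and> (c, b) \<in> r \<longrightarrow> c = a \<or> c = b)"

definition ord_limit :: "'u rel \<Rightarrow> 'u \<Rightarrow> bool" where
  "ord_limit r a \<longleftrightarrow> a \<in> Field r \<and> \<not> ord_min r a \<and> (\<nexists>b. ord_succ r b a)"

text \<open>A transfinite sequence in \<open>C\<close>, continuous at limit ordinals, with successor steps in \<open>D\<close>.\<close>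

definition lambda_sequence ::
    "('o, 'a) category \<Rightarrow> 'a set \<Rightarrow> 'u rel \<Rightarrow> ('u, 'u \<times> 'u, 'o, 'a) cfunctor \<Rightarrow> bool" where
  "lambda_sequence C D r X \<longleftrightarrow>
     is_functor (ord_cat r) C X \<and>
     (\<forall>a b. ord_succ r a b \<longrightarrow> Fa X (a, b) \<in> D) \<and>
     (\<forall>c. ord_limit r c \<longrightarrow>
        is_colimit (ord_cat (Restr r (underS r c))) C X (Fo X c) (\<lambda>b. Fa X (b, c)))"

definition cobase_changes :: "('o, 'a) category \<Rightarrow> 'a set \<Rightarrow> 'a set" where
  "cobase_changes C I = {g. \<exists>f\<in>I. \<exists>u v. is_pushout C f u v g}"

definition relative_cells :: "'u itself \<Rightarrow> ('o, 'a) category \<Rightarrow> 'a set \<Rightarrow> 'a set" where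
  "relative_cells U C I =
     {f. \<exists>(r :: 'u rel) X c \<iota> a.
           Well_order r \<and> small U (Field r) \<and> lambda_sequence C (cobase_changes C I) r X \<and>
           is_colimit (ord_cat r) C X c \<iota> \<and> ord_min r a \<and> f = \<iota> a}"

text \<open>The canonical map from \<open>colim Hom(W, X\<^sub>b)\<close> to \<open>Hom(W, colim X\<^sub>b)\<close> is bijective, written out using
  the usual description of filtered colimits of sets.\<close>

definition small_relative :: "'u itself \<Rightarrow> ('o, 'a) category \<Rightarrow> 'a set \<Rightarrow> 'o \<Rightarrow> bool" where
  "small_relative U C D W \<longleftrightarrow>
     (\<exists>\<kappa> :: 'u rel. Card_order \<kappa> \<and> small U (Field \<kappa>) \<and>
       (\<forall>(r :: 'u rel) X c \<iota>.
          Cinfinite r \<and> regularCard r \<and> small U (Field r) \<and> \<kappa> \<le>o r \<and>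
          lambda_sequence C D r X \<and> is_colimit (ord_cat r) C X c \<iota> \<longrightarrow>
          (\<forall>g\<in>Hom C W c. \<exists>b\<in>Field r. \<exists>h\<in>Hom C W (Fo X b). g = \<iota> b \<cdot>\<^bsub>C\<^esub> h) \<and>
          (\<forall>b\<in>Field r. \<forall>h\<in>Hom C W (Fo X b). \<forall>h'\<in>Hom C W (Fo X b).
             \<iota> b \<cdot>\<^bsub>C\<^esub> h = \<iota> b \<cdot>\<^bsub>C\<^esub> h' \<longrightarrow>
             (\<exists>b'. (b, b') \<in> r \<and> Fa X (b, b') \<cdot>\<^bsub>C\<^esub> h = Fa X (b, b') \<cdot>\<^bsub>C\<^esub> h'))))"

definition permits_small_object_argument ::
    "'u itself \<Rightarrow> ('o, 'a) category \<Rightarrow> 'a set \<Rightarrow> bool" where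
  "permits_small_object_argument U C I \<longleftrightarrow>
     (\<forall>f\<in>I. small_relative U C (relative_cells U C I) (Dom C f))"

definition cofibrantly_generated ::
    "'u itself \<Rightarrow> ('o, 'a) category \<Rightarrow> 'a model_structure \<Rightarrow> bool" where
  "cofibrantly_generated U C T \<longleftrightarrow>
     (\<exists>I J. I \<subseteq> Arr C \<and> J \<subseteq> Arr C \<and> small U I \<and> small U J \<and>
        permits_small_object_argument U C I \<and> permits_small_object_argument U C J \<and>
        Fib T \<inter> Weq T = rlp C I \<and> Fib T = rlp C J)"


section \<open>The simplex category and simplicial objects\<close>

text \<open>The object \<open>[n]\<close> is encoded as \<open>n\<close>, i.e. the ordered set \<open>{..n}\<close>.\<close>

type_synonym ord_map = "nat \<times> (nat \<Rightarrow> nat) \<times> nat"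

definition Delta :: "(nat, ord_map) category" where
  "Delta = \<lparr>Obj = UNIV,
            Arr = {(m, f, n). f \<in> {..m} \<rightarrow>\<^sub>E {..n} \<and> mono_on {..m} f},
            Dom = (\<lambda>(m, f, n). m),
            Cod = (\<lambda>(m, f, n). n),
            Idt = (\<lambda>n. (n, \<lambda>i\<in>{..n}. i, n)),
            Cmp = (\<lambda>(n', g, p) (m, f, n). (m, compose {..m} g f, p))\<rparr>"

definition om_inj :: "ord_map \<Rightarrow> bool" where
  "om_inj = (\<lambda>(m, f, n). inj_on f {..m})"

definition om_surj :: "ord_map \<Rightarrow> bool" where
  "om_surj = (\<lambda>(m, f, n). f ` {..m} = {..n})"

type_synonym ('o, 'a) simplicial = "(nat, ord_map, 'o, 'a) cfunctor"
type_synonym ('o, 'a) simplicial_map = "('o, 'a) simplicial \<times> (nat \<Rightarrow> 'a) \<times> ('o, 'a) simplicial"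

definition simplicial_objects ::
    "('o, 'a) category \<Rightarrow> (('o, 'a) simplicial, ('o, 'a) simplicial_map) category" where
  "simplicial_objects C = functor_cat (op_cat Delta) C"


subsection \<open>Reedy cofibrations and fibrations\<close>

text \<open>The latching category at \<open>[n]\<close>: degree raising maps of \<open>Delta\<^sup>o\<^sup>p\<close> with target \<open>[n]\<close> other than the
  identity, i.e. proper surjections \<open>\<sigma> : [n] \<rightarrow> [k]\<close>. A morphism \<open>(\<sigma>, \<phi>, \<tau>)\<close> from \<open>\<sigma>\<close> to \<open>\<tau>\<close> is
  a surjection \<open>\<phi>\<close> with \<open>\<phi> \<cdot> \<tau> = \<sigma>\<close>. Dually, objects of the matching category are proper
  injections \<open>\<delta> : [k] \<rightarrow> [n]\<close>, and a morphism \<open>(\<delta>, \<phi>, \<epsilon>)\<close> is an injection with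
  \<open>\<delta> \<cdot> \<phi> = \<epsilon>\<close>.\<close>

definition latching_cat :: "nat \<Rightarrow> (ord_map, ord_map \<times> ord_map \<times> ord_map) category" where
  "latching_cat n =
     (let Ob = {\<sigma> \<in> Arr Delta. Dom Delta \<sigma> = n \<and> Cod Delta \<sigma> < n \<and> om_surj \<sigma>}
      in \<lparr>Obj = Ob,
          Arr = {(\<sigma>, \<phi>, \<tau>). \<sigma> \<in> Ob \<and> \<tau> \<in> Ob \<and> \<phi> \<in> Hom Delta (Cod Delta \<tau>) (Cod Delta \<sigma>) \<and>
                             om_surj \<phi> \<and> \<phi> \<cdot>\<^bsub>Delta\<^esub> \<tau> = \<sigma>},
          Dom = (\<lambda>(\<sigma>, \<phi>, \<tau>). \<sigma>),
          Cod = (\<lambda>(\<sigma>, \<phi>, \<tau>). \<tau>),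
          Idt = (\<lambda>\<sigma>. (\<sigma>, Idt Delta (Cod Delta \<sigma>), \<sigma>)),
          Cmp = (\<lambda>(\<tau>', \<psi>, \<rho>) (\<sigma>, \<phi>, \<tau>). (\<sigma>, \<phi> \<cdot>\<^bsub>Delta\<^esub> \<psi>, \<rho>))\<rparr>)"

definition matching_cat :: "nat \<Rightarrow> (ord_map, ord_map \<times> ord_map \<times> ord_map) category" where
  "matching_cat n =
     (let Ob = {\<delta> \<in> Arr Delta. Cod Delta \<delta> = n \<and> Dom Delta \<delta> < n \<and> om_inj \<delta>}
      in \<lparr>Obj = Ob,
          Arr = {(\<delta>, \<phi>, \<epsilon>). \<delta> \<in> Ob \<and> \<epsilon> \<in> Ob \<and> \<phi> \<in> Hom Delta (Dom Delta \<epsilon>) (Dom Delta \<delta>) \<and>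
                             om_inj \<phi> \<and> \<delta> \<cdot>\<^bsub>Delta\<^esub> \<phi> = \<epsilon>},
          Dom = (\<lambda>(\<delta>, \<phi>, \<epsilon>). \<delta>),
          Cod = (\<lambda>(\<delta>, \<phi>, \<epsilon>). \<epsilon>),
          Idt = (\<lambda>\<delta>. (\<delta>, Idt Delta (Dom Delta \<delta>), \<delta>)),
          Cmp = (\<lambda>(\<epsilon>', \<psi>, \<zeta>) (\<delta>, \<phi>, \<epsilon>). (\<delta>, \<phi> \<cdot>\<^bsub>Delta\<^esub> \<psi>, \<zeta>))\<rparr>)"

definition latching_diagram ::
    "('o, 'a) simplicial \<Rightarrow> (ord_map, ord_map \<times> ord_map \<times> ord_map, 'o, 'a) cfunctor" where
  "latching_diagram X = \<lparr>Fo = (\<lambda>\<sigma>. Fo X (Cod Delta \<sigma>)), Fa = (\<lambda>(\<sigma>, \<phi>, \<tau>). Fa X \<phi>)\<rparr>"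

definition matching_diagram ::
    "('o, 'a) simplicial \<Rightarrow> (ord_map, ord_map \<times> ord_map \<times> ord_map, 'o, 'a) cfunctor" where
  "matching_diagram X = \<lparr>Fo = (\<lambda>\<delta>. Fo X (Dom Delta \<delta>)), Fa = (\<lambda>(\<delta>, \<phi>, \<epsilon>). Fa X \<phi>)\<rparr>"

text \<open>Given diagrams \<open>F, G : J \<rightarrow> C\<close>, cocones \<open>a : F \<rightarrow> x\<close> and \<open>b : G \<rightarrow> y\<close>, and compatible maps
  \<open>\<tau> : F \<rightarrow> G\<close>, \<open>t : x \<rightarrow> y\<close>, the arrow \<open>l\<close> is the induced map from the pushout of
  \<open>x \<leftarrow> colim F \<rightarrow> colim G\<close> to \<open>y\<close>.\<close>

definition corner_map ::
    "('i, 'j) category \<Rightarrow> ('o, 'a) category \<Rightarrow>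
     ('i, 'j, 'o, 'a) cfunctor \<Rightarrow> 'o \<Rightarrow> ('i \<Rightarrow> 'a) \<Rightarrow>
     ('i, 'j, 'o, 'a) cfunctor \<Rightarrow> 'o \<Rightarrow> ('i \<Rightarrow> 'a) \<Rightarrow> ('i \<Rightarrow> 'a) \<Rightarrow> 'a \<Rightarrow> 'a \<Rightarrow> bool" where
  "corner_map J C F x a G y b \<tau> t l \<longleftrightarrow>
     (\<exists>cF \<iota> cG \<kappa> h p q i j.
        is_colimit J C F cF \<iota> \<and> is_colimit J C G cG \<kappa> \<and>
        h \<in> Hom C cF cG \<and> (\<forall>s\<in>Obj J. h \<cdot>\<^bsub>C\<^esub> \<iota> s = \<kappa> s \<cdot>\<^bsub>C\<^esub> \<tau> s) \<and>
        p \<in> Hom C cF x \<and> (\<forall>s\<in>Obj J. p \<cdot>\<^bsub>C\<^esub> \<iota> s = a s) \<and>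
        q \<in> Hom C cG y \<and> (\<forall>s\<in>Obj J. q \<cdot>\<^bsub>C\<^esub> \<kappa> s = b s) \<and>
        is_pushout C p h i j \<and>
        l \<in> Hom C (Cod C i) y \<and> l \<cdot>\<^bsub>C\<^esub> i = t \<and> l \<cdot>\<^bsub>C\<^esub> j = q)"

definition relative_latching_map ::
    "('o, 'a) category \<Rightarrow> ('o, 'a) simplicial_map \<Rightarrow> nat \<Rightarrow> 'a \<Rightarrow> bool" where
  "relative_latching_map C = (\<lambda>(X, \<tau>, Y) n l.
     corner_map (latching_cat n) C
       (latching_diagram X) (Fo X n) (Fa X) (latching_diagram Y) (Fo Y n) (Fa Y)
       (\<lambda>\<sigma>. \<tau> (Cod Delta \<sigma>)) (\<tau> n) l)"

text \<open>Dually, in the opposite category: \<open>X\<^sub>n \<rightarrow> Y\<^sub>n \<times>\<^bsub>M\<^sub>nY\<^esub> M\<^sub>nX\<close>.\<close>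

definition relative_matching_map ::
    "('o, 'a) category \<Rightarrow> ('o, 'a) simplicial_map \<Rightarrow> nat \<Rightarrow> 'a \<Rightarrow> bool" where
  "relative_matching_map C = (\<lambda>(X, \<tau>, Y) n l.
     corner_map (op_cat (matching_cat n)) (op_cat C)
       (matching_diagram Y) (Fo Y n) (Fa Y) (matching_diagram X) (Fo X n) (Fa X)
       (\<lambda>\<delta>. \<tau> (Dom Delta \<delta>)) (\<tau> n) l)"

definition reedy_cofibrations ::
    "('o, 'a) category \<Rightarrow> 'a model_structure \<Rightarrow> ('o, 'a) simplicial_map set" where
  "reedy_cofibrations C T =
     {f \<in> Arr (simplicial_objects C). \<forall>n. \<exists>l\<in>Cof T. relative_latching_map C f n l}"

definition reedy_fibrations ::
    "('o, 'a) category \<Rightarrow> 'a model_structure \<Rightarrow> ('o, 'a) simplicial_map set" where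
  "reedy_fibrations C T =
     {f \<in> Arr (simplicial_objects C). \<forall>n. \<exists>l\<in>Fib T. relative_matching_map C f n l}"

definition level_equivalences ::
    "('o, 'a) category \<Rightarrow> 'a model_structure \<Rightarrow> ('o, 'a) simplicial_map set" where
  "level_equivalences C T =
     {(X, \<tau>, Y) \<in> Arr (simplicial_objects C). \<forall>n. \<tau> n \<in> Weq T}"

definition homotopically_constant :: "'a model_structure \<Rightarrow> ('o, 'a) simplicial \<Rightarrow> bool" where
  "homotopically_constant T X \<longleftrightarrow> (\<forall>\<alpha>\<in>Arr Delta. Fa X \<alpha> \<in> Weq T)"

definition canonical_model_structure_exists ::
    "'u itself \<Rightarrow> ('o, 'a) category \<Rightarrow> 'a model_structure \<Rightarrow> bool" where
  "canonical_model_structure_exists U C T \<longleftrightarrow>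
     (\<exists>T'. model_category U (simplicial_objects C) T' \<and>
        level_equivalences C T \<subseteq> Weq T' \<and>
        Cof T' = reedy_cofibrations C T \<and>
        (\<forall>X\<in>Obj (simplicial_objects C).
           fibrant (simplicial_objects C) (Fib T') X \<longleftrightarrow>
           homotopically_constant T X \<and>
           fibrant (simplicial_objects C) (reedy_fibrations C T) X))"


section \<open>Simplicial sets\<close>

record 'x sset =
  Simp :: "nat \<Rightarrow> 'x set"
  SAct :: "ord_map \<Rightarrow> 'x \<Rightarrow> 'x"

definition is_sset :: "'x sset \<Rightarrow> bool" where
  "is_sset X \<longleftrightarrow>
     (\<forall>m n \<alpha> x. \<alpha> \<in> Hom Delta m n \<and> x \<in> Simp X n \<longrightarrow> SAct X \<alpha> x \<in> Simp X m) \<and>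
     (\<forall>n x. x \<in> Simp X n \<longrightarrow> SAct X (Idt Delta n) x = x) \<and>
     (\<forall>l m n \<alpha> \<beta> x. \<alpha> \<in> Hom Delta l m \<and> \<beta> \<in> Hom Delta m n \<and> x \<in> Simp X n \<longrightarrow>
        SAct X (\<beta> \<cdot>\<^bsub>Delta\<^esub> \<alpha>) x = SAct X \<alpha> (SAct X \<beta> x))"

definition small_sset :: "'u itself \<Rightarrow> 'x sset \<Rightarrow> bool" where
  "small_sset U X \<longleftrightarrow> is_sset X \<and> (\<forall>n. small U (Simp X n))"

definition sset_map :: "'x sset \<Rightarrow> 'y sset \<Rightarrow> (nat \<Rightarrow> 'x \<Rightarrow> 'y) \<Rightarrow> bool" where
  "sset_map X Y f \<longleftrightarrow>
     (\<forall>n. \<forall>x\<in>Simp X n. f n x \<in> Simp Y n) \<and>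
     (\<forall>m n \<alpha> x. \<alpha> \<in> Hom Delta m n \<and> x \<in> Simp X n \<longrightarrow> f m (SAct X \<alpha> x) = SAct Y \<alpha> (f n x))"

definition sset_prod :: "'x sset \<Rightarrow> 'y sset \<Rightarrow> ('x \<times> 'y) sset" where
  "sset_prod X Y = \<lparr>Simp = (\<lambda>n. Simp X n \<times> Simp Y n),
                    SAct = (\<lambda>\<alpha> (x, y). (SAct X \<alpha> x, SAct Y \<alpha> y))\<rparr>"

definition std_simplex :: "nat \<Rightarrow> ord_map sset" where
  "std_simplex n = \<lparr>Simp = (\<lambda>m. Hom Delta m n), SAct = (\<lambda>\<alpha> \<theta>. \<theta> \<cdot>\<^bsub>Delta\<^esub> \<alpha>)\<rparr>"

definition horn :: "nat \<Rightarrow> nat \<Rightarrow> ord_map sset" where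
  "horn n k = \<lparr>Simp = (\<lambda>m. {\<theta> \<in> Hom Delta m n. \<not> {..n} - {k} \<subseteq> fst (snd \<theta>) ` {..m}}),
               SAct = SAct (std_simplex n)\<rparr>"

definition kan_fibration :: "'x sset \<Rightarrow> 'y sset \<Rightarrow> (nat \<Rightarrow> 'x \<Rightarrow> 'y) \<Rightarrow> bool" where
  "kan_fibration X Y p \<longleftrightarrow> sset_map X Y p \<and>
     (\<forall>n\<ge>1. \<forall>k\<le>n. \<forall>u v.
        sset_map (horn n k) X u \<and> sset_map (std_simplex n) Y v \<and>
        (\<forall>m. \<forall>\<theta>\<in>Simp (horn n k) m. p m (u m \<theta>) = v m \<theta>) \<longrightarrow>
        (\<exists>h. sset_map (std_simplex n) X h \<and>
           (\<forall>m. \<forall>\<theta>\<in>Simp (horn n k) m. h m \<theta> = u m \<theta>) \<and>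
           (\<forall>m. \<forall>\<theta>\<in>Simp (std_simplex n) m. p m (h m \<theta>) = v m \<theta>)))"


subsection \<open>Geometric realization and weak equivalences\<close>

definition simplex_pushforward :: "ord_map \<Rightarrow> (nat \<Rightarrow> real) \<Rightarrow> (nat \<Rightarrow> real)" where
  "simplex_pushforward = (\<lambda>(m, f, n) t j. \<Sum>i | i \<le> m \<and> f i = j. t i)"

type_synonym 'x real_point = "nat \<times> 'x \<times> (nat \<Rightarrow> real)"

definition realization_carrier :: "'x sset \<Rightarrow> 'x real_point set" where
  "realization_carrier X = {(n, x, t). x \<in> Simp X n \<and> t \<in> standard_simplex n}"

definition realization_step :: "'x sset \<Rightarrow> 'x real_point \<Rightarrow> 'x real_point \<Rightarrow> bool" where
  "realization_step X a b \<longleftrightarrow>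
     (\<exists>m n \<alpha> x t. \<alpha> \<in> Hom Delta m n \<and> x \<in> Simp X n \<and> t \<in> standard_simplex m \<and>
        a = (m, SAct X \<alpha> x, t) \<and> b = (n, x, simplex_pushforward \<alpha> t))"

definition realization_rel :: "'x sset \<Rightarrow> 'x real_point rel" where
  "realization_rel X = {(a, b). a \<in> realization_carrier X \<and> b \<in> realization_carrier X \<and>
                                equivclp (realization_step X) a b}"

definition realization_open :: "'x sset \<Rightarrow> 'x real_point set set \<Rightarrow> bool" where
  "realization_open X V \<longleftrightarrow>
     V \<subseteq> realization_carrier X // realization_rel X \<and>
     (\<forall>n. \<forall>x\<in>Simp X n.
        openin (subtopology (powertop_real UNIV) (standard_simplex n))
          {t \<in> standard_simplex n. realization_rel X `` {(n, x, t)} \<in> V})"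

lemma istopology_realization_open: "istopology (realization_open X)"
  unfolding istopology_def
proof (intro conjI allI impI)
  fix S T assume "realization_open X S" "realization_open X T"
  moreover have "{t \<in> standard_simplex n. realization_rel X `` {(n, x, t)} \<in> S \<inter> T} =
      {t \<in> standard_simplex n. realization_rel X `` {(n, x, t)} \<in> S} \<inter>
      {t \<in> standard_simplex n. realization_rel X `` {(n, x, t)} \<in> T}" for n x
    by blast
  ultimately show "realization_open X (S \<inter> T)"
    unfolding realization_open_def by (simp only:) (blast intro: openin_Int)
next
  fix \<K> assume K: "\<forall>K\<in>\<K>. realization_open X K"
  have "{t \<in> standard_simplex n. realization_rel X `` {(n, x, t)} \<in> \<Union>\<K>} =
      (\<Union>K\<in>\<K>. {t \<in> standard_simplex n. realization_rel X `` {(n, x, t)} \<in> K})" for n x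
    by blast
  then show "realization_open X (\<Union>\<K>)"
    using K unfolding realization_open_def by (simp only:) blast
qed

definition realization :: "'x sset \<Rightarrow> 'x real_point set topology" where
  "realization X = topology (realization_open X)"

definition realization_map ::
    "'y sset \<Rightarrow> (nat \<Rightarrow> 'x \<Rightarrow> 'y) \<Rightarrow> 'x real_point set \<Rightarrow> 'y real_point set" where
  "realization_map Y f c = realization_rel Y `` ((\<lambda>(n, x, t). (n, f n x, t)) ` c)"

definition cube :: "nat \<Rightarrow> (nat \<Rightarrow> real) set" where
  "cube n = {x. (\<forall>i<n. 0 \<le> x i \<and> x i \<le> 1) \<and> (\<forall>i\<ge>n. x i = 0)}"

definition cube_boundary :: "nat \<Rightarrow> (nat \<Rightarrow> real) set" where
  "cube_boundary n = {x \<in> cube n. \<exists>i<n. x i = 0 \<or> x i = 1}"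

definition cube_top :: "nat \<Rightarrow> (nat \<Rightarrow> real) topology" where
  "cube_top n = subtopology (powertop_real UNIV) (cube n)"

definition spheroid :: "nat \<Rightarrow> 'x topology \<Rightarrow> 'x \<Rightarrow> ((nat \<Rightarrow> real) \<Rightarrow> 'x) \<Rightarrow> bool" where
  "spheroid n S s f \<longleftrightarrow> continuous_map (cube_top n) S f \<and> (\<forall>x\<in>cube_boundary n. f x = s)"

definition spheroid_homotopic ::
    "nat \<Rightarrow> 'x topology \<Rightarrow> 'x \<Rightarrow> ((nat \<Rightarrow> real) \<Rightarrow> 'x) \<Rightarrow> ((nat \<Rightarrow> real) \<Rightarrow> 'x) \<Rightarrow> bool" where
  "spheroid_homotopic n S s = homotopic_with (\<lambda>f. \<forall>x\<in>cube_boundary n. f x = s) (cube_top n) S"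

text \<open>The induced maps on the homotopy groups (sets) at all base points are bijective. For \<open>n = 0\<close> the
  boundary is empty and this is the condition on path components, except that the case of an empty
  source has to be treated separately.\<close>

definition weak_homotopy_equivalence :: "'x topology \<Rightarrow> 'y topology \<Rightarrow> ('x \<Rightarrow> 'y) \<Rightarrow> bool" where
  "weak_homotopy_equivalence S T \<phi> \<longleftrightarrow>
     continuous_map S T \<phi> \<and>
     (topspace S = {} \<longrightarrow> topspace T = {}) \<and>
     (\<forall>n. \<forall>s\<in>topspace S.
        (\<forall>f g. spheroid n S s f \<and> spheroid n S s g \<and>
               spheroid_homotopic n T (\<phi> s) (\<phi> \<circ> f) (\<phi> \<circ> g) \<longrightarrow> spheroid_homotopic n S s f g) \<and>
        (\<forall>g. spheroid n T (\<phi> s) g \<longrightarrow>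
           (\<exists>f. spheroid n S s f \<and> spheroid_homotopic n T (\<phi> s) (\<phi> \<circ> f) g)))"

definition sset_weq :: "'x sset \<Rightarrow> 'y sset \<Rightarrow> (nat \<Rightarrow> 'x \<Rightarrow> 'y) \<Rightarrow> bool" where
  "sset_weq X Y f \<longleftrightarrow> sset_map X Y f \<and>
     weak_homotopy_equivalence (realization X) (realization Y) (realization_map Y f)"


section \<open>Simplicial model categories\<close>

text \<open>\<open>SMap X Y\<close> is the mapping space, \<open>SComp n X Y Z\<close> the composition
  \<open>Map(Y,Z)\<^sub>n \<times> Map(X,Y)\<^sub>n \<rightarrow> Map(X,Z)\<^sub>n\<close>, and \<open>SArr\<close> identifies arrows with 0-simplices.\<close>

record ('o, 'a, 'u) simplicial_enrichment =
  SMap :: "'o \<Rightarrow> 'o \<Rightarrow> 'u sset"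
  SComp :: "nat \<Rightarrow> 'o \<Rightarrow> 'o \<Rightarrow> 'o \<Rightarrow> 'u \<Rightarrow> 'u \<Rightarrow> 'u"
  SArr :: "'a \<Rightarrow> 'u"

definition sdegenerate :: "'x sset \<Rightarrow> nat \<Rightarrow> 'x \<Rightarrow> 'x" where
  "sdegenerate X n x = SAct X (n, \<lambda>i\<in>{..n}. 0, 0) x"

definition is_simplicial_category ::
    "('o, 'a) category \<Rightarrow> ('o, 'a, 'u) simplicial_enrichment \<Rightarrow> bool" where
  "is_simplicial_category C E \<longleftrightarrow>
     (\<forall>X\<in>Obj C. \<forall>Y\<in>Obj C.
        small_sset TYPE('u) (SMap E X Y) \<and>
        bij_betw (SArr E) (Hom C X Y) (Simp (SMap E X Y) 0)) \<and>
     (\<forall>X\<in>Obj C. \<forall>Y\<in>Obj C. \<forall>Z\<in>Obj C.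
        sset_map (sset_prod (SMap E Y Z) (SMap E X Y)) (SMap E X Z)
          (\<lambda>n (g, f). SComp E n X Y Z g f) \<and>
        (\<forall>f\<in>Hom C X Y. \<forall>g\<in>Hom C Y Z.
           SArr E (g \<cdot>\<^bsub>C\<^esub> f) = SComp E 0 X Y Z (SArr E g) (SArr E f))) \<and>
     (\<forall>X\<in>Obj C. \<forall>Y\<in>Obj C. \<forall>n. \<forall>f\<in>Simp (SMap E X Y) n.
        SComp E n X X Y f (sdegenerate (SMap E X X) n (SArr E (Idt C X))) = f \<and>
        SComp E n X Y Y (sdegenerate (SMap E Y Y) n (SArr E (Idt C Y))) f = f) \<and>
     (\<forall>X\<in>Obj C. \<forall>Y\<in>Obj C. \<forall>Z\<in>Obj C. \<forall>V\<in>Obj C. \<forall>n.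
        \<forall>f\<in>Simp (SMap E X Y) n. \<forall>g\<in>Simp (SMap E Y Z) n. \<forall>h\<in>Simp (SMap E Z V) n.
          SComp E n X Z V h (SComp E n X Y Z g f) = SComp E n X Y V (SComp E n Y Z V h g) f)"

text \<open>\<open>smap_post E A f\<close> is \<open>f\<^sub>* : Map(A,X) \<rightarrow> Map(A,Y)\<close> and \<open>smap_pre E f Z\<close> is
  \<open>f\<^sup>* : Map(Y,Z) \<rightarrow> Map(X,Z)\<close>, for \<open>f : X \<rightarrow> Y\<close>.\<close>

definition smap_post ::
    "('o, 'a) category \<Rightarrow> ('o, 'a, 'u) simplicial_enrichment \<Rightarrow> 'o \<Rightarrow> 'a \<Rightarrow> nat \<Rightarrow> 'u \<Rightarrow> 'u" where
  "smap_post C E A f n u =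
     SComp E n A (Dom C f) (Cod C f)
       (sdegenerate (SMap E (Dom C f) (Cod C f)) n (SArr E f)) u"

definition smap_pre ::
    "('o, 'a) category \<Rightarrow> ('o, 'a, 'u) simplicial_enrichment \<Rightarrow> 'a \<Rightarrow> 'o \<Rightarrow> nat \<Rightarrow> 'u \<Rightarrow> 'u" where
  "smap_pre C E f Z n u =
     SComp E n (Dom C f) (Cod C f) Z u
       (sdegenerate (SMap E (Dom C f) (Cod C f)) n (SArr E f))"

text \<open>Tensors and cotensors, by their universal maps \<open>\<alpha> : K \<rightarrow> Map(X, X \<otimes> K)\<close> and
  \<open>\<beta> : K \<rightarrow> Map(X\<^sup>K, X)\<close>: these are required to induce isomorphisms of simplicial sets
  \<open>Map(X \<otimes> K, Y) \<cong> Map(K, Map(X, Y))\<close> and \<open>Map(Y, X\<^sup>K) \<cong> Map(K, Map(Y, X))\<close>, where the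
  \<open>n\<close>-simplices of \<open>Map(K, L)\<close> are the simplicial maps \<open>K \<times> \<Delta>[n] \<rightarrow> L\<close>.\<close>

definition is_tensor ::
    "('o, 'a) category \<Rightarrow> ('o, 'a, 'u) simplicial_enrichment \<Rightarrow> 'o \<Rightarrow> 'u sset \<Rightarrow> 'o \<Rightarrow>
     (nat \<Rightarrow> 'u \<Rightarrow> 'u) \<Rightarrow> bool" where
  "is_tensor C E X K P \<alpha> \<longleftrightarrow> P \<in> Obj C \<and> sset_map K (SMap E X P) \<alpha> \<and>
     (\<forall>Y\<in>Obj C. \<forall>n h. sset_map (sset_prod K (std_simplex n)) (SMap E X Y) h \<longrightarrow>
        (\<exists>!\<sigma>. \<sigma> \<in> Simp (SMap E P Y) n \<and>
           (\<forall>m. \<forall>k\<in>Simp K m. \<forall>\<theta>\<in>Hom Delta m n.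
              h m (k, \<theta>) = SComp E m X P Y (SAct (SMap E P Y) \<theta> \<sigma>) (\<alpha> m k))))"

definition is_cotensor ::
    "('o, 'a) category \<Rightarrow> ('o, 'a, 'u) simplicial_enrichment \<Rightarrow> 'o \<Rightarrow> 'u sset \<Rightarrow> 'o \<Rightarrow>
     (nat \<Rightarrow> 'u \<Rightarrow> 'u) \<Rightarrow> bool" where
  "is_cotensor C E X K P \<beta> \<longleftrightarrow> P \<in> Obj C \<and> sset_map K (SMap E P X) \<beta> \<and>
     (\<forall>Y\<in>Obj C. \<forall>n h. sset_map (sset_prod K (std_simplex n)) (SMap E Y X) h \<longrightarrow>
        (\<exists>!\<sigma>. \<sigma> \<in> Simp (SMap E Y P) n \<and>
           (\<forall>m. \<forall>k\<in>Simp K m. \<forall>\<theta>\<in>Hom Delta m n.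
              h m (k, \<theta>) = SComp E m Y P X (\<beta> m k) (SAct (SMap E Y P) \<theta> \<sigma>))))"

text \<open>The target \<open>Map(A,X) \<times>\<^bsub>Map(A,Y)\<^esub> Map(B,Y)\<close> of the pullback corner map of
  \<open>i : A \<rightarrow> B\<close> and \<open>p : X \<rightarrow> Y\<close>.\<close>

definition corner_sset ::
    "('o, 'a) category \<Rightarrow> ('o, 'a, 'u) simplicial_enrichment \<Rightarrow> 'a \<Rightarrow> 'a \<Rightarrow> ('u \<times> 'u) sset" where
  "corner_sset C E i p =
     (let P = sset_prod (SMap E (Dom C i) (Dom C p)) (SMap E (Cod C i) (Cod C p))
      in \<lparr>Simp = (\<lambda>n. {(u, v) \<in> Simp P n.
                         smap_post C E (Dom C i) p n u = smap_pre C E i (Cod C p) n v}),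
          SAct = SAct P\<rparr>)"

definition simplicial_model_category ::
    "('o, 'a) category \<Rightarrow> 'a model_structure \<Rightarrow> ('o, 'a, 'u) simplicial_enrichment \<Rightarrow> bool" where
  "simplicial_model_category C T E \<longleftrightarrow>
     model_category TYPE('u) C T \<and> is_simplicial_category C E \<and>
     (\<forall>X\<in>Obj C. \<forall>K. small_sset TYPE('u) K \<longrightarrow>
        (\<exists>P \<alpha>. is_tensor C E X K P \<alpha>) \<and> (\<exists>P \<beta>. is_cotensor C E X K P \<beta>)) \<and>
     (\<forall>i\<in>Cof T. \<forall>p\<in>Fib T.
        let B = SMap E (Cod C i) (Dom C p);
            D = corner_sset C E i p;
            c = (\<lambda>n u. (smap_pre C E i (Dom C p) n u, smap_post C E (Cod C i) p n u))
        in kan_fibration B D c \<and> (i \<in> Weq T \<or> p \<in> Weq T \<longrightarrow> sset_weq B D c))"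


section \<open>The homotopy category\<close>

text \<open>The homotopy category is the localization \<open>C[W\<^sup>-\<^sup>1]\<close>: same objects, and zigzags modulo the
  congruence that makes \<open>C \<rightarrow> C[W\<^sup>-\<^sup>1]\<close> a functor and inverts \<open>W\<close>. Zigzags are lists written in
  diagrammatic order.\<close>

datatype 'a zig = Fwd 'a | Bwd 'a

inductive zigzag :: "('o, 'a) category \<Rightarrow> 'a set \<Rightarrow> 'o \<Rightarrow> 'a zig list \<Rightarrow> 'o \<Rightarrow> bool"
    for C :: "('o, 'a) category" and W :: "'a set" where
  zigzag_Nil: "X \<in> Obj C \<Longrightarrow> zigzag C W X [] X"
| zigzag_Fwd: "f \<in> Hom C X Y \<Longrightarrow> zigzag C W Y zs Z \<Longrightarrow> zigzag C W X (Fwd f # zs) Z"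
| zigzag_Bwd: "w \<in> W \<Longrightarrow> w \<in> Hom C Y X \<Longrightarrow> zigzag C W Y zs Z \<Longrightarrow> zigzag C W X (Bwd w # zs) Z"

inductive zigzag_eq ::
    "('o, 'a) category \<Rightarrow> 'a set \<Rightarrow> 'o \<Rightarrow> 'o \<Rightarrow> 'a zig list \<Rightarrow> 'a zig list \<Rightarrow> bool"
    for C :: "('o, 'a) category" and W :: "'a set" where
  zz_refl: "zigzag C W X zs Y \<Longrightarrow> zigzag_eq C W X Y zs zs"
| zz_sym: "zigzag_eq C W X Y zs zs' \<Longrightarrow> zigzag_eq C W X Y zs' zs"
| zz_trans: "zigzag_eq C W X Y zs zs' \<Longrightarrow> zigzag_eq C W X Y zs' zs'' \<Longrightarrow> zigzag_eq C W X Y zs zs''"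
| zz_app: "zigzag_eq C W X Y zs zs' \<Longrightarrow> zigzag_eq C W Y Z ys ys' \<Longrightarrow>
           zigzag_eq C W X Z (zs @ ys) (zs' @ ys')"
| zz_id: "X \<in> Obj C \<Longrightarrow> zigzag_eq C W X X [Fwd (Idt C X)] []"
| zz_comp: "f \<in> Hom C X Y \<Longrightarrow> g \<in> Hom C Y Z \<Longrightarrow>
            zigzag_eq C W X Z [Fwd f, Fwd g] [Fwd (g \<cdot>\<^bsub>C\<^esub> f)]"
| zz_inv1: "w \<in> W \<Longrightarrow> w \<in> Hom C X Y \<Longrightarrow> zigzag_eq C W X X [Fwd w, Bwd w] []"
| zz_inv2: "w \<in> W \<Longrightarrow> w \<in> Hom C X Y \<Longrightarrow> zigzag_eq C W Y Y [Bwd w, Fwd w] []"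

definition ho_class ::
    "('o, 'a) category \<Rightarrow> 'a set \<Rightarrow> 'o \<Rightarrow> 'a zig list \<Rightarrow> 'o \<Rightarrow> 'o \<times> 'a zig list set \<times> 'o" where
  "ho_class C W X zs Y = (X, {zs'. zigzag_eq C W X Y zs zs'}, Y)"

definition Ho :: "('o, 'a) category \<Rightarrow> 'a set \<Rightarrow> ('o, 'o \<times> 'a zig list set \<times> 'o) category" where
  "Ho C W = \<lparr>Obj = Obj C,
             Arr = {ho_class C W X zs Y | X zs Y. zigzag C W X zs Y},
             Dom = (\<lambda>(X, c, Y). X),
             Cod = (\<lambda>(X, c, Y). Y),
             Idt = (\<lambda>X. ho_class C W X [] X),
             Cmp = (\<lambda>(Y', d, Z) (X, c, Y).
                      (X, {zs''. \<exists>zs\<in>c. \<exists>zs'\<in>d. zigzag_eq C W X Z (zs @ zs') zs''}, Z))\<rparr>"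

definition ho_arr ::
    "('o, 'a) category \<Rightarrow> 'a set \<Rightarrow> 'a \<Rightarrow> 'o \<times> 'a zig list set \<times> 'o" where
  "ho_arr C W f = ho_class C W (Dom C f) [Fwd f] (Cod C f)"

definition preserves_weq :: "'a model_structure \<Rightarrow> ('o, 'a, 'o, 'a) cfunctor \<Rightarrow> bool" where
  "preserves_weq T L \<longleftrightarrow> (\<forall>w\<in>Weq T. Fa L w \<in> Weq T)"

text \<open>For \<open>L\<close> preserving weak equivalences: the functor and the transformation induced on the homotopy
  category have, at \<open>X\<close>, the components \<open>(\<eta>L)\<^sub>X\<close> and \<open>(L\<eta>)\<^sub>X\<close> given by the classes of \<open>\<eta> (L X)\<close>
  and \<open>L (\<eta> X)\<close>.\<close>

definition idempotent_in_Ho ::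
    "('o, 'a) category \<Rightarrow> 'a model_structure \<Rightarrow> ('o, 'a, 'o, 'a) cfunctor \<Rightarrow> ('o \<Rightarrow> 'a) \<Rightarrow> bool" where
  "idempotent_in_Ho C T L \<eta> \<longleftrightarrow>
     (\<forall>X\<in>Obj C. ho_arr C (Weq T) (\<eta> (Fo L X)) = ho_arr C (Weq T) (Fa L (\<eta> X)) \<and>
                is_iso (Ho C (Weq T)) (ho_arr C (Weq T) (Fa L (\<eta> X))))"


section \<open>Homotopy orthogonality\<close>

text \<open>The homotopy function complex is \<open>map(X, Y) = Map(Q X, R Y)\<close>.\<close>

definition hmap ::
    "('o, 'a, 'u) simplicial_enrichment \<Rightarrow> ('o, 'a, 'o, 'a) cfunctor \<Rightarrow> ('o, 'a, 'o, 'a) cfunctor \<Rightarrow>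
     'o \<Rightarrow> 'o \<Rightarrow> 'u sset" where
  "hmap E Q R X Y = SMap E (Fo Q X) (Fo R Y)"

definition homotopy_orthogonal ::
    "('o, 'a) category \<Rightarrow> ('o, 'a, 'u) simplicial_enrichment \<Rightarrow> ('o, 'a, 'o, 'a) cfunctor \<Rightarrow>
     ('o, 'a, 'o, 'a) cfunctor \<Rightarrow> 'a \<Rightarrow> 'o \<Rightarrow> bool" where
  "homotopy_orthogonal C E Q R f X \<longleftrightarrow>
     sset_weq (hmap E Q R (Cod C f) X) (hmap E Q R (Dom C f) X)
       (smap_pre C E (Fa Q f) (Fo R X))"

definition local_objects ::
    "('o, 'a) category \<Rightarrow> 'a model_structure \<Rightarrow> ('o, 'a, 'u) simplicial_enrichment \<Rightarrow>
     ('o, 'a, 'o, 'a) cfunctor \<Rightarrow> ('o, 'a, 'o, 'a) cfunctor \<Rightarrow> 'a set \<Rightarrow> 'o set" where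
  "local_objects C T E Q R S =
     {X \<in> Obj C. fibrant C (Fib T) X \<and> (\<forall>f\<in>S. homotopy_orthogonal C E Q R f X)}"

definition orthogonal_maps ::
    "('o, 'a) category \<Rightarrow> ('o, 'a, 'u) simplicial_enrichment \<Rightarrow> ('o, 'a, 'o, 'a) cfunctor \<Rightarrow>
     ('o, 'a, 'o, 'a) cfunctor \<Rightarrow> 'o set \<Rightarrow> 'a set" where
  "orthogonal_maps C E Q R D =
     {f \<in> Arr C. \<forall>X\<in>D. homotopy_orthogonal C E Q R f X}"

end

theory Submission
 imports Defs "HOL-Analysis.Abstract_Topological_Spaces"
begin

text \<open>
 The class \<open>S\<close> consists of all the maps \<open>\<eta> X\<close>. The point is that a fibrant object \<open>F\<close> for which
 \<open>\<eta> F\<close> is a weak equivalence is homotopy orthogonal to every \<open>\<eta> X\<close>; on homotopy classes of maps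
 this is the usual argument for idempotent monads, and the canonical model structure is what lifts it
 to mapping spaces.

 For fibrant \<open>F\<close> the \<open>n\<close>-simplices of the mapping space from \<open>A\<close> to \<open>F\<close> are the maps from \<open>A\<close> to the
 \<open>n\<close>-th cotensor power of \<open>F\<close>, and these powers form a simplicial object \<open>P\<close>. It is Reedy fibrant
 (\<open>PS_reedy_fibrant\<close>, from the lifting property against boundary inclusions) and homotopically
 constant (\<open>Pn_act_weq\<close>), hence fibrant in the canonical structure. Applying \<open>L\<close> in every level gives
 the levelwise map from \<open>P\<close> to \<open>L P\<close> with components \<open>\<eta>\<close>. It is a level equivalence because \<open>L\<close>
 preserves weak equivalences, so it is a weak equivalence of the canonical structure. Factoring it
 into a trivial cofibration and a fibration, and using that \<open>P\<close> is fibrant, exhibits \<open>P\<close> as a retract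
 along a levelwise equivalence. A map from \<open>L A\<close> to \<open>P\<close> can then be built from \<open>L\<close> applied to the
 simplices of the mapping space: copowers of a cofibrant object by inclusions of simplicial sets are
 Reedy cofibrations (\<open>copower_reedy_cofibration\<close>), so the extension of a family of simplices along
 \<open>\<eta>\<close> exists and is unique up to a simplicial homotopy. Idempotency makes restriction along \<open>\<eta> X\<close> and
 this extension inverse up to homotopy (\<open>eta_orthogonal\<close>), and a simplicial homotopy equivalence
 induces a weak equivalence of realizations (\<open>simplicial_homotopy_equivalence_weq\<close>). Hence every
 fibrant object equivalent to some \<open>L X\<close> is \<open>S\<close>-local.

 Conversely, if \<open>F\<close> is \<open>S\<close>-local, then the identity of \<open>F\<close> extends along \<open>\<eta> F\<close> up to homotopy, which
 gives a left inverse of \<open>\<eta> F\<close> in the homotopy category. Idempotency makes this inverse two-sided, and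
 a map that becomes invertible in the homotopy category is a weak equivalence, so \<open>F\<close> is weakly
 equivalent to \<open>L F\<close>. That \<open>\<eta> X\<close> is orthogonal to all \<open>S\<close>-local objects holds by the choice of \<open>S\<close>.
\<close>

section \<open>Spheroids and change of base point\<close>

abbreviation unit_interval :: "real topology" where
 "unit_interval \<equiv> top_of_set {0..1}"

lemma spheroid_homotopicI:
 assumes "continuous_map (prod_topology unit_interval (cube_top n)) S h"
  and "!!x. x : cube n ==> h (0, x) = f x" "!!x. x : cube n ==> h (1, x) = g x"
  and "!!t x. t : {0..1} ==> x : cube_boundary n ==> h (t, x) = s"
 shows "spheroid_homotopic n S s f g"
proof -
 have ts: "topspace (cube_top n) = cube n" by (simp add: cube_top_def)
 have "homotopic_with (%f. ALL x:cube_boundary n. f x = s) (cube_top n) S f g"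
 proof (subst homotopic_with)
  show "(ALL x:cube_boundary n. h x = s) \<longleftrightarrow> (ALL x:cube_boundary n. k x = s)"
  if "!!x. x : topspace (cube_top n) ==> h x = k x" for h k :: "(nat => real) => 'a"
  using that unfolding ts cube_boundary_def by auto
 next
  show "EX h. continuous_map (prod_topology unit_interval (cube_top n)) S h &
  (ALL x:topspace (cube_top n). h (0, x) = f x) & (ALL x:topspace (cube_top n). h (1, x) = g x) &
  (ALL t:{0..1}. ALL x:cube_boundary n. h (t, x) = s)"
  using assms unfolding ts by (intro exI[of _ h]) blast
 qed
 thus ?thesis by (simp add: spheroid_homotopic_def)
qed

lemma spheroid_homotopicD:
 assumes "spheroid_homotopic n S s f g"
 obtains h where "continuous_map (prod_topology unit_interval (cube_top n)) S h"
  "!!x. h (0, x) = f x" "!!x. h (1, x) = g x"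
  "!!t x. t : {0..1} ==> x : cube_boundary n ==> h (t, x) = s"
 using assms unfolding spheroid_homotopic_def homotopic_with_def by blast

lemma spheroid_homotopic_sym: "spheroid_homotopic n S s f g ==> spheroid_homotopic n S s g f"
 unfolding spheroid_homotopic_def by (rule homotopic_with_symD)

lemma spheroid_homotopic_trans [trans]:
 "spheroid_homotopic n S s f g ==> spheroid_homotopic n S s g h ==> spheroid_homotopic n S s f h"
 unfolding spheroid_homotopic_def by (rule homotopic_with_trans)

lemma spheroid_homotopic_compose:
 assumes "spheroid_homotopic n S s f g" "continuous_map S S' ph"
 shows "spheroid_homotopic n S' (ph s) (ph \<circ> f) (ph \<circ> g)"
proof -
 obtain h where h: "continuous_map (prod_topology unit_interval (cube_top n)) S h"
  "!!x. h (0, x) = f x" "!!x. h (1, x) = g x"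
  "!!t x. t : {0..1} ==> x : cube_boundary n ==> h (t, x) = s"
  using assms(1) by (rule spheroid_homotopicD) blast
 show ?thesis
  by (rule spheroid_homotopicI[of _ _ "ph \<circ> h"]) (use h assms(2) in \<open>auto intro: continuous_map_compose\<close>)
qed

lemma spheroid_compose: "spheroid n S s f ==> continuous_map S S' ph ==> spheroid n S' (ph s) (ph \<circ> f)"
 unfolding spheroid_def by (auto intro: continuous_map_compose)

text \<open>The distance to the boundary of the cube, scaled so that it equals 1 on the boundary of the
 concentric cube of side \<open>1/3\<close>; \<open>squeeze\<close> expands that inner cube to the whole cube and sends
 the collar outside it to the boundary.\<close>

primrec wall :: "nat => (nat => real) => real" where
 "wall 0 x = 2"
| "wall (Suc n) x = min (wall n x) (min (3 * x n) (3 * (1 - x n)))"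

definition squeeze :: "nat => (nat => real) => nat => real" where
 "squeeze n x = (%i. if i < n then max 0 (min 1 (3 * x i - 1)) else 0)"

lemma topspace_cube_top [simp]: "topspace (cube_top n) = cube n"
 by (simp add: cube_top_def)

lemma continuous_map_into_cube_top:
 "continuous_map X (cube_top n) f \<longleftrightarrow>
  (ALL i. continuous_map X euclideanreal (%x. f x i)) & (ALL x:topspace X. f x : cube n)"
 unfolding cube_top_def continuous_map_in_subtopology continuous_map_componentwise_UNIV
 by (auto simp: image_subset_iff Pi_iff)

lemma continuous_map_coordinate:
 "continuous_map X (cube_top n) f ==> continuous_map X euclideanreal (%x. f x i)"
 unfolding continuous_map_into_cube_top by blast

lemma continuous_map_wall [continuous_intros]:
 assumes "continuous_map X (cube_top m) f"
 shows "continuous_map X euclideanreal (%x. wall n (f x))"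
 proof (induction n)
 case (Suc n)
 show ?case unfolding wall.simps
  by (intro continuous_intros Suc continuous_map_coordinate[OF assms])
qed simp

lemma squeeze_in_cube: "squeeze n x : cube n"
 by (auto simp: squeeze_def cube_def)

lemma continuous_map_squeeze [continuous_intros]:
 assumes "continuous_map X (cube_top n) f"
 shows "continuous_map X (cube_top n) (%x. squeeze n (f x))"
 unfolding continuous_map_into_cube_top
proof (intro conjI allI ballI)
 show "continuous_map X euclideanreal (%x. squeeze n (f x) i)" for i
  unfolding squeeze_def
  by (cases "i < n"; simp; intro continuous_intros continuous_map_coordinate[OF assms])
qed (rule squeeze_in_cube)

lemma wall_le_1: "wall n x <= 1 \<longleftrightarrow> (EX i<n. x i <= 1/3 \<or> x i >= 2/3)"
 by (induction n) (auto simp: min_le_iff_disj less_Suc_eq)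

lemma squeeze_in_boundary: "wall n x <= 1 ==> squeeze n x : cube_boundary n"
proof -
 assume "wall n x <= 1"
 then obtain i where "i < n" "x i <= 1/3 \<or> x i >= 2/3" unfolding wall_le_1 by blast
 hence "squeeze n x i = 0 \<or> squeeze n x i = 1" by (auto simp: squeeze_def)
 with `i < n` show ?thesis unfolding cube_boundary_def using squeeze_in_cube[of n x] by blast
qed

lemma wall_nonneg: "x : cube m ==> n <= m ==> 0 <= wall n x"
 by (induction n) (auto simp: cube_def)

lemma wall_boundary: 
 assumes "x : cube_boundary n" shows "wall n x = 0"
proof -
 have "m <= n ==> i < m ==> x i = 0 \<or> x i = 1 ==> wall m x <= 0" for i m
  by (induction m) (auto simp: less_Suc_eq min_le_iff_disj)
 moreover have "0 <= wall n x" using assms wall_nonneg[of x n n] by (auto simp: cube_boundary_def)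
 ultimately show ?thesis using assms unfolding cube_boundary_def by force
qed

lemma squeeze_boundary: "x : cube_boundary n ==> squeeze n x : cube_boundary n"
 by (simp add: squeeze_in_boundary wall_boundary)

text \<open>The map that is \<open>K\<close> on the inner cube and \<open>\<Gamma>\<close> on the collar.\<close>

definition collar :: "nat => ((nat => real) => 's) => (real => 's) => (nat => real) => 's" where
 "collar n K \<Gamma> x = (if 1 <= wall n x then K (squeeze n x) else \<Gamma> (wall n x))"

lemma continuous_map_collar:
 assumes K: "continuous_map (prod_topology P (cube_top n)) S (%(p, x). K p x)"
  and G: "continuous_map (prod_topology P unit_interval) S (%(p, w). \<Gamma> p w)"
  and KG: "!!p x. p : topspace P ==> x : cube_boundary n ==> K p x = \<Gamma> p 1"
 shows "continuous_map (prod_topology P (cube_top n)) S (%(p, x). collar n (K p) (\<Gamma> p) x)"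
proof -
 let ?Z = "prod_topology P (cube_top n)"
 have "continuous_map ?Z S (%z. if 1 <= wall n (snd z)
  then (%(p, x). K p x) (fst z, squeeze n (snd z)) else (%(p, w). \<Gamma> p w) (fst z, wall n (snd z)))"
 proof (rule continuous_map_cases_le)
  have "continuous_map ?Z S ((%(p, x). K p x) \<circ> (%z. (fst z, squeeze n (snd z))))"
  by (rule continuous_map_compose[OF _ K])
  (intro continuous_map_pairedI continuous_map_squeeze continuous_map_fst continuous_map_snd)
  thus "continuous_map (subtopology ?Z {z : topspace ?Z. 1 <= wall n (snd z)}) S
  (%z. (%(p, x). K p x) (fst z, squeeze n (snd z)))"
  by (simp add: o_def continuous_map_from_subtopology)
  let ?V = "subtopology ?Z {z : topspace ?Z. wall n (snd z) <= 1}"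
  have "continuous_map ?V (prod_topology P unit_interval) (%z. (fst z, wall n (snd z)))"
  proof (intro continuous_map_pairedI)
  show "continuous_map ?V P fst" by (intro continuous_map_from_subtopology continuous_intros)
  have "continuous_map ?V euclideanreal (%z. wall n (snd z))"
  by (rule continuous_map_from_subtopology[OF continuous_map_wall[OF continuous_map_snd]])
  thus "continuous_map ?V unit_interval (%z. wall n (snd z))"
  by (auto simp: continuous_map_in_subtopology wall_nonneg)
  qed
  from continuous_map_compose[OF this G]
  show "continuous_map ?V S (%z. (%(p, w). \<Gamma> p w) (fst z, wall n (snd z)))" by (simp add: o_def)
  show "(%(p, x). K p x) (fst z, squeeze n (snd z)) = (%(p, w). \<Gamma> p w) (fst z, wall n (snd z))"
  if "z : topspace ?Z" "1 = wall n (snd z)" for z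
  using that KG[of "fst z"] squeeze_in_boundary[of n "snd z"] by auto
  show "continuous_map ?Z euclideanreal (%z. wall n (snd z))"
  by (rule continuous_map_wall[OF continuous_map_snd])
 qed simp
 thus ?thesis unfolding collar_def case_prod_unfold fst_conv snd_conv .
qed

lemma continuous_map_collar':
 assumes K: "continuous_map (cube_top n) S K" and G: "continuous_map unit_interval S \<Gamma>"
  and KG: "!!x. x : cube_boundary n ==> K x = \<Gamma> 1"
 shows "continuous_map (cube_top n) S (collar n K \<Gamma>)"
proof -
 let ?P = "top_of_set {0::real}"
 have "continuous_map (prod_topology ?P (cube_top n)) S (%(p, x). collar n K \<Gamma> x)"
 proof (rule continuous_map_collar)
  have "continuous_map (prod_topology ?P (cube_top n)) S (K \<circ> snd)"
  by (rule continuous_map_compose[OF _ K]) (intro continuous_intros)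
  thus "continuous_map (prod_topology ?P (cube_top n)) S (%(p, x). K x)"
  by (simp add: o_def case_prod_unfold)
  have "continuous_map (prod_topology ?P unit_interval) S (\<Gamma> \<circ> snd)"
  by (rule continuous_map_compose[OF _ G]) (intro continuous_intros)
  thus "continuous_map (prod_topology ?P unit_interval) S (%(p, x). \<Gamma> x)"
  by (simp add: o_def case_prod_unfold)
 qed (use KG in auto)
 from continuous_map_compose[OF _ this, of "cube_top n" "%x. (0, x)"]
 show ?thesis by (force simp: o_def intro: continuous_intros)
qed

lemma collar_squeeze:
 assumes "!!x. x : cube_boundary n ==> K x = s" 
 shows "collar n K (%_. s) x = K (squeeze n x)"
 using assms[OF squeeze_in_boundary, of x] by (auto simp: collar_def)

lemma homotopic_squeeze:
 assumes "spheroid n S s f"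
 shows "spheroid_homotopic n S s f (f \<circ> squeeze n)"
proof (rule spheroid_homotopicI)
 define rh :: "real \<times> (nat => real) => nat => real"
  where "rh = (%z i. if i < n then max 0 (min 1 ((1 + 2 * fst z) * snd z i - fst z)) else 0)"
 have f: "continuous_map (cube_top n) S f" using assms by (simp add: spheroid_def)
 let ?Z = "prod_topology unit_interval (cube_top n)"
 have fst: "continuous_map ?Z euclideanreal fst"
  using continuous_map_fst[of unit_interval "cube_top n"] by (simp add: continuous_map_in_subtopology)
 have "continuous_map ?Z (cube_top n) rh"
  unfolding continuous_map_into_cube_top
 proof (intro conjI allI ballI)
  show "continuous_map ?Z euclideanreal (%z. rh z i)" for i
  unfolding rh_def
  by (cases "i < n"; simp; intro continuous_intros fst continuous_map_coordinate[OF continuous_map_snd])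
  show "rh z : cube n" for z by (auto simp: rh_def cube_def)
 qed
 thus "continuous_map ?Z S (f \<circ> rh)" by (rule continuous_map_compose[OF _ f])
 show "(f \<circ> rh) (0, x) = f x" if "x : cube n" for x
 proof -
  have "rh (0, x) = x" using that by (auto simp: rh_def cube_def fun_eq_iff)
  thus ?thesis by simp
 qed
 show "(f \<circ> rh) (1, x) = (f \<circ> squeeze n) x" for x
 proof -
  have "rh (1, x) = squeeze n x" by (auto simp: rh_def squeeze_def fun_eq_iff)
  thus ?thesis by simp
 qed
 show "(f \<circ> rh) (t, x) = s" if "t : {0..1}" and x: "x : cube_boundary n" for t x
 proof -
  obtain i where i: "i < n" "x i = 0 \<or> x i = 1" using x unfolding cube_boundary_def by blast
  hence "rh (t, x) i = 0 \<or> rh (t, x) i = 1" using that by (auto simp: rh_def)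
  moreover have "rh (t, x) : cube n" by (auto simp: rh_def cube_def)
  ultimately have "rh (t, x) : cube_boundary n" using i by (auto simp: cube_boundary_def)
  thus ?thesis using assms by (simp add: spheroid_def)
 qed
qed

lemma spheroid_collar:
 assumes "spheroid n S (gm 1) f" "continuous_map unit_interval S gm"
 shows "spheroid n S (gm 0) (collar n f gm)"
 using assms continuous_map_collar'[of n S f gm] by (auto simp: spheroid_def collar_def wall_boundary)

lemma homotopic_collar:
 assumes "spheroid_homotopic n S (gm 1) f g" "continuous_map unit_interval S gm"
 shows "spheroid_homotopic n S (gm 0) (collar n f gm) (collar n g gm)"
proof -
 obtain h where h: "continuous_map (prod_topology unit_interval (cube_top n)) S h"
  "!!x. h (0, x) = f x" "!!x. h (1, x) = g x"
  "!!t x. t : {0..1} ==> x : cube_boundary n ==> h (t, x) = gm 1"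
  using assms(1) by (rule spheroid_homotopicD) blast
 show ?thesis
 proof (rule spheroid_homotopicI[of _ _ "%(t, x). collar n (%x. h (t, x)) gm x"])
  have "continuous_map (prod_topology unit_interval unit_interval) S (gm \<circ> snd)"
  by (rule continuous_map_compose[OF _ assms(2)]) (intro continuous_intros)
  thus "continuous_map (prod_topology unit_interval (cube_top n)) S
  (%(t, x). collar n (%x. h (t, x)) gm x)"
  using h by (intro continuous_map_collar) (auto simp: o_def case_prod_unfold)
 qed (use h in \<open>auto simp: collar_def wall_boundary\<close>)
qed

lemma continuous_map_reparametrize:
 assumes "continuous_map unit_interval S gm" "continuous_map X euclideanreal tz"
  "!!x. x : topspace X ==> tz x : {0..1}"
 shows "continuous_map X S (%x. gm (tz x))"
proof -
 have "continuous_map X unit_interval tz" using assms by (auto simp: continuous_map_in_subtopology)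
 from continuous_map_compose[OF this assms(1)] show ?thesis by (simp add: o_def)
qed

lemma homotopic_collar_reverse:
 assumes f: "spheroid n S (gm 1) f" and gm: "continuous_map unit_interval S gm"
 shows "spheroid_homotopic n S (gm 1) f (collar n (collar n f gm) (%t. gm (1 - t)))"
proof -
 let ?I = unit_interval
 define h where "h t = collar n (collar n f (%w. gm (max t w))) (%w. gm (max t (1 - w)))" for t
 have fst: "continuous_map (prod_topology ?I X) euclideanreal fst" for X :: "'z topology"
  using continuous_map_fst[of ?I X] by (simp add: continuous_map_in_subtopology)
 have snd: "continuous_map (prod_topology X ?I) euclideanreal snd" for X :: "'z topology"
  using continuous_map_snd[of X ?I] by (simp add: continuous_map_in_subtopology)
 have cont: "continuous_map (prod_topology ?I (cube_top n)) S (%(t, x). h t x)"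
  unfolding h_def
 proof (intro continuous_map_collar)
  have "continuous_map (prod_topology ?I (cube_top n)) S (f \<circ> snd)"
  using f by (intro continuous_map_compose[OF continuous_map_snd]) (simp add: spheroid_def)
  thus "continuous_map (prod_topology ?I (cube_top n)) S (%(t, x). f x)"
  by (simp add: o_def case_prod_unfold)
  show "continuous_map (prod_topology ?I ?I) S (%(t, w). gm (max t w))"
  unfolding case_prod_unfold
  by (rule continuous_map_reparametrize[OF gm]) (auto intro!: continuous_intros fst snd)
  show "continuous_map (prod_topology ?I ?I) S (%(t, w). gm (max t (1 - w)))"
  unfolding case_prod_unfold
  by (rule continuous_map_reparametrize[OF gm]) (auto intro!: continuous_intros fst snd)
 qed (use f in \<open>auto simp: spheroid_def collar_def wall_boundary\<close>)
 have *: "h 0 x = collar n (collar n f gm) (%t. gm (1 - t)) x" if "x : cube n" for x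
  using that wall_nonneg[OF that order_refl] wall_nonneg[OF squeeze_in_cube order_refl, of n x]
  by (auto simp: h_def collar_def max_def)
 have **: "h 1 x = f (squeeze n (squeeze n x))" if "x : cube n" for x
 proof -
  have "max 1 w = (1::real)" if "w <= 1" for w using that by simp
  hence "h 1 x = collar n (collar n f (%_. gm 1)) (%_. gm 1) x"
  using wall_nonneg[OF that order_refl] by (auto simp: h_def collar_def)
  also have "... = f (squeeze n (squeeze n x))"
  using f collar_squeeze[of n f "gm 1"] squeeze_boundary
  by (subst collar_squeeze) (auto simp: spheroid_def)
  finally show ?thesis .
 qed
 have "spheroid_homotopic n S (gm 1) (collar n (collar n f gm) (%t. gm (1 - t))) (f \<circ> squeeze n \<circ> squeeze n)"
 proof (rule spheroid_homotopicI[OF cont])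
  show "(case (t, x) of (t, x) => h t x) = gm 1" if "t : {0..1}" "x : cube_boundary n" for t x
  using that by (simp add: h_def collar_def wall_boundary max_def)
 qed (simp_all add: * **)
 moreover have fs: "spheroid n S (gm 1) (f \<circ> squeeze n)"
  using f continuous_map_compose[OF continuous_map_squeeze[OF continuous_map_id]] squeeze_boundary
  by (force simp: spheroid_def o_def id_def)
 have "spheroid_homotopic n S (gm 1) f (f \<circ> squeeze n \<circ> squeeze n)"
  using homotopic_squeeze[OF f] homotopic_squeeze[OF fs] by (rule spheroid_homotopic_trans)
 ultimately show ?thesis by (blast intro: spheroid_homotopic_trans spheroid_homotopic_sym)
qed

text \<open>A free homotopy from the identity to \<open>g\<close> drags the base point \<open>s\<close> along a path \<open>gm\<close>; running
 \<open>gm\<close> back through the collar turns \<open>g \<circ> f\<close> into a spheroid at \<open>s\<close> again.\<close>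

lemma homotopic_collar_drag:
 assumes H: "continuous_map (prod_topology unit_interval S) S H"
  and H0: "!!x. x : topspace S ==> H (0, x) = x" and f: "spheroid n S s f" and s: "s : topspace S"
 shows "spheroid_homotopic n S s f (collar n (%x. H (1, f x)) (%t. H (t, s)))"
proof -
 let ?I = unit_interval
 define h where "h t = collar n (%x. H (t, f x)) (%w. H (min t w, s))" for t
 have fst: "continuous_map (prod_topology ?I X) euclideanreal fst" for X :: "'z topology"
  using continuous_map_fst[of ?I X] by (simp add: continuous_map_in_subtopology)
 have snd: "continuous_map (prod_topology X ?I) euclideanreal snd" for X :: "'z topology"
  using continuous_map_snd[of X ?I] by (simp add: continuous_map_in_subtopology)
 have fc: "continuous_map (cube_top n) S f" using f by (simp add: spheroid_def)
 have cont: "continuous_map (prod_topology ?I (cube_top n)) S (%(t, x). h t x)"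
  unfolding h_def
 proof (rule continuous_map_collar)
  have "continuous_map (prod_topology ?I (cube_top n)) (prod_topology ?I S) (%z. (fst z, (f \<circ> snd) z))"
  by (intro continuous_map_pairedI continuous_map_fst continuous_map_compose[OF continuous_map_snd fc])
  from continuous_map_compose[OF this H]
  show "continuous_map (prod_topology ?I (cube_top n)) S (%(t, x). H (t, f x))"
  by (simp add: o_def case_prod_unfold)
  have "continuous_map (prod_topology ?I ?I) (prod_topology ?I S) (%z. (min (fst z) (snd z), s))"
  using s by (intro continuous_map_pairedI)
  (auto simp: continuous_map_in_subtopology intro!: continuous_intros fst snd)
  from continuous_map_compose[OF this H]
  show "continuous_map (prod_topology ?I ?I) S (%(t, w). H (min t w, s))"
  by (simp add: o_def case_prod_unfold)
 qed (use f in \<open>auto simp: spheroid_def\<close>)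
 have "spheroid_homotopic n S s (f \<circ> squeeze n) (collar n (%x. H (1, f x)) (%t. H (t, s)))"
 proof (rule spheroid_homotopicI[OF cont])
  show "(case (0, x) of (t, x) => h t x) = (f \<circ> squeeze n) x" if "x : cube n" for x
  proof -
  have "f (squeeze n x) : topspace S"
  using continuous_map_image_subset_topspace[OF fc] squeeze_in_cube[of n x] by auto
  moreover have "f (squeeze n x) = s" if "wall n x < 1"
  using f squeeze_in_boundary[of n x] that by (simp add: spheroid_def)
  ultimately show ?thesis 
  using H0 s wall_nonneg[OF that order_refl] by (auto simp: h_def collar_def)
  qed
  show "(case (1, x) of (t, x) => h t x) = collar n (%x. H (1, f x)) (%t. H (t, s)) x" 
  if "x : cube n" for x
  by (auto simp: h_def collar_def)
  show "(case (t, x) of (t, x) => h t x) = s" if "t : {0..1}" "x : cube_boundary n" for t x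
  using that H0 s by (auto simp: h_def collar_def wall_boundary)
 qed
 with homotopic_squeeze[OF f] show ?thesis by (rule spheroid_homotopic_trans)
qed

lemma weak_homotopy_equivalence_homotopic_id:
 assumes "homotopic_with (%_. True) S S (%x. x) g"
 shows "weak_homotopy_equivalence S S g"
proof -
 let ?I = unit_interval
 obtain H where H: "continuous_map (prod_topology ?I S) S H"
  and H0: "!!x. H (0, x) = x" and H1: "!!x. H (1, x) = g x"
  using assms unfolding homotopic_with_def by blast
 have g: "continuous_map S S g" using assms homotopic_with_imp_continuous_maps by blast
 have path: "continuous_map ?I S (%t. H (t, s))" if "s : topspace S" for s
  using continuous_map_compose[OF _ H, of ?I "%t. (t, s)"] that
  by (simp add: o_def continuous_map_pairedI continuous_map_id[unfolded id_def])
 have drag: "spheroid_homotopic n S s f (collar n (g \<circ> f) (%t. H (t, s)))"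
  if "spheroid n S s f" "s : topspace S" for n s f
  using homotopic_collar_drag[OF H H0 that] by (simp add: H1 o_def)
 show ?thesis
  unfolding weak_homotopy_equivalence_def
 proof (intro conjI allI ballI impI g)
  fix n s f f' assume s: "s : topspace S"
  and *: "spheroid n S s f & spheroid n S s f' & spheroid_homotopic n S (g s) (g \<circ> f) (g \<circ> f')"
  have "spheroid_homotopic n S s (collar n (g \<circ> f) (%t. H (t, s))) (collar n (g \<circ> f') (%t. H (t, s)))"
  using homotopic_collar[of n S "%t. H (t, s)"] * path[OF s] by (simp add: H0 H1)
  thus "spheroid_homotopic n S s f f'"
  using drag * s by (blast intro: spheroid_homotopic_trans spheroid_homotopic_sym)
 next
  fix n s d assume s: "s : topspace S" and d: "spheroid n S (g s) d"
  let ?gm = "%t. H (t, s)" and ?gm' = "%t. H (1 - t, s)"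
  have gm': "continuous_map ?I S ?gm'"
  using path[OF s] by (rule continuous_map_reparametrize) (auto intro!: continuous_intros)
  let ?f = "collar n d ?gm"
  have f: "spheroid n S s ?f"
  using spheroid_collar[of n S ?gm d] d path[OF s] by (simp add: H0 H1)
  have gf: "spheroid n S (g s) (g \<circ> ?f)" using spheroid_compose[OF f g] .
  have "spheroid_homotopic n S (g s) d (collar n ?f ?gm')"
  using homotopic_collar_reverse[of n S ?gm d] d path[OF s] by (simp add: H1)
  also have "spheroid_homotopic n S (g s) ... (collar n (collar n (g \<circ> ?f) ?gm) ?gm')"
  using homotopic_collar[of n S ?gm' ?f] drag[OF f s] gm' by (simp add: H0 H1)
  also have "spheroid_homotopic n S (g s) ... (g \<circ> ?f)"
  using homotopic_collar_reverse[of n S ?gm "g \<circ> ?f"] gf path[OF s]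
  by (simp add: H1 spheroid_homotopic_sym)
  finally have "spheroid_homotopic n S (g s) (g \<circ> ?f) d" by (rule spheroid_homotopic_sym)
  with f show "EX f. spheroid n S s f & spheroid_homotopic n S (g s) (g \<circ> f) d"
  by (intro exI[of _ ?f] conjI)
 qed auto
qed

lemma weak_homotopy_equivalence_inj:
 assumes w: "weak_homotopy_equivalence S T ph" and s: "s : topspace S"
  and "spheroid n S s f" "spheroid n S s g" "spheroid_homotopic n T (ph s) (ph \<circ> f) (ph \<circ> g)"
 shows "spheroid_homotopic n S s f g"
proof -
 have "ALL f g. spheroid n S s f & spheroid n S s g &
  spheroid_homotopic n T (ph s) (ph \<circ> f) (ph \<circ> g) --> spheroid_homotopic n S s f g"
  using w s unfolding weak_homotopy_equivalence_def by simp
 thus ?thesis using assms(3-5) by simp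
qed

lemma weak_homotopy_equivalence_surj:
 assumes w: "weak_homotopy_equivalence S T ph" and s: "s : topspace S"
  and g: "spheroid n T (ph s) g"
 shows "EX f. spheroid n S s f & spheroid_homotopic n T (ph s) (ph \<circ> f) g"
proof -
 have "ALL g. spheroid n T (ph s) g -->
  (EX f. spheroid n S s f & spheroid_homotopic n T (ph s) (ph \<circ> f) g)"
  using w s unfolding weak_homotopy_equivalence_def by simp
 thus ?thesis using g by simp
qed

proposition weak_homotopy_equivalence_if_homotopy_inverse:
 assumes ph: "continuous_map S T ph" and pw: "continuous_map T S pw"
  and "homotopic_with (%_. True) S S (%x. x) (pw \<circ> ph)"
  and "homotopic_with (%_. True) T T (%x. x) (ph \<circ> pw)"
 shows "weak_homotopy_equivalence S T ph"
proof -
 have S: "weak_homotopy_equivalence S S (pw \<circ> ph)" and T: "weak_homotopy_equivalence T T (ph \<circ> pw)"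
  by (rule weak_homotopy_equivalence_homotopic_id[OF assms(3)] weak_homotopy_equivalence_homotopic_id[OF assms(4)])+
 show ?thesis
  unfolding weak_homotopy_equivalence_def
 proof (intro conjI allI ballI impI ph)
  show "topspace T = {}" if "topspace S = {}"
  using continuous_map_image_subset_topspace[OF pw] that by auto
 next
  fix n s f f' assume s: "s : topspace S"
  and *: "spheroid n S s f & spheroid n S s f' & spheroid_homotopic n T (ph s) (ph \<circ> f) (ph \<circ> f')"
  have "spheroid_homotopic n S ((pw \<circ> ph) s) (pw \<circ> ph \<circ> f) (pw \<circ> ph \<circ> f')"
  using * spheroid_homotopic_compose[OF _ pw, of n "ph s" "ph \<circ> f" "ph \<circ> f'"] by (simp add: comp_assoc)
  thus "spheroid_homotopic n S s f f'" using * by (intro weak_homotopy_equivalence_inj[OF S s]) simp_all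
 next
  fix n s g assume s: "s : topspace S" and g: "spheroid n T (ph s) g"
  have phs: "ph s : topspace T" using continuous_map_image_subset_topspace[OF ph] s by auto
  have "spheroid n S ((pw \<circ> ph) s) (pw \<circ> g)" using spheroid_compose[OF g pw] by simp
  then obtain f where f: "spheroid n S s f" "spheroid_homotopic n S ((pw \<circ> ph) s) ((pw \<circ> ph) \<circ> f) (pw \<circ> g)"
  using weak_homotopy_equivalence_surj[OF S s] by metis
  have "spheroid_homotopic n T ((ph \<circ> pw) (ph s)) ((ph \<circ> pw) \<circ> (ph \<circ> f)) ((ph \<circ> pw) \<circ> g)"
  using spheroid_homotopic_compose[OF f(2) ph] by (simp add: comp_assoc)
  hence "spheroid_homotopic n T (ph s) (ph \<circ> f) g"
  by (rule weak_homotopy_equivalence_inj[OF T phs spheroid_compose[OF f(1) ph] g])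
  thus "EX f. spheroid n S s f & spheroid_homotopic n T (ph s) (ph \<circ> f) g" using f by blast
 qed
qed

section \<open>The simplex category\<close>

definition om :: "nat => (nat => nat) => nat => ord_map" where
 "om m f n = (m, restrict f {..m}, n)"

definition ap :: "ord_map => nat => nat" where
 "ap tq = fst (snd tq)"

abbreviation DHom :: "nat => nat => ord_map set" where
 "DHom \<equiv> Hom Delta"

abbreviation dcomp :: "ord_map => ord_map => ord_map" (infixl \<open>##\<close> 70) where
 "tq ## ph \<equiv> tq \<cdot>\<^bsub>Delta\<^esub> ph"

abbreviation dconst :: "nat => nat => nat => ord_map" where
 "dconst m i n \<equiv> om m (%_. i) n"

abbreviation did :: "nat => ord_map" where
 "did n \<equiv> om n (%i. i) n"

definition dface :: "nat => nat => ord_map" where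
 "dface l n = om n (%i. if i < l then i else Suc i) (Suc n)"

definition ddeg :: "nat => nat => ord_map" where
 "ddeg l n = om (Suc n) (%i. if i <= l then i else i - 1) n"

declare split_paired_All [simp del] split_paired_Ex [simp del]

definition darr :: "ord_map => bool" where "darr tq \<longleftrightarrow> tq : Arr Delta"
definition src :: "ord_map => nat" where "src tq = fst tq"
definition tgt :: "ord_map => nat" where "tgt tq = snd (snd tq)"

lemma Hom_Delta: "DHom m n = {(m, f, n) | f. f : {..m} \<rightarrow>\<^sub>E {..n} & mono_on {..m} f}"
 by (auto simp: Hom_def Delta_def)

lemma DHom_iff [simp]: "tq : DHom m n \<longleftrightarrow> darr tq & src tq = m & tgt tq = n"
 by (auto simp: Hom_def Delta_def darr_def src_def tgt_def)

lemma darr_form: "darr tq ==> EX f. tq = (src tq, f, tgt tq) & f : {..src tq} \<rightarrow>\<^sub>E {..tgt tq} & mono_on {..src tq} f"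
 by (auto simp: Delta_def darr_def src_def tgt_def)

lemma src_om [simp]: "src (om m f n) = m" and tgt_om [simp]: "tgt (om m f n) = n"
 by (simp_all add: om_def src_def tgt_def)

lemma darr_om: "(!!i. i <= m ==> f i <= n) ==> (!!i j. i <= j ==> j <= m ==> f i <= f j) ==> darr (om m f n)"
 by (auto simp: darr_def Delta_def om_def mono_on_def)

lemma ap_om [simp]: "i <= m ==> ap (om m f n) i = f i"
 by (simp add: ap_def om_def)

lemma ap_le [simp]: "darr tq ==> i <= src tq ==> tgt tq = n ==> ap tq i <= n"
 by (auto simp: darr_def Delta_def ap_def src_def tgt_def)

lemma ap_mono: "darr tq ==> i <= j ==> j <= src tq ==> ap tq i <= ap tq j"
 by (auto simp: darr_def Delta_def ap_def mono_on_def src_def)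

lemma om_ap: "darr tq ==> om (src tq) (ap tq) (tgt tq) = tq"
 by (auto simp: darr_def Delta_def ap_def src_def tgt_def om_def PiE_def extensional_restrict)

lemma darr_eqI:
 assumes "darr tq" "darr ph" "src tq = src ph" "tgt tq = tgt ph" "!!i. i <= src ph ==> ap tq i = ap ph i" shows "tq = ph"
proof -
 have "om (src tq) (ap tq) (tgt tq) = om (src ph) (ap ph) (tgt ph)" using assms(3-) by (auto simp: om_def)
 thus ?thesis using assms om_ap by metis
qed

lemma dcomp_eq:
 assumes "darr tq" "darr ph" "src tq = tgt ph" shows "tq ## ph = om (src ph) (%i. ap tq (ap ph i)) (tgt tq)"
proof -
 obtain f g where "tq = (src tq, g, tgt tq)" "ph = (src ph, f, tgt ph)" using assms darr_form by metis
 hence "tq ## ph = (src ph, compose {..src ph} g f, tgt tq)" "ap tq = g" "ap ph = f"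
  by (simp_all add: Delta_def ap_def split: prod.splits) (metis fst_conv snd_conv)+
 thus ?thesis by (simp add: om_def compose_def)
qed

lemma dcomp_simps [simp]:
 assumes "darr tq" "darr ph" "src tq = tgt ph"
 shows "darr (tq ## ph)" "src (tq ## ph) = src ph" "tgt (tq ## ph) = tgt tq"
  "i <= src ph ==> ap (tq ## ph) i = ap tq (ap ph i)"
 using assms by (auto simp: dcomp_eq intro!: darr_om ap_mono)

lemma did_darr [simp]: "darr (did n)" by (rule darr_om) auto

lemma Idt_Delta: "Idt Delta n = did n" by (simp add: Delta_def om_def)

lemma dcomp_did [simp]: 
 "darr tq ==> src tq = m ==> tq ## did m = tq" "darr tq ==> tgt tq = n ==> did n ## tq = tq"
 by (rule darr_eqI; auto)+

lemma dcomp_assoc: 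
 "darr tq ==> darr ph ==> darr pw ==> src tq = tgt ph ==> src ph = tgt pw ==> tq ## (ph ## pw) = tq ## ph ## pw"
 by (rule darr_eqI) auto

lemma dconst_darr [simp]: "i <= n ==> darr (dconst m i n)" by (rule darr_om) auto

lemma dface_simps [simp]: "darr (dface l n)" "src (dface l n) = n" "tgt (dface l n) = Suc n"
 unfolding dface_def by (auto intro!: darr_om)

lemma ddeg_simps [simp]: "l <= n ==> darr (ddeg l n)" "src (ddeg l n) = Suc n" "tgt (ddeg l n) = n"
 unfolding ddeg_def by (auto intro!: darr_om)

lemma dcomp_dconst [simp]:
 "darr tq ==> src tq = m ==> i <= m ==> tq ## dconst k i m = dconst k (ap tq i) (tgt tq)"
 by (rule darr_eqI) auto

lemma dconst_dcomp [simp]: "darr tq ==> tgt tq = n ==> i <= p ==> dconst n i p ## tq = dconst (src tq) i p"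
 by (rule darr_eqI) auto

lemma ap_dface [simp]: "i <= n ==> ap (dface l n) i = (if i < l then i else Suc i)" by (simp add: dface_def)
lemma ap_ddeg [simp]: "i <= Suc n ==> ap (ddeg l n) i = (if i <= l then i else i - 1)" by (simp add: ddeg_def)

lemma ddeg_dface [simp]: "l <= n ==> ddeg l n ## dface l n = did n" "l <= n ==> ddeg l n ## dface (Suc l) n = did n"
 by (rule darr_eqI; auto)+

text \<open>A map that misses \<open>l\<close> factors through the \<open>l\<close>-th face.\<close>

lemma factor_dface:
 assumes t: "darr tq" "tgt tq = Suc n" "l <= Suc n" and l: "!!i. i <= src tq ==> ap tq i ~= l"
 shows "dface l n ## (ddeg (l - 1) n ## tq) = tq"
proof (rule darr_eqI)
 fix i assume i: "i <= src tq"
 have *: "ap tq i <= Suc n" "ap tq i ~= l" using assms i by auto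
 have "ap (ddeg (l - 1) n) (ap tq i) <= n" using * t by (auto simp: not_le)
 thus "ap (dface l n ## (ddeg (l - 1) n ## tq)) i = ap tq i"
  using i t * by (auto simp: not_le not_less)
qed (use t in auto)

section \<open>Simplicial sets\<close>

lemma act_in [simp]:
 "is_sset X ==> darr tq ==> src tq = m ==> x : Simp X (tgt tq) ==> SAct X tq x : Simp X m"
 unfolding is_sset_def DHom_iff by blast

lemma act_id [simp]: "is_sset X ==> x : Simp X n ==> SAct X (did n) x = x"
 unfolding is_sset_def Idt_Delta by blast

lemma act_act [simp]:
 "is_sset X ==> darr tq ==> darr ph ==> src tq = tgt ph ==> x : Simp X (tgt tq) ==>
  SAct X ph (SAct X tq x) = SAct X (tq ## ph) x"
 unfolding is_sset_def DHom_iff by metis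

lemma sset_map_in: "sset_map X Y f ==> x : Simp X n ==> f n x : Simp Y n"
 by (simp add: sset_map_def)

lemma sset_map_act:
 "sset_map X Y f ==> darr tq ==> src tq = m ==> x : Simp X (tgt tq) ==>
  f m (SAct X tq x) = SAct Y tq (f (tgt tq) x)"
 unfolding sset_map_def DHom_iff by blast

lemma sset_map_comp: "sset_map X Y f ==> sset_map Y Z g ==> sset_map X Z (%n x. g n (f n x))"
 by (simp add: sset_map_def)

lemma std_simplex_simps [simp]:
 "Simp (std_simplex n) m = DHom m n" "SAct (std_simplex n) al tq = tq ## al"
 by (simp_all add: std_simplex_def)

lemma std_simplex_sset: "is_sset (std_simplex n)"
 by (subst is_sset_def) (auto simp: Idt_Delta dcomp_assoc)

lemma sset_prod_simps [simp]:
 "Simp (sset_prod X Y) n = Simp X n \<times> Simp Y n"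
 "SAct (sset_prod X Y) al z = (SAct X al (fst z), SAct Y al (snd z))"
 by (simp_all add: sset_prod_def case_prod_unfold)

lemma sset_prod_sset: "is_sset X ==> is_sset Y ==> is_sset (sset_prod X Y)"
 by (subst is_sset_def) (auto simp: Idt_Delta)

lemma simplex_sset_map: "is_sset X ==> x : Simp X n ==> sset_map (std_simplex n) X (%m tq. SAct X tq x)"
 by (auto simp: sset_map_def)

lemma sset_map_simplex:
 "sset_map (std_simplex n) X h ==> darr tq ==> src tq = m ==> tgt tq = n ==> h m tq = SAct X tq (h n (did n))"
 using sset_map_act[of "std_simplex n" X h tq m "did n"] by simp

definition vtx :: "'x sset => nat => nat => 'x => 'x" where
 "vtx X n i x = SAct X (dconst 0 i n) x"

lemma vtx_in [simp]: "is_sset X ==> x : Simp X n ==> i <= n ==> vtx X n i x : Simp X 0"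
 by (simp add: vtx_def)

lemma vtx_act [simp]: 
 "is_sset X ==> darr tq ==> src tq = m ==> x : Simp X (tgt tq) ==> i <= m ==>
  vtx X m i (SAct X tq x) = vtx X (tgt tq) (ap tq i) x"
 by (simp add: vtx_def)

lemma vtx_map: "sset_map X Y f ==> x : Simp X n ==> i <= n ==> f 0 (vtx X n i x) = vtx Y n i (f n x)"
 by (simp add: vtx_def sset_map_act)

lemma sdegenerate_eq: "sdegenerate X n x = SAct X (dconst n 0 0) x"
 by (simp add: sdegenerate_def om_def)

lemma sdegenerate_in [simp]: "is_sset X ==> x : Simp X 0 ==> sdegenerate X n x : Simp X n"
 by (simp add: sdegenerate_eq)

lemma act_sdegenerate [simp]:
 "is_sset X ==> x : Simp X 0 ==> darr tq ==> tgt tq = n ==>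
  SAct X tq (sdegenerate X n x) = sdegenerate X (src tq) x"
 by (simp add: sdegenerate_eq)

lemma sdegenerate_0 [simp]: "is_sset X ==> x : Simp X 0 ==> sdegenerate X 0 x = x"
 using act_id[of X x 0] by (simp add: sdegenerate_eq om_def restrict_def cong: if_cong)

lemma vtx_sdegenerate [simp]:
 "is_sset X ==> x : Simp X 0 ==> i <= n ==> vtx X n i (sdegenerate X n x) = x"
 unfolding vtx_def by simp

lemma act_dconst:
 "is_sset X ==> x : Simp X n ==> i <= n ==> SAct X (dconst m i n) x = sdegenerate X m (vtx X n i x)"
 by (simp add: sdegenerate_eq vtx_def)

lemma sdegenerate_map: "sset_map X Y f ==> x : Simp X 0 ==> f n (sdegenerate X n x) = sdegenerate Y n (f 0 x)"
 by (simp add: sdegenerate_eq sset_map_act)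

definition edge :: "'x sset => 'x => 'x => 'x => bool" where
 "edge X e a b \<longleftrightarrow> e : Simp X 1 & vtx X 1 0 e = a & vtx X 1 1 e = b"

abbreviation connected_by_edge :: "'x sset => 'x => 'x => bool" where
 "connected_by_edge X a b \<equiv> EX e. edge X e a b"

definition same_component :: "'x sset => 'x => 'x => bool" where
 "same_component X = equivclp (connected_by_edge X)"

lemma edge_map: "sset_map X Y f ==> edge X e a b ==> edge Y (f 1 e) (f 0 a) (f 0 b)"
 by (auto simp: edge_def sset_map_in vtx_map)

lemma edge_verts: "is_sset X ==> edge X e a b ==> a : Simp X 0 & b : Simp X 0"
 by (auto simp: edge_def)

lemma edge_sdegenerate: "is_sset X ==> x : Simp X 0 ==> edge X (sdegenerate X 1 x) x x"
 by (auto simp: edge_def)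

lemma same_component_refl [simp]: "same_component X a a"
 by (simp add: same_component_def)

lemma same_component_sym: "same_component X a b ==> same_component X b a"
 unfolding same_component_def by (rule equivclp_sym)

lemma same_component_trans [trans]: "same_component X a b ==> same_component X b c ==> same_component X a c"
 unfolding same_component_def by (rule equivclp_trans)

lemma edge_same_component: "edge X e a b ==> same_component X a b"
 unfolding same_component_def by (rule r_into_equivclp) blast

lemma same_component_induct [consumes 1, case_names refl step]:
 assumes "same_component X a b" "P a"
  "!!c d. same_component X a c ==> (EX e. edge X e c d \<or> edge X e d c) ==> P c ==> P d"
 shows "P b"
 using assms(1) unfolding same_component_def
proof (induction rule: equivclp_induct)
 case (step c d)
 thus ?case using assms(3)[of c d] by (auto simp: same_component_def)
qed (rule assms(2))

lemma same_component_map: 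
 assumes f: "sset_map X Y f" and "same_component X a b" shows "same_component Y (f 0 a) (f 0 b)"
 using assms(2)
proof (induction rule: same_component_induct)
 case (step c d)
 thus ?case
  using edge_map[OF f] edge_same_component same_component_sym same_component_trans by metis
qed simp

section \<open>Kan fibrations\<close>

lemma horn_iff [simp]: "tq : Simp (horn n k) m \<longleftrightarrow>
  darr tq & src tq = m & tgt tq = n & (EX l<=n. l ~= k & (ALL i<=m. ap tq i ~= l))"
 by (auto simp: horn_def ap_def)

lemma horn_act [simp]: "SAct (horn n k) al tq = tq ## al"
 by (simp add: horn_def)

lemma kan_map: "kan_fibration X Y p ==> sset_map X Y p" by (simp add: kan_fibration_def)

lemma kan_fill:
 assumes k: "kan_fibration X Y p" and Y: "is_sset Y"
  and n: "1 <= n" "k <= n"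
  and u1: "!!tq. tq : Simp (horn n k) (src tq) ==> u tq : Simp X (src tq)"
  and u2: "!!tq al. tq : Simp (horn n k) (src tq) ==> darr al ==> tgt al = src tq ==> u (tq ## al) = SAct X al (u tq)"
  and y: "y : Simp Y n"
  and py: "!!tq. tq : Simp (horn n k) (src tq) ==> p (src tq) (u tq) = SAct Y tq y"
 shows "EX x:Simp X n. p n x = y & (ALL tq. tq : Simp (horn n k) (src tq) --> SAct X tq x = u tq)"
proof -
 let ?v = "%m tq. SAct Y tq y"
 have a: "sset_map (horn n k) X (%m. u)" using u1 u2 by (auto simp: sset_map_def)
 have b: "sset_map (std_simplex n) Y ?v" using y Y by (rule simplex_sset_map[rotated])
 have c: "ALL m. ALL tq:Simp (horn n k) m. p m (u tq) = SAct Y tq y" using py by auto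
 have "EX h. sset_map (std_simplex n) X h & (ALL m. ALL tq:Simp (horn n k) m. h m tq = u tq) &
  (ALL m. ALL tq:Simp (std_simplex n) m. p m (h m tq) = SAct Y tq y)"
  by (rule k[unfolded kan_fibration_def, THEN conjunct2, THEN spec, THEN mp, OF n(1), THEN spec, THEN mp, OF n(2),
  THEN spec[of _ "%m. u"], THEN spec[of _ ?v], THEN mp, OF conjI[OF a conjI[OF b c]]])
 then obtain h where h: "sset_map (std_simplex n) X h" 
  "ALL m. ALL tq:Simp (horn n k) m. h m tq = u tq" "ALL m. ALL tq:Simp (std_simplex n) m. p m (h m tq) = SAct Y tq y"
  by (elim exE conjE)
 have "p n (h n (did n)) = SAct Y (did n) y" using bspec[OF spec[OF h(3), of n], of "did n"] by simp
 hence "p n (h n (did n)) = y" using Y y by simp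
 moreover have "h n (did n) : Simp X n" using sset_map_in[OF h(1), of "did n" n] by simp
 moreover have "ALL tq. tq : Simp (horn n k) (src tq) --> SAct X tq (h n (did n)) = u tq"
 proof (intro allI impI)
  fix tq assume t: "tq : Simp (horn n k) (src tq)"
  hence "h (src tq) tq = SAct X tq (h n (did n))" by (intro sset_map_simplex[OF h(1)]) auto
  thus "SAct X tq (h n (did n)) = u tq" using h(2) t by simp
 qed
 ultimately show ?thesis by (intro bexI[of _ "h n (did n)"] conjI)
qed

lemma kan_lift_edge:
 assumes k: "kan_fibration X Y p" and X: "is_sset X" and Y: "is_sset Y"
  and y: "y : Simp Y 1" and i: "i <= 1" and x: "x : Simp X 0" and px: "p 0 x = vtx Y 1 i y"
 shows "EX e:Simp X 1. p 1 e = y & vtx X 1 i e = x"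
proof -
 note p = kan_map[OF k]
 have h: "tq = dconst (src tq) i 1" if tq: "tq : Simp (horn 1 i) (src tq)" for tq
 proof (rule darr_eqI)
  fix j assume "j <= src (dconst (src tq) i 1)"
  moreover obtain l where "l <= 1" "l ~= i" "ALL j<=src tq. ap tq j ~= l" using tq by auto
  moreover have "ap tq j <= 1" using tq calculation by simp
  ultimately show "ap tq j = ap (dconst (src tq) i 1) j" using i by (auto simp: le_Suc_eq)
 qed (use tq i in auto)
 have "EX e:Simp X 1. p 1 e = y &
  (ALL tq. tq : Simp (horn 1 i) (src tq) --> SAct X tq e = sdegenerate X (src tq) x)"
 proof (rule kan_fill[OF k Y _ i _ _ y])
  show "p (src tq) (sdegenerate X (src tq) x) = SAct Y tq y" if "tq : Simp (horn 1 i) (src tq)" for tq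
  by (subst (3) h[OF that]) (use Y y i in \<open>simp add: act_dconst px sdegenerate_map[OF p x]\<close>)
 qed (use X x in auto)
 moreover have "dconst 0 i 1 : Simp (horn 1 i) (src (dconst 0 i 1))"
  using i by (cases i) (auto intro!: exI[of _ "1 - i"])
 ultimately obtain e where "e : Simp X 1" "p 1 e = y" "SAct X (dconst 0 i 1) e = sdegenerate X 0 x" 
  unfolding src_om by (metis src_om)
 thus ?thesis using X x unfolding vtx_def by auto
qed

lemma kan_lift_component:
 assumes k: "kan_fibration X Y p" and X: "is_sset X" and Y: "is_sset Y"
  and x: "x : Simp X 0" and s: "same_component Y (p 0 x) y"
 shows "EX x':Simp X 0. same_component X x x' & p 0 x' = y"
 using s
proof (induction rule: same_component_induct)
 case refl
 show ?case by (rule bexI[OF _ x]) simp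
next
 case (step c d)
 then obtain x' where x': "x' : Simp X 0" "same_component X x x'" "p 0 x' = c" by blast
 from step(2) obtain e where "edge Y e c d \<or> edge Y e d c" by (elim exE)
 hence "e : Simp Y 1 & (EX i<=1. vtx Y 1 i e = c & vtx Y 1 (1 - i) e = d)"
 proof
  assume "edge Y e c d"
  thus ?thesis by (auto simp: edge_def intro!: exI[of _ 0])
 next
  assume "edge Y e d c"
  thus ?thesis by (auto simp: edge_def intro!: exI[of _ 1])
 qed
 then obtain i where e: "e : Simp Y 1" "i <= 1" "vtx Y 1 i e = c" "vtx Y 1 (1 - i) e = d" by (elim conjE exE)
 obtain e' where e': "e' : Simp X 1" "p 1 e' = e" "vtx X 1 i e' = x'"
  using kan_lift_edge[OF k X Y e(1,2) x'(1)] x'(3) e by auto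
 have "same_component X x' (vtx X 1 (1 - i) e')"
 proof (cases "i = 0")
  case True
  hence "edge X e' x' (vtx X 1 (1 - i) e')" using e' by (simp add: edge_def)
  thus ?thesis by (rule edge_same_component)
 next
  case False
  hence "edge X e' (vtx X 1 (1 - i) e') x'" using e' e(2) by (simp add: edge_def le_Suc_eq)
  thus ?thesis by (rule edge_same_component[THEN same_component_sym])
 qed
 with x'(2) have "same_component X x (vtx X 1 (1 - i) e')" by (rule same_component_trans)
 moreover have "p 0 (vtx X 1 (1 - i) e') = d" using vtx_map[OF kan_map[OF k] e'(1)] e e' by simp
 moreover have "vtx X 1 (1 - i) e' : Simp X 0" using X e'(1) by simp
 ultimately show ?case by blast
qed

lemma horn2_fill:
 assumes k: "kan_fibration X Y p" and X: "is_sset X" and Y: "is_sset Y"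
  and kl: "(k, l, l') : {(0, Suc 1, 1), (1, Suc 1, 0), (Suc 1, 1, 0)}"
  and a: "a : Simp X 1" and b: "b : Simp X 1"
  and ab: "vtx X 1 (ap (ddeg (l - 1) 1) k) a = vtx X 1 (ap (ddeg (l' - 1) 1) k) b"
  and y: "y : Simp Y (Suc 1)" and ya: "SAct Y (dface l 1) y = p 1 a" and yb: "SAct Y (dface l' 1) y = p 1 b"
 shows "EX x:Simp X (Suc 1). p (Suc 1) x = y & SAct X (dface l 1) x = a & SAct X (dface l' 1) x = b"
proof -
 note p = kan_map[OF k]
 have kl': "k <= Suc 1" "l <= Suc 1" "l' <= Suc 1" "k ~= l" "k ~= l'" "l ~= l'" "l - 1 <= 1" "l' - 1 <= 1"
  and ex: "!!j. j <= Suc 1 ==> j = k \<or> j = l \<or> j = l'"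
  using kl by (auto simp: le_Suc_eq)
 have dl: "darr (ddeg (l - 1) 1)" "darr (ddeg (l' - 1) 1)" using kl' by auto
 define miss where "miss tq j \<longleftrightarrow> (ALL i<=src tq. ap tq i ~= j)" for tq j
 define u where "u tq = (if miss tq l then SAct X (ddeg (l - 1) 1 ## tq) a else SAct X (ddeg (l' - 1) 1 ## tq) b)" for tq
 have miss': "miss tq l'" if "tq : Simp (horn (Suc 1) k) (src tq)" "\<not> miss tq l" for tq
  using that ex by (auto simp: miss_def)
 have both: "tq = dconst (src tq) k (Suc 1)" if "darr tq" "tgt tq = Suc 1" "miss tq l" "miss tq l'" for tq
 proof (rule darr_eqI)
  fix i assume "i <= src (dconst (src tq) k (Suc 1))"
  hence "ap tq i ~= l" "ap tq i ~= l'" "ap tq i <= Suc 1" "i <= src tq" using that by (auto simp: miss_def)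
  thus "ap tq i = ap (dconst (src tq) k (Suc 1)) i" using ex by fastforce
 qed (use that kl' in auto)
 have const: "SAct X (ddeg (l - 1) 1 ## dconst m k (Suc 1)) a = SAct X (ddeg (l' - 1) 1 ## dconst m k (Suc 1)) b" for m
 proof -
  have "ap (ddeg (l - 1) 1) k <= 1" "ap (ddeg (l' - 1) 1) k <= 1" using kl' dl by (auto intro!: ap_le)
  hence "SAct X (dconst m (ap (ddeg (l - 1) 1) k) 1) a = SAct X (dconst m (ap (ddeg (l' - 1) 1) k) 1) b"
  using ab a b X act_dconst by metis
  thus ?thesis using dl kl' by (simp del: ap_ddeg)
 qed
 have "EX x:Simp X (Suc 1). p (Suc 1) x = y &
  (ALL tq. tq : Simp (horn (Suc 1) k) (src tq) --> SAct X tq x = u tq)"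
 proof (rule kan_fill[OF k Y _ kl'(1) _ _ y])
  fix tq assume tq: "tq : Simp (horn (Suc 1) k) (src tq)"
  hence t: "darr tq" "tgt tq = Suc 1" by auto
  show "u tq : Simp X (src tq)" using t dl a b X by (simp add: u_def)
  have *: "p (src tq) (SAct X (ddeg (j - 1) 1 ## tq) z) = SAct Y tq y"
  if "miss tq j" "z : Simp X 1" "SAct Y (dface j 1) y = p 1 z" "j <= Suc 1" "darr (ddeg (j - 1) 1)" for j z
  proof -
  have "p (src tq) (SAct X (ddeg (j - 1) 1 ## tq) z) = SAct Y (ddeg (j - 1) 1 ## tq) (p 1 z)"
  using t that by (simp add: sset_map_act[OF p])
  also have "... = SAct Y (dface j 1 ## (ddeg (j - 1) 1 ## tq)) y"
  unfolding that(3)[symmetric] using t that(4,5) y Y by simp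
  also have "dface j 1 ## (ddeg (j - 1) 1 ## tq) = tq"
  using factor_dface[of tq 1 j] t that by (simp add: miss_def)
  finally show ?thesis .
  qed
  show "p (src tq) (u tq) = SAct Y tq y"
  using *[OF _ a ya kl'(2) dl(1)] *[OF _ b yb kl'(3) dl(2)] miss'[OF tq] by (auto simp: u_def)
  fix al assume al: "darr al" "tgt al = src tq"
  have nat: "SAct X (d ## (tq ## al)) z = SAct X al (SAct X (d ## tq) z)" 
  if "darr d" "src d = Suc 1" "tgt d = 1" "z : Simp X 1" for d z
  using that t al X by (simp add: dcomp_assoc)
  have mono: "miss (tq ## al) j" if "miss tq j" for j using that t al by (simp add: miss_def)
  show "u (tq ## al) = SAct X al (u tq)"
  proof (cases "miss tq l")
  case True
  with mono[OF True] show ?thesis using nat[OF dl(1) _ _ a] by (simp add: u_def)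
  next
  case False
  have "u (tq ## al) = SAct X (ddeg (l' - 1) 1 ## (tq ## al)) b"
  proof (cases "miss (tq ## al) l")
  case True
  have "tq ## al = dconst (src (tq ## al)) k (Suc 1)"
  using t al True mono[OF miss'[OF tq False]] by (intro both) auto
  thus ?thesis using True const[of "src (tq ## al)"] by (simp add: u_def)
  qed (simp add: u_def)
  thus ?thesis using False nat[OF dl(2) _ _ b] by (simp add: u_def)
  qed
 qed simp
 then obtain x where x: "x : Simp X (Suc 1)" "p (Suc 1) x = y"
  "!!tq. tq : Simp (horn (Suc 1) k) (src tq) ==> SAct X tq x = u tq" by blast
 have ml: "miss (dface j 1) j" for j by (auto simp: miss_def)
 have hl: "dface j 1 : Simp (horn (Suc 1) k) (src (dface j 1))" if "j <= Suc 1" "j ~= k" for j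
  using ml[of j] that by (auto simp: miss_def)
 have idl: "ddeg (j - 1) 1 ## dface j 1 = did 1" if "j <= Suc 1" for j
  using ddeg_dface(1)[of 0 1] ddeg_dface(2)[of "j - 1" 1] that by (cases j) auto
 have "SAct X (dface l 1) x = a" using x(3)[OF hl[of l]] ml[of l] idl[of l] a X kl' by (simp add: u_def)
 moreover have "\<not> miss (dface l' 1) l"
  using kl unfolding miss_def by (auto intro: exI[of _ 0] exI[of _ 1])
 hence "SAct X (dface l' 1) x = b" using x(3)[OF hl[of l']] idl[of l'] b X kl' by (simp add: u_def)
 ultimately show ?thesis using x by blast
qed

definition vert_edge :: "'x sset => 'y sset => (nat => 'x => 'y) => 'x => 'x => bool" where
 "vert_edge X Y p a b \<longleftrightarrow> (EX e. edge X e a b & p 1 e = sdegenerate Y 1 (p 0 a))"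

text \<open>Two edges with the same image carry a vertical edge between their sources to one between their
 targets and conversely: each time two 2-dimensional horns are filled over degenerate simplices.\<close>

lemma vert_edge_transport:
 assumes k: "kan_fibration X Y p" and X: "is_sset X" and Y: "is_sset Y"
  and e: "edge X e x0 x1" and e': "edge X e' x0' x1'" and pe: "p 1 e = p 1 e'"
 shows "vert_edge X Y p x0 x0' \<longleftrightarrow> vert_edge X Y p x1 x1'"
proof -
 note p = kan_map[OF k]
 define c where "c = p 1 e"
 have c: "c : Simp Y 1" using e sset_map_in[OF p] by (simp add: c_def edge_def)
 have c0: "vtx Y 1 0 c = p 0 x0" "vtx Y 1 1 c = p 0 x1"
  using e vtx_map[OF p, of e 1] by (auto simp: c_def edge_def)
 define y0 where "y0 = SAct Y (ddeg 0 1) c"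
 define y1 where "y1 = SAct Y (ddeg 1 1) c"
 have y: "y0 : Simp Y (Suc 1)" "y1 : Simp Y (Suc 1)" using c Y by (simp_all add: y0_def y1_def)
 have ddf: "ddeg 0 1 ## dface (Suc 1) 1 = dconst 1 0 1" "ddeg 1 1 ## dface 0 1 = dconst 1 1 1"
  by (rule darr_eqI; auto)+
 have f0: "SAct Y (dface 0 1) y0 = c" "SAct Y (dface 1 1) y0 = c" "SAct Y (dface (Suc 1) 1) y0 = sdegenerate Y 1 (p 0 x0)"
  using ddeg_dface[of 0 1] ddf c Y c0 by (simp_all add: y0_def act_dconst)
 have f1: "SAct Y (dface 1 1) y1 = c" "SAct Y (dface (Suc 1) 1) y1 = c" "SAct Y (dface 0 1) y1 = sdegenerate Y 1 (p 0 x1)"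
  using ddeg_dface[of 1 1] ddf c Y c0 by (simp_all add: y1_def act_dconst)
 have third: "edge X (SAct X (dface j 1) x) (vtx X (Suc 1) (if j = 0 then 1 else 0) x) (vtx X (Suc 1) (if j = Suc 1 then 1 else Suc 1) x)"
  "vtx X 1 i (SAct X (dface j 1) x) = vtx X (Suc 1) (if i < j then i else Suc i) x"
  "p 1 (SAct X (dface j 1) x) = SAct Y (dface j 1) (p (Suc 1) x)"
  if "x : Simp X (Suc 1)" "i <= 1" "j <= Suc 1" for i j x
  using that X by (auto simp: edge_def sset_map_act[OF p] le_Suc_eq)
 show ?thesis
 proof
  assume "vert_edge X Y p x1 x1'"
  then obtain w where w: "edge X w x1 x1'" "p 1 w = sdegenerate Y 1 (p 0 x1)" by (auto simp: vert_edge_def)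
  have "EX x:Simp X (Suc 1). p (Suc 1) x = y1 & SAct X (dface (Suc 1) 1) x = e & SAct X (dface 0 1) x = w"
  by (rule horn2_fill[OF k X Y, of 1]) (use e w y f1 in \<open>auto simp: edge_def c_def\<close>)
  then obtain x where x: "x : Simp X (Suc 1)" "p (Suc 1) x = y1" "SAct X (dface (Suc 1) 1) x = e" "SAct X (dface 0 1) x = w" by blast
  define g where "g = SAct X (dface 1 1) x"
  have g: "edge X g x0 x1'" "p 1 g = c"
  using third(1)[OF x(1), of 0 1] third(2)[OF x(1), of 0 "Suc 1"] third(2)[OF x(1), of 1 0] third(3)[OF x(1), of 0 1]
  x e w f1(1) by (auto simp: g_def edge_def)
  have "EX x:Simp X (Suc 1). p (Suc 1) x = y0 & SAct X (dface 1 1) x = g & SAct X (dface 0 1) x = e'"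
  by (rule horn2_fill[OF k X Y, of "Suc 1"]) (use e' g y f0 pe in \<open>auto simp: edge_def c_def\<close>)
  then obtain z where z: "z : Simp X (Suc 1)" "p (Suc 1) z = y0" "SAct X (dface 1 1) z = g" "SAct X (dface 0 1) z = e'" by blast
  have "edge X (SAct X (dface (Suc 1) 1) z) x0 x0'"
  using third(1)[OF z(1), of 0 "Suc 1"] third(2)[OF z(1), of 0 1] third(2)[OF z(1), of 0 0] z e' g by (auto simp: edge_def)
  moreover have "p 1 (SAct X (dface (Suc 1) 1) z) = sdegenerate Y 1 (p 0 x0)"
  using third(3)[OF z(1), of 0 "Suc 1"] z f0 by simp
  ultimately show "vert_edge X Y p x0 x0'" by (auto simp: vert_edge_def)
 next
  assume "vert_edge X Y p x0 x0'"
  then obtain w where w: "edge X w x0 x0'" "p 1 w = sdegenerate Y 1 (p 0 x0)" by (auto simp: vert_edge_def)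
  have "EX x:Simp X (Suc 1). p (Suc 1) x = y0 & SAct X (dface (Suc 1) 1) x = w & SAct X (dface 0 1) x = e'"
  by (rule horn2_fill[OF k X Y, of 1]) (use e' w y f0 pe in \<open>auto simp: edge_def c_def\<close>)
  then obtain x where x: "x : Simp X (Suc 1)" "p (Suc 1) x = y0" "SAct X (dface (Suc 1) 1) x = w" "SAct X (dface 0 1) x = e'" by blast
  define g where "g = SAct X (dface 1 1) x"
  have g: "edge X g x0 x1'" "p 1 g = c"
  using third(1)[OF x(1), of 0 1] third(2)[OF x(1), of 0 "Suc 1"] third(2)[OF x(1), of 1 0] third(3)[OF x(1), of 0 1]
  x e' w f0(2) by (auto simp: g_def edge_def)
  have "EX x:Simp X (Suc 1). p (Suc 1) x = y1 & SAct X (dface (Suc 1) 1) x = e & SAct X (dface 1 1) x = g"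
  by (rule horn2_fill[OF k X Y, of 0]) (use e g y f1 in \<open>auto simp: edge_def c_def\<close>)
  then obtain z where z: "z : Simp X (Suc 1)" "p (Suc 1) z = y1" "SAct X (dface (Suc 1) 1) z = e" "SAct X (dface 1 1) z = g" by blast
  have "edge X (SAct X (dface 0 1) z) x1 x1'"
  using third(1)[OF z(1), of 0 0] third(2)[OF z(1), of 1 "Suc 1"] third(2)[OF z(1), of 1 1] z e g by (auto simp: edge_def)
  moreover have "p 1 (SAct X (dface 0 1) z) = sdegenerate Y 1 (p 0 x1)"
  using third(3)[OF z(1), of 0 0] z f1 by simp
  ultimately show "vert_edge X Y p x1 x1'" by (auto simp: vert_edge_def)
 qed
qed

lemma vert_edge_refl:
 "sset_map X Y p ==> is_sset X ==> x : Simp X 0 ==> vert_edge X Y p x x"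
 unfolding vert_edge_def using edge_sdegenerate sdegenerate_map by metis

text \<open>If two maps \<open>f, g : Z \<rightarrow> X\<close> agree after the fibration \<open>p\<close>, having a vertical edge from
 \<open>f z\<close> to \<open>g z\<close> depends only on the component of \<open>z\<close>.\<close>

lemma vert_edge_component:
 assumes k: "kan_fibration X Y p" and X: "is_sset X" and Y: "is_sset Y"
  and f: "sset_map Z X f" and g: "sset_map Z X g" and fg: "!!n z. z : Simp Z n ==> p n (f n z) = p n (g n z)"
  and z: "same_component Z z z'" and v: "vert_edge X Y p (f 0 z) (g 0 z)"
 shows "vert_edge X Y p (f 0 z') (g 0 z')"
 using z
proof (induction rule: same_component_induct)
 case (step c d)
 then obtain e where e: "edge Z e c d \<or> edge Z e d c" by blast
 hence "e : Simp Z 1" by (auto simp: edge_def)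
 with e show ?case
  using vert_edge_transport[OF k X Y edge_map[OF f] edge_map[OF g] fg] step by blast
qed (rule v)

declare split_paired_All [simp] split_paired_Ex [simp]

section \<open>Geometric realization\<close>

abbreviation simplex_top :: "nat => (nat => real) topology" where
 "simplex_top n \<equiv> subtopology (powertop_real UNIV) (standard_simplex n)"

definition pt :: "'x sset => 'x real_point => 'x real_point set" where
 "pt X a = realization_rel X `` {a}"

lemma pushforward_eq: "simplex_pushforward al t j = (\<Sum>i | i <= src al & ap al i = j. t i)"
 by (simp add: simplex_pushforward_def src_def ap_def case_prod_unfold)

lemma pushforward_in:
 assumes a: "darr al" "tgt al = n" and "t : standard_simplex (src al)"
 shows "simplex_pushforward al t : standard_simplex n"
proof -
 define m f where "m = src al" and "f = ap al"
 have f: "!!i. i <= m ==> f i <= n" using a by (simp add: f_def m_def)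
 have t: "!!i. 0 <= t i" "!!i. m < i ==> t i = 0" "(\<Sum>i\<le>m. t i) = 1" using assms(3) by (auto simp: standard_simplex_def m_def)
 define u where "u = simplex_pushforward al t"
 have u: "u j = (\<Sum>i | i <= m & f i = j. t i)" for j
  by (simp add: u_def f_def m_def pushforward_eq)
 have s: "(\<Sum>j\<le>n. u j) = 1"
  unfolding u t(3)[symmetric] by (rule sum.group[of "{..m}" "{..n}" f t, simplified]) (use f in auto)
 have nn: "0 <= u j" for j unfolding u by (rule sum_nonneg) (simp add: t)
 have z: "u j = 0" if "n < j" for j
 proof -
  have "{i. i <= m & f i = j} = {}" using f that not_le by blast
  thus ?thesis unfolding u by (simp only: sum.empty)
 qed
 have "u j <= 1" for j
 proof (cases "j <= n")
  case True
  hence "u j <= (\<Sum>j\<le>n. u j)" by (intro member_le_sum) (auto simp: nn)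
  thus ?thesis using s by simp
 qed (simp add: z)
 thus ?thesis using s nn z by (auto simp: standard_simplex_def u_def)
qed

lemma realization_rel_equiv: "equiv (realization_carrier X) (realization_rel X)"
proof (rule equivI)
 show "refl_on (realization_carrier X) (realization_rel X)"
  by (auto simp: refl_on_def realization_rel_def)
 show "sym (realization_rel X)" by (auto simp: sym_def realization_rel_def intro: equivclp_sym)
 show "trans (realization_rel X)" by (auto simp: trans_def realization_rel_def intro: equivclp_trans)
 show "realization_rel X \<subseteq> realization_carrier X \<times> realization_carrier X" by (auto simp: realization_rel_def)
qed

lemma carrier_iff [simp]: "(n, x, t) : realization_carrier X \<longleftrightarrow> x : Simp X n & t : standard_simplex n"
 by (simp add: realization_carrier_def)

lemma pt_eqI: "(a, b) : realization_rel X ==> pt X a = pt X b"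
 unfolding pt_def using realization_rel_equiv by (rule equiv_class_eq)

lemma pt_step:
 assumes X: "is_sset X" and a: "darr al" "src al = m" "tgt al = n" "x : Simp X n" "t : standard_simplex m"
 shows "pt X (m, SAct X al x, t) = pt X (n, x, simplex_pushforward al t)"
proof (rule pt_eqI)
 have "realization_step X (m, SAct X al x, t) (n, x, simplex_pushforward al t)"
  unfolding realization_step_def using a by (intro exI conjI) auto
 thus "((m, SAct X al x, t), (n, x, simplex_pushforward al t)) : realization_rel X"
  using assms by (auto simp: realization_rel_def pushforward_in)
qed

lemma openin_realization: "openin (realization X) = realization_open X"
 by (simp add: realization_def istopology_realization_open)

lemma pt_in: "a : realization_carrier X ==> pt X a : realization_carrier X // realization_rel X"
 by (simp add: pt_def quotientI)

lemma topspace_realization: "topspace (realization X) = pt X ` realization_carrier X"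
proof -
 have "realization_open X (realization_carrier X // realization_rel X)"
  unfolding realization_open_def
 proof (intro conjI allI ballI)
  fix n x assume "x : Simp X n"
  hence "{t : standard_simplex n. realization_rel X `` {(n, x, t)} : realization_carrier X // realization_rel X}
  = standard_simplex n" by (auto intro: quotientI)
  thus "openin (simplex_top n) {t : standard_simplex n. realization_rel X `` {(n, x, t)} : realization_carrier X // realization_rel X}"
  using openin_topspace[of "simplex_top n"] by simp
 qed simp
 hence "realization_carrier X // realization_rel X \<subseteq> topspace (realization X)"
  by (intro openin_subset) (simp add: openin_realization)
 moreover have "topspace (realization X) \<subseteq> realization_carrier X // realization_rel X"
  using openin_topspace[of "realization X"] unfolding openin_realization realization_open_def by blast
 ultimately show ?thesis by (auto simp: quotient_def pt_def)
qed

definition cells :: "'x sset => ((nat \<times> 'x) \<times> (nat => real)) topology" where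
 "cells X = sum_topology (%(n, x). simplex_top n) {(n, x). x : Simp X n}"

definition cell_pt :: "'x sset => (nat \<times> 'x) \<times> (nat => real) => 'x real_point set" where
 "cell_pt X = (%((n, x), t). pt X (n, x, t))"

lemma topspace_cells: "topspace (cells X) = {((n, x), t). x : Simp X n & t : standard_simplex n}"
 by (auto simp: cells_def)

lemma quotient_map_cell_pt: "quotient_map (cells X) (realization X) (cell_pt X)"
 unfolding quotient_map_def
proof (intro conjI allI impI)
 show "cell_pt X ` topspace (cells X) = topspace (realization X)"
  by (force simp: topspace_cells topspace_realization cell_pt_def realization_carrier_def image_iff)
 fix V assume V: "V \<subseteq> topspace (realization X)"
 have 1: "V \<subseteq> realization_carrier X // realization_rel X"
  using V by (auto simp: topspace_realization intro!: pt_in)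
 have "{t. ((n, x), t) : {z : topspace (cells X). cell_pt X z : V}} = {t : standard_simplex n. pt X (n, x, t) : V}"
  if "x : Simp X n" for n x
  using that by (auto simp: topspace_cells cell_pt_def)
 thus "openin (cells X) {x : topspace (cells X). cell_pt X x : V} = openin (realization X) V"
  unfolding openin_realization realization_open_def
  using 1 by (subst cells_def, subst openin_sum_topology) (auto simp: topspace_cells pt_def)
qed

lemma continuous_map_from_cells:
 fixes X :: "'x sset"
 assumes Z: "!!n x. x : Simp X n ==> continuous_map (prod_topology Z (simplex_top n)) W (%(s, t). g (s, ((n, x), t)))"
 shows "continuous_map (prod_topology Z (cells X)) W g"
proof -
 define T where "T = (%(n, x :: 'x). topspace Z \<times> ({(n, x)} \<times> standard_simplex n))"
 have op: "openin (cells X) ({(n, x)} \<times> U)" if "x : Simp X n" "openin (simplex_top n) U" for n x U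
 proof -
  have "openin (cells X) ((%t. ((n, x), t)) ` U)"
  using open_map_component_injection[of "(n, x)" "{(n, x). x : Simp X n}" "%(n, x). simplex_top n"] that
  unfolding cells_def open_map_def by auto
  moreover have "(%t. ((n, x), t)) ` U = {(n, x)} \<times> U" by auto
  ultimately show ?thesis by simp
 qed
 show ?thesis
 proof (rule pasting_lemma[where I = "{(n, x). x : Simp X n}" and T = T and f = "%_. g"])
  fix i assume "i : {(n, x). x : Simp X n}"
  then obtain n x where i: "i = (n, x)" "x : Simp X n" by blast
  have "openin (cells X) ({(n, x)} \<times> standard_simplex n)"
  using op[OF i(2)] openin_topspace[of "simplex_top n"] by simp
  thus "openin (prod_topology Z (cells X)) (T i)"
  by (simp add: T_def i openin_prod_Times_iff)
  let ?V = "subtopology (prod_topology Z (cells X)) (T i)"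
  have "continuous_map (subtopology (cells X) ({(n, x)} \<times> standard_simplex n)) (simplex_top n) snd"
  unfolding continuous_map_def
  proof (intro conjI allI impI)
  fix U assume U: "openin (simplex_top n) U"
  hence "U \<subseteq> standard_simplex n" using openin_subset by fastforce
  hence "{z : topspace (subtopology (cells X) ({(n, x)} \<times> standard_simplex n)). snd z : U} = {(n, x)} \<times> U"
  using i by (auto simp: topspace_cells)
  moreover have "openin (subtopology (cells X) ({(n, x)} \<times> standard_simplex n)) ({(n, x)} \<times> U)"
  using op[OF i(2) U] `U \<subseteq> standard_simplex n` by (auto simp: openin_subtopology)
  ultimately show "openin (subtopology (cells X) ({(n, x)} \<times> standard_simplex n))
  {z : topspace (subtopology (cells X) ({(n, x)} \<times> standard_simplex n)). snd z : U}" by simp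
  qed (auto simp: topspace_cells)
  moreover have "?V = prod_topology Z (subtopology (cells X) ({(n, x)} \<times> standard_simplex n))"
  by (simp add: T_def i subtopology_Times)
  ultimately have "continuous_map ?V (prod_topology Z (simplex_top n)) (%z. (fst z, (snd \<circ> snd) z))"
  by (simp only:) (intro continuous_map_pairedI continuous_map_fst continuous_map_compose[OF continuous_map_snd])
  hence "continuous_map ?V (prod_topology Z (simplex_top n)) (%z. (fst z, snd (snd z)))" by (simp only: o_apply)
  from continuous_map_compose[OF this Z[OF i(2)]]
  have "continuous_map ?V W (%z. g (fst z, ((n, x), snd (snd z))))" by (simp add: o_def)
  thus "continuous_map ?V W g"
  by (rule continuous_map_eq) (auto simp: T_def i)
 qed (auto simp: T_def topspace_cells)
qed

lemma continuous_map_pt: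
 assumes "x : Simp X n" shows "continuous_map (simplex_top n) (realization X) (%t. pt X (n, x, t))"
proof -
 have "continuous_map (simplex_top n) (cells X) (%t. ((n, x), t))"
  unfolding cells_def using continuous_map_component_injection[of "(n, x)" "{(n, x). x : Simp X n}" "%(n, x). simplex_top n"] assms by auto
 from continuous_map_compose[OF this quotient_imp_continuous_map[OF quotient_map_cell_pt]]
 show ?thesis by (simp add: o_def cell_pt_def)
qed

text \<open>Maps out of \<open>Z \<times> |X|\<close> for a locally compact parameter space \<open>Z\<close>: a product of a quotient map
 with such a space is again a quotient map.\<close>

lemma continuous_map_from_realization_param:
 assumes Z: "locally_compact_space Z" "Hausdorff_space Z"
  and g: "!!n x. x : Simp X n ==> continuous_map (prod_topology Z (simplex_top n)) W (%(s, t). g (s, pt X (n, x, t)))"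
 shows "continuous_map (prod_topology Z (realization X)) W g"
proof -
 have "continuous_map (prod_topology Z (cells X)) W (g \<circ> (%(s, z). (s, cell_pt X z)))"
  by (rule continuous_map_from_cells) (use g in \<open>simp add: o_def cell_pt_def case_prod_unfold\<close>)
 moreover have "quotient_map (prod_topology Z (cells X)) (prod_topology Z (realization X)) (%(s, z). (s, cell_pt X z))"
  using quotient_map_prod_right[OF Z(1) disjI1[OF Z(2)] quotient_map_cell_pt] .
 ultimately show ?thesis by (rule continuous_compose_quotient_map[rotated])
qed

lemma continuous_map_from_realization:
 assumes g: "!!n x. x : Simp X n ==> continuous_map (simplex_top n) W (%t. g (pt X (n, x, t)))"
 shows "continuous_map (realization X) W g"
proof -
 let ?Z = "top_of_set {0::real}"
 have "continuous_map (prod_topology ?Z (realization X)) W (%(s, z). g z)"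
 proof (rule continuous_map_from_realization_param)
  show "locally_compact_space ?Z"
  by (simp add: compact_imp_locally_compact_space compact_space_subtopology)
  show "Hausdorff_space ?Z" by (simp add: Hausdorff_space_subtopology)
  show "continuous_map (prod_topology ?Z (simplex_top n)) W (%(s, t). case (s, pt X (n, x, t)) of (s, z) => g z)"
  if "x : Simp X n" for n x
  using continuous_map_compose[OF continuous_map_snd g[OF that], of ?Z] by (simp add: o_def case_prod_unfold)
 qed
 from continuous_map_compose[OF _ this, of "realization X" "%z. (0, z)"]
 show ?thesis by (force simp: o_def intro: continuous_intros)
qed

text \<open>A function on points that respects the gluing descends to the realization.\<close>

definition descend :: "('x real_point => 'z) => 'x real_point set => 'z" where
 "descend F c = F (SOME a. a : c)"

lemma descend_pt:
 assumes inv: "!!al x t. darr al ==> x : Simp X (tgt al) ==> t : standard_simplex (src al) ==>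
  F (src al, SAct X al x, t) = F (tgt al, x, simplex_pushforward al t)"
  and a: "a : realization_carrier X"
 shows "descend F (pt X a) = F a"
proof -
 have 1: "F a = F b" if "equivclp (realization_step X) a b" for b
  using that
 proof (induction rule: equivclp_induct)
  case (step y z)
  have "F u = F v" if "realization_step X u v" for u v
  using that unfolding realization_step_def by (auto simp: inv)
  thus ?case using step.IH step.hyps by metis
 qed simp
 have "a : pt X a" unfolding pt_def using equiv_class_self[OF realization_rel_equiv a] .
 hence "(SOME b. b : pt X a) : pt X a" by (rule someI)
 hence "equivclp (realization_step X) a (SOME b. b : pt X a)"
  unfolding pt_def realization_rel_def by blast
 from 1[OF this] show ?thesis by (simp add: descend_def)
qed

lemma realization_map_pt:
 assumes X: "is_sset X" and Y: "is_sset Y" and f: "sset_map X Y f" and x: "x : Simp X n" and t: "t : standard_simplex n"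
 shows "realization_map Y f (pt X (n, x, t)) = pt Y (n, f n x, t)"
proof -
 define G where "G = (%(n, x, t). pt Y (n, f n x, t))"
 have G: "G a = G b" if "equivclp (realization_step X) a b" for a b
  using that
 proof (induction rule: equivclp_induct)
  case (step y z)
  have "G u = G v" if "realization_step X u v" for u v
  using that unfolding realization_step_def G_def
  by (auto simp: sset_map_act[OF f] sset_map_in[OF f] pt_step[OF Y])
  thus ?case using step by metis
 qed simp
 have xt: "(n, x, t) : pt X (n, x, t)"
  unfolding pt_def by (rule equiv_class_self[OF realization_rel_equiv]) (use x t in simp)
 have "realization_map Y f (pt X (n, x, t)) = (\<Union>b\<in>pt X (n, x, t). G b)"
 proof -
  have "realization_rel Y `` {(%(n, x, t). (n, f n x, t)) b} = G b" for b by (cases b) (simp add: G_def pt_def)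
  thus ?thesis unfolding realization_map_def by blast
 qed
 also have "... = (\<Union>b\<in>pt X (n, x, t). G (n, x, t))"
  by (intro SUP_cong refl) (auto simp: pt_def realization_rel_def dest: G)
 also have "... = G (n, x, t)" using xt by blast
 finally show ?thesis by (simp add: G_def)
qed

lemma continuous_realization_map:
 assumes X: "is_sset X" and Y: "is_sset Y" and f: "sset_map X Y f"
 shows "continuous_map (realization X) (realization Y) (realization_map Y f)"
proof (rule continuous_map_from_realization)
 fix n x assume x: "x : Simp X n"
 show "continuous_map (simplex_top n) (realization Y) (%t. realization_map Y f (pt X (n, x, t)))"
  by (rule continuous_map_eq[OF continuous_map_pt[OF sset_map_in[OF f x]]])
  (use realization_map_pt[OF X Y f x] in auto)
qed

subsection \<open>Components\<close>

definition vertex_pt :: "'x sset => 'x => 'x real_point set" where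
 "vertex_pt X a = pt X (0, a, %i. if i = 0 then 1 else 0)"

lemma barycentre_0: "(%i. if i = 0 then 1 else 0) : standard_simplex 0"
 by (simp add: standard_simplex_def)

lemma same_component_vtx:
 assumes X: "is_sset X" and x: "x : Simp X n" and i: "i <= n"
 shows "same_component X (vtx X n 0 x) (vtx X n i x)"
proof -
 have d: "darr (om 1 (%j. if j = 0 then 0 else i) n)" by (rule darr_om) (use i in auto)
 have "edge X (SAct X (om 1 (%j. if j = 0 then 0 else i) n) x) (vtx X n 0 x) (vtx X n i x)"
  using d X x by (auto simp: edge_def)
 thus ?thesis by (rule edge_same_component)
qed

lemma connected_realization_component:
 assumes X: "is_sset X" and gm: "continuous_map unit_interval (realization X) gm"
  and 0: "gm 0 = pt X (n, x, t)" "(n, x, t) : realization_carrier X"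
  and 1: "gm 1 = pt X (n', x', t')" "(n', x', t') : realization_carrier X"
 shows "same_component X (vtx X n 0 x) (vtx X n' 0 x')"
proof -
 define F where "F = (%(n, x, t :: nat => real). Collect (same_component X (vtx X n 0 x)))"
 have F: "descend F (pt X a) = F a" if "a : realization_carrier X" for a
 proof (rule descend_pt[OF _ that])
  fix al x and t :: "nat => real"
  assume a: "darr al" "x : Simp X (tgt al)" "t : standard_simplex (src al)"
  have c: "same_component X (vtx X (tgt al) 0 x) (vtx X (tgt al) (ap al 0) x)"
  by (rule same_component_vtx[OF X]) (use a in auto)
  have "Collect (same_component X (vtx X (tgt al) (ap al 0) x)) = Collect (same_component X (vtx X (tgt al) 0 x))"
  using same_component_trans[OF c] same_component_trans[OF same_component_sym[OF c]] by (intro Collect_cong iffI)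
  thus "F (src al, SAct X al x, t) = F (tgt al, x, simplex_pushforward al t)"
  using X a by (simp add: F_def)
 qed
 have "continuous_map (realization X) (discrete_topology UNIV) (descend F)"
 proof (rule continuous_map_from_realization)
  fix n x assume x: "x : Simp X n"
  show "continuous_map (simplex_top n) (discrete_topology UNIV) (%t. descend F (pt X (n, x, t)))"
  by (rule continuous_map_eq[of _ _ "%_. Collect (same_component X (vtx X n 0 x))"])
  (use x F in \<open>auto simp: F_def\<close>)
 qed
 hence "continuous_map unit_interval (discrete_topology UNIV) (descend F \<circ> gm)"
  by (rule continuous_map_compose[OF gm])
 moreover have "connectedin unit_interval {0..1}" by (simp add: connectedin_subtopology is_interval_connected_1)
 ultimately have "connectedin (discrete_topology UNIV) ((descend F \<circ> gm) ` {0..1})"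
  by (rule connectedin_continuous_map_image)
 then obtain c where "(descend F \<circ> gm) ` {0..1} \<subseteq> {c}" by (auto simp: connectedin_discrete_topology)
 from subsetD[OF this imageI[of 0]] subsetD[OF this imageI[of 1]]
 have "descend F (gm 0) = c" "descend F (gm 1) = c" by simp_all
 hence "F (n, x, t) = F (n', x', t')" using 0 1 F by simp
 hence "vtx X n' 0 x' : Collect (same_component X (vtx X n 0 x))" unfolding F_def by simp
 thus ?thesis by simp
qed

lemma cube_0: "cube 0 = {%_. 0}" by (auto simp: cube_def)

lemma homotopic_points_path:
 assumes "spheroid_homotopic 0 S s f g"
 obtains gm where "continuous_map unit_interval S gm" "gm 0 = f (%_. 0)" "gm 1 = g (%_. 0)"
proof -
 obtain h where h: "continuous_map (prod_topology unit_interval (cube_top 0)) S h"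
  "!!x. h (0, x) = f x" "!!x. h (1, x) = g x" 
  using assms by (rule spheroid_homotopicD) blast
 have "continuous_map unit_interval (prod_topology unit_interval (cube_top 0)) (%t. (t, %_. 0))"
  by (intro continuous_map_pairedI) (auto simp: continuous_map_const cube_0 continuous_map_id[unfolded id_def])
 from continuous_map_compose[OF this h(1)] show ?thesis by (rule that) (simp_all add: h[unfolded One_nat_def])
qed

lemma spheroid_0: "a : topspace S ==> spheroid 0 S s (%_. a)"
 by (simp add: spheroid_def cube_boundary_def)

lemma vertex_pt_in: "a : Simp X 0 ==> vertex_pt X a : topspace (realization X)"
 by (auto simp: vertex_pt_def topspace_realization barycentre_0)

lemma vtx_0_0: "is_sset X ==> a : Simp X 0 ==> vtx X 0 0 a = a"
 using vtx_sdegenerate[of X a 0 0] by simp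

lemma sset_weq_component_inj:
 assumes w: "sset_weq X Y f" and X: "is_sset X" and Y: "is_sset Y"
  and a: "a : Simp X 0" and b: "b : Simp X 0" and fab: "f 0 a = f 0 b"
 shows "same_component X a b"
proof -
 have f: "sset_map X Y f" and wh: "weak_homotopy_equivalence (realization X) (realization Y) (realization_map Y f)"
  using w by (auto simp: sset_weq_def)
 have rm: "realization_map Y f (vertex_pt X c) = vertex_pt Y (f 0 c)" if "c : Simp X 0" for c
  unfolding vertex_pt_def by (rule realization_map_pt[OF X Y f that barycentre_0])
 let ?S = "realization X" and ?T = "realization Y" and ?ph = "realization_map Y f"
 have "continuous_map (prod_topology unit_interval (cube_top 0)) ?T (%_. vertex_pt Y (f 0 a))"
  using vertex_pt_in[OF sset_map_in[OF f a]] by simp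
 hence "spheroid_homotopic 0 ?T (?ph (vertex_pt X a)) (?ph \<circ> (%_. vertex_pt X a)) (?ph \<circ> (%_. vertex_pt X b))"
  by (rule spheroid_homotopicI) (use rm a b fab in \<open>auto simp: cube_boundary_def\<close>)
 hence "spheroid_homotopic 0 ?S (vertex_pt X a) (%_. vertex_pt X a) (%_. vertex_pt X b)"
  by (intro weak_homotopy_equivalence_inj[OF wh] spheroid_0 vertex_pt_in a b)
 then obtain gm where "continuous_map unit_interval ?S gm" "gm 0 = vertex_pt X a" "gm 1 = vertex_pt X b"
  by (rule homotopic_points_path)
 hence "same_component X (vtx X 0 0 a) (vtx X 0 0 b)"
  using a b barycentre_0 unfolding vertex_pt_def by (intro connected_realization_component[OF X, of gm 0 a _ 0 b]) auto
 thus ?thesis using a b X by (simp add: vtx_0_0)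
qed

lemma sset_weq_component_surj:
 assumes w: "sset_weq X Y f" and X: "is_sset X" and Y: "is_sset Y" and y: "y : Simp Y 0"
 shows "EX x:Simp X 0. same_component Y (f 0 x) y"
proof -
 have f: "sset_map X Y f" and wh: "weak_homotopy_equivalence (realization X) (realization Y) (realization_map Y f)"
  using w by (auto simp: sset_weq_def)
 let ?S = "realization X" and ?T = "realization Y" and ?ph = "realization_map Y f"
 have "topspace ?S ~= {}" using wh vertex_pt_in[OF y] unfolding weak_homotopy_equivalence_def by blast
 then obtain s where s: "s : topspace ?S" by blast
 obtain g where g: "spheroid 0 ?S s g" "spheroid_homotopic 0 ?T (?ph s) (?ph \<circ> g) (%_. vertex_pt Y y)"
  using weak_homotopy_equivalence_surj[OF wh s spheroid_0[OF vertex_pt_in[OF y]]] by blast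
 obtain gm where gm: "continuous_map unit_interval ?T gm" "gm 0 = (?ph \<circ> g) (%_. 0)" "gm 1 = vertex_pt Y y"
  using g(2) by (rule homotopic_points_path)
 have "g (%_. 0) : topspace ?S"
  using g(1) continuous_map_image_subset_topspace[of "cube_top 0" ?S g] by (auto simp: spheroid_def cube_0)
 then obtain n x t where x: "g (%_. 0) = pt X (n, x, t)" "x : Simp X n" "t : standard_simplex n"
  by (auto simp: topspace_realization realization_carrier_def)
 have "same_component Y (vtx Y n 0 (f n x)) (vtx Y 0 0 y)"
  using gm x realization_map_pt[OF X Y f x(2,3)] sset_map_in[OF f x(2)] y barycentre_0
  by (intro connected_realization_component[OF Y gm(1)]) (auto simp: vertex_pt_def)
 thus ?thesis using X x(2) vtx_map[OF f x(2), of 0] y Y by (intro bexI[of _ "vtx X n 0 x"]) (auto simp: vtx_0_0)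
qed

subsection \<open>Simplicial homotopies\<close>

definition elem_homotopy :: "'x sset => 'y sset => (nat => 'x => 'y) => (nat => 'x => 'y) => bool" where
 "elem_homotopy X Y f g \<longleftrightarrow>
  (EX h. sset_map (sset_prod X (std_simplex 1)) Y h &
  (ALL n. ALL x:Simp X n. h n (x, dconst n 0 1) = f n x & h n (x, dconst n 1 1) = g n x))"

definition simp_homotopic :: "'x sset => 'y sset => (nat => 'x => 'y) => (nat => 'x => 'y) => bool" where
 "simp_homotopic X Y = equivclp (elem_homotopy X Y)"

definition psum :: "(nat => real) => nat => real" where
 "psum t k = (\<Sum>i<k. t i)"

lemma psum_simps [simp]: "psum t 0 = 0" "psum t (Suc k) = psum t k + t k"
 by (simp_all add: psum_def)

lemma psum_eqI: "(!!k. psum t k = psum u k) ==> t = u"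
 using psum_simps(2) by (metis add_left_cancel ext)

lemma psum_mono: "t : standard_simplex n ==> j <= k ==> psum t j <= psum t k"
 unfolding psum_def by (rule sum_mono2) (auto simp: standard_simplex_def)

lemma psum_total: "t : standard_simplex n ==> psum t (Suc n) = 1"
 unfolding psum_def by (simp add: standard_simplex_def lessThan_Suc_atMost)

lemma standard_simplexI:
 assumes "!!i. 0 <= t i" "!!i. n < i ==> t i = 0" "psum t (Suc n) = 1" shows "t : standard_simplex n"
proof -
 have s: "(\<Sum>i\<le>n. t i) = 1" using assms(3) by (simp only: psum_def lessThan_Suc_atMost)
 have "t i <= 1" for i
 proof (cases "i <= n")
  case True
  hence "t i <= (\<Sum>i\<le>n. t i)" by (intro member_le_sum) (auto simp: assms)
  thus ?thesis using s by simp
 qed (simp add: assms)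
 thus ?thesis using assms s by (simp add: standard_simplex_def)
qed

lemma psum_pushforward:
 assumes a: "darr al" and N: "N <= Suc (src al)" "!!i. i <= src al ==> ap al i < k \<longleftrightarrow> i < N"
 shows "psum (simplex_pushforward al t) k = psum t N"
proof -
 have "psum (simplex_pushforward al t) k = (\<Sum>j<k. \<Sum>i | i <= src al & i < N & ap al i = j. t i)"
  unfolding psum_def pushforward_eq by (intro sum.cong refl Collect_cong) (use N in auto)
 also have "... = (\<Sum>i<N. t i)"
 proof -
  have "(\<Sum>j<k. \<Sum>i | i : {..<N} & ap al i = j. t i) = (\<Sum>i<N. t i)"
  by (rule sum.group) (use N in auto)
  moreover have "{i. i <= src al & i < N & ap al i = j} = {i. i : {..<N} & ap al i = j}" for j using N(1) by auto
  ultimately show ?thesis by simp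
 qed
 finally show ?thesis by (simp add: psum_def)
qed

lemma initial_segment:
 assumes "darr al" obtains N where "N <= Suc (src al)" "!!i. i <= src al ==> ap al i < k \<longleftrightarrow> i < N"
proof -
 define N where "N = (LEAST i. src al < i \<or> k <= ap al i)"
 have "src al < N \<or> k <= ap al N" unfolding N_def by (rule LeastI[of _ "Suc (src al)"]) simp
 moreover have "N <= Suc (src al)" unfolding N_def by (rule Least_le) simp
 moreover have "ap al i < k" if "i < N" "i <= src al" for i using not_less_Least[OF that(1)[unfolded N_def]] that by auto
 moreover have "i < N" if "ap al i < k" "i <= src al" for i
 proof (rule ccontr)
  assume "\<not> i < N"
  hence "ap al N <= ap al i" "\<not> src al < N" using ap_mono[OF assms, of N i] that by auto
  thus False using that `src al < N \<or> k <= ap al N` by auto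
 qed
 ultimately show ?thesis using that by blast
qed

text \<open>The prism \<open>\<Delta>\<^sup>n \<times> [0,1]\<close> is cut into the simplices with vertices
 \<open>(0,0), \<dots>, (j,0), (j,1), \<dots>, (n,1)\<close>. The point \<open>(t, 1 - c)\<close> lies in the \<open>j\<close>-th one if \<open>c\<close> is between
 the partial sums \<open>t\<^sub>0 + \<dots> + t\<^sub>j\<^sub>-\<^sub>1\<close> and \<open>t\<^sub>0 + \<dots> + t\<^sub>j\<close>; its barycentric coordinates there are obtained by
 splitting \<open>t\<^sub>j\<close>, so that the partial sums of the new coordinates are those of \<open>t\<close> together with \<open>c\<close>.\<close>

definition cut_valid :: "nat => (nat => real) => real => nat => bool" where
 "cut_valid n t c j \<longleftrightarrow> j <= n & psum t j <= c & c <= psum t (Suc j)"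

definition cut_coords :: "nat => real => (nat => real) => nat => real" where
 "cut_coords j c t i = (if i < j then t i else if i = j then c - psum t j
  else if i = Suc j then psum t (Suc j) - c else t (i - 1))"

definition dcut :: "nat => nat => ord_map" where
 "dcut j n = om (Suc n) (%i. if i <= j then 0 else 1) 1"

lemma dcut_simps [simp]: "darr (dcut j n)" "src (dcut j n) = Suc n" "tgt (dcut j n) = 1"
 "i <= Suc n ==> ap (dcut j n) i = (if i <= j then 0 else 1)"
 unfolding dcut_def by (auto intro!: darr_om)

lemma psum_cut: "psum (cut_coords j c t) k = (if k <= j then psum t k else if k = Suc j then c else psum t (k - 1))"
proof (induction k)
 case (Suc k)
 consider "k < j" | "k = j" | "k = Suc j" | "k > Suc j" by linarith
 thus ?case
 proof cases
  case 4
  then obtain k' where "k = Suc k'" by (cases k) auto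
  thus ?thesis using Suc 4 by (auto simp: cut_coords_def)
 qed (use Suc in \<open>auto simp: cut_coords_def\<close>)
qed simp

lemma cut_coords_in:
 assumes t: "t : standard_simplex n" and c: "cut_valid n t c j"
 shows "cut_coords j c t : standard_simplex (Suc n)"
proof (rule standard_simplexI)
 have "0 <= t i" for i using t by (simp add: standard_simplex_def)
 thus "0 <= cut_coords j c t i" for i using c by (auto simp: cut_coords_def cut_valid_def)
 show "cut_coords j c t i = 0" if "Suc n < i" for i
  using t c that by (auto simp: cut_coords_def cut_valid_def standard_simplex_def)
 show "psum (cut_coords j c t) (Suc (Suc n)) = 1"
  unfolding psum_cut using psum_total[OF t] c by (auto simp: cut_valid_def)
qed

lemma cut_exists:
 assumes "t : standard_simplex n" "0 <= c" "c <= 1" shows "EX j. cut_valid n t c j"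
proof -
 define j where "j = (LEAST j. c <= psum t (Suc j))"
 have n: "c <= psum t (Suc n)" using psum_total[OF assms(1)] assms by simp
 have "c <= psum t (Suc j)" unfolding j_def by (rule LeastI, rule n)
 moreover have "j <= n" unfolding j_def by (rule Least_le, rule n)
 moreover have "psum t j <= c"
 proof (cases j)
  case (Suc i)
  hence "\<not> c <= psum t (Suc i)" using not_less_Least[of i "%j. c <= psum t (Suc j)"] by (simp add: j_def)
  thus ?thesis using Suc by simp
 qed (use assms in simp)
 ultimately show ?thesis by (auto simp: cut_valid_def)
qed

lemma pt_face:
 assumes Y: "is_sset Y" and y: "y : Simp Y (Suc n)" and w: "w : standard_simplex (Suc n)" and l: "l <= Suc n" "w l = 0"
 shows "pt Y (Suc n, y, w) = pt Y (n, SAct Y (dface l n) y, %i. w (if i < l then i else Suc i))"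
proof -
 let ?w = "%i. w (if i < l then i else Suc i)"
 have ps: "psum ?w k = psum w (if k <= l then k else Suc k)" for k
 proof (induction k)
  case (Suc k)
  consider "k < l" | "k = l" | "k > l" by linarith
  thus ?case by cases (use Suc l in auto)
 qed simp
 have w': "?w : standard_simplex n"
 proof (rule standard_simplexI)
  show "psum ?w (Suc n) = 1" unfolding ps using psum_total[OF w] l by (auto simp: le_Suc_eq)
 qed (use w l in \<open>auto simp: standard_simplex_def\<close>)
 have "simplex_pushforward (dface l n) ?w = w"
 proof (rule psum_eqI)
  fix k
  show "psum (simplex_pushforward (dface l n) ?w) k = psum w k"
  proof (cases "k <= Suc (Suc n)")
  case True
  have "psum (simplex_pushforward (dface l n) ?w) k = psum ?w (if k <= l then k else k - 1)"
  by (rule psum_pushforward) (use True l in auto)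
  also have "... = psum w k"
  proof -
  consider "k <= l" | "k = Suc l" | "k > Suc l" by linarith
  thus ?thesis unfolding ps by cases (use l in auto)
  qed
  finally show ?thesis .
  next
  case False
  have "psum (simplex_pushforward (dface l n) ?w) k = psum ?w (Suc n)"
  by (rule psum_pushforward) (use False in auto)
  moreover have "psum w k = 1" 
  proof -
  have "psum w (Suc (Suc n) + i) = 1" for i
  using psum_total[OF w] w by (induction i) (auto simp: standard_simplex_def)
  moreover obtain d where "k = Suc (Suc n) + d" using False by (metis le_Suc_ex nat_le_linear)
  ultimately show ?thesis by (simp only:)
  qed
  ultimately show ?thesis using psum_total[OF w'] by simp
  qed
 qed
 thus ?thesis using pt_step[OF Y, of "dface l n" n "Suc n" y ?w] y w' by simp
qed

context
 fixes X :: "'x sset" and Y :: "'y sset" and h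
 assumes X: "is_sset X" and Y: "is_sset Y" and h: "sset_map (sset_prod X (std_simplex 1)) Y h"
begin

definition cut_pt :: "real => nat => 'x => (nat => real) => nat => 'y real_point set" where
 "cut_pt c n x t j = pt Y (Suc n, h (Suc n) (SAct X (ddeg j n) x, dcut j n), cut_coords j c t)"

lemma h_act:
 "darr tq ==> src tq = m ==> x : Simp X (tgt tq) ==> darr kp ==> src kp = tgt tq ==> tgt kp = 1 ==>
  SAct Y tq (h (tgt tq) (x, kp)) = h m (SAct X tq x, kp ## tq)"
 using sset_map_act[OF h, of tq m "(x, kp)"] by simp

lemma h_in: "x : Simp X n ==> darr kp ==> src kp = n ==> tgt kp = 1 ==> h n (x, kp) : Simp Y n"
 using sset_map_in[OF h, of "(x, kp)"] by simp

lemma cut_pt_Suc: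
 assumes x: "x : Simp X n" and t: "t : standard_simplex n"
  and c: "cut_valid n t c j" and c': "cut_valid n t c (Suc j)"
 shows "cut_pt c n x t j = cut_pt c n x t (Suc j)"
proof -
 have j: "j <= n" "Suc j <= n" and ce: "c = psum t (Suc j)" using c c' by (auto simp: cut_valid_def)
 have d: "dcut j n ## dface (Suc j) n = dcut (Suc j) n ## dface (Suc j) n" by (rule darr_eqI) auto
 have "cut_pt c n x t j = pt Y (n, h n (x, dcut j n ## dface (Suc j) n), %i. cut_coords j c t (if i < Suc j then i else Suc i))"
  unfolding cut_pt_def using x t j X Y cut_coords_in[OF t c]
  by (subst pt_face[of _ _ n _ "Suc j"]) (auto simp: h_in h_act[of "dface (Suc j) n", simplified] cut_coords_def ce)
 also have "... = pt Y (n, h n (x, dcut (Suc j) n ## dface (Suc j) n), %i. cut_coords (Suc j) c t (if i < Suc j then i else Suc i))"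
  unfolding d by (intro arg_cong[of _ _ "pt Y"] arg_cong2[of _ _ _ _ Pair] refl) (auto simp: fun_eq_iff cut_coords_def ce less_Suc_eq)
 also have "... = cut_pt c n x t (Suc j)"
  unfolding cut_pt_def using x t j X Y cut_coords_in[OF t c']
  by (subst pt_face[of _ _ n _ "Suc j"]) (auto simp: h_in h_act[of "dface (Suc j) n", simplified] cut_coords_def ce)
 finally show ?thesis .
qed

lemma cut_pt_unique:
 assumes x: "x : Simp X n" and t: "t : standard_simplex n"
  and c: "cut_valid n t c j" and c': "cut_valid n t c k"
 shows "cut_pt c n x t j = cut_pt c n x t k"
proof -
 have *: "cut_pt c n x t j = cut_pt c n x t k" if "j <= k" "cut_valid n t c j" "cut_valid n t c k" for j k
  using that
 proof (induction k rule: dec_induct)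
  case (step k)
  have "psum t k <= psum t (Suc k)" "psum t (Suc j) <= psum t (Suc k)"
  by (rule psum_mono[OF t], use step.hyps in simp)+
  hence v: "cut_valid n t c k" using step.prems unfolding cut_valid_def by linarith
  thus ?case using step.IH[OF step.prems(1) v] cut_pt_Suc[OF x t v step.prems(2)] by simp
 qed simp
 show ?thesis
 proof (cases j k rule: le_cases)
  case le
  thus ?thesis using c c' by (rule *)
 next
  case ge
  show ?thesis by (rule *[OF ge c' c, symmetric])
 qed
qed

definition homotopy_pt :: "real => 'x real_point => 'y real_point set" where
 "homotopy_pt c = (%(n, x, t). cut_pt c n x t (SOME j. cut_valid n t c j))"

lemma homotopy_pt_eq:
 assumes x: "x : Simp X n" and t: "t : standard_simplex n" and c: "cut_valid n t c j"
 shows "homotopy_pt c (n, x, t) = cut_pt c n x t j"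
 using cut_pt_unique[OF x t someI[of "cut_valid n t c", OF c] c] by (simp add: homotopy_pt_def)

lemma homotopy_pt_step:
 assumes a: "darr al" and x: "x : Simp X (tgt al)" and t: "t : standard_simplex (src al)" and c: "0 <= c" "c <= 1"
 shows "homotopy_pt c (src al, SAct X al x, t) = homotopy_pt c (tgt al, x, simplex_pushforward al t)"
proof -
 define m n u where "m = src al" and "n = tgt al" and "u = simplex_pushforward al t"
 have u: "u : standard_simplex n" unfolding u_def n_def using a t by (intro pushforward_in) auto
 obtain j where j: "cut_valid m t c j" using cut_exists[OF t c] by (auto simp: m_def)
 hence jm: "j <= m" by (simp add: cut_valid_def)
 let ?k = "ap al j"
 have kn: "?k <= n" using a jm by (simp add: m_def n_def)
 define bt where "bt = om (Suc m) (%i. if i <= j then ap al i else Suc (ap al (i - 1))) (Suc n)"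
 have mono: "ap al i <= ap al i'" if "i <= i'" "i' <= m" for i i' using ap_mono[OF a] that by (simp add: m_def)
 have bt: "darr bt" "src bt = Suc m" "tgt bt = Suc n"
 proof -
  have apn: "ap al i <= n" if "i <= m" for i using a that by (simp add: m_def n_def)
  show "darr bt" unfolding bt_def
  proof (rule darr_om)
  show "(if i <= j then ap al i else Suc (ap al (i - 1))) <= Suc n" if "i <= Suc m" for i
  using apn[of i] apn[of "i - 1"] that jm by auto
  show "(if i <= j then ap al i else Suc (ap al (i - 1))) <= (if i' <= j then ap al i' else Suc (ap al (i' - 1)))"
  if "i <= i'" "i' <= Suc m" for i i'
  using mono[of i i'] le_SucI[OF mono[of i "i' - 1"]] mono[of "i - 1" "i' - 1"] jm that by auto
  qed
 qed (simp_all add: bt_def)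
 have apbt: "ap bt i = (if i <= j then ap al i else Suc (ap al (i - 1)))" if "i <= Suc m" for i
  using that by (simp add: bt_def)
 have down: "ap al j <= ap al (i - 1)" if "\<not> i <= j" "i <= Suc m" for i
 proof -
  have "j <= i - 1" "i - 1 <= m" using that by linarith+
  thus ?thesis by (rule mono)
 qed
 have seg: "psum u k = psum t N" if "N <= Suc m" "!!i. i <= m ==> ap al i < k \<longleftrightarrow> i < N" for k N
  unfolding u_def using that psum_pushforward[OF a] by (simp add: m_def)
 have kv: "cut_valid n u c ?k"
 proof -
  obtain N where N: "N <= Suc m" "!!i. i <= m ==> ap al i < ?k \<longleftrightarrow> i < N" 
  using that by (rule initial_segment[OF a, of ?k, folded m_def])
  obtain N' where N': "N' <= Suc m" "!!i. i <= m ==> ap al i < Suc ?k \<longleftrightarrow> i < N'" 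
  using that by (rule initial_segment[OF a, of "Suc ?k", folded m_def])
  have "N <= j" "Suc j <= N'" using N(2)[OF jm] N'(2)[OF jm] by auto
  hence "psum u ?k <= psum t j" "psum t (Suc j) <= psum u (Suc ?k)"
  using psum_mono[OF t, of N j] psum_mono[OF t, of "Suc j" N'] seg[OF N] seg[OF N'] by (simp_all only:)
  thus ?thesis using j kn unfolding cut_valid_def by linarith
 qed
 have coords: "simplex_pushforward bt (cut_coords j c t) = cut_coords ?k c u"
 proof (rule psum_eqI)
  fix k
  consider "k <= ?k" | "k = Suc ?k" | "k > Suc ?k" by linarith
  thus "psum (simplex_pushforward bt (cut_coords j c t)) k = psum (cut_coords ?k c u) k"
  proof cases
  case 1
  obtain N where N: "N <= Suc m" "!!i. i <= m ==> ap al i < k \<longleftrightarrow> i < N" 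
  using that by (rule initial_segment[OF a, of k, folded m_def])
  have Nj: "N <= j" using N(2)[OF jm] 1 by auto
  have "psum (simplex_pushforward bt (cut_coords j c t)) k = psum (cut_coords j c t) N"
  proof (rule psum_pushforward[OF bt(1)])
  fix i assume i: "i <= src bt"
  have "\<not> Suc (ap al (i - 1)) < k" if "\<not> i <= j" using down[of i] that i 1 bt by auto
  thus "ap bt i < k \<longleftrightarrow> i < N" using i bt apbt N(2) Nj jm by auto
  qed (use N bt in auto)
  thus ?thesis using Nj 1 seg[OF N] by (simp add: psum_cut)
  next
  case 2
  have "psum (simplex_pushforward bt (cut_coords j c t)) k = psum (cut_coords j c t) (Suc j)"
  proof (rule psum_pushforward[OF bt(1)])
  fix i assume i: "i <= src bt"
  have "\<not> Suc (ap al (i - 1)) < k" if "\<not> i <= j" using down[of i] that i 2 bt by auto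
  moreover have "ap al i < k" if "i <= j" using mono[of i j] that jm 2 by auto
  ultimately show "ap bt i < k \<longleftrightarrow> i < Suc j" using i bt apbt by auto
  qed (use jm bt in auto)
  thus ?thesis using 2 by (simp add: psum_cut del: psum_simps)
  next
  case 3
  obtain N where N: "N <= Suc m" "!!i. i <= m ==> ap al i < k - 1 \<longleftrightarrow> i < N" 
  using that by (rule initial_segment[OF a, of "k - 1", folded m_def])
  have Nj: "Suc j <= N" using N(2)[OF jm] 3 by auto
  have "psum (simplex_pushforward bt (cut_coords j c t)) k = psum (cut_coords j c t) (Suc N)"
  proof (rule psum_pushforward[OF bt(1)])
  fix i assume i: "i <= src bt"
  have "ap al i < k" if "i <= j" using mono[of i j] that jm 3 by auto
  moreover have "Suc (ap al (i - 1)) < k \<longleftrightarrow> i < Suc N" if "\<not> i <= j" using N(2)[of "i - 1"] that i 3 bt by (cases i) auto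
  ultimately show "ap bt i < k \<longleftrightarrow> i < Suc N" using i bt apbt Nj by auto
  qed (use N bt in auto)
  thus ?thesis using Nj 3 seg[OF N] by (simp add: psum_cut del: psum_simps)
  qed
 qed
 have ka: "darr (ddeg ?k n)" "darr (ddeg j m)" using kn jm by simp_all
 have 1: "al ## ddeg j m = ddeg ?k n ## bt"
 proof (rule darr_eqI)
  fix i assume "i <= src (ddeg ?k n ## bt)"
  hence i: "i <= Suc m" using ka bt by simp
  have "ap (ddeg ?k n) (ap bt i) = (if ap bt i <= ?k then ap bt i else ap bt i - 1)"
  by (rule ap_ddeg) (use bt i in simp)
  moreover have "ap al i <= ?k" if "i <= j" using mono that jm by simp
  moreover have "?k <= ap al (i - 1)" if "\<not> i <= j" using down that i by simp
  ultimately show "ap (al ## ddeg j m) i = ap (ddeg ?k n ## bt) i"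
  using i ka bt a apbt[OF i] by (auto simp: m_def n_def)
 qed (use a ka bt in \<open>auto simp: m_def n_def\<close>)
 have 2: "dcut j m = dcut ?k n ## bt"
 proof (rule darr_eqI)
  fix i assume "i <= src (dcut ?k n ## bt)"
  hence i: "i <= Suc m" using bt by simp
  have "ap (dcut ?k n) (ap bt i) = (if ap bt i <= ?k then 0 else 1)"
  by (rule dcut_simps) (use bt i in simp)
  moreover have "ap al i <= ?k" if "i <= j" using mono that jm by simp
  moreover have "?k <= ap al (i - 1)" if "\<not> i <= j" using down that i by simp
  ultimately show "ap (dcut j m) i = ap (dcut ?k n ## bt) i" using i bt apbt[OF i] by auto
 qed (use bt in auto)
 have xn: "x : Simp X n" using x by (simp add: n_def)
 have "homotopy_pt c (m, SAct X al x, t) = cut_pt c m (SAct X al x) t j"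
  by (rule homotopy_pt_eq) (use j x a t X in \<open>auto simp: m_def\<close>)
 also have "... = pt Y (Suc m, SAct Y bt (h (Suc n) (SAct X (ddeg ?k n) x, dcut ?k n)), cut_coords j c t)"
 proof -
  have "SAct Y bt (h (Suc n) (SAct X (ddeg ?k n) x, dcut ?k n)) = h (Suc m) (SAct X bt (SAct X (ddeg ?k n) x), dcut ?k n ## bt)"
  using h_act[of bt "Suc m" "SAct X (ddeg ?k n) x" "dcut ?k n"] bt ka X xn by simp
  also have "SAct X bt (SAct X (ddeg ?k n) x) = SAct X (ddeg j m) (SAct X al x)"
  using bt ka X xn a 1 by (simp add: m_def n_def)
  finally show ?thesis by (simp add: cut_pt_def 2)
 qed
 also have "... = pt Y (Suc n, h (Suc n) (SAct X (ddeg ?k n) x, dcut ?k n), simplex_pushforward bt (cut_coords j c t))"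
  by (rule pt_step[OF Y]) (use bt ka X xn cut_coords_in[OF _ j] t in \<open>auto intro!: h_in simp: m_def\<close>)
 also have "... = cut_pt c n x u ?k" by (simp add: coords cut_pt_def)
 also have "... = homotopy_pt c (n, x, u)" by (rule homotopy_pt_eq[symmetric]) (use xn u kv in auto)
 finally show ?thesis by (simp add: m_def n_def u_def)
qed

lemma continuous_homotopy_pt:
 assumes x: "x : Simp X n"
 shows "continuous_map (prod_topology unit_interval (simplex_top n)) (realization Y) (%(s, t). homotopy_pt (1 - s) (n, x, t))"
proof -
 let ?Z = "prod_topology unit_interval (simplex_top n)"
 define T where "T j = {z : topspace ?Z. cut_valid n (snd z) (1 - fst z) j}" for j
 have coord: "continuous_map ?Z euclideanreal (%z. snd z i)" for i
  using continuous_map_compose[OF continuous_map_snd[of unit_interval "simplex_top n"]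
  continuous_map_from_subtopology[OF continuous_map_product_projection[of i UNIV "%_. euclideanreal"]]]
  by (simp add: o_def)
 have fst: "continuous_map ?Z euclideanreal fst"
  using continuous_map_fst[of unit_interval "simplex_top n"] by (simp add: continuous_map_in_subtopology)
 have ps: "continuous_map ?Z euclideanreal (%z. psum (snd z) k)" for k
  unfolding psum_def by (intro continuous_map_sum coord) simp
 show ?thesis
 proof (rule pasting_lemma_closed[where I = "{..n}" and T = T and f = "%j (s, t). cut_pt (1 - s) n x t j"])
  fix j assume j: "j : {..n}"
  have "closedin ?Z ({z : topspace ?Z. (1 - fst z) - psum (snd z) j : {0..}} Int {z : topspace ?Z. psum (snd z) (Suc j) - (1 - fst z) : {0..}})"
  by (intro closedin_Int closedin_continuous_map_preimage[of _ euclideanreal] continuous_map_diff ps fst continuous_map_const[THEN iffD2]) auto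
  moreover have "T j = {z : topspace ?Z. (1 - fst z) - psum (snd z) j : {0..}} Int {z : topspace ?Z. psum (snd z) (Suc j) - (1 - fst z) : {0..}}"
  using j by (auto simp: T_def cut_valid_def)
  ultimately show "closedin ?Z (T j)" by simp
  have cc: "continuous_map ?Z euclideanreal (%z. cut_coords j (1 - fst z) (snd z) i)" for i
  unfolding cut_coords_def
  by (cases "i < j"; cases "i = j"; cases "i = Suc j"; simp only: if_True if_False simp_thms; intro continuous_map_diff ps fst coord continuous_map_const[THEN iffD2]; simp)
  have "continuous_map (subtopology ?Z (T j)) (simplex_top (Suc n)) (%z. cut_coords j (1 - fst z) (snd z))"
  unfolding continuous_map_in_subtopology continuous_map_componentwise_UNIV
  using cc by (auto intro!: continuous_map_from_subtopology cut_coords_in simp: T_def)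
  moreover have "h (Suc n) (SAct X (ddeg j n) x, dcut j n) : Simp Y (Suc n)"
  by (rule h_in) (use X x j in auto)
  ultimately have "continuous_map (subtopology ?Z (T j)) (realization Y)
  ((%t. pt Y (Suc n, h (Suc n) (SAct X (ddeg j n) x, dcut j n), t)) \<circ> (%z. cut_coords j (1 - fst z) (snd z)))"
  by (intro continuous_map_compose[OF _ continuous_map_pt])
  thus "continuous_map (subtopology ?Z (T j)) (realization Y) (%(s, t). cut_pt (1 - s) n x t j)"
  by (simp add: o_def cut_pt_def case_prod_unfold)
 next
  show "(case z of (s, t) => cut_pt (1 - s) n x t i) = (case z of (s, t) => cut_pt (1 - s) n x t j)"
  if "z : topspace ?Z Int T i Int T j" for i j z
  proof -
  have "snd z : standard_simplex n" "cut_valid n (snd z) (1 - fst z) i" "cut_valid n (snd z) (1 - fst z) j"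
  using that by (auto simp: T_def)
  from cut_pt_unique[OF x this] show ?thesis by (simp add: case_prod_unfold)
  qed
  show "EX j. j : {..n} & z : T j & (case z of (s, t) => homotopy_pt (1 - s) (n, x, t)) = (case z of (s, t) => cut_pt (1 - s) n x t j)"
  if z: "z : topspace ?Z" for z
  proof -
  obtain j where "cut_valid n (snd z) (1 - fst z) j" using cut_exists[of "snd z" n "1 - fst z"] z by auto
  thus ?thesis using z homotopy_pt_eq[OF x] by (intro exI[of _ j]) (auto simp: T_def cut_valid_def)
  qed
 qed simp
qed

lemma homotopic_realization:
 assumes f: "sset_map X Y f" and g: "sset_map X Y g"
  and h0: "!!n x. x : Simp X n ==> h n (x, dconst n 0 1) = f n x"
  and h1: "!!n x. x : Simp X n ==> h n (x, dconst n 1 1) = g n x"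
 shows "homotopic_with (%_. True) (realization X) (realization Y) (realization_map Y f) (realization_map Y g)"
proof -
 let ?H = "%(s, z). descend (homotopy_pt (1 - s)) z"
 have H: "descend (homotopy_pt c) (pt X (n, x, t)) = homotopy_pt c (n, x, t)"
  if "x : Simp X n" "t : standard_simplex n" "0 <= c" "c <= 1" for c n x t
  by (rule descend_pt) (use homotopy_pt_step that in auto)
 have C: "continuous_map (prod_topology unit_interval (realization X)) (realization Y) ?H"
 proof (rule continuous_map_from_realization_param)
  show "locally_compact_space unit_interval"
  by (simp add: compact_imp_locally_compact_space compact_space_subtopology)
  show "Hausdorff_space unit_interval" by (simp add: Hausdorff_space_subtopology)
  fix n x assume x: "x : Simp X n"
  show "continuous_map (prod_topology unit_interval (simplex_top n)) (realization Y) (%(s, t). ?H (s, pt X (n, x, t)))"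
  by (rule continuous_map_eq[OF continuous_homotopy_pt[OF x]]) (use x H in auto)
 qed
 have E: "?H (0, z) = realization_map Y f z & ?H (1, z) = realization_map Y g z"
  if zX: "z : topspace (realization X)" for z
 proof -
 obtain n x t where z: "z = pt X (n, x, t)" "x : Simp X n" "t : standard_simplex n"
  using zX by (auto simp: topspace_realization realization_carrier_def)
 have t: "t i = 0" if "n < i" for i using z that by (simp add: standard_simplex_def)
 have "cut_valid n t 1 n"
  using psum_total[OF z(3)] psum_mono[OF z(3), of n "Suc n"] by (auto simp: cut_valid_def)
 hence "?H (0, z) = cut_pt 1 n x t n" using z H homotopy_pt_eq by simp
 also have "... = pt Y (n, h n (x, dcut n n ## dface (Suc n) n), %i. cut_coords n 1 t (if i < Suc n then i else Suc i))"
  unfolding cut_pt_def using z X Y cut_coords_in[OF z(3) `cut_valid n t 1 n`] psum_total[OF z(3)]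
  by (subst pt_face[of _ _ n _ "Suc n"]) (auto simp: h_in h_act[of "dface (Suc n) n", simplified] cut_coords_def)
 also have "dcut n n ## dface (Suc n) n = dconst n 0 1" by (rule darr_eqI) auto
 also have "(%i. cut_coords n 1 t (if i < Suc n then i else Suc i)) = t"
  using psum_total[OF z(3)] t by (auto simp: cut_coords_def fun_eq_iff less_Suc_eq)
 finally have E0: "?H (0, z) = realization_map Y f z" using z h0 realization_map_pt[OF X Y f] by simp
 have t0: "0 <= t 0" using z by (simp add: standard_simplex_def)
 hence v: "cut_valid n t 0 0" by (simp add: cut_valid_def)
 hence "?H (1, z) = cut_pt 0 n x t 0" using z H homotopy_pt_eq by simp
 also have "... = pt Y (n, h n (x, dcut 0 n ## dface 0 n), %i. cut_coords 0 0 t (if i < 0 then i else Suc i))"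
  unfolding cut_pt_def using z X Y cut_coords_in[OF z(3) v]
  by (subst pt_face[of _ _ n _ 0]) (auto simp: h_in h_act[of "dface 0 n", simplified] cut_coords_def)
 also have "dcut 0 n ## dface 0 n = dconst n 1 1" by (rule darr_eqI) auto
 also have "(%i. cut_coords 0 0 t (if i < 0 then i else Suc i)) = t"
  by (auto simp: cut_coords_def fun_eq_iff)
 finally have "?H (1, z) = realization_map Y g z" using z h1 realization_map_pt[OF X Y g] by simp
 with E0 show ?thesis ..
 qed
 show ?thesis unfolding homotopic_with[of "realization X" "%_. True", OF refl]
  by (intro exI[of _ ?H] conjI ballI C TrueI; simp only: E)
qed

end

lemma elem_homotopyI:
 assumes "sset_map (sset_prod X (std_simplex 1)) Y h"
  and "!!n x. x : Simp X n ==> h n (x, dconst n 0 1) = f n x" "!!n x. x : Simp X n ==> h n (x, dconst n 1 1) = g n x"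
 shows "elem_homotopy X Y f g"
 using assms by (auto simp: elem_homotopy_def)

lemma sset_map_end:
 assumes X: "is_sset X" and h: "sset_map (sset_prod X (std_simplex 1)) Y h" and i: "i <= 1"
  and f: "!!n x. x : Simp X n ==> h n (x, dconst n i 1) = f n x"
 shows "sset_map X Y f"
 unfolding sset_map_def
proof (intro conjI allI ballI impI)
 show "f n x : Simp Y n" if "x : Simp X n" for n x
  using sset_map_in[OF h, of "(x, dconst n i 1)" n] f[OF that] that i by simp
 fix m n al x assume *: "al : DHom m n & x : Simp X n"
 hence "f m (SAct X al x) = h m (SAct X al x, dconst m i 1)" using X by (intro f[symmetric]) auto
 also have "dconst m i 1 = dconst n i 1 ## al" using * i by simp
 also have "h m (SAct X al x, dconst n i 1 ## al) = SAct Y al (f n x)"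
  using sset_map_act[OF h, of al m "(x, dconst n i 1)"] * i f[of x n] by simp
 finally show "f m (SAct X al x) = SAct Y al (f n x)" .
qed

lemma simp_homotopic_realization:
 assumes X: "is_sset X" and Y: "is_sset Y" and f: "sset_map X Y f" and s: "simp_homotopic X Y f g"
 shows "homotopic_with (%_. True) (realization X) (realization Y) (realization_map Y f) (realization_map Y g)"
proof -
 have e: "homotopic_with (%_. True) (realization X) (realization Y) (realization_map Y f) (realization_map Y g)"
  if eh: "elem_homotopy X Y f g" for f g
 proof -
  obtain h where h: "sset_map (sset_prod X (std_simplex 1)) Y h"
  "!!n x. x : Simp X n ==> h n (x, dconst n 0 1) = f n x" "!!n x. x : Simp X n ==> h n (x, dconst n 1 1) = g n x"
  using eh by (auto simp: elem_homotopy_def)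
  show ?thesis
  by (rule homotopic_realization[OF X Y h(1) sset_map_end[OF X h(1) _ h(2)] sset_map_end[OF X h(1) _ h(3)] h(2,3)]) auto
 qed
 show ?thesis
  using s unfolding simp_homotopic_def
 proof (induction rule: equivclp_induct)
  case base
  show ?case using continuous_realization_map[OF X Y f] by simp
 next
  case (step g h)
  thus ?case using e homotopic_with_trans homotopic_with_symD by metis
 qed
qed

lemma simp_homotopic_refl [simp]: "simp_homotopic X Y f f"
 by (simp add: simp_homotopic_def)

lemma simp_homotopic_sym: "simp_homotopic X Y f g ==> simp_homotopic X Y g f"
 unfolding simp_homotopic_def by (rule equivclp_sym)

lemma simp_homotopic_trans [trans]:
 "simp_homotopic X Y f g ==> simp_homotopic X Y g h ==> simp_homotopic X Y f h"
 unfolding simp_homotopic_def by (rule equivclp_trans)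

lemma elementary_imp_homotopic: "elem_homotopy X Y f g ==> simp_homotopic X Y f g"
 unfolding simp_homotopic_def by (rule r_into_equivclp)

lemma simp_homotopic_map:
 assumes s: "simp_homotopic X Y f f'" and F: "!!f f'. elem_homotopy X Y f f' ==> elem_homotopy X' Y' (F f) (F f')"
 shows "simp_homotopic X' Y' (F f) (F f')"
 using s unfolding simp_homotopic_def
proof (induction rule: equivclp_induct)
 case (step y z)
 have "equivclp (elem_homotopy X' Y') (F y) (F z)"
  using step.hyps F by (auto intro: r_into_equivclp equivclp_sym)
 with step.IH show ?case by (rule equivclp_trans)
qed simp

lemma simp_homotopic_precomp:
 assumes k: "sset_map X' X k" and s: "simp_homotopic X Y f f'"
 shows "simp_homotopic X' Y (%n x. f n (k n x)) (%n x. f' n (k n x))"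
proof (rule simp_homotopic_map[OF s])
 fix f f' assume "elem_homotopy X Y f f'"
 then obtain h where h: "sset_map (sset_prod X (std_simplex 1)) Y h"
  "!!n x. x : Simp X n ==> h n (x, dconst n 0 1) = f n x" "!!n x. x : Simp X n ==> h n (x, dconst n 1 1) = f' n x"
  by (auto simp: elem_homotopy_def)
 have "sset_map (sset_prod X' (std_simplex 1)) (sset_prod X (std_simplex 1)) (%n z. (k n (fst z), snd z))"
  using k unfolding sset_map_def by auto
 from sset_map_comp[OF this h(1)]
 show "elem_homotopy X' Y (%n x. f n (k n x)) (%n x. f' n (k n x))"
  by (rule elem_homotopyI) (simp_all add: h[unfolded One_nat_def] sset_map_in[OF k])
qed

lemma realization_map_comp:
 assumes X: "is_sset X" and Y: "is_sset Y" and Z: "is_sset Z" and f: "sset_map X Y f" and g: "sset_map Y Z g"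
  and z: "z : topspace (realization X)"
 shows "realization_map Z g (realization_map Y f z) = realization_map Z (%n x. g n (f n x)) z"
proof -
 obtain n x t where "z = pt X (n, x, t)" "x : Simp X n" "t : standard_simplex n"
  using z by (auto simp: topspace_realization realization_carrier_def)
 thus ?thesis
  by (simp add: realization_map_pt[OF X Y f] realization_map_pt[OF Y Z g] sset_map_in[OF f] 
  realization_map_pt[OF X Z sset_map_comp[OF f g]])
qed

lemma sset_map_id: "sset_map X X (%n x. x)" by (simp add: sset_map_def)

lemma realization_map_id:
 assumes X: "is_sset X" and z: "z : topspace (realization X)"
 shows "realization_map X (%n x. x) z = z"
proof -
 obtain n x t where "z = pt X (n, x, t)" "x : Simp X n" "t : standard_simplex n"
  using z by (auto simp: topspace_realization realization_carrier_def)
 thus ?thesis by (simp add: realization_map_pt[OF X X sset_map_id])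
qed

theorem simplicial_homotopy_equivalence_weq:
 assumes X: "is_sset X" and Y: "is_sset Y" and f: "sset_map X Y f" and g: "sset_map Y X g"
  and gf: "simp_homotopic X X (%n x. x) (%n x. g n (f n x))"
  and fg: "simp_homotopic Y Y (%n y. y) (%n y. f n (g n y))"
 shows "sset_weq X Y f"
 unfolding sset_weq_def
proof (intro conjI f, rule weak_homotopy_equivalence_if_homotopy_inverse)
 show "continuous_map (realization X) (realization Y) (realization_map Y f)"
  "continuous_map (realization Y) (realization X) (realization_map X g)"
  using continuous_realization_map X Y f g by blast+
 show "homotopic_with (%_. True) (realization X) (realization X) (%x. x) (realization_map X g \<circ> realization_map Y f)"
  by (rule homotopic_with_eq[OF simp_homotopic_realization[OF X X sset_map_id gf]])
  (auto simp: realization_map_id[OF X] realization_map_comp[OF X Y X f g])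
 show "homotopic_with (%_. True) (realization Y) (realization Y) (%x. x) (realization_map Y f \<circ> realization_map X g)"
  by (rule homotopic_with_eq[OF simp_homotopic_realization[OF Y Y sset_map_id fg]])
  (auto simp: realization_map_id[OF Y] realization_map_comp[OF Y X Y g f])
qed

section \<open>Categories and model categories\<close>

locale category =
 fixes C :: "('o, 'a) category"
 assumes category: "is_category C"
begin

abbreviation comp (infixr \<open>$$\<close> 70) where "g $$ f \<equiv> Cmp C g f"
abbreviation arr where "arr f \<equiv> f : Arr C"
abbreviation dom where "dom f \<equiv> Dom C f"
abbreviation cod where "cod f \<equiv> Cod C f"

lemma hom_iff: "f : Hom C X Y \<longleftrightarrow> arr f & dom f = X & cod f = Y"
 by (simp add: Hom_def)

lemma dom_cod_obj [simp]: "arr f ==> dom f : Obj C" "arr f ==> cod f : Obj C"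
 using category unfolding is_category_def by blast+

lemma comp_hom: "f : Hom C X Y ==> g : Hom C Y Z ==> g $$ f : Hom C X Z"
 using category unfolding is_category_def by blast

lemma comp_simps [simp]:
 assumes "arr f" "arr g" "cod f = dom g"
 shows "arr (g $$ f)" "dom (g $$ f) = dom f" "cod (g $$ f) = cod g"
 using comp_hom[of f "dom f" "cod f" g "cod g"] assms by (simp_all add: hom_iff)

lemma id_hom: "X : Obj C ==> Idt C X : Hom C X X"
 using category unfolding is_category_def by blast

lemma id_simps [simp]:
 assumes "X : Obj C" shows "arr (Idt C X)" "dom (Idt C X) = X" "cod (Idt C X) = X"
 using id_hom[OF assms] by (simp_all add: hom_iff)

lemma comp_id [simp]: "arr f ==> dom f = X ==> f $$ Idt C X = f" "arr f ==> cod f = Y ==> Idt C Y $$ f = f"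
proof -
 have "ALL X Y f. f : Hom C X Y --> f $$ Idt C X = f & Idt C Y $$ f = f"
  using category unfolding is_category_def by blast
 thus "arr f ==> dom f = X ==> f $$ Idt C X = f" "arr f ==> cod f = Y ==> Idt C Y $$ f = f"
  by (auto simp: hom_iff)
qed

lemma comp_assoc:
 assumes "arr f" "arr g" "arr h" "cod f = dom g" "cod g = dom h"
 shows "(h $$ g) $$ f = h $$ (g $$ f)"
proof -
 have "ALL X Y Z V f g h. f : Hom C X Y & g : Hom C Y Z & h : Hom C Z V --> h $$ (g $$ f) = (h $$ g) $$ f"
  using category unfolding is_category_def by blast
 from this[rule_format, of f "dom f" "cod f" g "cod g" h "cod h"] show ?thesis using assms by (simp add: hom_iff)
qed

end

lemma op_cat_simps [simp]:
 "Obj (op_cat C) = Obj C" "Arr (op_cat C) = Arr C" "Dom (op_cat C) = Cod C" "Cod (op_cat C) = Dom C"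
 "Idt (op_cat C) = Idt C" "Cmp (op_cat C) g f = Cmp C f g" "Hom (op_cat C) X Y = Hom C Y X"
 by (auto simp: op_cat_def Hom_def)

lemma (in category) op_category: "is_category (op_cat C)"
 unfolding is_category_def by (auto simp: hom_iff comp_assoc)

lemma liftsD:
 assumes "lifts C i p" "u : Hom C (Dom C i) (Dom C p)" "v : Hom C (Cod C i) (Cod C p)"
  "p \<cdot>\<^bsub>C\<^esub> u = v \<cdot>\<^bsub>C\<^esub> i"
 shows "EX h:Hom C (Cod C i) (Dom C p). h \<cdot>\<^bsub>C\<^esub> i = u & p \<cdot>\<^bsub>C\<^esub> h = v"
 using assms unfolding lifts_def by blast

locale model = category C for C :: "('o, 'a) category" +
 fixes T :: "'a model_structure" and U :: "'u itself"
 assumes model: "model_category U C T"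
begin

abbreviation W where "W \<equiv> Weq T"

lemma W_arr: "w : W ==> arr w" and Cof_arr: "w : Cof T ==> arr w" and Fib_arr: "w : Fib T ==> arr w"
 using model unfolding model_category_def by blast+

lemma two_of_three: "two_of_three C W" using model unfolding model_category_def by blast

lemma
 assumes "arr f" "arr g" "cod f = dom g"
 shows W_comp: "f : W ==> g : W ==> g $$ f : W"
  and W_cancel_right: "f : W ==> g $$ f : W ==> g : W"
  and W_cancel_left: "g : W ==> g $$ f : W ==> f : W"
 using two_of_three[unfolded two_of_three_def, rule_format, of f "dom f" "cod f" g "cod g"] assms
 by (auto simp: hom_iff)

lemma retracts: "retract_closed C W" "retract_closed C (Cof T)" "retract_closed C (Fib T)"
 using model unfolding model_category_def by blast+

lemma lift_axiom: "i : Cof T ==> p : Fib T ==> i : W \<or> p : W ==> lifts C i p"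
 using model unfolding model_category_def by blast

lemma factorization:
 assumes "functorial_factorization C A B" "arr f"
 shows "EX i:A. EX p:B. arr i & arr p & dom i = dom f & cod p = cod f & cod i = dom p & p $$ i = f"
proof -
 obtain E :: "'a => 'o" and i p where
  "ALL f:Arr C. i f : A Int Hom C (dom f) (E f) & p f : B Int Hom C (E f) (cod f) & p f $$ i f = f"
  using assms(1) unfolding functorial_factorization_def by (elim exE conjE) blast
 thus ?thesis using assms(2) by (intro bexI[of _ "i f"] bexI[of _ "p f"]) (auto simp: hom_iff)
qed

lemma factor_cof_tfib:
 assumes "arr f"
 obtains i p where "i : Cof T" "p : Fib T" "p : W" "arr i" "arr p" "dom i = dom f" "cod p = cod f" "cod i = dom p" "p $$ i = f"
proof -
 have "functorial_factorization C (Cof T) (Fib T Int W)" using model unfolding model_category_def by blast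
 from factorization[OF this assms] show ?thesis using that by blast
qed

lemma factor_tcof_fib:
 assumes "arr f"
 obtains i p where "i : Cof T" "i : W" "p : Fib T" "arr i" "arr p" "dom i = dom f" "cod p = cod f" "cod i = dom p" "p $$ i = f"
proof -
 have "functorial_factorization C (Cof T Int W) (Fib T)" using model unfolding model_category_def by blast
 from factorization[OF this assms] show ?thesis using that by blast
qed

text \<open>The retract argument: if \<open>f = p \<cdot> i\<close> and \<open>f\<close> lifts against \<open>p\<close>, then \<open>f\<close> is a retract of \<open>i\<close>, and dually.\<close>

lemma retract_of_left:
 assumes "arr i" "arr p" "cod i = dom p" "lifts C (p $$ i) p"
 shows "is_retract C (p $$ i) i"
proof -
 obtain h where h: "h : Hom C (cod p) (dom p)" "h $$ (p $$ i) = i" "p $$ h = Idt C (cod p)"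
  using liftsD[OF assms(4), of i "Idt C (cod p)"] assms by (auto simp: hom_iff)
 show ?thesis unfolding is_retract_def
  by (rule conjI[OF _ conjI], use assms in simp, use assms in simp,
  intro exI[of _ "Idt C (dom i)"] exI[of _ h] exI[of _ p])
  (use assms h in \<open>auto simp: hom_iff comp_assoc\<close>)
qed

lemma retract_of_right:
 assumes "arr i" "arr p" "cod i = dom p" "lifts C i (p $$ i)"
 shows "is_retract C (p $$ i) p"
proof -
 obtain h where h: "h : Hom C (cod i) (dom i)" "h $$ i = Idt C (dom i)" "(p $$ i) $$ h = p"
  using liftsD[OF assms(4), of "Idt C (dom i)" p] assms by (auto simp: hom_iff)
 show ?thesis unfolding is_retract_def
  by (rule conjI[OF _ conjI], use assms in simp, use assms in simp,
  intro exI[of _ i] exI[of _ "Idt C (cod p)"] exI[of _ h] exI[of _ "Idt C (cod p)"])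
  (use assms h in \<open>auto simp: hom_iff comp_assoc\<close>)
qed

lemma Cof_if_lifts:
 assumes "arr f" "!!p. p : Fib T ==> p : W ==> lifts C f p" shows "f : Cof T"
proof -
 obtain i p where ip: "i : Cof T" "p : Fib T" "p : W" "arr i" "arr p" "cod i = dom p" "p $$ i = f"
  using factor_cof_tfib[OF assms(1)] by metis
 hence "is_retract C f i" using retract_of_left[of i p] assms(2)[of p] by simp
 thus ?thesis using retracts(2) ip(1) unfolding retract_closed_def by blast
qed

lemma tcof_if_lifts:
 assumes "arr f" "!!p. p : Fib T ==> lifts C f p" shows "f : Cof T" "f : W"
proof -
 obtain i p where ip: "i : Cof T" "i : W" "p : Fib T" "arr i" "arr p" "cod i = dom p" "p $$ i = f"
  using factor_tcof_fib[OF assms(1)] by metis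
 hence "is_retract C f i" using retract_of_left[of i p] assms(2)[of p] by simp
 thus "f : Cof T" "f : W" using retracts ip(1,2) unfolding retract_closed_def by blast+
qed

lemma Fib_if_lifts:
 assumes "arr f" "!!i. i : Cof T ==> i : W ==> lifts C i f" shows "f : Fib T"
proof -
 obtain i p where ip: "i : Cof T" "i : W" "p : Fib T" "arr i" "arr p" "cod i = dom p" "p $$ i = f"
  using factor_tcof_fib[OF assms(1)] by metis
 hence "is_retract C f p" using retract_of_right[of i p] assms(2)[of i] by simp
 thus ?thesis using retracts(3) ip(3) unfolding retract_closed_def by blast
qed

lemma tfib_if_lifts:
 assumes "arr f" "!!i. i : Cof T ==> lifts C i f" shows "f : Fib T" "f : W"
proof -
 obtain i p where ip: "i : Cof T" "p : Fib T" "p : W" "arr i" "arr p" "cod i = dom p" "p $$ i = f"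
  using factor_cof_tfib[OF assms(1)] by metis
 hence "is_retract C f p" using retract_of_right[of i p] assms(2)[of i] by simp
 thus "f : Fib T" "f : W" using retracts ip(2,3) unfolding retract_closed_def by blast+
qed

lemma id_W: assumes "X : Obj C" shows "Idt C X : W"
proof -
 obtain i p where ip: "p : W" "arr i" "arr p" "dom i = X" "cod p = X" "cod i = dom p" "p $$ i = Idt C X"
  using factor_cof_tfib[of "Idt C X"] assms by (metis id_simps)
 have "is_retract C (Idt C X) p" unfolding is_retract_def
  by (rule conjI[OF _ conjI], use assms in simp, use ip in simp,
  intro exI[of _ i] exI[of _ "Idt C X"] exI[of _ p])
  (use assms ip in \<open>auto simp: hom_iff\<close>)
 thus ?thesis using retracts(1) ip(1) unfolding retract_closed_def by blast
qed

abbreviation fibrant_obj where "fibrant_obj X \<equiv> fibrant C (Fib T) X"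
abbreviation cofibrant_obj where "cofibrant_obj X \<equiv> cofibrant C (Cof T) X"

lemma fibrant_obj: "fibrant_obj X ==> X : Obj C" by (simp add: fibrant_def)
lemma cofibrant_obj: "cofibrant_obj X ==> X : Obj C" by (simp add: cofibrant_def)

lemma fibrant_extend:
 assumes F: "fibrant_obj F" and j: "j : Cof T" "j : W" and u: "u : Hom C (dom j) F"
 shows "EX h:Hom C (cod j) F. h $$ j = u"
proof -
 obtain t f where t: "terminal C t" "f : Hom C F t" "f : Fib T" using F by (auto simp: fibrant_def)
 have j': "arr j" using Cof_arr j by blast
 have tm: "EX! f. f : Hom C X t" if "X : Obj C" for X using t(1) that by (simp add: terminal_def)
 obtain v where v: "v : Hom C (cod j) t" using tm[of "cod j"] j' by auto
 have "f $$ u : Hom C (dom j) t" "v $$ j : Hom C (dom j) t" using t u v j' by (auto simp: hom_iff)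
 hence "f $$ u = v $$ j" using tm[of "dom j"] j' by auto
 moreover have "lifts C j f" using lift_axiom j t(3) by blast
 ultimately show ?thesis using liftsD[of C j f u v] t(2) u v by (auto simp: hom_iff)
qed

lemma fibrant_if_extend:
 assumes F: "F : Obj C" and t: "terminal C t"
  and "!!j u. j : Cof T ==> j : W ==> arr j ==> u : Hom C (dom j) F ==> EX h:Hom C (cod j) F. h $$ j = u"
 shows "fibrant_obj F"
proof -
 have tm: "EX! f. f : Hom C X t" if "X : Obj C" for X using t(1) that by (simp add: terminal_def)
 obtain f where f: "f : Hom C F t" using tm[OF F] by auto
 have "f : Fib T"
 proof (rule Fib_if_lifts)
  show "arr f" using f by (simp add: hom_iff)
  fix j assume j: "j : Cof T" "j : W"
  hence j': "arr j" using Cof_arr by blast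
  show "lifts C j f" unfolding lifts_def
  proof (intro allI impI)
  fix u v assume *: "u : Hom C (dom j) (dom f) & v : Hom C (cod j) (cod f) & f $$ u = v $$ j"
  hence "EX h:Hom C (cod j) F. h $$ j = u" using f by (intro assms(3)[OF j j']) (simp add: hom_iff)
  then obtain h where h: "h : Hom C (cod j) F" "h $$ j = u" by blast
  have "f $$ h : Hom C (cod j) t" "v : Hom C (cod j) t" using h f * by (auto simp: hom_iff)
  hence "f $$ h = v" using tm[of "cod j"] j' by auto
  thus "EX h:Hom C (cod j) (dom f). h $$ j = u & f $$ h = v" using h f by (auto simp: hom_iff)
  qed
 qed
 thus ?thesis using F t f by (auto simp: fibrant_def)
qed

lemma cofibrant_lift:
 assumes B: "cofibrant_obj B" and p: "p : Fib T" "p : W" and v: "v : Hom C B (cod p)"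
 shows "EX h:Hom C B (dom p). p $$ h = v"
proof -
 obtain t f where t: "initial C t" "f : Hom C t B" "f : Cof T" using B by (auto simp: cofibrant_def)
 have p': "arr p" using Fib_arr p by blast
 have tm: "EX! f. f : Hom C t X" if "X : Obj C" for X using t(1) that by (simp add: initial_def)
 obtain u where u: "u : Hom C t (dom p)" using tm[of "dom p"] p' by auto
 have "v $$ f : Hom C t (cod p)" "p $$ u : Hom C t (cod p)" using t u v p' by (auto simp: hom_iff)
 hence "p $$ u = v $$ f" using tm[of "cod p"] p' by auto
 moreover have "lifts C f p" using lift_axiom p t(3) by blast
 ultimately show ?thesis using liftsD[of C f p u v] t(2) u v by (auto simp: hom_iff)
qed

lemma cofibrant_if_lift:
 assumes B: "B : Obj C" and t: "initial C t"
  and "!!p v. p : Fib T ==> p : W ==> arr p ==> v : Hom C B (cod p) ==> EX h:Hom C B (dom p). p $$ h = v"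
 shows "cofibrant_obj B"
proof -
 have tm: "EX! f. f : Hom C t X" if "X : Obj C" for X using t(1) that by (simp add: initial_def)
 obtain f where f: "f : Hom C t B" using tm[OF B] by auto
 have "f : Cof T"
 proof (rule Cof_if_lifts)
  show "arr f" using f by (simp add: hom_iff)
  fix p assume p: "p : Fib T" "p : W"
  hence p': "arr p" using Fib_arr by blast
  show "lifts C f p" unfolding lifts_def
  proof (intro allI impI)
  fix u v assume *: "u : Hom C (dom f) (dom p) & v : Hom C (cod f) (cod p) & p $$ u = v $$ f"
  hence "EX h:Hom C B (dom p). p $$ h = v" using f by (intro assms(3)[OF p p']) (simp add: hom_iff)
  then obtain h where h: "h : Hom C B (dom p)" "p $$ h = v" by blast
  have "h $$ f : Hom C t (dom p)" "u : Hom C t (dom p)" using h f * by (auto simp: hom_iff)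
  hence "h $$ f = u" using tm[of "dom p"] p' by auto
  thus "EX h:Hom C (cod f) (dom p). h $$ f = u & p $$ h = v" using h f by (auto simp: hom_iff)
  qed
 qed
 thus ?thesis using B t f by (auto simp: cofibrant_def)
qed

lemma cofibrant_cod:
 assumes A: "cofibrant_obj A" and i: "i : Cof T" "dom i = A" shows "cofibrant_obj (cod i)"
proof -
 obtain t where t: "initial C t" using A by (auto simp: cofibrant_def)
 have i': "arr i" using Cof_arr i by blast
 show ?thesis
 proof (rule cofibrant_if_lift[OF _ t])
  fix p v assume p: "p : Fib T" "p : W" "arr p" and v: "v : Hom C (cod i) (cod p)"
  have "v $$ i : Hom C A (cod p)" using v i i' by (auto simp: hom_iff)
  then obtain u where u: "u : Hom C A (dom p)" "p $$ u = v $$ i" using cofibrant_lift[OF A p(1,2)] by blast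
  thus "EX h:Hom C (cod i) (dom p). p $$ h = v"
  using liftsD[OF lift_axiom[OF i(1) p(1)], of u v] p v i by auto
 qed (use i' in simp)
qed

lemma fibrant_dom:
 assumes A: "fibrant_obj A" and i: "p : Fib T" "cod p = A" shows "fibrant_obj (dom p)"
proof -
 obtain t where t: "terminal C t" using A by (auto simp: fibrant_def)
 have i': "arr p" using Fib_arr i by blast
 show ?thesis
 proof (rule fibrant_if_extend[OF _ t])
  fix j u assume j: "j : Cof T" "j : W" "arr j" and u: "u : Hom C (dom j) (dom p)"
  have "p $$ u : Hom C (dom j) A" using u i i' by (auto simp: hom_iff)
  then obtain v where v: "v : Hom C (cod j) A" "v $$ j = p $$ u" using fibrant_extend[OF A j(1,2)] by blast
  thus "EX h:Hom C (cod j) (dom p). h $$ j = u"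
  using liftsD[OF lift_axiom[OF j(1) i(1)], of u v] j u i by auto
 qed (use i' in simp)
qed

end

subsection \<open>Existence of colimits\<close>

lemma universe_infinite: "universe TYPE('u) ==> infinite (UNIV :: 'u set)"
proof -
 assume "universe TYPE('u)"
 hence "(UNIV :: nat set) \<lesssim> (UNIV :: 'u set)" by (simp add: universe_def small_def lesspoll_imp_lepoll)
 thus ?thesis by (simp add: infinite_le_lepoll)
qed

lemma small_finite: "universe TYPE('u) ==> finite A ==> small TYPE('u) A"
 unfolding small_def using universe_infinite finite_lesspoll_infinite by blast

lemma small_lepoll: "A \<lesssim> B ==> small U B ==> small U A"
 unfolding small_def using lesspoll_trans1 by blast

lemma small_subset: "A \<subseteq> B ==> small U B ==> small U A"
 using small_lepoll subset_imp_lepoll by blast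

lemma small_Times_finite:
 assumes u: "universe TYPE('u)" and A: "small TYPE('u) A" and B: "finite B"
 shows "small TYPE('u) (A \<times> B)"
proof (cases "finite A")
 case True
 thus ?thesis by (intro small_finite[OF u] finite_cartesian_product B)
next
 case False
 have "A \<times> B \<lesssim> A \<times> A"
  using finite_lepoll_infinite[OF False B] by (intro times_lepoll_mono) auto
 also have "A \<times> A \<approx> A" unfolding eqpoll_iff_card_of_ordIso using False by (rule card_of_Times_same_infinite)
 finally show ?thesis using A by (rule small_lepoll)
qed

definition is_coproduct :: "('o, 'a) category => 'i set => ('i => 'o) => 'o => ('i => 'a) => bool" where
 "is_coproduct C I X c io \<longleftrightarrow> c : Obj C & (ALL i:I. io i : Hom C (X i) c) &
  (ALL d:Obj C. ALL g. (ALL i:I. g i : Hom C (X i) d) --> (EX! h. h : Hom C c d & (ALL i:I. h \<cdot>\<^bsub>C\<^esub> io i = g i)))"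

lemma (in category) coproduct_exists:
 assumes co: "cocomplete TYPE('u) C" and I: "small TYPE('u) I" and X: "!!i. i : I ==> X i : Obj C"
 shows "EX c io. is_coproduct C I X c io"
proof -
 have "I \<lesssim> (UNIV :: 'u set)" using I by (simp add: small_def lesspoll_imp_lepoll)
 then obtain e :: "_ => 'u" where e: "inj_on e I" by (auto simp: lepoll_def)
 let ?I = "e ` I"
 define J :: "('u, 'u) category" where
  "J = \<lparr>Obj = ?I, Arr = ?I, Dom = (%x. x), Cod = (%x. x), Idt = (%x. x), Cmp = (%g f. f)\<rparr>"
 define F where "F = \<lparr>Fo = (%x. X (inv_into I e x)), Fa = (%x. Idt C (X (inv_into I e x)))\<rparr>"
 have J: "Obj J = ?I" "Arr J = ?I" "f : Hom J a b \<longleftrightarrow> f : ?I & a = f & b = f" "Cmp J g f = f" "Idt J a = a" for f g a b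
  by (auto simp: J_def Hom_def)
 have inv: "inv_into I e (e i) = i" if "i : I" for i using e that by simp
 have sm: "small TYPE('u) ?I" using small_lepoll[OF image_lepoll I] .
 have "is_category J" unfolding is_category_def by (auto simp: J J_def[THEN arg_cong[of _ _ Dom]] J_def[THEN arg_cong[of _ _ Cod]])
 moreover have "is_functor J C F" unfolding is_functor_def by (auto simp: J F_def inv X hom_iff)
 ultimately obtain c io where c: "is_colimit J C F c io" using co sm unfolding cocomplete_def by (metis J(1,2))
 have cone: "is_cocone J C F d kp \<longleftrightarrow> d : Obj C & (ALL i:I. kp (e i) : Hom C (X i) d)" for d kp
  unfolding is_cocone_def by (auto simp: J F_def inv hom_iff)
 have "is_coproduct C I X c (%i. io (e i))" unfolding is_coproduct_def
 proof (intro conjI ballI allI impI)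
  show "io (e i) : Hom C (X i) c" if "i : I" for i using c that unfolding is_colimit_def cone by auto
  show "c : Obj C" using c unfolding is_colimit_def cone by auto
  fix d g assume "d : Obj C" "ALL i:I. g i : Hom C (X i) d"
  hence "is_cocone J C F d (%x. g (inv_into I e x))" unfolding cone by (simp add: inv)
  hence "EX! h. h : Hom C c d & (ALL j:Obj J. h $$ io j = g (inv_into I e j))" using c unfolding is_colimit_def by blast
  thus "EX! h. h : Hom C c d & (ALL i:I. h $$ io (e i) = g i)" by (simp add: J inv)
 qed
 thus ?thesis by blast
qed

lemma coproductD:
 assumes "is_coproduct C I X c io"
 shows "c : Obj C" "!!i. i : I ==> io i : Hom C (X i) c"
  "d : Obj C ==> (!!i. i : I ==> g i : Hom C (X i) d) ==> EX h:Hom C c d. ALL i:I. h \<cdot>\<^bsub>C\<^esub> io i = g i"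
proof -
 show "c : Obj C" "!!i. i : I ==> io i : Hom C (X i) c" using assms by (simp_all add: is_coproduct_def)
 assume d: "d : Obj C" and g: "!!i. i : I ==> g i : Hom C (X i) d"
 have "EX! h. h : Hom C c d & (ALL i:I. h \<cdot>\<^bsub>C\<^esub> io i = g i)"
  using assms[unfolded is_coproduct_def, THEN conjunct2, THEN conjunct2, THEN bspec, OF d, THEN spec[of _ g]] g by simp
 thus "EX h:Hom C c d. ALL i:I. h \<cdot>\<^bsub>C\<^esub> io i = g i" by (auto elim!: ex1E)
qed

lemma (in category) coproduct_ext:
 assumes c: "is_coproduct C I X c io" and h: "h : Hom C c d" "h' : Hom C c d" and e: "!!i. i : I ==> h $$ io i = h' $$ io i"
 shows "h = h'"
proof -
 note 1 = coproductD(2)[OF c]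
 have d: "d : Obj C" using h by (auto simp: hom_iff)
 have "ALL i:I. h' $$ io i : Hom C (X i) d" using 1 comp_hom[OF _ h(2)] by blast
 with d have "EX! k. k : Hom C c d & (ALL i:I. k $$ io i = h' $$ io i)"
  using c[unfolded is_coproduct_def, THEN conjunct2, THEN conjunct2, THEN bspec, OF d, THEN spec[of _ "%i. h' $$ io i"]] by simp
 from ex1_implies_ex[THEN exE, OF this] this show ?thesis using h e by (auto elim!: ex1E)
qed

lemma (in category) pushout_exists:
 assumes u: "universe TYPE('u)" and co: "cocomplete TYPE('u) C" and fg: "arr f" "arr g" "dom f = dom g"
 shows "EX i j. is_pushout C f g i j"
proof -
 obtain A :: "'u set" where A: "finite A" "card A = 5" using infinite_arbitrarily_large[OF universe_infinite[OF u]] by blast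
 obtain vs where "set vs = A" "distinct vs" using finite_distinct_list[OF A(1)] by blast
 hence vs: "distinct vs" "length vs = 5" using distinct_card[of vs] A(2) by simp_all
 obtain a b c x y where "vs = [a, b, c, x, y]" using vs(2) by (auto simp: numeral_eq_Suc length_Suc_conv)
 with vs(1) have d: "distinct [a, b, c, x, y]" by simp
 define J :: "('u, 'u) category" where
  "J = \<lparr>Obj = {a, b, c}, Arr = {a, b, c, x, y}, Dom = (%z. if z = b \<or> z = c then z else a),
  Cod = (%z. if z = x then b else if z = y then c else z), Idt = (%z. z),
  Cmp = (%v u. if u = x \<or> u = y then u else v)\<rparr>"
 have J: "Obj J = {a, b, c}" "Arr J = {a, b, c, x, y}" "Idt J z = z" "Cmp J v w = (if w = x \<or> w = y then w else v)"
  "z : Hom J p q \<longleftrightarrow> (z = a & p = a & q = a) \<or> (z = b & p = b & q = b) \<or> (z = c & p = c & q = c) \<or>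
  (z = x & p = a & q = b) \<or> (z = y & p = a & q = c)" for z v w p q
  using d by (auto simp: J_def Hom_def)
 have JD: "Dom J z : Obj J" "Cod J z : Obj J" if "z : Arr J" for z using that by (auto simp: J_def)
 have Jc: "is_category J" unfolding is_category_def
 proof (intro conjI ballI allI impI)
  show "!!z. z : Arr J ==> Dom J z : Obj J" "!!z. z : Arr J ==> Cod J z : Obj J" using JD by blast+
 qed (use d in \<open>auto simp: J\<close>)
 define F where "F = \<lparr>Fo = (%z. if z = b then cod f else if z = c then cod g else dom f),
  Fa = (%z. if z = x then f else if z = y then g else if z = b then Idt C (cod f) else if z = c then Idt C (cod g) else Idt C (dom f))\<rparr>"
 have F: "Fo F a = dom f" "Fo F b = cod f" "Fo F c = cod g" "Fa F x = f" "Fa F y = g" "Fa F a = Idt C (dom f)"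
  "Fa F b = Idt C (cod f)" "Fa F c = Idt C (cod g)"
  using d by (auto simp: F_def)
 have fh: "f : Hom C (dom f) (cod f)" "g : Hom C (dom f) (cod g)" using fg by (simp_all add: hom_iff)
 have F1: "Fa F u : Hom C (Fo F p) (Fo F q)" if "u : Hom J p q" for u p q
  using that[unfolded J(5)] fg by (elim disjE conjE) (simp_all add: F hom_iff)
 have F2: "Fa F (Cmp J v u) = Fa F v $$ Fa F u" if "u : Hom J p q" "v : Hom J q s" for u v p q s
  using that(1)[unfolded J(5)] that(2)[unfolded J(5)] d fg by (elim disjE conjE) (simp_all add: F J hom_iff)
 have Ff: "is_functor J C F" unfolding is_functor_def
 proof (intro conjI ballI allI impI)
  show "Fo F z : Obj C" if "z : Obj J" for z using that fg by (auto simp: J F)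
  show "Fa F (Idt J z) = Idt C (Fo F z)" if "z : Obj J" for z using that by (auto simp: J F)
 qed (use F1 F2 in blast)+
 have sm: "small TYPE('u) (Obj J)" "small TYPE('u) (Arr J)" unfolding J by (intro small_finite[OF u]; simp)+
 obtain p io where p: "is_colimit J C F p io" using co Jc Ff sm unfolding cocomplete_def by blast
 have cone: "is_cocone J C F q kp \<longleftrightarrow> q : Obj C & kp a : Hom C (dom f) q & kp b : Hom C (cod f) q & kp c : Hom C (cod g) q &
  kp b $$ f = kp a & kp c $$ g = kp a" for q kp
 proof -
  have "(ALL i j a'. a' : Hom J i j --> kp j $$ Fa F a' = kp i) \<longleftrightarrow>
  kp a $$ Idt C (dom f) = kp a & kp b $$ Idt C (cod f) = kp b & kp c $$ Idt C (cod g) = kp c & kp b $$ f = kp a & kp c $$ g = kp a"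
  proof -
  have "(ALL i j z. (z = a & i = a & j = a) \<or> (z = b & i = b & j = b) \<or> (z = c & i = c & j = c) \<or>
  (z = x & i = a & j = b) \<or> (z = y & i = a & j = c) --> P i j z) \<longleftrightarrow>
  P a a a & P b b b & P c c c & P a b x & P a c y" for P by blast
  from this[of "%i j z. kp j $$ Fa F z = kp i"] show ?thesis unfolding J(5) F .
  qed
  thus ?thesis unfolding is_cocone_def by (auto simp: J F hom_iff)
 qed
 have p1: "io a : Hom C (dom f) p" "io b : Hom C (cod f) p" "io c : Hom C (cod g) p" "io b $$ f = io a" "io c $$ g = io a"
  using p unfolding is_colimit_def cone by blast+
 have "is_pushout C f g (io b) (io c)" unfolding is_pushout_def
 proof (intro conjI allI impI)
  fix Z u v assume *: "u : Hom C (cod f) Z & v : Hom C (cod g) Z & u $$ f = v $$ g"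
  let ?k = "%z. if z = b then u else if z = c then v else u $$ f"
  have "is_cocone J C F Z ?k" unfolding cone using * d fg by (auto simp: hom_iff)
  hence "EX! h. h : Hom C p Z & (ALL j:Obj J. h $$ io j = ?k j)" using p unfolding is_colimit_def by blast
  moreover have "(h : Hom C p Z & (ALL j:Obj J. h $$ io j = ?k j)) \<longleftrightarrow> (h : Hom C (cod (io b)) Z & h $$ io b = u & h $$ io c = v)" for h
  proof -
  have "h $$ io a = u $$ f" if "h : Hom C p Z" "h $$ io b = u"
  using that p1 fg comp_assoc[of f "io b" h] by (auto simp: hom_iff)
  thus ?thesis using d p1(2) by (auto simp: J hom_iff)
  qed
  ultimately show "EX! h. h : Hom C (cod (io b)) Z & h $$ io b = u & h $$ io c = v" by simp
 qed (use fg p1 in \<open>auto simp: hom_iff\<close>)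
 thus ?thesis by blast
qed

section \<open>Simplicial model categories\<close>

lemma finite_DHom: "finite (DHom m n)"
proof -
 have "DHom m n \<subseteq> (%f. (m, f, n)) ` ({..m} \<rightarrow>\<^sub>E {..n})" unfolding Hom_Delta by auto
 thus ?thesis using finite_surj finite_PiE[of "{..m}" "%_. {..n}"] by (metis finite_atMost finite_subset finite_imageI)
qed

lemma ap_0 [simp]: "darr tq ==> tgt tq = 0 ==> i <= src tq ==> ap tq i = 0"
 using ap_le[of tq i 0] by simp

locale smc = model M T "TYPE('u)"
 for M :: "('o, 'a) category" and T :: "'a model_structure" and E :: "('o, 'a, 'u) simplicial_enrichment" +
 assumes univ: "universe TYPE('u)" and smc: "simplicial_model_category M T E"

lemma smcI: 
 fixes E :: "('o, 'a, 'u) simplicial_enrichment"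
 assumes "universe TYPE('u)" "simplicial_model_category M T E" shows "smc M T E"
proof -
 have "model_category TYPE('u) M T" using assms by (simp add: simplicial_model_category_def)
 thus ?thesis by unfold_locales (use assms in \<open>simp_all add: model_category_def\<close>)
qed

context smc
begin

abbreviation mcomp (infixr \<open>$$\<close> 70) where "g $$ f \<equiv> Cmp M g f"
abbreviation Map where "Map X Y \<equiv> SMap E X Y"
abbreviation pre where "pre f Z n u \<equiv> smap_pre M E f Z n u"
abbreviation post where "post A f n u \<equiv> smap_post M E A f n u"
abbreviation cst where "cst f n \<equiv> sdegenerate (Map (dom f) (cod f)) n (SArr E f)"

lemma simplicial_category: "is_simplicial_category M E" using smc by (simp add: simplicial_model_category_def)

lemma Map_sset [simp]: "X : Obj M ==> Y : Obj M ==> is_sset (Map X Y)"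
 and Map_small: "X : Obj M ==> Y : Obj M ==> small TYPE('u) (Simp (Map X Y) n)"
 and SArr_bij: "X : Obj M ==> Y : Obj M ==> bij_betw (SArr E) (Hom M X Y) (Simp (Map X Y) 0)"
 using simplicial_category unfolding is_simplicial_category_def small_sset_def by (elim conjE; simp)+

lemma SArr_in [simp]: "arr f ==> dom f = X ==> cod f = Y ==> SArr E f : Simp (Map X Y) 0"
 using bij_betw_apply[OF SArr_bij, of X Y f] by (auto simp: hom_iff)

lemma SArr_inj: "f : Hom M X Y ==> g : Hom M X Y ==> SArr E f = SArr E g ==> f = g"
 using SArr_bij[of X Y] by (auto simp: bij_betw_def inj_on_def hom_iff)

lemma SArr_surj: "X : Obj M ==> Y : Obj M ==> x : Simp (Map X Y) 0 ==> EX f:Hom M X Y. x = SArr E f"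
 using SArr_bij[of X Y] by (auto simp: bij_betw_def)

lemma SComp_map:
 assumes "X : Obj M" "Y : Obj M" "Z : Obj M"
 shows "sset_map (sset_prod (Map Y Z) (Map X Y)) (Map X Z) (%n (g, f). SComp E n X Y Z g f)"
  and "f : Hom M X Y ==> g : Hom M Y Z ==> SArr E (g $$ f) = SComp E 0 X Y Z (SArr E g) (SArr E f)"
 using simplicial_category assms unfolding is_simplicial_category_def by blast+

lemma SComp_in [simp]:
 assumes "X : Obj M" "Y : Obj M" "Z : Obj M" "f : Simp (Map X Y) n" "g : Simp (Map Y Z) n"
 shows "SComp E n X Y Z g f : Simp (Map X Z) n"
 using sset_map_in[OF SComp_map(1)[OF assms(1-3)], of "(g, f)" n] assms by simp

lemma SComp_act:
 assumes "X : Obj M" "Y : Obj M" "Z : Obj M" "darr al" "f : Simp (Map X Y) (tgt al)" "g : Simp (Map Y Z) (tgt al)"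
 shows "SAct (Map X Z) al (SComp E (tgt al) X Y Z g f) = SComp E (src al) X Y Z (SAct (Map Y Z) al g) (SAct (Map X Y) al f)"
 using sset_map_act[OF SComp_map(1)[OF assms(1-3)], of al "src al" "(g, f)"] assms by simp

lemma SComp_unit:
 assumes "X : Obj M" "Y : Obj M" "f : Simp (Map X Y) n"
 shows "SComp E n X X Y f (cst (Idt M X) n) = f" "SComp E n X Y Y (cst (Idt M Y) n) f = f"
 using simplicial_category assms unfolding is_simplicial_category_def by simp_all

lemma SComp_assoc:
 assumes "X : Obj M" "Y : Obj M" "Z : Obj M" "V : Obj M"
  "f : Simp (Map X Y) n" "g : Simp (Map Y Z) n" "h : Simp (Map Z V) n"
 shows "SComp E n X Z V h (SComp E n X Y Z g f) = SComp E n X Y V (SComp E n Y Z V h g) f"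
proof -
 have "ALL X:Obj M. ALL Y:Obj M. ALL Z:Obj M. ALL V:Obj M. ALL n.
  ALL f:Simp (SMap E X Y) n. ALL g:Simp (SMap E Y Z) n. ALL h:Simp (SMap E Z V) n.
  SComp E n X Z V h (SComp E n X Y Z g f) = SComp E n X Y V (SComp E n Y Z V h g) f"
  using simplicial_category unfolding is_simplicial_category_def by (elim conjE)
 thus ?thesis using assms by simp
qed

lemma cst_in [simp]: "arr f ==> dom f = X ==> cod f = Y ==> sdegenerate (Map X Y) n (SArr E f) : Simp (Map X Y) n"
 by (auto simp: sdegenerate_in)

lemma cst_comp:
 assumes "arr f" "arr g" "cod f = dom g"
 shows "cst (g $$ f) n = SComp E n (dom f) (cod f) (cod g) (cst g n) (cst f n)"
proof -
 have "SAct (Map (dom f) (cod g)) (dconst n 0 0) (SComp E (tgt (dconst n 0 0)) (dom f) (cod f) (cod g) (SArr E g) (SArr E f)) =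
  SComp E (src (dconst n 0 0)) (dom f) (cod f) (cod g) (SAct (Map (cod f) (cod g)) (dconst n 0 0) (SArr E g)) (SAct (Map (dom f) (cod f)) (dconst n 0 0) (SArr E f))"
  by (rule SComp_act) (use assms in auto)
 thus ?thesis using assms SComp_map(2)[of "dom f" "cod f" "cod g" f g] by (simp add: sdegenerate_eq hom_iff)
qed

lemma pre_map:
 assumes "arr f" "Z : Obj M" shows "sset_map (Map (cod f) Z) (Map (dom f) Z) (smap_pre M E f Z)"
 unfolding sset_map_def
proof (intro conjI allI ballI impI)
 show "pre f Z n x : Simp (Map (dom f) Z) n" if "x : Simp (Map (cod f) Z) n" for n x
  unfolding smap_pre_def using assms that by auto
 fix m n al x assume "al : DHom m n & x : Simp (Map (cod f) Z) n"
 thus "pre f Z m (SAct (Map (cod f) Z) al x) = SAct (Map (dom f) Z) al (pre f Z n x)"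
  using SComp_act[of "dom f" "cod f" Z al "cst f n" x] assms by (auto simp: smap_pre_def)
qed

lemma post_map:
 assumes "arr f" "A : Obj M" shows "sset_map (Map A (dom f)) (Map A (cod f)) (smap_post M E A f)"
 unfolding sset_map_def
proof (intro conjI allI ballI impI)
 show "post A f n x : Simp (Map A (cod f)) n" if "x : Simp (Map A (dom f)) n" for n x
  unfolding smap_post_def using assms that by auto
 fix m n al x assume "al : DHom m n & x : Simp (Map A (dom f)) n"
 thus "post A f m (SAct (Map A (dom f)) al x) = SAct (Map A (cod f)) al (post A f n x)"
  using SComp_act[of A "dom f" "cod f" al x "cst f n"] assms by (auto simp: smap_post_def)
qed

lemma pre_in [simp]: "arr f ==> Z : Obj M ==> dom f = X ==> u : Simp (Map (cod f) Z) n ==> pre f Z n u : Simp (Map X Z) n"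
 using sset_map_in[OF pre_map] by blast

lemma post_in [simp]: "arr f ==> A : Obj M ==> cod f = Y ==> u : Simp (Map A (dom f)) n ==> post A f n u : Simp (Map A Y) n"
 using sset_map_in[OF post_map] by blast

lemma pre_comp:
 "arr f ==> arr g ==> cod f = dom g ==> V : Obj M ==> u : Simp (Map (cod g) V) n ==> pre (g $$ f) V n u = pre f V n (pre g V n u)"
 using cst_comp[of f g n] SComp_assoc[of "dom f" "cod f" "cod g" V "cst f n" n "cst g n" u] by (auto simp: smap_pre_def)

lemma post_comp:
 "arr f ==> arr g ==> cod f = dom g ==> A : Obj M ==> u : Simp (Map A (dom f)) n ==> post A (g $$ f) n u = post A g n (post A f n u)"
 using cst_comp[of f g n] SComp_assoc[of A "dom f" "cod f" "cod g" u n "cst f n" "cst g n"] by (auto simp: smap_post_def)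

lemma pre_id: "X : Obj M ==> Z : Obj M ==> u : Simp (Map X Z) n ==> pre (Idt M X) Z n u = u"
 using SComp_unit(1)[of X Z u n] by (simp add: smap_pre_def)

lemma pre_post:
 "arr f ==> arr g ==> u : Simp (Map (cod f) (dom g)) n ==> pre f (cod g) n (post (cod f) g n u) = post (dom f) g n (pre f (dom g) n u)"
 using SComp_assoc[of "dom f" "cod f" "dom g" "cod g" "cst f n" n u "cst g n"] by (auto simp: smap_pre_def smap_post_def)

lemma pre_SArr: "arr f ==> arr g ==> cod f = dom g ==> cod g = Z ==> pre f Z 0 (SArr E g) = SArr E (g $$ f)"
 using SComp_map(2)[of "dom f" "cod f" "cod g" f g] by (auto simp: smap_pre_def hom_iff)

lemma post_SArr: "arr f ==> arr g ==> cod f = dom g ==> dom f = A ==> post A g 0 (SArr E f) = SArr E (g $$ f)"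
 using SComp_map(2)[of "dom f" "cod f" "cod g" f g] by (auto simp: smap_post_def hom_iff)

lemma SComp_pre:
 "arr w ==> cod w = X ==> Y : Obj M ==> Z : Obj M ==> f : Simp (Map X Y) n ==> g : Simp (Map Y Z) n ==>
  pre w Z n (SComp E n X Y Z g f) = SComp E n (dom w) Y Z g (pre w Y n f)"
 using SComp_assoc[of "dom w" "cod w" Y Z "cst w n" n f g] by (auto simp: smap_pre_def)

lemma SComp_mid:
 "arr p ==> X : Obj M ==> Z : Obj M ==> f : Simp (Map X (dom p)) n ==> g : Simp (Map (cod p) Z) n ==>
  SComp E n X (cod p) Z g (post X p n f) = SComp E n X (dom p) Z (pre p Z n g) f"
 using SComp_assoc[of X "dom p" "cod p" Z f n "cst p n" g] by (auto simp: smap_pre_def smap_post_def)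

lemma SComp_cst: "arr f ==> dom f = X ==> cod f = Y ==> SComp E n X Y Z g (sdegenerate (Map X Y) n (SArr E f)) = pre f Z n g"
 by (auto simp: smap_pre_def)

subsection \<open>Tensors and cotensors with simplicial sets of finite type\<close>

definition cot :: "'o => 'k sset => 'o => (nat => 'k => 'u) => bool" where
 "cot X K P bt \<longleftrightarrow> P : Obj M & sset_map K (Map P X) bt &
  (ALL Y:Obj M. ALL n h. sset_map (sset_prod K (std_simplex n)) (Map Y X) h -->
  (EX! sg. sg : Simp (Map Y P) n & (ALL m. ALL k:Simp K m. ALL tq:DHom m n.
  h m (k, tq) = SComp E m Y P X (bt m k) (SAct (Map Y P) tq sg))))"

definition tens :: "'o => 'k sset => 'o => (nat => 'k => 'u) => bool" where
 "tens X K P al \<longleftrightarrow> P : Obj M & sset_map K (Map X P) al &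
  (ALL Y:Obj M. ALL n h. sset_map (sset_prod K (std_simplex n)) (Map X Y) h -->
  (EX! sg. sg : Simp (Map P Y) n & (ALL m. ALL k:Simp K m. ALL tq:DHom m n.
  h m (k, tq) = SComp E m X P Y (SAct (Map P Y) tq sg) (al m k))))"

lemma small_copy:
 fixes K :: "'k sset"
 assumes K: "is_sset K" and fin: "!!n. finite (Simp K n)"
 obtains e :: "'k => 'u" and d and K' where "small_sset TYPE('u) K'" "!!n. Simp K' n = e ` Simp K n"
  "!!n x. x : Simp K n ==> d (e x) = x" "sset_map K K' (%n. e)" "sset_map K' K (%n. d)"
proof -
 have "countable (\<Union>n. Simp K n)" by (intro countable_UN countable_finite fin countableI_type)
 then obtain c :: "'k => nat" where c: "inj_on c (\<Union>n. Simp K n)" unfolding countable_def by blast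
 obtain b :: "nat => 'u" where b: "inj b"
  using infinite_countable_subset[OF universe_infinite[OF univ]] by blast
 let ?e = "%x. b (c x)" and ?d = "inv_into (\<Union>n. Simp K n) (%x. b (c x))"
 have inj: "inj_on ?e (\<Union>n. Simp K n)" using c b by (auto simp: inj_on_def inj_def)
 have de: "?d (?e x) = x" if "x : Simp K n" for n x using inv_into_f_f[OF inj, of x] that by blast
 define K' where "K' = \<lparr>Simp = (%n. ?e ` Simp K n), SAct = (%al y. ?e (SAct K al (?d y)))\<rparr>"
 have S: "Simp K' n = ?e ` Simp K n" "SAct K' al y = ?e (SAct K al (?d y))" for n al y by (simp_all add: K'_def)
 have "is_sset K'" unfolding is_sset_def
  using K by (auto simp: S de Idt_Delta act_in intro!: imageI) 
  (metis act_act act_in de)?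
 hence "small_sset TYPE('u) K'" unfolding small_sset_def S by (auto intro!: small_finite[OF univ] fin)
 moreover have "sset_map K K' (%n. ?e)" unfolding sset_map_def by (auto simp: S de)
 moreover have "sset_map K' K (%n. ?d)"
 proof -
  have "?d (?e (SAct K al x)) = SAct K al x" if "darr al" "x : Simp K (tgt al)" for al x
  by (rule de[of _ "src al"]) (use that K in simp)
  thus ?thesis unfolding sset_map_def using K by (auto simp: S de)
 qed
 ultimately show ?thesis using that[of K' ?e ?d] S(1) de by blast
qed

lemma cot_exists:
 fixes K :: "'k sset"
 assumes X: "X : Obj M" and K: "is_sset K" "!!n. finite (Simp K n)"
 shows "EX P bt. cot X K P bt"
proof -
 obtain e :: "'k => 'u" and d and K' where e: "small_sset TYPE('u) K'" "!!n. Simp K' n = e ` Simp K n"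
  "!!n x. x : Simp K n ==> d (e x) = x" "sset_map K K' (%n. e)" "sset_map K' K (%n. d)"
  by (rule small_copy[OF K]) blast
 obtain P bt where P: "is_cotensor M E X K' P bt"
  using smc e(1) X unfolding simplicial_model_category_def by blast
 have "cot X K P (%n k. bt n (e k))" unfolding cot_def
 proof (intro conjI ballI allI impI)
  show "P : Obj M" using P by (simp add: is_cotensor_def)
  show "sset_map K (Map P X) (%n k. bt n (e k))"
  by (rule sset_map_comp[OF e(4)]) (use P in \<open>simp add: is_cotensor_def\<close>)
  fix Y n h assume Y: "Y : Obj M" and h: "sset_map (sset_prod K (std_simplex n)) (Map Y X) h"
  have "sset_map (sset_prod K' (std_simplex n)) (sset_prod K (std_simplex n)) (%m z. (d (fst z), snd z))"
  using e(5) unfolding sset_map_def by auto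
  from sset_map_comp[OF this h]
  have "sset_map (sset_prod K' (std_simplex n)) (Map Y X) (%m z. h m (d (fst z), snd z))" .
  hence "EX! sg. sg : Simp (Map Y P) n & (ALL m. ALL k:Simp K' m. ALL tq:DHom m n.
  h m (d (fst (k, tq)), snd (k, tq)) = SComp E m Y P X (bt m k) (SAct (Map Y P) tq sg))"
  using P[unfolded is_cotensor_def, THEN conjunct2, THEN conjunct2, THEN bspec, OF Y, THEN spec, THEN spec, THEN mp] by blast
  thus "EX! sg. sg : Simp (Map Y P) n & (ALL m. ALL k:Simp K m. ALL tq:DHom m n.
  h m (k, tq) = SComp E m Y P X (bt m (e k)) (SAct (Map Y P) tq sg))"
  unfolding e(2) ball_simps by (simp only: fst_conv snd_conv e(3) cong: ball_cong)
 qed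
 thus ?thesis by blast
qed

lemma tens_exists:
 fixes K :: "'k sset"
 assumes X: "X : Obj M" and K: "is_sset K" "!!n. finite (Simp K n)"
 shows "EX P al. tens X K P al"
proof -
 obtain e :: "'k => 'u" and d and K' where e: "small_sset TYPE('u) K'" "!!n. Simp K' n = e ` Simp K n"
  "!!n x. x : Simp K n ==> d (e x) = x" "sset_map K K' (%n. e)" "sset_map K' K (%n. d)"
  by (rule small_copy[OF K]) blast
 obtain P al where P: "is_tensor M E X K' P al"
  using smc e(1) X unfolding simplicial_model_category_def by blast
 have "tens X K P (%n k. al n (e k))" unfolding tens_def
 proof (intro conjI ballI allI impI)
  show "P : Obj M" using P by (simp add: is_tensor_def)
  show "sset_map K (Map X P) (%n k. al n (e k))"
  by (rule sset_map_comp[OF e(4)]) (use P in \<open>simp add: is_tensor_def\<close>)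
  fix Y n h assume Y: "Y : Obj M" and h: "sset_map (sset_prod K (std_simplex n)) (Map X Y) h"
  have "sset_map (sset_prod K' (std_simplex n)) (sset_prod K (std_simplex n)) (%m z. (d (fst z), snd z))"
  using e(5) unfolding sset_map_def by auto
  from sset_map_comp[OF this h]
  have "sset_map (sset_prod K' (std_simplex n)) (Map X Y) (%m z. h m (d (fst z), snd z))" .
  hence "EX! sg. sg : Simp (Map P Y) n & (ALL m. ALL k:Simp K' m. ALL tq:DHom m n.
  h m (d (fst (k, tq)), snd (k, tq)) = SComp E m X P Y (SAct (Map P Y) tq sg) (al m k))"
  using P[unfolded is_tensor_def, THEN conjunct2, THEN conjunct2, THEN bspec, OF Y, THEN spec, THEN spec, THEN mp] by blast
  thus "EX! sg. sg : Simp (Map P Y) n & (ALL m. ALL k:Simp K m. ALL tq:DHom m n.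
  h m (k, tq) = SComp E m X P Y (SAct (Map P Y) tq sg) (al m (e k)))"
  unfolding e(2) ball_simps by (simp only: fst_conv snd_conv e(3) cong: ball_cong)
 qed
 thus ?thesis by blast
qed

lemma cot_vertex:
 assumes c: "cot X K P bt" and Y: "Y : Obj M" and X: "X : Obj M" and h: "sset_map K (Map Y X) h"
 shows "EX! g. g : Hom M Y P & (ALL m. ALL k:Simp K m. h m k = pre g X m (bt m k))"
proof -
 have P: "P : Obj M" using c by (simp add: cot_def)
 have "sset_map (sset_prod K (std_simplex 0)) (Map Y X) (%m z. h m (fst z))" using h unfolding sset_map_def by auto
 hence ex: "EX! sg. sg : Simp (Map Y P) 0 & (ALL m. ALL k:Simp K m. ALL tq:DHom m 0.
  h m (fst (k, tq)) = SComp E m Y P X (bt m k) (SAct (Map Y P) tq sg))"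
  using c[unfolded cot_def, THEN conjunct2, THEN conjunct2, THEN bspec, OF Y, THEN spec, THEN spec, THEN mp] by blast
 have D0: "DHom m 0 = {dconst m 0 0}" for m
 proof -
  have "tq = dconst (src tq) 0 0" if "darr tq" "tgt tq = 0" for tq using that by (intro darr_eqI) auto
  thus ?thesis by auto
 qed
 have *: "(ALL m. ALL k:Simp K m. ALL tq:DHom m 0. h m (fst (k, tq)) = SComp E m Y P X (bt m k) (SAct (Map Y P) tq (SArr E g))) \<longleftrightarrow>
  (ALL m. ALL k:Simp K m. h m k = pre g X m (bt m k))" if "g : Hom M Y P" for g
  unfolding D0 using that SComp_cst[of g Y P] by (auto simp: hom_iff simp flip: sdegenerate_eq)
 obtain sg where sg: "sg : Simp (Map Y P) 0" "ALL m. ALL k:Simp K m. ALL tq:DHom m 0. h m (fst (k, tq)) = SComp E m Y P X (bt m k) (SAct (Map Y P) tq sg)"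
  using ex by (elim ex1E conjE)
 obtain g where g: "g : Hom M Y P" "sg = SArr E g" using SArr_surj[OF Y P sg(1)] by blast
 show ?thesis
 proof (rule ex1I[of _ g])
  show "g : Hom M Y P & (ALL m. ALL k:Simp K m. h m k = pre g X m (bt m k))" using g(1) iffD1[OF *[OF g(1)]] sg(2)[unfolded g(2)] by blast
  fix g' assume g': "g' : Hom M Y P & (ALL m. ALL k:Simp K m. h m k = pre g' X m (bt m k))"
  hence "SArr E g' : Simp (Map Y P) 0" "ALL m. ALL k:Simp K m. ALL tq:DHom m 0. h m (fst (k, tq)) = SComp E m Y P X (bt m k) (SAct (Map Y P) tq (SArr E g'))"
  using * by (auto simp: hom_iff)
  hence "SArr E g' = sg" using ex sg by (elim ex1E) metis
  thus "g' = g" using SArr_inj[of g' Y P g] g g' by blast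
 qed
qed

lemma Map_terminal:
 assumes t: "terminal M t" and X: "X : Obj M" and u: "u : Simp (Map X t) n" "v : Simp (Map X t) n"
 shows "u = v"
proof -
 have tO: "t : Obj M" using t by (simp add: terminal_def)
 obtain P al where P: "tens X (std_simplex n) P al"
  using tens_exists[OF X std_simplex_sset] finite_DHom by (metis std_simplex_simps(1))
 have PO: "P : Obj M" using P by (simp add: tens_def)
 have *: "EX sg:Simp (Map P t) 0. w = SComp E n X P t (SAct (Map P t) (dconst n 0 0) sg) (al n (did n))"
  if w: "w : Simp (Map X t) n" for w
 proof -
  have "sset_map (sset_prod (std_simplex n) (std_simplex 0)) (Map X t) (%m z. SAct (Map X t) (fst z) w)"
  unfolding sset_map_def using w X tO by auto
  hence "EX! sg. sg : Simp (Map P t) 0 & (ALL m. ALL k:Simp (std_simplex n) m. ALL tq:DHom m 0.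
  SAct (Map X t) (fst (k, tq)) w = SComp E m X P t (SAct (Map P t) tq sg) (al m k))"
  using P[unfolded tens_def, THEN conjunct2, THEN conjunct2, THEN bspec, OF tO, THEN spec, THEN spec, THEN mp] by blast
  then obtain sg where sg: "sg : Simp (Map P t) 0" "ALL m. ALL k:Simp (std_simplex n) m. ALL tq:DHom m 0.
  SAct (Map X t) (fst (k, tq)) w = SComp E m X P t (SAct (Map P t) tq sg) (al m k)" by (elim ex1E conjE)
  have "SAct (Map X t) (did n) w = SComp E n X P t (SAct (Map P t) (dconst n 0 0) sg) (al n (did n))"
  using bspec[OF bspec[OF spec[OF sg(2), of n], of "did n"], of "dconst n 0 0"] by simp
  thus ?thesis using sg(1) w X tO by auto
 qed
 have "sg = sg'" if "sg : Simp (Map P t) 0" "sg' : Simp (Map P t) 0" for sg sg'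
  using SArr_surj[OF PO tO] that t PO unfolding terminal_def by metis
 thus ?thesis using *[OF u(1)] *[OF u(2)] by metis
qed

lemma Map_initial:
 assumes t: "initial M t" and X: "X : Obj M" and u: "u : Simp (Map t X) n" "v : Simp (Map t X) n"
 shows "u = v"
proof -
 have tO: "t : Obj M" using t by (simp add: initial_def)
 obtain P bt where P: "cot X (std_simplex n) P bt"
  using cot_exists[OF X std_simplex_sset] finite_DHom by (metis std_simplex_simps(1))
 have PO: "P : Obj M" using P by (simp add: cot_def)
 have *: "EX g:Hom M t P. w = pre g X n (bt n (did n))" if w: "w : Simp (Map t X) n" for w
 proof -
  have "EX! g. g : Hom M t P & (ALL m. ALL k:Simp (std_simplex n) m. SAct (Map t X) k w = pre g X m (bt m k))"
  by (rule cot_vertex[OF P tO X]) (use simplex_sset_map[OF Map_sset[OF tO X] w] in simp)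
  then obtain g where g: "g : Hom M t P" "ALL m. ALL k:Simp (std_simplex n) m. SAct (Map t X) k w = pre g X m (bt m k)"
  by (elim ex1E conjE)
  from bspec[OF spec[OF g(2), of n], of "did n"] have "w = pre g X n (bt n (did n))" using w tO X by simp
  thus ?thesis using g(1) by blast
 qed
 have "g = g'" if "g : Hom M t P" "g' : Hom M t P" for g g'
  using that t PO unfolding initial_def by blast
 thus ?thesis using *[OF u(1)] *[OF u(2)] by metis
qed

subsection \<open>Kan fibrations between mapping spaces\<close>

abbreviation corner where
 "corner i p \<equiv> (%n u. (pre i (dom p) n u, post (cod i) p n u))"

lemma corner_axiom:
 assumes "i : Cof T" "p : Fib T"
 shows "kan_fibration (Map (cod i) (dom p)) (corner_sset M E i p) (corner i p)"
  and "i : W \<or> p : W ==> sset_weq (Map (cod i) (dom p)) (corner_sset M E i p) (corner i p)"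
 using smc assms unfolding simplicial_model_category_def Let_def by blast+

lemma corner_sset_simps [simp]:
 "Simp (corner_sset M E i p) n = {(u, v). u : Simp (Map (dom i) (dom p)) n & v : Simp (Map (cod i) (cod p)) n &
  post (dom i) p n u = pre i (cod p) n v}"
 "SAct (corner_sset M E i p) al z = (SAct (Map (dom i) (dom p)) al (fst z), SAct (Map (cod i) (cod p)) al (snd z))"
 by (auto simp: corner_sset_def Let_def)

lemma corner_is_sset: 
 assumes "arr i" "arr p" shows "is_sset (corner_sset M E i p)"
 unfolding is_sset_def
proof (intro conjI allI impI)
 fix m n al z assume "al : DHom m n & z : Simp (corner_sset M E i p) n"
 thus "SAct (corner_sset M E i p) al z : Simp (corner_sset M E i p) m"
  using assms sset_map_act[OF post_map[of p "dom i"], of al m "fst z"] sset_map_act[OF pre_map[of i "cod p"], of al m "snd z"]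
  by auto
qed (use assms in \<open>auto simp: Idt_Delta\<close>)

text \<open>Over a terminal object and under an initial one the corner map reduces to restriction along a
 cofibration into a fibrant object, and to composition with a fibration out of a cofibrant object.\<close>

lemma kan_pre:
 assumes i: "i : Cof T" and F: "fibrant_obj F"
 shows "kan_fibration (Map (cod i) F) (Map (dom i) F) (smap_pre M E i F)"
  and "i : W ==> a : Simp (Map (cod i) F) 0 ==> b : Simp (Map (cod i) F) 0 ==> pre i F 0 a = pre i F 0 b ==>
  same_component (Map (cod i) F) a b"
proof -
 obtain t p where t: "terminal M t" "p : Hom M F t" "p : Fib T" using F by (auto simp: fibrant_def)
 have p: "arr p" "dom p = F" "cod p = t" using t by (auto simp: hom_iff)
 have ia: "arr i" using i Cof_arr by blast
 have O: "F : Obj M" "t : Obj M" using p by auto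
 note tm = Map_terminal[OF t(1)]
 note k = corner_axiom[OF i t(3)]
 show "kan_fibration (Map (cod i) F) (Map (dom i) F) (smap_pre M E i F)"
  unfolding kan_fibration_def
 proof (intro conjI allI impI)
  show "sset_map (Map (cod i) F) (Map (dom i) F) (smap_pre M E i F)" using pre_map ia O by blast
  fix n k' u v assume n: "1 <= n" "k' <= n" and uv: "sset_map (horn n k') (Map (cod i) F) u & sset_map (std_simplex n) (Map (dom i) F) v &
  (ALL m. ALL tq:Simp (horn n k') m. pre i F m (u m tq) = v m tq)"
  define v0 where "v0 = v n (did n)"
  have v0: "v0 : Simp (Map (dom i) F) n" using uv sset_map_in[of "std_simplex n" "Map (dom i) F" v "did n" n] by (simp add: v0_def)
  have v: "v m tq = SAct (Map (dom i) F) tq v0" if "tq : DHom m n" for m tq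
  using uv sset_map_simplex[of n "Map (dom i) F" v tq m] that by (simp add: v0_def)
  obtain w where w: "w : Simp (Map (cod i) t) 0"
  using t(1) ia SArr_in unfolding terminal_def by (metis dom_cod_obj(2) hom_iff)
  define y where "y = (v0, sdegenerate (Map (cod i) t) n w)"
  have y: "y : Simp (corner_sset M E i p) n"
  using v0 w ia p O unfolding y_def by (auto intro!: tm[of "dom i" _ n])
  have "EX x:Simp (Map (cod i) F) n. (pre i F n x, post (cod i) p n x) = y & (ALL tq. tq : Simp (horn n k') (src tq) --> SAct (Map (cod i) F) tq x = u (src tq) tq)"
  proof (rule kan_fill[OF k(1)[unfolded p(2)] corner_is_sset[OF ia p(1)] n _ _ y, where u = "%tq. u (src tq) tq"])
  fix tq assume tq: "tq : Simp (horn n k') (src tq)"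
  show u1: "u (src tq) tq : Simp (Map (cod i) F) (src tq)" using uv tq sset_map_in by fast
  have "pre i F (src tq) (u (src tq) tq) = SAct (Map (dom i) F) tq v0" using uv v tq by auto
  moreover have "post (cod i) p (src tq) (u (src tq) tq) = SAct (Map (cod i) t) tq (sdegenerate (Map (cod i) t) n w)"
  by (rule tm[of "cod i" _ "src tq"]) (use u1 w ia p O tq in auto)
  ultimately show "(pre i F (src tq) (u (src tq) tq), post (cod i) p (src tq) (u (src tq) tq)) = SAct (corner_sset M E i p) tq y" by (simp add: y_def p)
  show "u (src (tq ## al)) (tq ## al) = SAct (Map (cod i) F) al (u (src tq) tq)" if al: "darr al" "tgt al = src tq" for al
  using uv sset_map_act[of "horn n k'" "Map (cod i) F" u al "src al" tq] tq al by auto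
  qed
  then obtain x where x: "x : Simp (Map (cod i) F) n" "(pre i F n x, post (cod i) p n x) = y"
  "!!tq. tq : Simp (horn n k') (src tq) ==> SAct (Map (cod i) F) tq x = u (src tq) tq" by blast
  have px: "pre i F n x = v0" using x(2) by (simp add: y_def p)
  show "EX h. sset_map (std_simplex n) (Map (cod i) F) h & (ALL m. ALL tq:Simp (horn n k') m. h m tq = u m tq) &
  (ALL m. ALL tq:Simp (std_simplex n) m. pre i F m (h m tq) = v m tq)"
  proof (intro exI[of _ "%m tq. SAct (Map (cod i) F) tq x"] conjI allI ballI)
  show "sset_map (std_simplex n) (Map (cod i) F) (%m tq. SAct (Map (cod i) F) tq x)"
  by (rule simplex_sset_map) (use x ia O in auto)
  show "SAct (Map (cod i) F) tq x = u m tq" if "tq : Simp (horn n k') m" for m tq using x(3)[of tq] that by auto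
  show "pre i F m (SAct (Map (cod i) F) tq x) = v m tq" if "tq : Simp (std_simplex n) m" for m tq
  using sset_map_act[OF pre_map[OF ia O(1)], of tq m x] that v[of tq m] px x by auto
  qed
 qed
 assume ab: "i : W" "a : Simp (Map (cod i) F) 0" "b : Simp (Map (cod i) F) 0" "pre i F 0 a = pre i F 0 b"
 have "post (cod i) p 0 a = post (cod i) p 0 b" by (rule tm[of "cod i" _ 0]) (use ab ia p in auto)
 thus "same_component (Map (cod i) F) a b"
  using ab p sset_weq_component_inj[OF k(2)[OF disjI1] Map_sset corner_is_sset, of a b] ia O by auto
qed

lemma kan_post:
 assumes p: "p : Fib T" and B: "cofibrant_obj B"
 shows "kan_fibration (Map B (dom p)) (Map B (cod p)) (smap_post M E B p)"
proof -
 obtain t i where t: "initial M t" "i : Hom M t B" "i : Cof T" using B by (auto simp: cofibrant_def)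
 have i: "arr i" "dom i = t" "cod i = B" using t by (auto simp: hom_iff)
 have pa: "arr p" using p Fib_arr by blast
 have O: "B : Obj M" "t : Obj M" using i by auto
 note tm = Map_initial[OF t(1)]
 note k = corner_axiom[OF t(3) p]
 show "kan_fibration (Map B (dom p)) (Map B (cod p)) (smap_post M E B p)"
  unfolding kan_fibration_def
 proof (intro conjI allI impI)
  show "sset_map (Map B (dom p)) (Map B (cod p)) (smap_post M E B p)" using post_map pa O by blast
  fix n k' u v assume n: "1 <= n" "k' <= n" and uv: "sset_map (horn n k') (Map B (dom p)) u & sset_map (std_simplex n) (Map B (cod p)) v &
  (ALL m. ALL tq:Simp (horn n k') m. post B p m (u m tq) = v m tq)"
  define v0 where "v0 = v n (did n)"
  have v0: "v0 : Simp (Map B (cod p)) n" using uv sset_map_in[of "std_simplex n" "Map B (cod p)" v "did n" n] by (simp add: v0_def)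
  have v: "v m tq = SAct (Map B (cod p)) tq v0" if "tq : DHom m n" for m tq
  using uv sset_map_simplex[of n "Map B (cod p)" v tq m] that by (simp add: v0_def)
  obtain w where w: "w : Simp (Map t (dom p)) 0"
  using t(1) pa SArr_in unfolding initial_def by (metis dom_cod_obj(1) hom_iff)
  define y where "y = (sdegenerate (Map t (dom p)) n w, v0)"
  have y: "y : Simp (corner_sset M E i p) n"
  using v0 w i pa O unfolding y_def by (auto intro!: tm[of "cod p" _ n])
  have "EX x:Simp (Map B (dom p)) n. (pre i (dom p) n x, post B p n x) = y & (ALL tq. tq : Simp (horn n k') (src tq) --> SAct (Map B (dom p)) tq x = u (src tq) tq)"
  proof (rule kan_fill[OF k(1)[unfolded i(3)] corner_is_sset[OF i(1) pa] n _ _ y, where u = "%tq. u (src tq) tq"])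
  fix tq assume tq: "tq : Simp (horn n k') (src tq)"
  show u1: "u (src tq) tq : Simp (Map B (dom p)) (src tq)" using uv tq sset_map_in by fast
  have "post B p (src tq) (u (src tq) tq) = SAct (Map B (cod p)) tq v0" using uv v tq by auto
  moreover have "pre i (dom p) (src tq) (u (src tq) tq) = SAct (Map t (dom p)) tq (sdegenerate (Map t (dom p)) n w)"
  by (rule tm[of "dom p" _ "src tq"]) (use u1 w i pa O tq in auto)
  ultimately show "(pre i (dom p) (src tq) (u (src tq) tq), post B p (src tq) (u (src tq) tq)) = SAct (corner_sset M E i p) tq y" by (simp add: y_def i)
  show "u (src (tq ## al)) (tq ## al) = SAct (Map B (dom p)) al (u (src tq) tq)" if al: "darr al" "tgt al = src tq" for al
  using uv sset_map_act[of "horn n k'" "Map B (dom p)" u al "src al" tq] tq al i by auto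
  qed
  then obtain x where x: "x : Simp (Map B (dom p)) n" "(pre i (dom p) n x, post B p n x) = y"
  "!!tq. tq : Simp (horn n k') (src tq) ==> SAct (Map B (dom p)) tq x = u (src tq) tq" by blast
  have px: "post B p n x = v0" using x(2) by (simp add: y_def i)
  show "EX h. sset_map (std_simplex n) (Map B (dom p)) h & (ALL m. ALL tq:Simp (horn n k') m. h m tq = u m tq) &
  (ALL m. ALL tq:Simp (std_simplex n) m. post B p m (h m tq) = v m tq)"
  proof (intro exI[of _ "%m tq. SAct (Map B (dom p)) tq x"] conjI allI ballI)
  show "sset_map (std_simplex n) (Map B (dom p)) (%m tq. SAct (Map B (dom p)) tq x)"
  by (rule simplex_sset_map) (use x pa O in auto)
  show "SAct (Map B (dom p)) tq x = u m tq" if "tq : Simp (horn n k') m" for m tq using x(3)[of tq] that by auto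
  show "post B p m (SAct (Map B (dom p)) tq x) = v m tq" if "tq : Simp (std_simplex n) m" for m tq
  using sset_map_act[OF post_map[OF pa O(1)], of tq m x] that v[of tq m] px x by auto
  qed
 qed
qed

end

section \<open>The simplicial path objects of a fibrant object\<close>

context category
begin

lemma lifts_comp:
 assumes "lifts C f p" "lifts C g p" "arr f" "arr g" "cod f = dom g" "arr p"
 shows "lifts C (g $$ f) p"
 unfolding lifts_def
proof (intro allI impI)
 fix u v assume *: "u : Hom C (dom (g $$ f)) (dom p) & v : Hom C (cod (g $$ f)) (cod p) & p $$ u = v $$ (g $$ f)"
 obtain h where h: "h : Hom C (cod f) (dom p)" "h $$ f = u" "p $$ h = v $$ g"
  using liftsD[OF assms(1), of u "v $$ g"] * assms by (auto simp: hom_iff comp_assoc)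
 obtain k where k: "k : Hom C (cod g) (dom p)" "k $$ g = h" "p $$ k = v"
  using liftsD[OF assms(2), of h v] h * assms by (auto simp: hom_iff)
 show "EX h:Hom C (cod (g $$ f)) (dom p). h $$ (g $$ f) = u & p $$ h = v"
  using h k assms by (intro bexI[of _ k]) (auto simp: hom_iff simp flip: comp_assoc)
qed

lemma pushout_facts:
 assumes "is_pushout C f g i j"
 shows "arr f" "arr g" "dom f = dom g" "arr i" "arr j" "dom i = cod f" "dom j = cod g" "cod j = cod i" "i $$ f = j $$ g"
 using assms by (auto simp: is_pushout_def hom_iff)

lemma pushout_induced:
 assumes "is_pushout C f g i j" "u : Hom C (cod f) Z" "v : Hom C (cod g) Z" "u $$ f = v $$ g"
 shows "EX h:Hom C (cod i) Z. h $$ i = u & h $$ j = v"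
 using assms unfolding is_pushout_def by blast

lemma pushout_ext:
 assumes p: "is_pushout C f g i j" and h: "h : Hom C (cod i) Z" "h' : Hom C (cod i) Z" "h $$ i = h' $$ i" "h $$ j = h' $$ j"
 shows "h = h'"
proof -
 note f = pushout_facts[OF p]
 have "(h' $$ i) $$ f = (h' $$ j) $$ g" using f h by (simp add: hom_iff comp_assoc)
 moreover have "h' $$ i : Hom C (cod f) Z" "h' $$ j : Hom C (cod g) Z" using f h by (auto simp: hom_iff)
 ultimately have "EX! k. k : Hom C (cod i) Z & k $$ i = h' $$ i & k $$ j = h' $$ j" using p unfolding is_pushout_def by blast
 thus ?thesis using h by (elim ex1E) metis
qed

lemma pushout_lifts:
 assumes p: "is_pushout C f g i j" and l: "lifts C f p" and pa: "arr p"
 shows "lifts C j p"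
 unfolding lifts_def
proof (intro allI impI)
 note f = pushout_facts[OF p]
 fix u v assume *: "u : Hom C (dom j) (dom p) & v : Hom C (cod j) (cod p) & p $$ u = v $$ j"
 have "p $$ (u $$ g) = (v $$ i) $$ f" using * f pa by (simp add: hom_iff comp_assoc flip: comp_assoc[of _ u p])
 then obtain h where h: "h : Hom C (cod f) (dom p)" "h $$ f = u $$ g" "p $$ h = v $$ i"
  using liftsD[OF l, of "u $$ g" "v $$ i"] * f pa by (auto simp: hom_iff)
 obtain k where k: "k : Hom C (cod i) (dom p)" "k $$ i = h" "k $$ j = u"
  using pushout_induced[OF p h(1), of u] h * f by (auto simp: hom_iff)
 have "p $$ k = v"
  by (rule pushout_ext[OF p, of _ "cod p"]) (use k h * f pa in \<open>auto simp: hom_iff comp_assoc\<close>)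
 thus "EX h:Hom C (cod j) (dom p). h $$ j = u & p $$ h = v" using k f by auto
qed

lemma lifts_op: "lifts (op_cat C) p i \<longleftrightarrow> lifts C i p"
 unfolding lifts_def by (auto, metis+)

end

context smc
begin

text \<open>For a trivial cofibration \<open>j : A \<rightarrow> B\<close> and \<open>b, b' : B \<rightarrow> X\<close> with \<open>b j = b' j\<close>: the maps \<open>(b, b)\<close> and \<open>(b, b')\<close> out
 of \<open>B \<union>\<^sub>A B\<close> have the same restriction to \<open>A\<close>, hence lie in the same component of the mapping space. Restricting
 a path between them to both copies of \<open>B\<close> gives two paths that agree on \<open>A\<close>, and these fold up to an
 edge from \<open>b\<close> to \<open>b'\<close> that is constant on \<open>A\<close>.\<close>

lemma vert_edge_under:
 assumes j: "j : Cof T" "j : W" and X: "fibrant_obj X" and b: "b : Hom M (cod j) X" "b' : Hom M (cod j) X" "b $$ j = b' $$ j"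
 shows "vert_edge (Map (cod j) X) (Map (dom j) X) (smap_pre M E j X) (SArr E b) (SArr E b')"
proof -
 have ja: "arr j" using j Cof_arr by blast
 have XO: "X : Obj M" using X by (rule fibrant_obj)
 have co: "cocomplete TYPE('u) M" using model by (simp add: model_category_def)
 obtain i0 i1 where po: "is_pushout M j j i0 i1" using pushout_exists[OF univ co ja ja] by blast
 note f = pushout_facts[OF po]
 let ?k = "i1 $$ j"
 have k: "?k : Cof T" "?k : W"
 proof -
  have l: "lifts M ?k p" if p: "p : Fib T" for p
  proof -
  have "lifts M j p" using lift_axiom[OF j(1) p] j(2) by blast
  thus ?thesis using lifts_comp[of j p i1] pushout_lifts[OF po, of p] f Fib_arr[OF p] by simp
  qed
  show "?k : Cof T" "?k : W" using tcof_if_lifts[of ?k] l f by simp_all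
 qed
 have bh: "arr b" "dom b = cod j" "cod b = X" "arr b'" "dom b' = cod j" "cod b' = X" using b by (auto simp: hom_iff)
 obtain c where c: "c : Hom M (cod i0) X" "c $$ i0 = b" "c $$ i1 = b'" using pushout_induced[OF po b] by blast
 obtain d where d: "d : Hom M (cod i0) X" "d $$ i0 = b" "d $$ i1 = b" using pushout_induced[OF po b(1) b(1)] by blast
 have cd: "arr c" "dom c = cod i0" "cod c = X" "arr d" "dom d = cod i0" "cod d = X" using c d by (auto simp: hom_iff)
 have "same_component (Map (cod ?k) X) (SArr E d) (SArr E c)"
 proof (rule kan_pre(2)[OF k(1) X k(2)])
  have "d $$ ?k = c $$ ?k"
  using f cd d(3) c(3) b(3) comp_assoc[of j i1 c] comp_assoc[of j i1 d] by simp
  thus "pre ?k X 0 (SArr E d) = pre ?k X 0 (SArr E c)" using f cd by (simp add: pre_SArr)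
 qed (use f cd in auto)
 hence sc: "same_component (Map (cod i0) X) (SArr E d) (SArr E c)" using f by simp
 have m0: "sset_map (Map (cod i0) X) (Map (cod j) X) (smap_pre M E i0 X)" using pre_map[of i0 X] f XO by simp
 have m1: "sset_map (Map (cod i0) X) (Map (cod j) X) (smap_pre M E i1 X)" using pre_map[of i1 X] f XO by simp
 have "vert_edge (Map (cod j) X) (Map (dom j) X) (smap_pre M E j X) (pre i0 X 0 (SArr E c)) (pre i1 X 0 (SArr E c))"
 proof (rule vert_edge_component[OF kan_pre(1)[OF j(1) X] _ _ m0 m1 _ sc])
  show "pre j X n (pre i0 X n z) = pre j X n (pre i1 X n z)" if "z : Simp (Map (cod i0) X) n" for n z
  using pre_comp[of j i0 X z n] pre_comp[of j i1 X z n] f that XO by simp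
  have "vert_edge (Map (cod j) X) (Map (dom j) X) (smap_pre M E j X) (SArr E b) (SArr E b)"
  by (rule vert_edge_refl) (use pre_map[of j X] ja XO bh in auto)
  thus "vert_edge (Map (cod j) X) (Map (dom j) X) (smap_pre M E j X) (pre i0 X 0 (SArr E d)) (pre i1 X 0 (SArr E d))"
  using f cd d by (simp add: pre_SArr)
 qed (use ja XO in auto)
 thus ?thesis using f cd c by (simp add: pre_SArr)
qed

text \<open>The relative form follows from the absolute one for the fibrant object \<open>X \<times>\<^sub>Y X\<close>: the two projections of the
 edge obtained there agree in \<open>Y\<close> and, being degenerate, on \<open>A\<close>.\<close>

lemma vert_edge_corner:
 assumes j: "j : Cof T" "j : W" and p: "p : Fib T" and X: "fibrant_obj (dom p)"
  and b: "b : Hom M (cod j) (dom p)" "b' : Hom M (cod j) (dom p)" "b $$ j = b' $$ j" "p $$ b = p $$ b'"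
 shows "vert_edge (Map (cod j) (dom p)) (corner_sset M E j p) (corner j p) (SArr E b) (SArr E b')"
proof -
 have ja: "arr j" using j Cof_arr by blast
 have pa: "arr p" using p Fib_arr by blast
 interpret O: category "op_cat M" by unfold_locales (rule op_category)
 have co: "cocomplete TYPE('u) (op_cat M)" using model by (simp add: model_category_def complete_cat_def)
 obtain q0 q1 where po: "is_pushout (op_cat M) p p q0 q1" using O.pushout_exists[OF univ co, of p p] pa by auto
 note f = O.pushout_facts[OF po, simplified]
 have q1: "q1 : Fib T"
 proof (rule Fib_if_lifts)
  show "lifts M i q1" if i: "i : Cof T" "i : W" for i
  proof -
  have "lifts M i p" using lift_axiom[OF i(1) p] i(2) by blast
  thus ?thesis using O.pushout_lifts[OF po, of i] Cof_arr[OF i(1)] by (simp add: lifts_op)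
  qed
 qed (use f in simp)
 have X2: "fibrant_obj (dom q0)" using fibrant_dom[OF X q1] f by simp
 have bh: "arr b" "dom b = cod j" "cod b = dom p" "arr b'" "dom b' = cod j" "cod b' = dom p" using b by (auto simp: hom_iff)
 obtain c where c: "c : Hom M (cod j) (dom q0)" "q0 $$ c = b" "q1 $$ c = b'" 
  using O.pushout_induced[OF po, of b "cod j" b'] b f by auto
 obtain d where d: "d : Hom M (cod j) (dom q0)" "q0 $$ d = b" "q1 $$ d = b" 
  using O.pushout_induced[OF po, of b "cod j" b] b f by auto
 have cd: "arr c" "dom c = cod j" "cod c = dom q0" "arr d" "dom d = cod j" "cod d = dom q0" using c d by (auto simp: hom_iff)
 have cj: "d $$ j = c $$ j"
  by (rule O.pushout_ext[OF po, of _ "dom j", simplified])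
  (use f cd ja c d b in \<open>auto simp: hom_iff simp flip: comp_assoc\<close>)
 obtain e where e: "edge (Map (cod j) (dom q0)) e (SArr E d) (SArr E c)"
  "pre j (dom q0) 1 e = sdegenerate (Map (dom j) (dom q0)) 1 (pre j (dom q0) 0 (SArr E d))"
  using vert_edge_under[OF j X2 d(1) c(1) cj] unfolding vert_edge_def by blast
 have eS: "e : Simp (Map (cod j) (dom q0)) 1" using e by (simp add: edge_def)
 have q0f: "arr q0" "arr q1" "dom q1 = dom q0" "cod q0 = dom p" "cod q1 = dom p" using f by auto
 have m: "edge (Map (cod j) (dom p)) (post (cod j) q 1 e) (SArr E (q $$ d)) (SArr E (q $$ c))"
  if "arr q" "dom q = dom q0" "cod q = dom p" for q
  using edge_map[OF post_map[of q "cod j"], of e "SArr E d" "SArr E c"] e that cd ja by (simp add: post_SArr)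
 have pj: "pre j (dom p) 1 (post (cod j) q 1 e) = sdegenerate (Map (dom j) (dom p)) 1 (SArr E (q $$ (d $$ j)))"
  if q: "arr q" "dom q = dom q0" "cod q = dom p" for q
 proof -
  have "pre j (dom p) 1 (post (cod j) q 1 e) = post (dom j) q 1 (pre j (dom q0) 1 e)"
  using pre_post[of j q e 1] q eS ja by simp
  also have "... = post (dom j) q 1 (sdegenerate (Map (dom j) (dom q0)) 1 (SArr E (d $$ j)))"
  using e(2) cd ja by (simp add: pre_SArr)
  also have "... = sdegenerate (Map (dom j) (dom p)) 1 (post (dom j) q 0 (SArr E (d $$ j)))"
  using sdegenerate_map[OF post_map[of q "dom j"], of "SArr E (d $$ j)" 1] q cd ja by simp
  also have "... = sdegenerate (Map (dom j) (dom p)) 1 (SArr E (q $$ (d $$ j)))"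
  using q cd ja by (simp add: post_SArr)
  finally show ?thesis .
 qed
 have "corner j p 1 (post (cod j) q0 1 e) = corner j p 1 (post (cod j) q1 1 e)"
 proof -
  have "q0 $$ (d $$ j) = q1 $$ (d $$ j)" using d cd q0f ja by (simp flip: comp_assoc)
  moreover have "post (cod j) p 1 (post (cod j) q0 1 e) = post (cod j) p 1 (post (cod j) q1 1 e)"
  using post_comp[of q0 p "cod j" e 1] post_comp[of q1 p "cod j" e 1] q0f f pa eS ja by simp
  ultimately show ?thesis using pj[of q0] pj[of q1] q0f by simp
 qed
 from vert_edge_transport[OF corner_axiom(1)[OF j(1) p] _ corner_is_sset[OF ja pa] m[of q0] m[of q1] this]
 have "vert_edge (Map (cod j) (dom p)) (corner_sset M E j p) (corner j p) (SArr E b) (SArr E b) \<longleftrightarrow>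
  vert_edge (Map (cod j) (dom p)) (corner_sset M E j p) (corner j p) (SArr E b) (SArr E b')"
  using q0f c d ja pa by simp
 moreover have "vert_edge (Map (cod j) (dom p)) (corner_sset M E j p) (corner j p) (SArr E b) (SArr E b)"
  by (rule vert_edge_refl[OF kan_map[OF corner_axiom(1)[OF j(1) p]]]) (use ja pa bh in auto)
 ultimately show ?thesis by blast
qed

end

definition bdry :: "nat => ord_map sset" where
 "bdry n = \<lparr>Simp = (%m. {tq : DHom m n. EX l<=n. ALL i<=m. ap tq i ~= l}), SAct = (%al tq. tq ## al)\<rparr>"

lemma bdry_simps [simp]:
 "tq : Simp (bdry n) m \<longleftrightarrow> darr tq & src tq = m & tgt tq = n & (EX l<=n. ALL i<=m. ap tq i ~= l)"
 "SAct (bdry n) al tq = tq ## al"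
 by (auto simp: bdry_def)

lemma bdry_sset: "is_sset (bdry n)"
 by (subst is_sset_def) (auto simp: Idt_Delta dcomp_assoc; metis ap_le)

lemma bdry_finite: "finite (Simp (bdry n) m)"
 by (rule finite_subset[OF _ finite_DHom[of m n]]) auto

locale path_objects = smc M T E 
 for M :: "('o, 'a) category" and T :: "'a model_structure" and E :: "('o, 'a, 'u) simplicial_enrichment" +
 fixes F :: 'o
 assumes F: "fibrant_obj F"
begin

lemma F_obj [simp]: "F : Obj M" using F by (rule fibrant_obj)

definition Pn :: "nat => 'o" where "Pn n = (SOME P. EX bt. cot F (std_simplex n) P bt)"
definition Pn_map :: "nat => nat => ord_map => 'u" where "Pn_map n = (SOME bt. cot F (std_simplex n) (Pn n) bt)"
definition univ_simplex :: "nat => 'u" where "univ_simplex n = Pn_map n n (did n)"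
definition Bn :: "nat => 'o" where "Bn n = (SOME P. EX bt. cot F (bdry n) P bt)"
definition Bn_map :: "nat => nat => ord_map => 'u" where "Bn_map n = (SOME bt. cot F (bdry n) (Bn n) bt)"

abbreviation us where "us \<equiv> univ_simplex"

lemma Pn_cot: "cot F (std_simplex n) (Pn n) (Pn_map n)"
proof -
 have "EX P bt. cot F (std_simplex n) P bt"
  by (rule cot_exists[OF F_obj std_simplex_sset]) (unfold std_simplex_simps, rule finite_DHom)
 thus ?thesis unfolding Pn_map_def Pn_def by (metis (mono_tags, lifting) someI_ex)
qed

lemma Bn_cot: "cot F (bdry n) (Bn n) (Bn_map n)"
proof -
 have "EX P bt. cot F (bdry n) P bt" by (rule cot_exists[OF F_obj bdry_sset bdry_finite])
 thus ?thesis unfolding Bn_map_def Bn_def by (metis (mono_tags, lifting) someI_ex)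
qed

lemma Pn_obj [simp]: "Pn n : Obj M" and Bn_obj [simp]: "Bn n : Obj M"
 using Pn_cot Bn_cot by (simp_all add: cot_def)

lemma Pn_sset_map: "sset_map (std_simplex n) (Map (Pn n) F) (Pn_map n)" 
 and Bn_sset_map: "sset_map (bdry n) (Map (Bn n) F) (Bn_map n)"
 using Pn_cot Bn_cot by (simp_all add: cot_def)

lemma us_in [simp]: "us n : Simp (Map (Pn n) F) n"
 using sset_map_in[OF Pn_sset_map, of "did n" n n] by (simp add: univ_simplex_def)

lemma Pn_map_eq: "tq : DHom m n ==> Pn_map n m tq = SAct (Map (Pn n) F) tq (us n)"
 using sset_map_simplex[OF Pn_sset_map, of tq m n] by (simp add: univ_simplex_def)

lemma Bn_map_in: "tq : Simp (bdry n) m ==> Bn_map n m tq : Simp (Map (Bn n) F) m"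
 using sset_map_in[OF Bn_sset_map] .

lemma classify:
 assumes Y: "Y : Obj M" and x: "x : Simp (Map Y F) n"
 shows "EX g:Hom M Y (Pn n). pre g F n (us n) = x"
proof -
 have "EX! g. g : Hom M Y (Pn n) & (ALL m. ALL k:Simp (std_simplex n) m. SAct (Map Y F) k x = pre g F m (Pn_map n m k))"
  by (rule cot_vertex[OF Pn_cot Y F_obj]) (use simplex_sset_map[OF Map_sset[OF Y F_obj] x] in simp)
 then obtain g where g: "g : Hom M Y (Pn n)" "ALL m. ALL k:Simp (std_simplex n) m. SAct (Map Y F) k x = pre g F m (Pn_map n m k)"
  by (elim ex1E conjE)
 have "pre g F n (us n) = x" using bspec[OF spec[OF g(2), of n], of "did n"] Y x by (simp add: univ_simplex_def)
 thus ?thesis using g(1) by blast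
qed

lemma pre_act: 
 "arr g ==> cod g = X ==> Z : Obj M ==> darr tq ==> src tq = m ==> u : Simp (Map X Z) (tgt tq) ==>
  pre g Z m (SAct (Map X Z) tq u) = SAct (Map (dom g) Z) tq (pre g Z (tgt tq) u)"
 using sset_map_act[OF pre_map[of g Z], of tq m u] by auto

lemma classify_unique:
 assumes g: "g : Hom M Y (Pn n)" "g' : Hom M Y (Pn n)" "pre g F n (us n) = pre g' F n (us n)"
 shows "g = g'"
proof -
 have Y: "Y : Obj M" and ga: "arr g" "dom g = Y" "cod g = Pn n" "arr g'" "dom g' = Y" "cod g' = Pn n" using g by (auto simp: hom_iff)
 have *: "pre k F m (Pn_map n m tq) = SAct (Map Y F) tq (pre k F n (us n))" if "tq : DHom m n" "arr k" "dom k = Y" "cod k = Pn n" for m tq k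
  using that by (simp add: Pn_map_eq pre_act)
 have "EX! g. g : Hom M Y (Pn n) & (ALL m. ALL k:Simp (std_simplex n) m. SAct (Map Y F) k (pre g' F n (us n)) = pre g F m (Pn_map n m k))"
  by (rule cot_vertex[OF Pn_cot Y F_obj]) (use simplex_sset_map[OF Map_sset[OF Y F_obj], of "pre g' F n (us n)"] ga in auto)
 moreover have "ALL m. ALL k:Simp (std_simplex n) m. SAct (Map Y F) k (pre g' F n (us n)) = pre g F m (Pn_map n m k)"
  using *[of _ _ g] ga g(3) by auto
 moreover have "ALL m. ALL k:Simp (std_simplex n) m. SAct (Map Y F) k (pre g' F n (us n)) = pre g' F m (Pn_map n m k)"
  using *[of _ _ g'] ga by auto
 ultimately show ?thesis using g(1,2) by (elim ex1E) metis
qed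

lemma classify_prism:
 assumes Y: "Y : Obj M" and h: "sset_map (sset_prod (std_simplex n) (std_simplex 1)) (Map Y F) h"
 shows "EX sg:Simp (Map Y (Pn n)) 1. ALL tq kp. darr tq --> darr kp --> src tq = src kp --> tgt tq = n --> tgt kp = 1 -->
  h (src tq) (tq, kp) = SComp E (src tq) Y (Pn n) F (SAct (Map (Pn n) F) tq (us n)) (SAct (Map Y (Pn n)) kp sg)"
proof -
 have "EX! sg. sg : Simp (Map Y (Pn n)) 1 & (ALL m. ALL k:Simp (std_simplex n) m. ALL tq:DHom m 1.
  h m (k, tq) = SComp E m Y (Pn n) F (Pn_map n m k) (SAct (Map Y (Pn n)) tq sg))"
  using Pn_cot[of n, unfolded cot_def, THEN conjunct2, THEN conjunct2, THEN bspec, OF Y, THEN spec, THEN spec, THEN mp, OF h] .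
 then obtain sg where sg: "sg : Simp (Map Y (Pn n)) 1" "ALL m. ALL k:Simp (std_simplex n) m. ALL tq:DHom m 1.
  h m (k, tq) = SComp E m Y (Pn n) F (Pn_map n m k) (SAct (Map Y (Pn n)) tq sg)" by (elim ex1E conjE)
 show ?thesis
 proof (intro bexI[OF _ sg(1)] allI impI)
  fix tq kp assume *: "darr tq" "darr kp" "src tq = src kp" "tgt tq = n" "tgt kp = 1"
  thus "h (src tq) (tq, kp) = SComp E (src tq) Y (Pn n) F (SAct (Map (Pn n) F) tq (us n)) (SAct (Map Y (Pn n)) kp sg)"
  using bspec[OF bspec[OF spec[OF sg(2), of "src tq"], of tq], of kp] Pn_map_eq[of tq "src tq" n] by simp
 qed
qed

text \<open>Evaluation at the initial vertex is a trivial fibration: to lift an \<open>(k+1)\<close>-simplex, lift its last face and then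
 an edge in the path object of dimension \<open>k\<close>, using the retraction \<open>\<Delta>\<^sup>k \<times> \<Delta>\<^sup>1 \<rightarrow> \<Delta>\<^sup>k\<^sup>+\<^sup>1\<close> that collapses the end to the last vertex.\<close>

definition cone :: "nat => ord_map => ord_map => ord_map" where
 "cone k tq kp = om (src tq) (%l. if ap kp l = 0 then ap tq l else Suc k) (Suc k)"

lemma cone_simps [simp]:
 assumes "darr tq" "darr kp" "src kp = src tq" "tgt tq = k" 
 shows "darr (cone k tq kp)" "src (cone k tq kp) = src tq" "tgt (cone k tq kp) = Suc k"
  "l <= src tq ==> ap (cone k tq kp) l = (if ap kp l = 0 then ap tq l else Suc k)"
proof -
 show "darr (cone k tq kp)" unfolding cone_def
 proof (rule darr_om)
  have 1: "ap tq i <= k" if "i <= src tq" for i using assms that by simp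
  show "(if ap kp i = 0 then ap tq i else Suc k) <= Suc k" if "i <= src tq" for i using 1[OF that] by simp
  show "(if ap kp i = 0 then ap tq i else Suc k) <= (if ap kp j = 0 then ap tq j else Suc k)" if "i <= j" "j <= src tq" for i j
  using ap_mono[OF assms(1) that] ap_mono[OF assms(2) that(1)] that assms(3) 1[of i] by auto
 qed
qed (simp_all add: cone_def)

lemma lift_from_vertex:
 assumes "i : Cof T" "x : Simp (Map (dom i) F) n" "y : Simp (Map (cod i) F) 0" "pre i F 0 y = vtx (Map (dom i) F) n 0 x"
 shows "EX z:Simp (Map (cod i) F) n. pre i F n z = x & vtx (Map (cod i) F) n 0 z = y"
 using assms
proof (induction n arbitrary: i x y)
 case 0
 hence "arr i" using Cof_arr by blast
 thus ?case using 0 by (intro bexI[of _ y]) (auto simp: vtx_0_0)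
next
 case (Suc k)
 have fib: "fibrant_obj (Pn k)"
 proof -
  obtain t where t: "terminal M t" using F by (auto simp: fibrant_def)
  show ?thesis
  proof (rule fibrant_if_extend[OF Pn_obj t])
  fix j u assume j: "j : Cof T" "j : W" "arr j" and u: "u : Hom M (dom j) (Pn k)"
  have ua: "arr u" "dom u = dom j" "cod u = Pn k" using u by (auto simp: hom_iff)
  let ?x = "pre u F k (us k)"
  have x: "?x : Simp (Map (dom j) F) k" using ua by simp
  obtain a where a: "a : Hom M (dom j) F" "vtx (Map (dom j) F) k 0 ?x = SArr E a"
  using SArr_surj[of "dom j" F "vtx (Map (dom j) F) k 0 ?x"] x j(3) by auto
  obtain b where b: "b : Hom M (cod j) F" "b $$ j = a" using fibrant_extend[OF F j(1,2) a(1)] by blast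
  obtain z where z: "z : Simp (Map (cod j) F) k" "pre j F k z = ?x"
  using Suc.IH[OF j(1) x, of "SArr E b"] a b j(3) by (auto simp: hom_iff pre_SArr)
  obtain h where h: "h : Hom M (cod j) (Pn k)" "pre h F k (us k) = z" using classify[OF _ z(1)] j(3) by auto
  have "h $$ j = u"
  by (rule classify_unique[of _ "dom j" k]) (use h ua j(3) z pre_comp[of j h F "us k" k] in \<open>auto simp: hom_iff\<close>)
  thus "EX h:Hom M (cod j) (Pn k). h $$ j = u" using h by blast
  qed
 qed
 have ia: "arr i" using Suc.prems Cof_arr by blast
 let ?A = "dom i" and ?B = "cod i"
 have x: "x : Simp (Map ?A F) (Suc k)" using Suc.prems by simp
 define w where "w = SAct (Map ?A F) (dface (Suc k) k) x"
 have w: "w : Simp (Map ?A F) k" using x ia by (simp add: w_def)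
 have "vtx (Map ?A F) k 0 w = vtx (Map ?A F) (Suc k) 0 x" using x ia by (simp add: w_def)
 then obtain z' where z': "z' : Simp (Map ?B F) k" "pre i F k z' = w" "vtx (Map ?B F) k 0 z' = y"
  using Suc.IH[OF Suc.prems(1) w Suc.prems(3)] Suc.prems(4) by auto
 obtain g where g: "g : Hom M ?B (Pn k)" "pre g F k (us k) = z'" using classify[OF _ z'(1)] ia by auto
 have ga: "arr g" "dom g = ?B" "cod g = Pn k" using g by (auto simp: hom_iff)
 let ?h = "%m (z :: ord_map \<times> ord_map). SAct (Map ?A F) (cone k (fst z) (snd z)) x"
 have "sset_map (sset_prod (std_simplex k) (std_simplex 1)) (Map ?A F) ?h"
  unfolding sset_map_def
 proof (intro conjI allI ballI impI)
  fix m n al z assume *: "al : DHom m n & z : Simp (sset_prod (std_simplex k) (std_simplex 1)) n"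
  hence t: "darr (fst z)" "darr (snd z)" "src (fst z) = n" "src (snd z) = n" "tgt (fst z) = k" "tgt (snd z) = 1"
  "darr al" "src al = m" "tgt al = n" by auto
  have "cone k (fst z ## al) (snd z ## al) = cone k (fst z) (snd z) ## al" by (rule darr_eqI) (use t in auto)
  thus "?h m (SAct (sset_prod (std_simplex k) (std_simplex 1)) al z) = SAct (Map ?A F) al (?h n z)" using t x ia by simp
 qed (use x ia in auto)
 then obtain sg where sg: "sg : Simp (Map ?A (Pn k)) 1" "ALL tq kp. darr tq --> darr kp --> src tq = src kp --> tgt tq = k --> tgt kp = 1 -->
  SAct (Map ?A F) (cone k tq kp) x = SComp E (src tq) ?A (Pn k) F (SAct (Map (Pn k) F) tq (us k)) (SAct (Map ?A (Pn k)) kp sg)"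
  using classify_prism[of ?A k ?h] ia by auto
 obtain g0 where g0: "g0 : Hom M ?A (Pn k)" "vtx (Map ?A (Pn k)) 1 0 sg = SArr E g0"
  using SArr_surj[of ?A "Pn k" "vtx (Map ?A (Pn k)) 1 0 sg"] sg(1) ia by auto
 have g0a: "arr g0" "dom g0 = ?A" "cod g0 = Pn k" using g0 by (auto simp: hom_iff)
 have "g0 = g $$ i"
 proof (rule classify_unique[of _ ?A k])
  have "cone k (did k) (dconst k 0 1) = dface (Suc k) k" by (rule darr_eqI) auto
  hence "w = SComp E k ?A (Pn k) F (SAct (Map (Pn k) F) (did k) (us k)) (SAct (Map ?A (Pn k)) (dconst k 0 1) sg)"
  using sg(2)[rule_format, of "did k" "dconst k 0 1"] by (simp add: w_def)
  also have "SAct (Map ?A (Pn k)) (dconst k 0 1) sg = sdegenerate (Map ?A (Pn k)) k (SArr E g0)"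
  using act_dconst[of "Map ?A (Pn k)" sg 1 0 k] sg(1) g0 ia by simp
  finally have "w = pre g0 F k (us k)" using g0a by (simp add: SComp_cst)
  thus "pre g0 F k (us k) = pre (g $$ i) F k (us k)" using z' g(2) ga ia by (simp add: pre_comp)
 qed (use g0 ga ia in \<open>auto simp: hom_iff\<close>)
 hence "EX e:Simp (Map ?B (Pn k)) 1. pre i (Pn k) 1 e = sg & vtx (Map ?B (Pn k)) 1 0 e = SArr E g"
  by (intro kan_lift_edge[OF kan_pre(1)[OF Suc.prems(1) fib] _ _ sg(1)]) (use ga ia g0 in \<open>auto simp: pre_SArr\<close>)
 then obtain tz where tz: "tz : Simp (Map ?B (Pn k)) 1" "pre i (Pn k) 1 tz = sg" "vtx (Map ?B (Pn k)) 1 0 tz = SArr E g" by blast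
 define z where "z = SComp E (Suc k) ?B (Pn k) F (SAct (Map (Pn k) F) (ddeg k k) (us k)) (SAct (Map ?B (Pn k)) (dcut k k) tz)"
 have z: "z : Simp (Map ?B F) (Suc k)" using tz ia by (simp add: z_def)
 have "pre i F (Suc k) z = x"
 proof -
  have "pre i F (Suc k) z = SComp E (Suc k) ?A (Pn k) F (SAct (Map (Pn k) F) (ddeg k k) (us k)) (pre i (Pn k) (Suc k) (SAct (Map ?B (Pn k)) (dcut k k) tz))"
  unfolding z_def by (rule SComp_pre) (use tz ia in auto)
  also have "pre i (Pn k) (Suc k) (SAct (Map ?B (Pn k)) (dcut k k) tz) = SAct (Map ?A (Pn k)) (dcut k k) sg"
  using tz ia by (simp add: pre_act)
  also have "SComp E (Suc k) ?A (Pn k) F (SAct (Map (Pn k) F) (ddeg k k) (us k)) (SAct (Map ?A (Pn k)) (dcut k k) sg)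
  = SAct (Map ?A F) (cone k (ddeg k k) (dcut k k)) x"
  using sg(2)[rule_format, of "ddeg k k" "dcut k k"] by simp
  also have "cone k (ddeg k k) (dcut k k) = did (Suc k)" by (rule darr_eqI) auto
  finally show ?thesis using x ia by simp
 qed
 moreover have "vtx (Map ?B F) (Suc k) 0 z = y"
 proof -
  have "vtx (Map ?B F) (Suc k) 0 z = SComp E 0 ?B (Pn k) F (SAct (Map (Pn k) F) (dconst 0 0 (Suc k)) (SAct (Map (Pn k) F) (ddeg k k) (us k)))
  (SAct (Map ?B (Pn k)) (dconst 0 0 (Suc k)) (SAct (Map ?B (Pn k)) (dcut k k) tz))"
  unfolding z_def vtx_def using SComp_act[of ?B "Pn k" F "dconst 0 0 (Suc k)" "SAct (Map ?B (Pn k)) (dcut k k) tz" "SAct (Map (Pn k) F) (ddeg k k) (us k)"]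
  tz ia by simp
  also have "... = SComp E 0 ?B (Pn k) F (vtx (Map (Pn k) F) k 0 (us k)) (vtx (Map ?B (Pn k)) 1 0 tz)"
  using tz ia by (simp add: vtx_def)
  also have "... = pre g F 0 (vtx (Map (Pn k) F) k 0 (us k))"
  unfolding tz(3) using SComp_cst[of g ?B "Pn k" 0 F "vtx (Map (Pn k) F) k 0 (us k)"] ga ia by simp
  also have "... = vtx (Map ?B F) k 0 z'" using vtx_map[OF pre_map[of g F], of "us k" k 0] ga g(2) by simp
  finally show ?thesis using z' by simp
 qed
 ultimately show ?case using z by blast
qed

lemma lift_simplex:
 assumes j: "j : Cof T" "j : W" and x: "x : Simp (Map (dom j) F) n"
 shows "EX z:Simp (Map (cod j) F) n. pre j F n z = x"
proof -
 have ja: "arr j" using j Cof_arr by blast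
 obtain a where a: "a : Hom M (dom j) F" "vtx (Map (dom j) F) n 0 x = SArr E a"
  using SArr_surj[of "dom j" F "vtx (Map (dom j) F) n 0 x"] x ja by auto
 obtain b where b: "b : Hom M (cod j) F" "b $$ j = a" using fibrant_extend[OF F j a(1)] by blast
 thus ?thesis using lift_from_vertex[OF j(1) x, of "SArr E b"] a ja by (auto simp: hom_iff pre_SArr)
qed

lemma Pn_fibrant: "fibrant_obj (Pn n)"
proof -
 obtain t where t: "terminal M t" using F by (auto simp: fibrant_def)
 show ?thesis
 proof (rule fibrant_if_extend[OF Pn_obj t])
  fix j u assume j: "j : Cof T" "j : W" "arr j" and u: "u : Hom M (dom j) (Pn n)"
  have ua: "arr u" "dom u = dom j" "cod u = Pn n" using u by (auto simp: hom_iff)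
  obtain z where z: "z : Simp (Map (cod j) F) n" "pre j F n z = pre u F n (us n)"
  using lift_simplex[OF j(1,2), of "pre u F n (us n)" n] ua by auto
  obtain h where h: "h : Hom M (cod j) (Pn n)" "pre h F n (us n) = z" using classify[OF _ z(1)] j(3) by auto
  have "h $$ j = u"
  by (rule classify_unique[of _ "dom j" n]) (use h ua j(3) z pre_comp[of j h F "us n" n] in \<open>auto simp: hom_iff\<close>)
  thus "EX h:Hom M (cod j) (Pn n). h $$ j = u" using h by blast
 qed
qed

text \<open>The structure maps of the path objects.\<close>

definition Pn_act :: "ord_map => 'a" where
 "Pn_act al = (SOME g. g : Hom M (Pn (tgt al)) (Pn (src al)) &
  pre g F (src al) (us (src al)) = SAct (Map (Pn (tgt al)) F) al (us (tgt al)))"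

lemma Pn_act:
 assumes "darr al"
 shows "arr (Pn_act al)" "dom (Pn_act al) = Pn (tgt al)" "cod (Pn_act al) = Pn (src al)"
  and "pre (Pn_act al) F (src al) (us (src al)) = SAct (Map (Pn (tgt al)) F) al (us (tgt al))"
proof -
 have "EX g. g : Hom M (Pn (tgt al)) (Pn (src al)) &
  pre g F (src al) (us (src al)) = SAct (Map (Pn (tgt al)) F) al (us (tgt al))"
  using classify[of "Pn (tgt al)" "SAct (Map (Pn (tgt al)) F) al (us (tgt al))" "src al"] assms by auto
 from someI_ex[OF this, folded Pn_act_def]
 show "arr (Pn_act al)" "dom (Pn_act al) = Pn (tgt al)" "cod (Pn_act al) = Pn (src al)"
  "pre (Pn_act al) F (src al) (us (src al)) = SAct (Map (Pn (tgt al)) F) al (us (tgt al))"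
  by (auto simp: hom_iff)
qed

text \<open>Simplices of \<open>Map(Y, F)\<close> correspond to maps from \<open>Y\<close> into the simplicial object of path objects.\<close>

lemma pre_Pn_act:
 assumes "darr al" "arr g" "cod g = Pn (tgt al)"
 shows "pre (Pn_act al $$ g) F (src al) (us (src al)) = SAct (Map (dom g) F) al (pre g F (tgt al) (us (tgt al)))"
 using assms Pn_act[OF assms(1)] by (simp add: pre_comp pre_act)

lemma Pn_act_comp:
 assumes "darr al" "darr bt" "src bt = tgt al"
 shows "Pn_act (bt ## al) = Pn_act al $$ Pn_act bt"
proof (rule classify_unique[of _ "Pn (tgt bt)" "src al"])
 show "pre (Pn_act (bt ## al)) F (src al) (us (src al)) = pre (Pn_act al $$ Pn_act bt) F (src al) (us (src al))"
  using Pn_act[of "bt ## al"] Pn_act[of bt] pre_Pn_act[of al "Pn_act bt"] assms by simp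
qed (use Pn_act[of "bt ## al"] Pn_act[of bt] Pn_act[of al] assms in \<open>auto simp: hom_iff\<close>)

lemma Pn_act_id: "Pn_act (did n) = Idt M (Pn n)"
 by (rule classify_unique[of _ "Pn n" n]) (use Pn_act[of "did n"] in \<open>auto simp: hom_iff pre_id\<close>)

lemma ev_tfib: "Pn_act (dconst 0 0 n) : Fib T" "Pn_act (dconst 0 0 n) : W"
proof -
 let ?e = "Pn_act (dconst 0 0 n)"
 have e: "arr ?e" "dom ?e = Pn n" "cod ?e = Pn 0" using Pn_act[of "dconst 0 0 n"] by auto
 have "lifts M i ?e" if i: "i : Cof T" for i
  unfolding lifts_def
 proof (intro allI impI)
  fix u v assume *: "u : Hom M (dom i) (dom ?e) & v : Hom M (cod i) (cod ?e) & ?e $$ u = v $$ i"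
  have ia: "arr i" using i Cof_arr by blast
  have uv: "arr u" "dom u = dom i" "cod u = Pn n" "arr v" "dom v = cod i" "cod v = Pn 0" using * e by (auto simp: hom_iff)
  let ?x = "pre u F n (us n)" and ?y = "pre v F 0 (us 0)"
  have "pre i F 0 ?y = pre (?e $$ u) F 0 (us 0)" using uv ia * pre_comp[of i v F "us 0" 0] by simp
  also have "... = vtx (Map (dom i) F) n 0 ?x" using pre_Pn_act[of "dconst 0 0 n" u] uv by (simp add: vtx_def)
  finally obtain z where z: "z : Simp (Map (cod i) F) n" "pre i F n z = ?x" "vtx (Map (cod i) F) n 0 z = ?y"
  using lift_from_vertex[OF i, of ?x n ?y] uv ia by auto
  obtain h where h: "h : Hom M (cod i) (Pn n)" "pre h F n (us n) = z" using classify[OF _ z(1)] ia by auto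
  have ha: "arr h" "dom h = cod i" "cod h = Pn n" using h by (auto simp: hom_iff)
  have "h $$ i = u" by (rule classify_unique[of _ "dom i" n]) (use h ha uv ia z pre_comp[of i h F "us n" n] in \<open>auto simp: hom_iff\<close>)
  moreover have "?e $$ h = v"
  by (rule classify_unique[of _ "cod i" 0])
  (use h ha uv ia z e pre_Pn_act[of "dconst 0 0 n" h] in \<open>auto simp: hom_iff vtx_def\<close>)
  ultimately show "EX h:Hom M (cod i) (dom ?e). h $$ i = u & ?e $$ h = v" using h e by auto
 qed
 thus "?e : Fib T" "?e : W" using tfib_if_lifts[OF e(1)] by blast+
qed

lemma Pn_act_weq: assumes a: "darr al" shows "Pn_act al : W"
proof -
 have c: "Pn_act (dconst n 0 0) : W" for n
 proof -
  have "dconst 0 0 0 = did 0" by (rule darr_eqI) auto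
  hence "Pn_act (dconst 0 0 n) $$ Pn_act (dconst n 0 0) = Idt M (Pn 0)"
  using Pn_act_comp[of "dconst 0 0 n" "dconst n 0 0"] Pn_act_id[of 0] by simp
  thus ?thesis
  using W_cancel_left[of "Pn_act (dconst n 0 0)" "Pn_act (dconst 0 0 n)"] ev_tfib(2)[of n] id_W[of "Pn 0"]
  Pn_act[of "dconst 0 0 n"] Pn_act[of "dconst n 0 0"] by simp
 qed
 have "dconst (tgt al) 0 0 ## al = dconst (src al) 0 0" using a by simp
 hence "Pn_act al $$ Pn_act (dconst (tgt al) 0 0) = Pn_act (dconst (src al) 0 0)"
  using Pn_act_comp[of al "dconst (tgt al) 0 0"] a by simp
 thus ?thesis
  using W_cancel_right[of "Pn_act (dconst (tgt al) 0 0)" "Pn_act al"] c[of "tgt al"] c[of "src al"]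
  Pn_act[OF a] Pn_act[of "dconst (tgt al) 0 0"] by simp
qed

text \<open>Restriction to the boundary.\<close>

definition bd :: "nat => 'a" where
 "bd n = (SOME p. p : Hom M (Pn n) (Bn n) &
  (ALL m. ALL tq:Simp (bdry n) m. SAct (Map (Pn n) F) tq (us n) = pre p F m (Bn_map n m tq)))"

lemma classify_bdry:
 assumes Y: "Y : Obj M" and u: "sset_map (bdry n) (Map Y F) u"
 shows "EX! g. g : Hom M Y (Bn n) & (ALL m. ALL tq:Simp (bdry n) m. u m tq = pre g F m (Bn_map n m tq))"
 by (rule cot_vertex[OF Bn_cot Y F_obj u])

lemma bd: "arr (bd n)" "dom (bd n) = Pn n" "cod (bd n) = Bn n"
 and bd_act: "tq : Simp (bdry n) m ==> SAct (Map (Pn n) F) tq (us n) = pre (bd n) F m (Bn_map n m tq)"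
proof -
 have "sset_map (bdry n) (Map (Pn n) F) (%m tq. SAct (Map (Pn n) F) tq (us n))" unfolding sset_map_def by auto
 from ex1_implies_ex[OF classify_bdry[OF Pn_obj this]]
 have 1: "bd n : Hom M (Pn n) (Bn n) &
  (ALL m. ALL tq:Simp (bdry n) m. SAct (Map (Pn n) F) tq (us n) = pre (bd n) F m (Bn_map n m tq))"
  unfolding bd_def by (rule someI_ex)
 thus "arr (bd n)" "dom (bd n) = Pn n" "cod (bd n) = Bn n" by (auto simp: hom_iff)
 show "tq : Simp (bdry n) m ==> SAct (Map (Pn n) F) tq (us n) = pre (bd n) F m (Bn_map n m tq)" using 1 by blast
qed

lemma pre_bd:
 assumes g: "g : Hom M Y (Pn n)" and t: "tq : Simp (bdry n) m"
 shows "pre (bd n $$ g) F m (Bn_map n m tq) = SAct (Map Y F) tq (pre g F n (us n))"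
proof -
 have ga: "arr g" "dom g = Y" "cod g = Pn n" using g by (auto simp: hom_iff)
 have "pre (bd n $$ g) F m (Bn_map n m tq) = pre g F m (pre (bd n) F m (Bn_map n m tq))"
  using pre_comp[of g "bd n" F "Bn_map n m tq" m] ga bd[of n] Bn_map_in[OF t] by simp
 also have "... = pre g F m (SAct (Map (Pn n) F) tq (us n))" using bd_act[OF t] by simp
 also have "... = SAct (Map Y F) tq (pre g F n (us n))" using t ga by (auto simp: pre_act)
 finally show ?thesis .
qed

lemma bd_eqI:
 assumes g: "g : Hom M Y (Pn n)" and c: "c : Hom M Y (Bn n)"
  and e: "!!m tq. tq : Simp (bdry n) m ==> SAct (Map Y F) tq (pre g F n (us n)) = pre c F m (Bn_map n m tq)"
 shows "bd n $$ g = c"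
proof -
 have Y: "Y : Obj M" using g by (auto simp: hom_iff)
 have 1: "sset_map (bdry n) (Map Y F) (%m tq. pre c F m (Bn_map n m tq))"
  using sset_map_comp[OF Bn_sset_map pre_map[of c F, unfolded conjunct2[OF conjunct2[OF c[unfolded hom_iff]]] conjunct1[OF conjunct2[OF c[unfolded hom_iff]]]]] c
  by (simp add: hom_iff)
 have "bd n $$ g : Hom M Y (Bn n)" using g bd[of n] by (auto simp: hom_iff)
 thus ?thesis using classify_bdry[OF Y 1] c pre_bd[OF g] e by (elim ex1E) metis
qed

definition bdry_lifts :: "nat => bool" where
 "bdry_lifts n \<longleftrightarrow> (ALL j u v. j : Cof T & j : W & sset_map (bdry n) (Map (cod j) F) u & v : Simp (Map (dom j) F) n &
  (ALL m. ALL tq:Simp (bdry n) m. pre j F m (u m tq) = SAct (Map (dom j) F) tq v) -->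
  (EX b:Simp (Map (cod j) F) n. pre j F n b = v & (ALL m. ALL tq:Simp (bdry n) m. SAct (Map (cod j) F) tq b = u m tq)))"

lemma bd_Fib:
 assumes "bdry_lifts n" shows "bd n : Fib T"
proof (rule Fib_if_lifts)
 fix j assume j: "j : Cof T" "j : W"
 have ja: "arr j" using j Cof_arr by blast
 show "lifts M j (bd n)" unfolding lifts_def
 proof (intro allI impI)
  fix a c assume *: "a : Hom M (dom j) (dom (bd n)) & c : Hom M (cod j) (cod (bd n)) & bd n $$ a = c $$ j"
  hence ac: "arr a" "dom a = dom j" "cod a = Pn n" "arr c" "dom c = cod j" "cod c = Bn n" "bd n $$ a = c $$ j"
  using bd[of n] by (auto simp: hom_iff)
  let ?u = "%m tq. pre c F m (Bn_map n m tq)" and ?v = "pre a F n (us n)"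
  have "sset_map (bdry n) (Map (cod j) F) ?u"
  using sset_map_comp[OF Bn_sset_map, of n "Map (cod j) F" "smap_pre M E c F"] pre_map[of c F] ac by simp
  moreover have "pre j F m (?u m tq) = SAct (Map (dom j) F) tq ?v" if t: "tq : Simp (bdry n) m" for m tq
  proof -
  have "pre j F m (?u m tq) = pre (bd n $$ a) F m (Bn_map n m tq)"
  unfolding ac(7) using ac ja Bn_map_in[OF t] by (simp add: pre_comp)
  also have "... = SAct (Map (dom j) F) tq ?v" by (rule pre_bd[OF _ t]) (use ac in \<open>simp add: hom_iff\<close>)
  finally show ?thesis .
  qed
  moreover have "?v : Simp (Map (dom j) F) n" using ac by simp
  ultimately obtain b where b: "b : Simp (Map (cod j) F) n" "pre j F n b = ?v"
  "ALL m. ALL tq:Simp (bdry n) m. SAct (Map (cod j) F) tq b = ?u m tq"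
  using assms[unfolded bdry_lifts_def, THEN spec[of _ j], THEN spec[of _ ?u], THEN spec[of _ ?v]] j by auto
  obtain h where h: "h : Hom M (cod j) (Pn n)" "pre h F n (us n) = b" using classify[OF _ b(1)] ja by auto
  have ha: "arr h" "dom h = cod j" "cod h = Pn n" using h by (auto simp: hom_iff)
  have "h $$ j = a" by (rule classify_unique[of _ "dom j" n]) (use h ha ac ja b pre_comp[of j h F "us n" n] in \<open>auto simp: hom_iff\<close>)
  moreover have "bd n $$ h = c" by (rule bd_eqI[OF h(1)]) (use ac b(3) h(2) in \<open>auto simp: hom_iff\<close>)
  ultimately show "EX h:Hom M (cod j) (dom (bd n)). h $$ j = a & bd n $$ h = c" using h bd[of n] by auto
 qed
qed (rule bd)

text \<open>Two \<open>n\<close>-simplices of \<open>Map(B, F)\<close> with the same boundary that also agree on \<open>A\<close> are connected by a homotopy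
 \<open>\<Delta>\<^sup>n \<times> \<Delta>\<^sup>1 \<rightarrow> Map(B, F)\<close> that is constant on the boundary and on \<open>A\<close>: this is \<open>vert_edge_corner\<close> for the fibration
 \<open>bd n\<close>.\<close>

lemma bdry_homotopy:
 assumes G: "bdry_lifts n" and j: "j : Cof T" "j : W"
  and y: "y : Simp (Map (cod j) F) n" and y': "y' : Simp (Map (cod j) F) n"
  and yy: "!!m tq. tq : Simp (bdry n) m ==> SAct (Map (cod j) F) tq y = SAct (Map (cod j) F) tq y'"
  and jy: "pre j F n y = pre j F n y'"
 obtains h where
  "!!tq kp. darr tq ==> darr kp ==> src kp = src tq ==> tgt tq = n ==> tgt kp = 1 ==> h tq kp : Simp (Map (cod j) F) (src tq)"
  "!!tq kp al. darr tq ==> darr kp ==> src kp = src tq ==> tgt tq = n ==> tgt kp = 1 ==> darr al ==> tgt al = src tq ==>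
  SAct (Map (cod j) F) al (h tq kp) = h (tq ## al) (kp ## al)"
  "h (did n) (dconst n 0 1) = y" "h (did n) (dconst n 1 1) = y'"
  "!!tq kp m. tq : Simp (bdry n) m ==> darr kp ==> src kp = m ==> tgt kp = 1 ==> h tq kp = SAct (Map (cod j) F) tq y"
  "!!tq kp. darr tq ==> darr kp ==> src kp = src tq ==> tgt tq = n ==> tgt kp = 1 ==>
  pre j F (src tq) (h tq kp) = SAct (Map (dom j) F) tq (pre j F n y)"
proof -
 have ja: "arr j" using j Cof_arr by blast
 let ?B = "cod j"
 obtain c where c: "c : Hom M ?B (Pn n)" "pre c F n (us n) = y" using classify[OF _ y] ja by auto
 obtain c' where c': "c' : Hom M ?B (Pn n)" "pre c' F n (us n) = y'" using classify[OF _ y'] ja by auto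
 have ca: "arr c" "dom c = ?B" "cod c = Pn n" "arr c'" "dom c' = ?B" "cod c' = Pn n" using c c' by (auto simp: hom_iff)
 have bc: "bd n $$ c = bd n $$ c'"
  by (rule bd_eqI[OF c(1)]) (use c c' ca bd[of n] yy pre_bd[OF c'(1)] in \<open>auto simp: hom_iff simp del: bdry_simps\<close>)
 have cj: "c $$ j = c' $$ j"
  by (rule classify_unique[of _ "dom j" n]) (use c c' ca ja jy in \<open>auto simp: hom_iff pre_comp\<close>)
 have "vert_edge (Map ?B (Pn n)) (corner_sset M E j (bd n)) (corner j (bd n)) (SArr E c) (SArr E c')"
  using vert_edge_corner[OF j bd_Fib[OF G], of c c'] Pn_fibrant bd[of n] c c' cj bc by simp
 then obtain e where e: "edge (Map ?B (Pn n)) e (SArr E c) (SArr E c')"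
  "corner j (bd n) 1 e = sdegenerate (corner_sset M E j (bd n)) 1 (corner j (bd n) 0 (SArr E c))"
  unfolding vert_edge_def by blast
 have eS: "e : Simp (Map ?B (Pn n)) 1" and e01: "vtx (Map ?B (Pn n)) 1 0 e = SArr E c" "vtx (Map ?B (Pn n)) 1 1 e = SArr E c'"
  using e by (auto simp: edge_def)
 have ej: "pre j (Pn n) 1 e = sdegenerate (Map (dom j) (Pn n)) 1 (SArr E (c $$ j))"
  and ep: "post ?B (bd n) 1 e = sdegenerate (Map ?B (Bn n)) 1 (SArr E (bd n $$ c))"
  using e(2) bd[of n] ca ja by (simp_all add: sdegenerate_eq pre_SArr post_SArr)
 define h where "h tq kp = SComp E (src tq) ?B (Pn n) F (SAct (Map (Pn n) F) tq (us n)) (SAct (Map ?B (Pn n)) kp e)" for tq kp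
 show ?thesis
 proof (rule that[of h])
  fix tq kp :: ord_map
  assume t: "darr tq" "darr kp" "src kp = src tq" "tgt tq = n" "tgt kp = 1"
  show "h tq kp : Simp (Map ?B F) (src tq)" using t eS ja by (simp add: h_def)
  show "SAct (Map ?B F) al (h tq kp) = h (tq ## al) (kp ## al)" if "darr al" "tgt al = src tq" for al
  using SComp_act[of ?B "Pn n" F al "SAct (Map ?B (Pn n)) kp e" "SAct (Map (Pn n) F) tq (us n)"] t that eS ja by (simp add: h_def)
  have "pre j F (src tq) (h tq kp) = SComp E (src tq) (dom j) (Pn n) F (SAct (Map (Pn n) F) tq (us n)) (pre j (Pn n) (src tq) (SAct (Map ?B (Pn n)) kp e))"
  unfolding h_def by (rule SComp_pre) (use t eS ja in auto)
  also have "pre j (Pn n) (src tq) (SAct (Map ?B (Pn n)) kp e) = sdegenerate (Map (dom j) (Pn n)) (src tq) (SArr E (c $$ j))"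
  using pre_act[of j ?B "Pn n" kp "src tq" e] t eS ja ej ca by simp
  also have "SComp E (src tq) (dom j) (Pn n) F (SAct (Map (Pn n) F) tq (us n)) (sdegenerate (Map (dom j) (Pn n)) (src tq) (SArr E (c $$ j)))
  = pre (c $$ j) F (src tq) (SAct (Map (Pn n) F) tq (us n))"
  by (rule SComp_cst) (use ca ja in auto)
  also have "... = SAct (Map (dom j) F) tq (pre j F n y)" using t ca ja c(2) y by (simp add: pre_comp pre_act)
  finally show "pre j F (src tq) (h tq kp) = SAct (Map (dom j) F) tq (pre j F n y)" .
 next
  have "SAct (Map ?B (Pn n)) (dconst n 0 1) e = sdegenerate (Map ?B (Pn n)) n (SArr E c)"
  "SAct (Map ?B (Pn n)) (dconst n 1 1) e = sdegenerate (Map ?B (Pn n)) n (SArr E c')"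
  using act_dconst[of "Map ?B (Pn n)" e 1 0 n] act_dconst[of "Map ?B (Pn n)" e 1 1 n] eS e01 ja by simp_all
  thus "h (did n) (dconst n 0 1) = y" "h (did n) (dconst n 1 1) = y'"
  using c c' ca by (simp_all add: h_def SComp_cst)
 next
  fix tq kp :: ord_map and m
  assume b: "tq : Simp (bdry n) m" and t: "darr kp" "src kp = m" "tgt kp = 1"
  have s: "src tq = m" using b by simp
  have "h tq kp = SComp E m ?B (Pn n) F (pre (bd n) F m (Bn_map n m tq)) (SAct (Map ?B (Pn n)) kp e)"
  unfolding h_def s using bd_act[OF b] by simp
  also have "... = SComp E m ?B (Bn n) F (Bn_map n m tq) (post ?B (bd n) m (SAct (Map ?B (Pn n)) kp e))"
  using SComp_mid[of "bd n" ?B F "SAct (Map ?B (Pn n)) kp e" m "Bn_map n m tq"] bd[of n] Bn_map_in[OF b] t eS ja by simp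
  also have "post ?B (bd n) m (SAct (Map ?B (Pn n)) kp e) = sdegenerate (Map ?B (Bn n)) m (SArr E (bd n $$ c))"
  using sset_map_act[OF post_map[of "bd n" ?B], of kp m e] ep bd[of n] t eS ja ca by simp
  also have "SComp E m ?B (Bn n) F (Bn_map n m tq) (sdegenerate (Map ?B (Bn n)) m (SArr E (bd n $$ c))) = pre (bd n $$ c) F m (Bn_map n m tq)"
  by (rule SComp_cst) (use bd[of n] ca in auto)
  also have "... = SAct (Map ?B F) tq y" using pre_bd[OF c(1) b] c(2) by simp
  finally show "h tq kp = SAct (Map ?B F) tq y" .
 qed
qed

text \<open>The boundary map \<open>F\<^sup>\<Delta>\<^sup>n \<rightarrow> F\<^sup>\<partial>\<^sup>\<Delta>\<^sup>n\<close> is a fibration. In the inductive step a lift is found on the horn that omits the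
 last face; its last face has the prescribed boundary, and the homotopy between it and the prescribed face is used to
 exchange the one for the other, through the simplices of the prism one after another.\<close>

lemma bdry_lifts_Suc:
 assumes G: "bdry_lifts n" shows "bdry_lifts (Suc n)"
 unfolding bdry_lifts_def
proof (intro allI impI)
 fix j u v
 assume *: "j : Cof T & j : W & sset_map (bdry (Suc n)) (Map (cod j) F) u & v : Simp (Map (dom j) F) (Suc n) &
  (ALL m. ALL tq:Simp (bdry (Suc n)) m. pre j F m (u m tq) = SAct (Map (dom j) F) tq v)"
 hence j: "j : Cof T" "j : W" and u: "sset_map (bdry (Suc n)) (Map (cod j) F) u" and v: "v : Simp (Map (dom j) F) (Suc n)"
  and uv: "!!m tq. tq : Simp (bdry (Suc n)) m ==> pre j F m (u m tq) = SAct (Map (dom j) F) tq v" by blast+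
 have ja: "arr j" using j Cof_arr by blast
 let ?X = "Map (cod j) F" and ?Y = "Map (dom j) F" and ?d = "dface (Suc n) n"
 let ?horn = "%tq. tq : Simp (horn (Suc n) (Suc n)) (src tq)"
 have X: "is_sset ?X" "is_sset ?Y" using ja by simp_all
 have hb: "tq : Simp (bdry (Suc n)) (src tq)" if "?horn tq" for tq using that by auto
 note kan = kan_pre(1)[OF j(1) F]
 have u_act: "u (src al) (tq ## al) = SAct ?X al (u (src tq) tq)" if "tq : Simp (bdry (Suc n)) (src tq)" "darr al" "tgt al = src tq" for tq al
  using sset_map_act[OF u, of al "src al" tq] that by auto
 have "EX x:Simp ?X (Suc n). pre j F (Suc n) x = v & (ALL tq. ?horn tq --> SAct ?X tq x = u (src tq) tq)"
  by (rule kan_fill[OF kan X(2) _ _ _ _ v]) (use uv[OF hb] u_act[OF hb] sset_map_in[OF u hb] in \<open>simp_all del: horn_iff\<close>, auto)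
 then obtain b0 where b0: "b0 : Simp ?X (Suc n)" "pre j F (Suc n) b0 = v" "!!tq. ?horn tq ==> SAct ?X tq b0 = u (src tq) tq" by blast
 have dB: "?d : Simp (bdry (Suc n)) n" by (auto intro!: exI[of _ "Suc n"])
 define y where "y = u n ?d"
 define y' where "y' = SAct ?X ?d b0"
 have y: "y : Simp ?X n" unfolding y_def by (rule sset_map_in[OF u dB])
 have y': "y' : Simp ?X n" unfolding y'_def using b0 X by simp
 have dh: "?horn (?d ## tq)" if b: "tq : Simp (bdry n) m" for m tq
 proof -
  obtain l where l: "l <= n" "ALL i<=m. ap tq i ~= l" and t: "darr tq" "src tq = m" "tgt tq = n" using b by auto
  have "ap (?d ## tq) i = ap tq i" if "i <= m" for i using t that by (simp add: less_Suc_eq_le)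
  thus ?thesis using t l by (auto intro!: exI[of _ l])
 qed
 have uy: "SAct ?X tq y = u m (?d ## tq)" if "tq : Simp (bdry n) m" for m tq
  using u_act[of ?d tq] dB that unfolding y_def by (auto simp del: bdry_simps(1)) auto
 have yy: "SAct ?X tq y = SAct ?X tq y'" if t: "tq : Simp (bdry n) m" for m tq
  using uy[OF t] b0(3)[OF dh[OF t]] t b0(1) X by (auto simp: y'_def)
 have jy: "pre j F n y = SAct ?Y ?d v" unfolding y_def by (rule uv[OF dB])
 have jy': "pre j F n y' = SAct ?Y ?d v" unfolding y'_def using pre_act[of j "cod j" F ?d n b0] b0 ja by simp
 obtain h where h:
  "!!tq kp. darr tq ==> darr kp ==> src kp = src tq ==> tgt tq = n ==> tgt kp = 1 ==> h tq kp : Simp ?X (src tq)"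
  "!!tq kp al. darr tq ==> darr kp ==> src kp = src tq ==> tgt tq = n ==> tgt kp = 1 ==> darr al ==> tgt al = src tq ==>
  SAct ?X al (h tq kp) = h (tq ## al) (kp ## al)"
  "h (did n) (dconst n 0 1) = y" "h (did n) (dconst n 1 1) = y'"
  "!!tq kp m. tq : Simp (bdry n) m ==> darr kp ==> src kp = m ==> tgt kp = 1 ==> h tq kp = SAct ?X tq y"
  "!!tq kp. darr tq ==> darr kp ==> src kp = src tq ==> tgt tq = n ==> tgt kp = 1 ==>
  pre j F (src tq) (h tq kp) = SAct ?Y tq (SAct ?Y ?d v)"
  by (rule bdry_homotopy[OF G j y y' yy jy[folded jy'], unfolded jy]) (assumption, rule that)
 define kp where "kp i = om n (%l. if l < i then 0 else 1 :: nat) 1" for i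
 have kp: "darr (kp i)" "src (kp i) = n" "tgt (kp i) = 1" "!!l. l <= n ==> ap (kp i) l = (if l < i then 0 else 1)" for i
  unfolding kp_def by (auto intro!: darr_om)
 have "EX b:Simp ?X (Suc n). pre j F (Suc n) b = v & (ALL tq. ?horn tq --> SAct ?X tq b = u (src tq) tq) & SAct ?X ?d b = h (did n) (kp i)"
  if "i <= Suc n" for i
  using that
 proof (induction i)
  case 0
  have "kp 0 = dconst n 1 1" by (rule darr_eqI) (auto simp: kp)
  thus ?case using b0 h(4) y'_def by (intro bexI[of _ b0]) auto
 next
  case (Suc i)
  hence i: "i <= n" by simp
  obtain b where b: "b : Simp ?X (Suc n)" "pre j F (Suc n) b = v" "!!tq. ?horn tq ==> SAct ?X tq b = u (src tq) tq"
  "SAct ?X ?d b = h (did n) (kp i)" using Suc by auto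
  define z where "z = h (ddeg i n) (dcut i n)"
  have z: "z : Simp ?X (Suc n)" using h(1)[of "ddeg i n" "dcut i n"] i by (simp add: z_def)
  have z_act: "SAct ?X mu z = h (ddeg i n ## mu) (dcut i n ## mu)" if "darr mu" "tgt mu = Suc n" for mu
  using h(2)[of "ddeg i n" "dcut i n" mu] i that by (simp add: z_def)
  have key: "SAct ?X mu z = SAct ?X (?d ## (ddeg i n ## mu)) b"
  if mu: "darr mu" "tgt mu = Suc n" and l: "l <= Suc n" "l ~= Suc i" "ALL t<=src mu. ap mu t ~= l" for mu l
  proof (cases "l = i")
  case True
  have "dcut i n ## mu = kp i ## (ddeg i n ## mu)"
  proof (rule darr_eqI)
  fix t assume t: "t <= src (kp i ## (ddeg i n ## mu))"
  hence "t <= src mu" using mu i kp by simp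
  hence a: "ap mu t ~= i" "ap mu t <= Suc n" using l True mu i by auto
  hence "ap (ddeg i n) (ap mu t) <= n" using i by auto
  with a show "ap (dcut i n ## mu) t = ap (kp i ## (ddeg i n ## mu)) t"
  using `t <= src mu` mu i kp by auto
  qed (use mu i kp in auto)
  hence "SAct ?X mu z = SAct ?X (ddeg i n ## mu) (h (did n) (kp i))"
  using z_act[OF mu] h(2)[of "did n" "kp i" "ddeg i n ## mu"] mu i kp by simp
  also have "... = SAct ?X (?d ## (ddeg i n ## mu)) b" unfolding b(4)[symmetric] using b(1) X mu i by simp
  finally show ?thesis .
  next
  case False
  let ?l = "if l < i then l else l - 1"
  have ln: "ap (ddeg i n ## mu) t ~= ?l" if "t <= src mu" for t
  proof -
  have "ap mu t ~= l" "ap mu t <= Suc n" using l mu that by auto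
  thus ?thesis using that mu i l False by (auto split: if_splits)
  qed
  have "darr (ddeg i n ## mu)" "src (ddeg i n ## mu) = src mu" "tgt (ddeg i n ## mu) = n" using mu i by simp_all
  moreover have "?l <= n" using l False i by auto
  ultimately have bb: "ddeg i n ## mu : Simp (bdry n) (src mu)" using ln unfolding bdry_simps by blast
  have "SAct ?X mu z = SAct ?X (ddeg i n ## mu) y" unfolding z_act[OF mu] by (rule h(5)[OF bb]) (use mu in auto)
  also have "... = u (src mu) (?d ## (ddeg i n ## mu))" by (rule uy[OF bb])
  also have "... = SAct ?X (?d ## (ddeg i n ## mu)) b" using b(3)[OF dh[OF bb]] mu i by simp
  finally show ?thesis .
  qed
  let ?s = "ddeg (Suc n) (Suc n)" and ?t = "ddeg i (Suc n)"
  have collapse: "?d ## (ddeg i n ## (?s ## tq)) = ?t ## tq" if t: "darr tq" "tgt tq = Suc (Suc n)" "ALL t<=src tq. ap tq t ~= Suc (Suc n)" for tq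
  proof (rule darr_eqI)
  fix k assume k: "k <= src (?t ## tq)"
  hence "k <= src tq" using t i by simp
  hence "ap tq k ~= Suc (Suc n)" "ap tq k <= Suc (Suc n)" using t by auto
  hence a: "ap tq k <= Suc n" by simp
  hence c: "ap (ddeg i n) (ap tq k) <= n" using i by auto
  have "ap (?d ## (ddeg i n ## (?s ## tq))) k = ap ?d (ap (ddeg i n) (ap tq k))" using `k <= src tq` t i a by simp
  also have "... = ap (ddeg i n) (ap tq k)" using c by (simp del: ap_ddeg)
  also have "... = ap (?t ## tq) k" using `k <= src tq` t i a by simp
  finally show "ap (?d ## (ddeg i n ## (?s ## tq))) k = ap (?t ## tq) k" .
  qed (use t i in auto)
  define miss where "miss tq \<longleftrightarrow> (ALL t<=src tq. ap tq t ~= Suc (Suc n))" for tq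
  define w where "w tq = (if miss tq then SAct ?X (?s ## tq) z else SAct ?X (?t ## tq) b)" for tq
  have w_b: "w tq = SAct ?X (?t ## tq) b"
  if t: "darr tq" "tgt tq = Suc (Suc n)" and l: "l <= Suc n" "l ~= Suc i" "ALL t<=src tq. ap tq t ~= l" for tq l
  proof (cases "miss tq")
  case True
  have "ap (?s ## tq) k ~= l" if k: "k <= src (?s ## tq)" for k
  proof -
  have "k <= src tq" using k t by simp
  hence "ap tq k ~= Suc (Suc n)" "ap tq k <= Suc (Suc n)" "ap tq k ~= l" using True t l by (auto simp: miss_def)
  hence "ap tq k <= Suc n" "ap tq k ~= l" by linarith+
  thus ?thesis using `k <= src tq` t by simp
  qed
  hence "SAct ?X (?s ## tq) z = SAct ?X (?d ## (ddeg i n ## (?s ## tq))) b" using t l by (intro key[of _ l]) auto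
  thus ?thesis using True collapse[OF t] by (simp add: w_def miss_def)
  qed (simp add: w_def)
  let ?H = "%tq. tq : Simp (horn (Suc (Suc n)) (Suc i)) (src tq)"
  have not_miss: "EX l<=Suc n. l ~= Suc i & (ALL t<=src tq. ap tq t ~= l)" if "?H tq" "\<not> miss tq" for tq
  using that by (auto simp: miss_def le_Suc_eq)
  have "EX x:Simp ?X (Suc (Suc n)). pre j F (Suc (Suc n)) x = SAct ?Y ?t v & (ALL tq. ?H tq --> SAct ?X tq x = w tq)"
  proof (rule kan_fill[OF kan X(2)])
  show "SAct ?Y ?t v : Simp ?Y (Suc (Suc n))" using v X i by simp
  fix tq assume tq: "?H tq"
  hence t: "darr tq" "tgt tq = Suc (Suc n)" by auto
  show "w tq : Simp ?X (src tq)" using t z b(1) X i by (simp add: w_def)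
  show "pre j F (src tq) (w tq) = SAct ?Y tq (SAct ?Y ?t v)"
  proof (cases "miss tq")
  case True
  have "pre j F (src tq) (w tq) = SAct ?Y (ddeg i n ## (?s ## tq)) (SAct ?Y ?d v)"
  using True t i z_act[of "?s ## tq"] h(6)[of "ddeg i n ## (?s ## tq)" "dcut i n ## (?s ## tq)"] by (simp add: w_def)
  also have "... = SAct ?Y (?t ## tq) v" using v t i X collapse[OF t] True by (simp add: miss_def)
  finally show ?thesis using v t i X by simp
  next
  case False
  hence "pre j F (src tq) (w tq) = SAct ?Y (?t ## tq) v"
  using pre_act[of j "cod j" F "?t ## tq" "src tq" b] b t i ja by (simp add: w_def)
  thus ?thesis using v t i X by simp
  qed
  fix al assume al: "darr al" "tgt al = src tq"
  show "w (tq ## al) = SAct ?X al (w tq)"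
  proof (cases "miss tq")
  case True
  hence "miss (tq ## al)" using t al by (simp add: miss_def)
  thus ?thesis using True t al z X by (simp add: w_def dcomp_assoc)
  next
  case False
  then obtain l where l: "l <= Suc n" "l ~= Suc i" "ALL t<=src tq. ap tq t ~= l" using not_miss[OF tq] by blast
  hence "ALL k<=src (tq ## al). ap (tq ## al) k ~= l" using t al by simp
  hence "w (tq ## al) = SAct ?X (?t ## (tq ## al)) b" using t al l by (intro w_b[of _ l]) auto
  thus ?thesis using False t al b(1) X i by (simp add: w_def dcomp_assoc)
  qed
  qed (use i in auto)
  then obtain x where x: "x : Simp ?X (Suc (Suc n))" "pre j F (Suc (Suc n)) x = SAct ?Y ?t v" "!!tq. ?H tq ==> SAct ?X tq x = w tq" by blast
  let ?f = "dface (Suc i) (Suc n)"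
  show ?case
  proof (intro bexI[of _ "SAct ?X ?f x"] conjI allI impI)
  show "SAct ?X ?f x : Simp ?X (Suc n)" using x X by simp
  show "pre j F (Suc n) (SAct ?X ?f x) = v"
  using pre_act[of j "cod j" F ?f "Suc n" x] x v X i ja by simp
  next
  fix tq assume tq: "?horn tq"
  then obtain l where l: "l <= n" "ALL t<=src tq. ap tq t ~= l" and t: "darr tq" "tgt tq = Suc n" by (auto simp: le_Suc_eq)
  let ?l = "if l < Suc i then l else Suc l"
  have "ap (?f ## tq) k ~= ?l" if k: "k <= src tq" for k
  proof -
  have "ap tq k ~= l" "ap tq k <= Suc n" using l t k by auto
  thus ?thesis using t k by auto
  qed
  hence m: "?l <= Suc n" "?l ~= Suc i" "ALL k<=src (?f ## tq). ap (?f ## tq) k ~= ?l" using l t by (simp_all del: ap_dface)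
  moreover have "darr (?f ## tq)" "tgt (?f ## tq) = Suc (Suc n)" using t by simp_all
  ultimately have "?H (?f ## tq)" unfolding horn_iff using le_SucI by blast
  hence "SAct ?X (?f ## tq) x = w (?f ## tq)" by (rule x(3))
  also have "... = SAct ?X (?t ## (?f ## tq)) b" by (rule w_b[OF _ _ m]) (use t in auto)
  also have "?t ## (?f ## tq) = tq" using t i dcomp_assoc[of ?t ?f tq] by simp
  finally show "SAct ?X tq (SAct ?X ?f x) = u (src tq) tq" using b(3)[OF tq] x(1) X t by simp
  next
  have m: "miss (?f ## ?d)" unfolding miss_def
  proof (intro allI impI)
  fix k assume "k <= src (?f ## ?d)"
  thus "ap (?f ## ?d) k ~= Suc (Suc n)" by (simp add: less_Suc_eq_le)
  qed
  hence "?H (?f ## ?d)" using i by (auto simp: miss_def intro!: exI[of _ "Suc (Suc n)"])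
  hence "SAct ?X (?f ## ?d) x = h (ddeg i n ## (?s ## (?f ## ?d))) (dcut i n ## (?s ## (?f ## ?d)))"
  using x(3)[of "?f ## ?d"] m z_act[of "?s ## (?f ## ?d)"] by (simp add: w_def)
  also have "ddeg i n ## (?s ## (?f ## ?d)) = did n" by (rule darr_eqI) (use i in \<open>auto simp: less_Suc_eq_le\<close>)
  also have "dcut i n ## (?s ## (?f ## ?d)) = kp (Suc i)" by (rule darr_eqI) (use i in \<open>auto simp: less_Suc_eq_le kp\<close>)
  finally show "SAct ?X ?d (SAct ?X ?f x) = h (did n) (kp (Suc i))" using x(1) X by simp
  qed
 qed
 from this[of "Suc n"] obtain b where b: "b : Simp ?X (Suc n)" "pre j F (Suc n) b = v" "!!tq. ?horn tq ==> SAct ?X tq b = u (src tq) tq"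
  "SAct ?X ?d b = h (did n) (kp (Suc n))" by auto
 have "kp (Suc n) = dconst n 0 1" by (rule darr_eqI) (auto simp: kp)
 hence bd: "SAct ?X ?d b = u n ?d" using b(4) h(3) y_def by simp
 show "EX b:Simp ?X (Suc n). pre j F (Suc n) b = v & (ALL m. ALL tq:Simp (bdry (Suc n)) m. SAct ?X tq b = u m tq)"
 proof (intro bexI[of _ b] conjI allI ballI b(1,2))
  fix m tq assume tq: "tq : Simp (bdry (Suc n)) m"
  hence t: "darr tq" "src tq = m" "tgt tq = Suc n" by auto
  show "SAct ?X tq b = u m tq"
  proof (cases "?horn tq")
  case True
  thus ?thesis using b(3) t by blast
  next
  case False
  hence l: "!!k. k <= src tq ==> ap tq k ~= Suc n" using tq by auto
  have f: "?d ## (ddeg n n ## tq) = tq" using factor_dface[OF t(1) t(3), of "Suc n"] l by simp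
  have "u m tq = SAct ?X (ddeg n n ## tq) (u n ?d)" using u_act[of ?d "ddeg n n ## tq"] dB t f by (simp del: bdry_simps(1))
  also have "... = SAct ?X (?d ## (ddeg n n ## tq)) b" unfolding bd[symmetric] using b(1) X t by simp
  finally show ?thesis using f by simp
  qed
 qed
qed

lemma bdry_lifts: "bdry_lifts n"
proof (induction n)
 case 0
 have "False" if "tq : Simp (bdry 0) m" for tq m using that by auto
 thus ?case unfolding bdry_lifts_def using lift_simplex[of _ _ 0] by blast
qed (rule bdry_lifts_Suc)

lemma bd_fibration: "bd n : Fib T" by (rule bd_Fib[OF bdry_lifts])

end

declare split_paired_All [simp del] split_paired_Ex [simp del]

section \<open>Injections, surjections and nondegenerate simplices\<close>

lemma om_inj_iff: "om_inj tq \<longleftrightarrow> inj_on (ap tq) {..src tq}"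
 by (simp add: om_inj_def ap_def src_def case_prod_unfold)

lemma om_surj_iff: "om_surj tq \<longleftrightarrow> ap tq ` {..src tq} = {..tgt tq}"
 by (simp add: om_surj_def ap_def src_def tgt_def case_prod_unfold)

lemma om_injD: "om_inj tq ==> i <= src tq ==> j <= src tq ==> ap tq i = ap tq j ==> i = j"
 unfolding om_inj_iff by (rule inj_onD[of "ap tq" "{..src tq}"]) simp_all

lemma om_injI: "(!!i j. i <= src tq ==> j <= src tq ==> ap tq i = ap tq j ==> i = j) ==> om_inj tq"
 unfolding om_inj_iff by (rule inj_onI) simp

lemma om_inj_comp:
 assumes "darr tq" "darr ph" "src tq = tgt ph" "om_inj tq" "om_inj ph" shows "om_inj (tq ## ph)"
proof (rule om_injI)
 fix i j assume ij: "i <= src (tq ## ph)" "j <= src (tq ## ph)" "ap (tq ## ph) i = ap (tq ## ph) j"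
 hence "i <= src ph" "j <= src ph" "ap tq (ap ph i) = ap tq (ap ph j)" using assms by simp_all
 moreover from this have "ap ph i = ap ph j" using assms by - (rule om_injD[OF assms(4)], simp_all)
 ultimately show "i = j" by - (rule om_injD[OF assms(5)])
qed

lemma om_inj_left:
 assumes "darr tq" "darr ph" "src tq = tgt ph" "om_inj (tq ## ph)" shows "om_inj ph"
 by (rule om_injI, rule om_injD[OF assms(4)]) (use assms(1-3) in simp_all)

lemma om_inj_cancel:
 assumes "om_inj dt" "darr dt" "darr mu" "darr \<nu>" "tgt mu = src dt" "tgt \<nu> = src dt" "dt ## mu = dt ## \<nu>"
 shows "mu = \<nu>"
proof (rule darr_eqI)
 show s: "src mu = src \<nu>" using assms(2-7) by (metis dcomp_simps(2))
 show "ap mu i = ap \<nu> i" if "i <= src \<nu>" for i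
  by (rule om_injD[OF assms(1)]) (use that s assms in auto, metis dcomp_simps(4))
qed (use assms in auto)

lemma om_inj_growth:
 assumes "darr tq" "om_inj tq" shows "i + d <= src tq ==> ap tq i + d <= ap tq (i + d)"
proof (induction d)
 case (Suc d)
 hence "ap tq (i + d) <= ap tq (Suc (i + d))" using ap_mono[OF assms(1), of "i + d" "Suc (i + d)"] by simp
 moreover have "ap tq (i + d) ~= ap tq (Suc (i + d))"
 proof
  assume "ap tq (i + d) = ap tq (Suc (i + d))"
  hence "i + d = Suc (i + d)" using Suc.prems by - (rule om_injD[OF assms(2)], simp_all)
  thus False by simp
 qed
 ultimately show ?case using Suc by simp
qed simp

lemma om_inj_le: assumes "darr tq" "om_inj tq" shows "src tq <= tgt tq"
 using om_inj_growth[OF assms, of 0 "src tq"] ap_le[OF assms(1), of "src tq"] by simp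

lemma om_inj_id: assumes t: "darr tq" "om_inj tq" and n: "src tq = n" "tgt tq = n" shows "tq = did n"
proof (rule darr_eqI[OF t(1) did_darr])
 show "src tq = src (did n)" "tgt tq = tgt (did n)" using n by simp_all
 fix i assume "i <= src (did n)"
 hence i: "i <= n" by simp
 have "i <= ap tq i" using om_inj_growth[OF t, of 0 i] i n by simp
 moreover have "ap tq i + (n - i) <= ap tq n" using om_inj_growth[OF t, of i "n - i"] i n by simp
 moreover have "ap tq n <= n" using t(1) n by simp
 ultimately show "ap tq i = ap (did n) i" using i by simp
qed

lemma om_surj_section:
 assumes s: "darr sg" "om_surj sg" and i: "i <= src sg"
 shows "EX dt. darr dt & src dt = tgt sg & tgt dt = src sg & sg ## dt = did (tgt sg) & ap dt (ap sg i) = i"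
proof -
 define g where "g k = (if k = ap sg i then i else LEAST l. l <= src sg & ap sg l = k)" for k
 have g: "g k <= src sg" "ap sg (g k) = k" if "k <= tgt sg" for k
 proof -
  have "EX l. l <= src sg & ap sg l = k" using s(2) that unfolding om_surj_iff by (metis atMost_iff imageE)
  from LeastI_ex[OF this] show "g k <= src sg" "ap sg (g k) = k" using i by (auto simp: g_def)
 qed
 have mono: "g k <= g l" if "k <= l" "l <= tgt sg" for k l
 proof (rule ccontr)
  assume "\<not> g k <= g l"
  hence "l <= k" using ap_mono[OF s(1), of "g l" "g k"] g[of l] g[of k] that by simp
  thus False using that `\<not> g k <= g l` by simp
 qed
 have d: "darr (om (tgt sg) g (src sg))" using g mono by (intro darr_om) auto
 show ?thesis
 proof (rule exI[of _ "om (tgt sg) g (src sg)"], intro conjI)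
  show "darr (om (tgt sg) g (src sg))" by (rule d)
  show "sg ## om (tgt sg) g (src sg) = did (tgt sg)" by (rule darr_eqI) (use d g s in auto)
  show "ap (om (tgt sg) g (src sg)) (ap sg i) = i" using s i by (simp add: g_def)
 qed simp_all
qed

lemma om_surj_comp:
 assumes "darr tq" "darr ph" "src tq = tgt ph" "om_surj tq" "om_surj ph" shows "om_surj (tq ## ph)"
proof -
 have "ap (tq ## ph) ` {..src ph} = ap tq ` (ap ph ` {..src ph})" unfolding image_image using assms by (intro image_cong) auto
 thus ?thesis using assms by (simp add: om_surj_iff)
qed

lemma om_surj_le: assumes "darr sg" "om_surj sg" shows "tgt sg <= src sg"
proof -
 have "card (ap sg ` {..src sg}) <= card {..src sg}" by (rule card_image_le) simp
 thus ?thesis using assms(2) unfolding om_surj_iff by (metis card_atMost Suc_le_mono)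
qed

lemma om_surj_id: assumes "darr sg" "om_surj sg" "src sg = n" "tgt sg = n" shows "sg = did n"
proof (rule om_inj_id[OF assms(1) _ assms(3,4)])
 have "card (ap sg ` {..n}) = card {..n}" using assms(2-4) unfolding om_surj_iff by metis
 thus "om_inj sg" unfolding om_inj_iff assms(3) by (intro eq_card_imp_inj_on) simp
qed

lemma om_did [simp]: "om_inj (did n)" "om_surj (did n)"
proof -
 have "ap (did n) ` {..n} = (%i. i) ` {..n}" by (intro image_cong) simp_all
 thus "om_surj (did n)" by (simp add: om_surj_iff)
 show "om_inj (did n)" by (rule om_injI) simp
qed

lemma epi_mono:
 assumes "darr tq"
 shows "EX ez sg. darr ez & darr sg & om_inj ez & om_surj sg & src ez = tgt sg & src sg = src tq & tgt ez = tgt tq & tq = ez ## sg"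
 using assms
 proof (induction "tgt tq" arbitrary: tq rule: less_induct)
  case less
  show ?case
  proof (cases "om_surj tq")
  case True
  with less(2) show ?thesis by (intro exI[of _ "did (tgt tq)"] exI[of _ tq]) simp
  next
  case False
  have "ap tq ` {..src tq} \<subseteq> {..tgt tq}" using less(2) by auto
  hence "EX l:{..tgt tq}. l \<notin> ap tq ` {..src tq}" using False unfolding om_surj_iff by blast
  then obtain l where l: "l <= tgt tq" "!!i. i <= src tq ==> ap tq i ~= l" by fastforce
  then obtain n where n: "tgt tq = Suc n" using l(1) l(2)[OF le0] ap_le[OF less(2), of 0] by (cases "tgt tq") auto
  have f: "dface l n ## (ddeg (l - 1) n ## tq) = tq" using factor_dface[OF less(2) n] l n by simp
  have d: "darr (ddeg (l - 1) n ## tq)" "tgt (ddeg (l - 1) n ## tq) = n" "src (ddeg (l - 1) n ## tq) = src tq"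
  using n l less(2) by simp_all
  obtain ez sg where e: "darr ez" "darr sg" "om_inj ez" "om_surj sg" "src ez = tgt sg" "src sg = src tq" "tgt ez = n"
  "ddeg (l - 1) n ## tq = ez ## sg" using less(1)[of "ddeg (l - 1) n ## tq"] d n by (metis lessI)
  have "om_inj (dface l n)" by (rule om_injI) (auto split: if_splits)
  hence "om_inj (dface l n ## ez)" using e by (intro om_inj_comp) auto
  thus ?thesis using e f n by (intro exI[of _ "dface l n ## ez"] exI[of _ sg]) (auto simp: dcomp_assoc)
  qed
 qed

lemma epi_mono_unique:
 assumes e: "darr ez" "darr sg" "om_inj ez" "om_surj sg" "src ez = tgt sg"
  and e': "darr ez'" "darr sg'" "om_inj ez'" "om_surj sg'" "src ez' = tgt sg'" and eq: "ez ## sg = ez' ## sg'"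
 shows "ez = ez'" "sg = sg'"
proof -
 have s: "src sg = src sg'" "tgt ez = tgt ez'" using arg_cong[OF eq, of src] arg_cong[OF eq, of tgt] e e' by simp_all
 obtain dt where d: "darr dt" "src dt = tgt sg" "tgt dt = src sg" "sg ## dt = did (tgt sg)" using om_surj_section[OF e(2,4) le0] by blast
 obtain dt' where d': "darr dt'" "src dt' = tgt sg'" "tgt dt' = src sg'" "sg' ## dt' = did (tgt sg')" using om_surj_section[OF e'(2,4) le0] by blast
 have swap: "mu = mu' ## (rh' ## \<nu>)" if "darr mu" "darr rh" "darr mu'" "darr rh'" "darr \<nu>" "src mu = tgt rh" "src mu' = tgt rh'"
  "src rh = tgt \<nu>" "src rh' = tgt \<nu>" "rh ## \<nu> = did (tgt rh)" "mu ## rh = mu' ## rh'" for mu rh mu' rh' \<nu>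
 proof -
  have "mu = mu ## (rh ## \<nu>)" using that(1,6,10) by simp
  also have "... = (mu' ## rh') ## \<nu>" using that(1,2,5,6,8) unfolding that(11)[symmetric] by (intro dcomp_assoc)
  also have "... = mu' ## (rh' ## \<nu>)" using that by (intro dcomp_assoc[symmetric])
  finally show ?thesis .
 qed
 have 1: "ez = ez' ## (sg' ## dt)" by (rule swap[of _ sg]) (use d e e' s eq in simp_all)
 have 2: "ez' = ez ## (sg ## dt')" by (rule swap[of _ sg']) (use d' e e' s eq in simp_all)
 have i: "om_inj (sg' ## dt)" by (rule om_inj_left[of ez']) (use 1[symmetric] e d e' s in simp_all)
 have i': "om_inj (sg ## dt')" by (rule om_inj_left[of ez]) (use 2[symmetric] e' d' e s in simp_all)
 have "tgt sg = tgt sg'" using om_inj_le[OF _ i] om_inj_le[OF _ i'] e e' d d' s by simp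
 hence "sg' ## dt = did (tgt sg')" using om_inj_id[OF _ i] d e' s by simp
 thus "ez = ez'" using 1 e' by simp
 hence "tgt sg' = src ez" "ez ## sg = ez ## sg'" using e'(5) eq by simp_all
 thus "sg = sg'" by - (rule om_inj_cancel[OF e(3,1,2) e'(2) e(5)[symmetric]])
qed

definition degenerate :: "'k sset => nat => 'k => bool" where
 "degenerate K n x \<longleftrightarrow> (EX sg y. darr sg & om_surj sg & src sg = n & tgt sg < n & y : Simp K (tgt sg) & x = SAct K sg y)"

lemma nondegenerate_root:
 assumes K: "is_sset K" and x: "x : Simp K n"
 obtains sg y where "darr sg" "om_surj sg" "src sg = n" "y : Simp K (tgt sg)" "\<not> degenerate K (tgt sg) y" "x = SAct K sg y"
proof -
 have "EX sg y. darr sg & om_surj sg & src sg = n & y : Simp K (tgt sg) & \<not> degenerate K (tgt sg) y & x = SAct K sg y"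
  using x
 proof (induction n arbitrary: x rule: less_induct)
  case (less n)
  show ?case
  proof (cases "degenerate K n x")
  case True
  then obtain sg y where s: "darr sg" "om_surj sg" "src sg = n" "tgt sg < n" "y : Simp K (tgt sg)" "x = SAct K sg y"
  unfolding degenerate_def by (elim exE conjE)
  obtain tz z where t: "darr tz" "om_surj tz" "src tz = tgt sg" "z : Simp K (tgt tz)" "\<not> degenerate K (tgt tz) z" "y = SAct K tz z"
  using less(1)[OF s(4,5)] by (elim exE conjE)
  have "om_surj (tz ## sg)" using s t by (intro om_surj_comp) auto
  thus ?thesis using s t K by (intro exI[of _ "tz ## sg"] exI[of _ z]) simp
  next
  case False
  with less(2) K show ?thesis by (intro exI[of _ "did n"] exI[of _ x]) simp
  qed
 qed
 thus ?thesis using that by (elim exE conjE)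
qed

text \<open>The Eilenberg-Zilber lemma: if \<open>sg\<^sup>*y = tz\<^sup>*z\<close> with \<open>y\<close>, \<open>z\<close> nondegenerate, then \<open>tzdt\<close> is the identity for every
 section \<open>dt\<close> of \<open>sg\<close>; a section can be chosen through any given point.\<close>

lemma nondegenerate_unique:
 assumes K: "is_sset K" and s: "darr sg" "om_surj sg" "src sg = n" "y : Simp K (tgt sg)" "\<not> degenerate K (tgt sg) y"
  and t: "darr tz" "om_surj tz" "src tz = n" "z : Simp K (tgt tz)" "\<not> degenerate K (tgt tz) z"
  and eq: "SAct K sg y = SAct K tz z"
 shows "sg = tz" "y = z"
proof -
 have half: "om_inj (tz' ## dt)" "y' = SAct K (tz' ## dt) z'"
  if h: "darr sg'" "src sg' = n" "y' : Simp K (tgt sg')" "\<not> degenerate K (tgt sg') y'" "darr tz'" "src tz' = n" "z' : Simp K (tgt tz')"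
  "SAct K sg' y' = SAct K tz' z'" and d: "darr dt" "src dt = tgt sg'" "tgt dt = n" "sg' ## dt = did (tgt sg')" for sg' tz' y' z' dt
 proof -
  have "SAct K dt (SAct K sg' y') = SAct K dt (SAct K tz' z')" by (rule arg_cong[OF h(8)])
  thus y': "y' = SAct K (tz' ## dt) z'" using h(1-3,5-7) d K by simp
  obtain ez rh where e: "darr ez" "darr rh" "om_inj ez" "om_surj rh" "src ez = tgt rh" "src rh = src dt" "tgt ez = tgt tz'" "tz' ## dt = ez ## rh"
  using epi_mono[of "tz' ## dt"] h(5,6) d by auto
  have "degenerate K (tgt sg') y'" if "tgt rh < tgt sg'"
  unfolding degenerate_def
  proof (intro exI conjI)
  show "SAct K ez z' : Simp K (tgt rh)" using e h(7) K by simp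
  show "y' = SAct K rh (SAct K ez z')" using y' e h(7) K by simp
  qed (use e d that in simp_all)
  hence "\<not> tgt rh < tgt sg'" using h(4) by blast
  hence "tgt rh = src rh" using om_surj_le[OF e(2,4)] e d by simp
  hence "rh = did (src rh)" using om_surj_id[OF e(2,4)] by simp
  hence "tz' ## dt = ez" using e(1,5,8) `tgt rh = src rh` dcomp_did(1)[of ez "src rh"] by simp
  thus "om_inj (tz' ## dt)" using e by simp
 qed
 obtain dt' where d': "darr dt'" "src dt' = tgt tz" "tgt dt' = n" "tz ## dt' = did (tgt tz)" using om_surj_section[OF t(1,2) le0] t by blast
 have le': "tgt tz <= tgt sg" using om_inj_le[OF _ half(1)[OF t(1,3-5) s(1,3,4) eq[symmetric] d']] s d' by simp
 have id: "tz ## dt = did (tgt tz)" "tgt sg = tgt tz" if d: "darr dt" "src dt = tgt sg" "tgt dt = n" "sg ## dt = did (tgt sg)" for dt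
 proof -
  note i = half(1)[OF s(1,3-5) t(1,3,4) eq d]
  show "tgt sg = tgt tz" using le' om_inj_le[OF _ i] t d by simp
  thus "tz ## dt = did (tgt tz)" using om_inj_id[OF _ i] t d by simp
 qed
 show "sg = tz"
 proof (rule darr_eqI)
  fix i assume "i <= src tz"
  then obtain dt where d: "darr dt" "src dt = tgt sg" "tgt dt = src sg" "sg ## dt = did (tgt sg)" "ap dt (ap sg i) = i"
  using om_surj_section[OF s(1,2), of i] s(3) t(3) by auto
  have "ap sg i <= tgt sg" using s(1,3) t(3) `i <= src tz` by simp
  hence "ap tz i = ap (tz ## dt) (ap sg i)" "ap sg i <= tgt tz" using d s(1,3) t(1,3) id(2)[of dt] by simp_all
  thus "ap sg i = ap tz i" using id(1)[of dt] d s(3) by simp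
 next
  show "tgt sg = tgt tz" using om_surj_section[OF s(1,2) le0] id(2) s(3) by blast
 qed (use s t in auto)
 then obtain dt where "darr dt" "src dt = tgt sg" "tgt dt = n" "sg ## dt = did (tgt sg)" using om_surj_section[OF s(1,2) le0] s by blast
 thus "y = z" using half(2)[OF s(1,3-5) t(1,3,4) eq, of dt] `sg = tz` K t by simp
qed

section \<open>Simplicial objects\<close>

context category
begin

abbreviation sC where "sC \<equiv> simplicial_objects C"

lemma Hom_op_Delta: "al : Hom (op_cat Delta) m n \<longleftrightarrow> darr al & src al = n & tgt al = m" by simp

lemma sobj_iff:
 "X : Obj sC \<longleftrightarrow> (ALL n. Fo X n : Obj C) & (ALL al. darr al --> Fa X al : Hom C (Fo X (tgt al)) (Fo X (src al))) &
  (ALL n. Fa X (did n) = Idt C (Fo X n)) &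
  (ALL al bt. darr al --> darr bt --> src bt = tgt al --> Fa X (bt ## al) = Fa X al $$ Fa X bt) & Fa X : extensional (Arr Delta)"
 unfolding simplicial_objects_def functor_cat_def Let_def is_functor_def
 by (auto simp: Hom_op_Delta Idt_Delta Delta_def[THEN arg_cong[of _ _ Obj]] simp del: DHom_iff op_cat_simps(7))

lemma sobjD:
 assumes "X : Obj sC"
 shows "Fo X n : Obj C" "darr al ==> Fa X al : Hom C (Fo X (tgt al)) (Fo X (src al))"
  "Fa X (did n) = Idt C (Fo X n)" "darr al ==> darr bt ==> src bt = tgt al ==> Fa X (bt ## al) = Fa X al $$ Fa X bt"
 using assms unfolding sobj_iff by blast+

lemma sarr_iff:
 "(X, tz, Y) : Arr sC \<longleftrightarrow> X : Obj sC & Y : Obj sC & (ALL n. tz n : Hom C (Fo X n) (Fo Y n)) &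
  (ALL al. darr al --> tz (src al) $$ Fa X al = Fa Y al $$ tz (tgt al))"
 unfolding simplicial_objects_def functor_cat_def Let_def nat_trans_def
 by (auto simp: Hom_op_Delta Delta_def[THEN arg_cong[of _ _ Obj]] simp del: DHom_iff op_cat_simps(7))

lemma sC_simps [simp]:
 "Dom sC (X, tz, Y) = X" "Cod sC (X, tz, Y) = Y" "Cmp sC (Y', sg, Z) (X, tz, Y) = (X, %n. sg n $$ tz n, Z)"
 "Idt sC X = (X, %n. Idt C (Fo X n), X)"
 by (auto simp: simplicial_objects_def functor_cat_def Let_def Delta_def restrict_def)

lemma sarr_cases:
 assumes "f : Hom sC X Y" obtains tz where "f = (X, tz, Y)" "(X, tz, Y) : Arr sC"
 using assms by (cases f) (auto simp: Hom_def)

lemma id_pushout: assumes "h : Hom C X Y" shows "is_pushout C (Idt C X) h h (Idt C Y)"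
 unfolding is_pushout_def
proof (intro conjI allI impI)
 have h: "arr h" "dom h = X" "cod h = Y" "X : Obj C" using assms by (auto simp: hom_iff)
 fix Z u v assume *: "u : Hom C (cod (Idt C X)) Z & v : Hom C (cod h) Z & u $$ Idt C X = v $$ h"
 show "EX! k. k : Hom C (cod h) Z & k $$ h = u & k $$ Idt C Y = v"
 proof (rule ex1I[of _ v])
  show "v : Hom C (cod h) Z & v $$ h = u & v $$ Idt C Y = v" using * h comp_id(1)[of u X] by (simp add: hom_iff)
  show "k = v" if "k : Hom C (cod h) Z & k $$ h = u & k $$ Idt C Y = v" for k
  using that comp_id(1)[of k Y] h by (simp add: hom_iff)
 qed
qed (use assms in \<open>auto simp: hom_iff\<close>)

end

lemma matching_simps:
 "Obj (matching_cat n) = {dt. darr dt & tgt dt = n & src dt < n & om_inj dt}"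
 "a : Hom (matching_cat n) dt ez \<longleftrightarrow> (EX ph. a = (dt, ph, ez) & dt : Obj (matching_cat n) & ez : Obj (matching_cat n) &
  darr ph & src ph = src ez & tgt ph = src dt & om_inj ph & dt ## ph = ez)"
proof -
 have D: "Dom Delta tq = src tq" "Cod Delta tq = tgt tq" for tq by (simp_all add: Delta_def src_def tgt_def case_prod_unfold)
 show o: "Obj (matching_cat n) = {dt. darr dt & tgt dt = n & src dt < n & om_inj dt}"
  unfolding matching_cat_def Let_def D darr_def by auto
 show "a : Hom (matching_cat n) dt ez \<longleftrightarrow> (EX ph. a = (dt, ph, ez) & dt : Obj (matching_cat n) & ez : Obj (matching_cat n) &
  darr ph & src ph = src ez & tgt ph = src dt & om_inj ph & dt ## ph = ez)"
  unfolding o Hom_def[of "matching_cat n"] unfolding matching_cat_def Let_def D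
  by (cases a rule: prod_cases3) (auto simp: darr_def[symmetric] simp del: split_paired_All split_paired_Ex)
qed

lemma latching_cat_simps:
 "Obj (latching_cat n) = {sg. darr sg & src sg = n & tgt sg < n & om_surj sg}"
 "a : Hom (latching_cat n) sg tz \<longleftrightarrow> (EX ph. a = (sg, ph, tz) & sg : Obj (latching_cat n) & tz : Obj (latching_cat n) &
  darr ph & src ph = tgt tz & tgt ph = tgt sg & om_surj ph & ph ## tz = sg)"
proof -
 have D: "Dom Delta tq = src tq" "Cod Delta tq = tgt tq" for tq by (simp_all add: Delta_def src_def tgt_def case_prod_unfold)
 show o: "Obj (latching_cat n) = {sg. darr sg & src sg = n & tgt sg < n & om_surj sg}"
  unfolding latching_cat_def Let_def D darr_def by auto
 show "a : Hom (latching_cat n) sg tz \<longleftrightarrow> (EX ph. a = (sg, ph, tz) & sg : Obj (latching_cat n) & tz : Obj (latching_cat n) &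
  darr ph & src ph = tgt tz & tgt ph = tgt sg & om_surj ph & ph ## tz = sg)"
  unfolding o Hom_def[of "latching_cat n"] unfolding latching_cat_def Let_def D
  by (cases a rule: prod_cases3) (auto simp: darr_def[symmetric] simp del: split_paired_All split_paired_Ex)
qed

lemma Dom_Delta [simp]: "Dom Delta tq = src tq" "Cod Delta tq = tgt tq"
 by (simp_all add: Delta_def src_def tgt_def case_prod_unfold)

lemma bdry_iff: "tq : Simp (bdry n) m \<longleftrightarrow> darr tq & src tq = m & tgt tq = n & \<not> om_surj tq"
proof -
 have "om_surj tq \<longleftrightarrow> (ALL l<=n. EX i<=m. ap tq i = l)" if "darr tq" "src tq = m" "tgt tq = n"
 proof -
  have "ap tq ` {..m} \<subseteq> {..n}" using that by auto
  hence "om_surj tq \<longleftrightarrow> {..n} \<subseteq> ap tq ` {..m}" unfolding om_surj_iff that(2,3) by blast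
  thus ?thesis unfolding subset_iff image_iff by (metis atMost_iff)
 qed
 thus ?thesis unfolding bdry_simps by blast
qed

context path_objects
begin

definition path_simplicial :: "('o, 'a) simplicial" where
 "path_simplicial = \<lparr>Fo = Pn, Fa = restrict Pn_act (Arr Delta)\<rparr>"

abbreviation PS where "PS \<equiv> path_simplicial"

lemma PS_simps [simp]: "Fo PS n = Pn n" "darr al ==> Fa PS al = Pn_act al"
 by (simp_all add: path_simplicial_def darr_def)

lemma PS_obj: "PS : Obj sC"
 unfolding sobj_iff using Pn_act Pn_act_comp Pn_act_id by (simp add: hom_iff) (simp add: path_simplicial_def)

lemma Bn_map_act: "tq : Simp (bdry n) m ==> darr al ==> tgt al = m ==> Bn_map n (src al) (tq ## al) = SAct (Map (Bn n) F) al (Bn_map n m tq)"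
 using sset_map_act[OF Bn_sset_map, of al "src al" tq n] by simp

definition bproj :: "nat => ord_map => 'a" where
 "bproj n dt = (SOME g. g : Hom M (Bn n) (Pn (src dt)) & pre g F (src dt) (us (src dt)) = Bn_map n (src dt) dt)"

lemma bproj:
 assumes "dt : Simp (bdry n) m"
 shows "bproj n dt : Hom M (Bn n) (Pn m)" "pre (bproj n dt) F m (us m) = Bn_map n m dt"
proof -
 have s: "src dt = m" using assms by simp
 obtain g where "g : Hom M (Bn n) (Pn m)" "pre g F m (us m) = Bn_map n m dt" using classify[OF Bn_obj Bn_map_in[OF assms]] by blast
 hence "EX g. g : Hom M (Bn n) (Pn (src dt)) & pre g F (src dt) (us (src dt)) = Bn_map n (src dt) dt" unfolding s by blast
 from someI_ex[OF this, folded bproj_def, unfolded s] show "bproj n dt : Hom M (Bn n) (Pn m)" "pre (bproj n dt) F m (us m) = Bn_map n m dt"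
  by blast+
qed

lemma matching_bdry: "dt : Obj (matching_cat n) ==> dt : Simp (bdry n) (src dt)"
 using om_surj_le[of dt] by (auto simp: matching_simps bdry_iff simp del: bdry_simps)

lemma bdry_matching:
 assumes "tq : Simp (bdry n) m"
 shows "EX ez sg. ez : Obj (matching_cat n) & darr sg & om_surj sg & src sg = m & tgt sg = src ez & tq = ez ## sg"
proof -
 have t: "darr tq" "src tq = m" "tgt tq = n" "\<not> om_surj tq" using assms unfolding bdry_iff by blast+
 obtain ez sg where e: "darr ez" "darr sg" "om_inj ez" "om_surj sg" "src ez = tgt sg" "src sg = m" "tgt ez = n" "tq = ez ## sg"
  using epi_mono[OF t(1)] unfolding t(2,3) by blast
 have "src ez ~= n"
 proof
  assume "src ez = n"
  hence "ez = did n" using om_inj_id e by blast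
  thus False using e t by simp
 qed
 hence "ez : Obj (matching_cat n)" using om_inj_le[OF e(1,3)] e by (simp add: matching_simps)
 thus ?thesis using e by (intro exI[of _ ez] exI[of _ sg]) simp
qed

text \<open>The object of boundaries is the matching object: a compatible family of maps to the path objects of the proper faces
 gives a map from the boundary to \<open>Map(D, F)\<close>, by factoring a simplex of the boundary as a face after a surjection.\<close>

lemma Bn_matching: "is_colimit (op_cat (matching_cat n)) (op_cat M) (matching_diagram PS) (Bn n) (bproj n)"
proof -
 let ?J = "matching_cat n"
 have cone: "is_cocone (op_cat ?J) (op_cat M) (matching_diagram PS) d kp \<longleftrightarrow> d : Obj M &
  (ALL dt:Obj ?J. kp dt : Hom M d (Pn (src dt))) &
  (ALL dt ph. dt : Obj ?J --> darr ph --> tgt ph = src dt --> om_inj ph --> Pn_act ph $$ kp dt = kp (dt ## ph))" for d kp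
 proof -
  have "(ALL i j a. a : Hom ?J j i --> Fa (matching_diagram PS) a $$ kp j = kp i) \<longleftrightarrow>
  (ALL dt ph. dt : Obj ?J --> darr ph --> tgt ph = src dt --> om_inj ph --> Pn_act ph $$ kp dt = kp (dt ## ph))" (is "?l \<longleftrightarrow> ?r")
  proof
  assume l: ?l
  show ?r
  proof (intro allI impI)
  fix dt ph assume d: "dt : Obj ?J" and p: "darr ph" "tgt ph = src dt" "om_inj ph"
  have dd: "darr dt" "tgt dt = n" "src dt < n" "om_inj dt" using d by (simp_all add: matching_simps)
  hence "dt ## ph : Obj ?J" using om_inj_comp[of dt ph] om_inj_le[OF p(1,3)] p by (simp add: matching_simps)
  hence "(dt, ph, dt ## ph) : Hom ?J dt (dt ## ph)" using d dd p by (simp add: matching_simps)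
  from l[rule_format, OF this] show "Pn_act ph $$ kp dt = kp (dt ## ph)" using p by (simp add: matching_diagram_def)
  qed
  next
  assume r: ?r
  show ?l
  proof (intro allI impI)
  fix ez dt a assume "a : Hom ?J dt ez"
  then obtain ph where a: "a = (dt, ph, ez)" "dt : Obj ?J" "darr ph" "tgt ph = src dt" "om_inj ph" "dt ## ph = ez"
  unfolding matching_simps(2) by blast
  thus "Fa (matching_diagram PS) a $$ kp dt = kp ez" using r by (auto simp: matching_diagram_def)
  qed
  qed
  thus ?thesis unfolding is_cocone_def op_cat_simps by (simp add: matching_diagram_def)
 qed
 have b: "bproj n dt : Hom M (Bn n) (Pn (src dt))" "pre (bproj n dt) F (src dt) (us (src dt)) = Bn_map n (src dt) dt"
  if "dt : Obj ?J" for dt using bproj[OF matching_bdry[OF that]] by blast+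
 have c: "is_cocone (op_cat ?J) (op_cat M) (matching_diagram PS) (Bn n) (bproj n)"
  unfolding cone
 proof (intro conjI ballI allI impI)
  fix dt ph assume d: "dt : Obj ?J" and p: "darr ph" "tgt ph = src dt" "om_inj ph"
  have dd: "darr dt" "tgt dt = n" "src dt < n" "om_inj dt" using d by (simp_all add: matching_simps)
  hence "dt ## ph : Obj ?J" using om_inj_comp[of dt ph] om_inj_le[OF p(1,3)] p by (simp add: matching_simps)
  note e = b[OF this]
  show "Pn_act ph $$ bproj n dt = bproj n (dt ## ph)"
  proof (rule classify_unique[of _ "Bn n" "src ph"])
  show "pre (Pn_act ph $$ bproj n dt) F (src ph) (us (src ph)) = pre (bproj n (dt ## ph)) F (src ph) (us (src ph))"
  using pre_Pn_act[of ph "bproj n dt"] b[OF d] e p dd Bn_map_act[OF matching_bdry[OF d], of ph] by (simp add: hom_iff)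
  qed (use b[OF d] e p dd Pn_act[OF p(1)] in \<open>auto simp: hom_iff\<close>)
 qed (use b in simp_all)
 show ?thesis unfolding is_colimit_def
 proof (intro conjI allI impI c)
  fix d kp assume "is_cocone (op_cat ?J) (op_cat M) (matching_diagram PS) d kp"
  hence d: "d : Obj M" and k: "!!dt. dt : Obj ?J ==> kp dt : Hom M d (Pn (src dt))"
  "!!dt ph. dt : Obj ?J ==> darr ph ==> tgt ph = src dt ==> om_inj ph ==> Pn_act ph $$ kp dt = kp (dt ## ph)"
  unfolding cone by blast+
  let ?x = "%dt. pre (kp dt) F (src dt) (us (src dt))"
  have x: "?x dt : Simp (Map d F) (src dt)" if "dt : Obj ?J" for dt using k(1)[OF that] by (simp add: hom_iff)
  define dec where "dec tq = (SOME z. om_inj (fst z) & darr (fst z) & darr (snd z) & om_surj (snd z) & src (fst z) = tgt (snd z) & tq = fst z ## snd z)" for tq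
  define u where "u m tq = SAct (Map d F) (snd (dec tq)) (?x (fst (dec tq)))" for m :: nat and tq
  have u: "u m (dt ## mu) = SAct (Map d F) mu (?x dt)" if dl: "dt : Obj ?J" and m: "darr mu" "tgt mu = src dt" for m dt mu
  proof -
  have dd: "darr dt" "tgt dt = n" "src dt < n" "om_inj dt" using dl by (simp_all add: matching_simps)
  obtain ph sg where p: "darr ph" "darr sg" "om_inj ph" "om_surj sg" "src ph = tgt sg" "src sg = src mu" "tgt ph = tgt mu" "mu = ph ## sg"
  using epi_mono[OF m(1)] by blast
  have tp: "tgt ph = src dt" using p(7) m(2) by simp
  have i: "om_inj (dt ## ph)" using om_inj_comp[of dt ph] dd p(1,3) tp by simp
  have e: "dt ## mu = (dt ## ph) ## sg" unfolding p(8) using p(1,2,5) dd tp by (intro dcomp_assoc) simp_all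
  let ?P = "%z. om_inj (fst z) & darr (fst z) & darr (snd z) & om_surj (snd z) & src (fst z) = tgt (snd z) & dt ## mu = fst z ## snd z"
  have "?P (dt ## ph, sg)" using i e p(1,2,4,5) dd tp by simp
  hence "?P (dec (dt ## mu))" unfolding dec_def by (rule someI)
  hence z: "om_inj (fst (dec (dt ## mu)))" "darr (fst (dec (dt ## mu)))" "darr (snd (dec (dt ## mu)))" "om_surj (snd (dec (dt ## mu)))"
  "src (fst (dec (dt ## mu))) = tgt (snd (dec (dt ## mu)))" "fst (dec (dt ## mu)) ## snd (dec (dt ## mu)) = (dt ## ph) ## sg" using e by simp_all
  have "darr (dt ## ph)" "src (dt ## ph) = tgt sg" using p(1,5) dd tp by simp_all
  hence "fst (dec (dt ## mu)) = dt ## ph" "snd (dec (dt ## mu)) = sg"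
  using epi_mono_unique[OF z(2,3,1,4,5) _ p(2) i p(4) _ z(6)] by blast+
  hence "u m (dt ## mu) = SAct (Map d F) sg (?x (dt ## ph))" by (simp add: u_def)
  also have "?x (dt ## ph) = SAct (Map d F) ph (?x dt)"
  using pre_Pn_act[of ph "kp dt"] k(1)[OF dl] k(2)[OF dl, of ph] p(1,3) tp dd by (simp add: hom_iff)
  finally show ?thesis unfolding p(8) using x[OF dl] p(1,2,5) tp d by simp
  qed
  have um: "sset_map (bdry n) (Map d F) u" unfolding sset_map_def
  proof (intro conjI allI ballI impI)
  fix m tq assume "tq : Simp (bdry n) m"
  then obtain ez sg where e: "ez : Obj ?J" "darr sg" "src sg = m" "tgt sg = src ez" "tq = ez ## sg" using bdry_matching by blast
  thus "u m tq : Simp (Map d F) m" using u[OF e(1,2,4)] x[OF e(1)] d by simp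
  next
  fix m m' al tq assume *: "al : DHom m m' & tq : Simp (bdry n) m'"
  then obtain ez sg where e: "ez : Obj ?J" "darr sg" "src sg = m'" "tgt sg = src ez" "tq = ez ## sg" using bdry_matching by blast
  have a: "darr al" "src al = m" "tgt al = m'" using * by auto
  have "darr ez" using e(1) by (simp add: matching_simps)
  hence "SAct (bdry n) al tq = ez ## (sg ## al)" using e a dcomp_assoc[of ez sg al] by simp
  thus "u m (SAct (bdry n) al tq) = SAct (Map d F) al (u m' tq)"
  using u[OF e(1,2,4)] u[OF e(1), of "sg ## al"] x[OF e(1)] d e a by simp
  qed
  have eqv: "(ALL m. ALL tq:Simp (bdry n) m. u m tq = pre g F m (Bn_map n m tq)) \<longleftrightarrow> (ALL dt:Obj ?J. bproj n dt $$ g = kp dt)"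
  if g: "g : Hom M d (Bn n)" for g
  proof -
  have ga: "arr g" "dom g = d" "cod g = Bn n" using g by (auto simp: hom_iff)
  have pb: "pre (bproj n dt $$ g) F (src dt) (us (src dt)) = pre g F (src dt) (Bn_map n (src dt) dt)" if "dt : Obj ?J" for dt
  using pre_comp[of g "bproj n dt" F "us (src dt)" "src dt"] b[OF that] ga by (simp add: hom_iff)
  show ?thesis
  proof (intro iffI ballI allI)
  fix dt assume *: "ALL m. ALL tq:Simp (bdry n) m. u m tq = pre g F m (Bn_map n m tq)" and dl: "dt : Obj ?J"
  have dd: "darr dt" using dl by (simp add: matching_simps)
  have "u (src dt) dt = ?x dt" using u[OF dl, of "did (src dt)" "src dt"] x[OF dl] d dd by simp
  hence "pre (bproj n dt $$ g) F (src dt) (us (src dt)) = ?x dt" unfolding pb[OF dl] using bspec[OF spec[OF *] matching_bdry[OF dl]] by simp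
  thus "bproj n dt $$ g = kp dt"
  by (intro classify_unique[of _ d "src dt"]) (use k(1)[OF dl] b[OF dl] comp_hom[OF g] in auto)
  next
  fix m tq assume *: "ALL dt:Obj ?J. bproj n dt $$ g = kp dt" and "tq : Simp (bdry n) m"
  then obtain ez sg where e: "ez : Obj ?J" "darr sg" "src sg = m" "tgt sg = src ez" "tq = ez ## sg" using bdry_matching by blast
  have "u m tq = SAct (Map d F) sg (pre g F (src ez) (Bn_map n (src ez) ez))"
  unfolding e(5) u[OF e(1,2,4)] using pb[OF e(1)] * e(1) by simp
  also have "... = pre g F m (Bn_map n m tq)"
  using pre_act[of g "Bn n" F sg m "Bn_map n (src ez) ez"] Bn_map_act[OF matching_bdry[OF e(1)], of sg] Bn_map_in[OF matching_bdry[OF e(1)]] e ga by simp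
  finally show "u m tq = pre g F m (Bn_map n m tq)" .
  qed
  qed
  have "(g : Hom M d (Bn n) & (ALL m. ALL tq:Simp (bdry n) m. u m tq = pre g F m (Bn_map n m tq))) \<longleftrightarrow>
  (g : Hom M d (Bn n) & (ALL dt:Obj ?J. bproj n dt $$ g = kp dt))" for g using eqv by blast
  from classify_bdry[OF d um, unfolded this]
  have "EX! h. h : Hom M d (Bn n) & (ALL dt:Obj ?J. bproj n dt $$ h = kp dt)" .
  thus "EX! h. h : Hom (op_cat M) (Bn n) d & (ALL j:Obj (op_cat ?J). Cmp (op_cat M) h (bproj n j) = kp j)" by simp
 qed
qed

definition const_simplicial :: "'o => ('o, 'a) simplicial" where
 "const_simplicial t = \<lparr>Fo = (%_. t), Fa = restrict (%_. Idt M t) (Arr Delta)\<rparr>"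

text \<open>Over the terminal object the relative matching map is the boundary map \<open>bd n\<close>.\<close>

lemma PS_reedy_fibrant: "fibrant sC (reedy_fibrations M T) PS"
proof -
 obtain t where t: "terminal M t" using F by (auto simp: fibrant_def)
 hence tO: "t : Obj M" and tm: "!!X. X : Obj M ==> EX! f. f : Hom M X t" by (auto simp: terminal_def)
 define to where "to X = (THE f. f : Hom M X t)" for X
 have to: "to X : Hom M X t" if "X : Obj M" for X unfolding to_def using theI'[OF tm[OF that]] .
 have tu: "f = g" if "f : Hom M X t" "g : Hom M X t" for f g X
  using tm[of X] that by (auto simp: hom_iff)
 let ?t = "const_simplicial t"
 have ts: "Fo ?t n = t" "darr al ==> Fa ?t al = Idt M t" for n al by (simp_all add: const_simplicial_def darr_def)
 have tob: "?t : Obj sC" unfolding sobj_iff using tO ts by (simp add: hom_iff) (simp add: const_simplicial_def)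
 have arrt: "(X, %n. to (Fo X n), ?t) : Arr sC" if X: "X : Obj sC" for X
 proof -
  note O = sobjD(1)[OF X] and a = sobjD(2)[OF X]
  show ?thesis unfolding sarr_iff
  proof (intro conjI allI impI X tob)
  show "to (Fo X n) : Hom M (Fo X n) (Fo ?t n)" for n using to[OF O] by (simp add: ts)
  fix al assume d: "darr al"
  show "to (Fo X (src al)) $$ Fa X al = Fa ?t al $$ to (Fo X (tgt al))"
  by (rule tu[of _ "Fo X (tgt al)"]) (use a[OF d] to[OF O] tO d in \<open>auto simp: hom_iff ts\<close>)
  qed
 qed
 have "terminal sC ?t" unfolding terminal_def
 proof (intro conjI ballI tob)
  fix X assume X: "X : Obj sC"
  show "EX! f. f : Hom sC X ?t"
  proof (rule ex1I)
  show "(X, %n. to (Fo X n), ?t) : Hom sC X ?t" using arrt[OF X] by (simp add: Hom_def)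
  fix f assume "f : Hom sC X ?t"
  then obtain tz where f: "f = (X, tz, ?t)" "(X, tz, ?t) : Arr sC" by (rule sarr_cases)
  have "tz = (%n. to (Fo X n))"
  proof
  fix n
  have "tz n : Hom M (Fo X n) t" "Fo X n : Obj M" using f(2) unfolding sarr_iff by (simp_all add: ts sobj_iff)
  thus "tz n = to (Fo X n)" using tu to by blast
  qed
  thus "f = (X, %n. to (Fo X n), ?t)" using f by simp
  qed
 qed
 moreover have "(PS, %n. to (Pn n), ?t) : reedy_fibrations M T"
 proof -
  have "relative_matching_map M (PS, %n. to (Pn n), ?t) n (bd n)" for n
  unfolding relative_matching_map_def prod.case corner_map_def
  proof (intro exI conjI ballI)
  let ?J = "matching_cat n"
  interpret O: category "op_cat M" by unfold_locales (rule op_category)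
  have cc: "is_cocone (op_cat ?J) (op_cat M) (matching_diagram ?t) d kp ==> d : Obj M & (ALL dt:Obj ?J. kp dt : Hom M d t)" for d kp
  unfolding is_cocone_def by (simp add: matching_diagram_def ts)
  show "is_colimit (op_cat ?J) (op_cat M) (matching_diagram ?t) t (%_. Idt M t)"
  unfolding is_colimit_def
  proof (intro conjI allI impI)
  show "is_cocone (op_cat ?J) (op_cat M) (matching_diagram ?t) t (%_. Idt M t)"
  unfolding is_cocone_def using tO
  by (auto simp: matching_diagram_def ts hom_iff matching_simps(2))
  fix d kp assume "is_cocone (op_cat ?J) (op_cat M) (matching_diagram ?t) d kp"
  note k = cc[OF this]
  show "EX! h. h : Hom (op_cat M) t d & (ALL j:Obj (op_cat ?J). Cmp (op_cat M) h (Idt M t) = kp j)"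
  proof (rule ex1I[of _ "to d"])
  have "to d = kp j" if "j : Obj ?J" for j using k that tu to by blast
  thus "to d : Hom (op_cat M) t d & (ALL j:Obj (op_cat ?J). Cmp (op_cat M) (to d) (Idt M t) = kp j)"
  using to[of d] k by (simp add: hom_iff)
  show "h = to d" if "h : Hom (op_cat M) t d & (ALL j:Obj (op_cat ?J). Cmp (op_cat M) h (Idt M t) = kp j)" for h
  using that to[of d] k tu[of h d "to d"] by simp
  qed
  qed
  show "is_colimit (op_cat ?J) (op_cat M) (matching_diagram PS) (Bn n) (bproj n)" by (rule Bn_matching)
  show "to (Bn n) : Hom (op_cat M) t (Bn n)" using to by simp
  show "Idt M t : Hom (op_cat M) t (Fo ?t n)" using tO by (simp add: ts hom_iff)
  show "bd n : Hom (op_cat M) (Bn n) (Fo PS n)" using bd[of n] by (simp add: hom_iff)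
  show "is_pushout (op_cat M) (Idt M t) (to (Bn n)) (to (Bn n)) (Idt M (Bn n))"
  using O.id_pushout[of "to (Bn n)" t "Bn n"] to by simp
  show "bd n : Hom (op_cat M) (Cod (op_cat M) (to (Bn n))) (Fo PS n)" using bd[of n] to[of "Bn n"] by (simp add: hom_iff)
  show "Cmp (op_cat M) (bd n) (Idt M (Bn n)) = bd n" using bd[of n] by simp
  show "Cmp (op_cat M) (bd n) (to (Bn n)) = to (Pn n)"
  using tu[of "to (Bn n) $$ bd n" "Pn n" "to (Pn n)"] comp_hom[of "bd n" "Pn n" "Bn n" "to (Bn n)" t] to bd[of n] by (simp add: hom_iff)
  fix dt assume "dt : Obj (op_cat ?J)"
  hence d: "dt : Obj ?J" by simp
  hence dd: "darr dt" "tgt dt = n" by (simp_all add: matching_simps)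
  note b = bproj[OF matching_bdry[OF d]]
  show "Cmp (op_cat M) (to (Bn n)) (Idt M t) = Cmp (op_cat M) (bproj n dt) (to (Pn (Dom Delta dt)))"
  using tu[of "to (Bn n)" "Bn n" "to (Pn (src dt)) $$ bproj n dt"] comp_hom[OF b(1), of "to (Pn (src dt))" t] to[of "Bn n"] to[of "Pn (src dt)"]
  by (simp add: hom_iff)
  show "Cmp (op_cat M) (Idt M t) (Idt M t) = Fa ?t dt" using dd tO by (simp add: ts)
  show "Cmp (op_cat M) (bd n) (bproj n dt) = Fa PS dt"
  unfolding op_cat_simps PS_simps(2)[OF dd(1)]
  proof (rule classify_unique[of _ "Pn n" "src dt"])
  show "pre (bproj n dt $$ bd n) F (src dt) (us (src dt)) = pre (Pn_act dt) F (src dt) (us (src dt))"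
  using pre_comp[of "bd n" "bproj n dt" F "us (src dt)" "src dt"] b bd_act[OF matching_bdry[OF d]] bd[of n] Pn_act[OF dd(1)] dd by (simp add: hom_iff)
  qed (use b bd[of n] Pn_act[OF dd(1)] dd in \<open>auto simp: hom_iff\<close>)
  qed
  thus ?thesis using arrt[OF PS_obj] bd_fibration unfolding reedy_fibrations_def by auto
 qed
 moreover have "(PS, %n. to (Pn n), ?t) : Hom sC PS ?t" using arrt[OF PS_obj] by (simp add: Hom_def)
 ultimately show ?thesis using PS_obj unfolding fibrant_def by blast
qed

lemma PS_homotopically_constant: "homotopically_constant T PS"
 unfolding homotopically_constant_def using Pn_act_weq by (simp add: darr_def[symmetric])

end

section \<open>Copowers of a cofibrant object by simplicial sets\<close>

definition degs :: "'k sset => nat => 'k set" where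
 "degs K n = {x : Simp K n. degenerate K n x}"

definition sub_sset :: "'k sset => 'k sset => bool" where
 "sub_sset K K' \<longleftrightarrow> is_sset K & is_sset K' & (ALL n. Simp K n \<subseteq> Simp K' n) &
  (ALL al x. darr al --> x : Simp K (tgt al) --> SAct K al x = SAct K' al x)"

lemma sub_ssetD:
 assumes "sub_sset K K'"
 shows "is_sset K" "is_sset K'" "Simp K n \<subseteq> Simp K' n" "darr al ==> x : Simp K (tgt al) ==> SAct K al x = SAct K' al x"
 using assms by (simp_all add: sub_sset_def)

lemma degs_subset: "degs K n \<subseteq> Simp K n" by (auto simp: degs_def)

lemma latching_degs: "is_sset K ==> sg : Obj (latching_cat n) ==> y : Simp K (tgt sg) ==> SAct K sg y : degs K n"
 by (auto simp: latching_cat_simps degs_def degenerate_def)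

lemma degs_latching: "x : degs K n ==> EX sg:Obj (latching_cat n). EX y:Simp K (tgt sg). x = SAct K sg y"
 unfolding degs_def degenerate_def latching_cat_simps by blast

lemma sub_sset_degs:
 assumes s: "sub_sset K K'" shows "Simp K n Int degs K' n = degs K n"
proof (intro equalityI subsetI)
 note K = sub_ssetD(1,2)[OF s] and act = sub_ssetD(4)[OF s]
 fix x assume x: "x : Simp K n Int degs K' n"
 hence "x : degs K' n" by simp
 from degs_latching[OF this] obtain sg y where y: "sg : Obj (latching_cat n)" "y : Simp K' (tgt sg)" "x = SAct K' sg y" by blast
 hence sg: "darr sg" "src sg = n" "om_surj sg" by (simp_all add: latching_cat_simps)
 obtain dt where d: "darr dt" "src dt = tgt sg" "tgt dt = src sg" "sg ## dt = did (tgt sg)" using om_surj_section[OF sg(1,3) le0] by blast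
 have "y = SAct K' dt x" using y d sg K by simp
 hence y': "y = SAct K dt x" using act[OF d(1), of x] x d sg by simp
 have "y : Simp K (tgt sg)" unfolding y' using x d sg K by simp
 thus "x : degs K n" using latching_degs[OF K(1) y(1)] act[OF sg(1)] y(3) by simp
next
 fix x assume x: "x : degs K n"
 from degs_latching[OF this] obtain sg y where y: "sg : Obj (latching_cat n)" "y : Simp K (tgt sg)" "x = SAct K sg y" by blast
 moreover have "darr sg" using y(1) by (simp add: latching_cat_simps)
 ultimately have "x = SAct K' sg y" "y : Simp K' (tgt sg)" using sub_ssetD(3,4)[OF s] by auto
 hence "x : degs K' n" using latching_degs[OF sub_ssetD(2)[OF s] y(1)] by simp
 thus "x : Simp K n Int degs K' n" using x by (simp add: degs_def)
qed

text \<open>A family of maps \<open>P \<rightarrow> H\<^sub>n\<close>, natural in the simplices of \<open>K\<close>, is a simplicial map from \<open>K\<close> to the simplicial set \<open>Hom(P, H)\<close>.\<close>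

definition (in category) family :: "'o => 'k sset => ('o, 'a) simplicial => (nat => 'k => 'a) => bool" where
 "family P K H ph \<longleftrightarrow> (ALL n. ALL x:Simp K n. ph n x : Hom C P (Fo H n)) &
  (ALL al. darr al --> (ALL x:Simp K (tgt al). ph (src al) (SAct K al x) = Fa H al $$ ph (tgt al) x))"

locale copowers = smc M T E
 for M :: "('o, 'a) category" and T :: "'a model_structure" and E :: "('o, 'a, 'u) simplicial_enrichment" +
 fixes P :: 'o
 assumes P: "cofibrant_obj P"
begin

lemma P_obj [simp]: "P : Obj M" using P by (rule cofibrant_obj)

definition cop :: "'k set => 'o" where "cop I = (SOME c. EX io. is_coproduct M I (%_. P) c io)"
definition cin :: "'k set => 'k => 'a" where "cin I = (SOME io. is_coproduct M I (%_. P) (cop I) io)"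
definition cdesc :: "'k set => 'o => ('k => 'a) => 'a" where
 "cdesc I d g = (SOME h. h : Hom M (cop I) d & (ALL i:I. h $$ cin I i = g i))"
definition cinc :: "'k set => 'k set => 'a" where "cinc I J = cdesc I (cop J) (cin J)"

lemma cop_coproduct: assumes "small TYPE('u) I" shows "is_coproduct M I (%_. P) (cop I) (cin I)"
proof -
 have "EX c io. is_coproduct M I (%_. P) c io"
  by (rule coproduct_exists[OF _ assms]) (use model in \<open>simp_all add: model_category_def\<close>)
 from someI_ex[OF someI_ex[OF this, folded cop_def], folded cin_def] show ?thesis .
qed

lemma cop_obj [simp]: "small TYPE('u) I ==> cop I : Obj M" using coproductD(1)[OF cop_coproduct] .
lemma cin_hom: "small TYPE('u) I ==> i : I ==> cin I i : Hom M P (cop I)" using coproductD(2)[OF cop_coproduct] .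

lemma cin_simps [simp]: 
 assumes "small TYPE('u) I" "i : I" shows "arr (cin I i)" "dom (cin I i) = P" "cod (cin I i) = cop I"
 using cin_hom[OF assms] by (simp_all add: hom_iff)

lemma cdesc:
 assumes "small TYPE('u) I" "d : Obj M" "ALL i:I. g i : Hom M P d"
 shows "cdesc I d g : Hom M (cop I) d" "!!i. i : I ==> cdesc I d g $$ cin I i = g i"
proof -
 have "EX h:Hom M (cop I) d. ALL i:I. h $$ cin I i = g i"
  by (rule coproductD(3)[OF cop_coproduct[OF assms(1)] assms(2)]) (use assms(3) in blast)
 hence "EX h. h : Hom M (cop I) d & (ALL i:I. h $$ cin I i = g i)" by blast
 from someI_ex[OF this, folded cdesc_def]
 show "cdesc I d g : Hom M (cop I) d" "!!i. i : I ==> cdesc I d g $$ cin I i = g i" by blast+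
qed

lemma cop_ext: "small TYPE('u) I ==> h : Hom M (cop I) d ==> h' : Hom M (cop I) d ==> (!!i. i : I ==> h $$ cin I i = h' $$ cin I i) ==> h = h'"
 using coproduct_ext[OF cop_coproduct] .

lemma cdesc_eqI:
 assumes "small TYPE('u) I" "h : Hom M (cop I) d" "!!i. i : I ==> h $$ cin I i = g i" shows "cdesc I d g = h"
proof (rule cop_ext[OF assms(1) _ assms(2)])
 have "ALL i:I. g i : Hom M P d" using comp_hom[OF cin_hom[OF assms(1)] assms(2)] assms(3) by auto
 note c = cdesc[OF assms(1) _ this]
 have d: "d : Obj M" using assms(2) by (auto simp: hom_iff)
 show "cdesc I d g : Hom M (cop I) d" by (rule c(1)[OF d])
 show "cdesc I d g $$ cin I i = h $$ cin I i" if "i : I" for i using c(2)[OF d that] assms(3)[OF that] by simp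
qed

lemma comp_cdesc:
 assumes "small TYPE('u) I" "k : Hom M d e" "ALL i:I. g i : Hom M P d"
 shows "k $$ cdesc I d g = cdesc I e (%i. k $$ g i)"
proof (rule cdesc_eqI[symmetric, OF assms(1)])
 have k: "arr k" "dom k = d" "cod k = e" "d : Obj M" using assms(2) by (auto simp: hom_iff)
 note c = cdesc[OF assms(1) k(4) assms(3)]
 show "k $$ cdesc I d g : Hom M (cop I) e" using comp_hom[OF c(1) assms(2)] by simp
 show "(k $$ cdesc I d g) $$ cin I i = k $$ g i" if "i : I" for i
  using c(1) c(2)[OF that] comp_assoc[of "cin I i" "cdesc I d g" k] k assms(1) that by (simp add: hom_iff)
qed

lemma cdesc_cong: "(!!i. i : I ==> g i = g' i) ==> cdesc I d g = cdesc I d g'"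
 unfolding cdesc_def by simp

lemma small_sub: "I \<subseteq> J ==> small TYPE('u) J ==> small TYPE('u) I" by (rule small_subset)

lemma 
 assumes s: "I \<subseteq> J" "small TYPE('u) J"
 shows cinc_hom: "cinc I J : Hom M (cop I) (cop J)" and cinc_cin: "i : I ==> cinc I J $$ cin I i = cin J i"
proof -
 have "ALL i:I. cin J i : Hom M P (cop J)" using cin_hom[OF s(2)] s(1) by blast
 note c = cdesc[OF small_sub[OF s] cop_obj[OF s(2)] this, folded cinc_def]
 show "cinc I J : Hom M (cop I) (cop J)" by (rule c(1))
 show "i : I ==> cinc I J $$ cin I i = cin J i" by (rule c(2))
qed

lemma cinc_cdesc: 
 assumes "J \<subseteq> L" "small TYPE('u) I" "small TYPE('u) L" "!!i. i : I ==> f i : J"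
 shows "cinc J L $$ cdesc I (cop J) (%i. cin J (f i)) = cdesc I (cop L) (%i. cin L (f i))"
proof -
 have "cinc J L $$ cdesc I (cop J) (%i. cin J (f i)) = cdesc I (cop L) (%i. cinc J L $$ cin J (f i))"
  using cinc_hom[OF assms(1,3)] cin_hom[OF small_sub[OF assms(1,3)]] assms by (intro comp_cdesc) auto
 also have "... = cdesc I (cop L) (%i. cin L (f i))" using cinc_cin[OF assms(1,3)] assms(4) by (intro cdesc_cong) auto
 finally show ?thesis .
qed

lemma cinc_cinc: "I \<subseteq> J ==> J \<subseteq> L ==> small TYPE('u) L ==> cinc J L $$ cinc I J = cinc I L"
 unfolding cinc_def[of I] by (rule cinc_cdesc) (auto intro: small_sub)

lemma cdesc_cinc:
 assumes "I \<subseteq> J" "small TYPE('u) J" "d : Obj M" "ALL j:J. g j : Hom M P d"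
 shows "cdesc J d g $$ cinc I J = cdesc I d g"
proof -
 have "cdesc J d g $$ cinc I J = cdesc I d (%i. cdesc J d g $$ cin J i)" unfolding cinc_def
  using cdesc(1)[OF assms(2-4)] cin_hom[OF assms(2)] assms(1) small_sub[OF assms(1,2)] by (intro comp_cdesc) blast+
 also have "... = cdesc I d g" using cdesc(2)[OF assms(2-4)] assms(1) by (intro cdesc_cong) auto
 finally show ?thesis .
qed

lemma cdesc_cin: assumes "small TYPE('u) I" "f : Hom M (cop I) d" shows "cdesc I d (%i. f $$ cin I i) = f"
 using assms by (intro cdesc_eqI) auto

lemma cinc_pushout:
 assumes AB: "small TYPE('u) (A Un B)"
 shows "is_pushout M (cinc (A Int B) A) (cinc (A Int B) B) (cinc A (A Un B)) (cinc B (A Un B))"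
proof -
 have s: "small TYPE('u) A" "small TYPE('u) B" "small TYPE('u) (A Int B)" using small_sub[OF _ AB] by blast+
 have h: "cinc (A Int B) A : Hom M (cop (A Int B)) (cop A)" "cinc (A Int B) B : Hom M (cop (A Int B)) (cop B)"
  "cinc A (A Un B) : Hom M (cop A) (cop (A Un B))" "cinc B (A Un B) : Hom M (cop B) (cop (A Un B))"
  using s AB by (auto intro!: cinc_hom)
 have ha: "arr (cinc (A Int B) A)" "dom (cinc (A Int B) A) = cop (A Int B)" "cod (cinc (A Int B) A) = cop A"
  "arr (cinc (A Int B) B)" "dom (cinc (A Int B) B) = cop (A Int B)" "cod (cinc (A Int B) B) = cop B"
  "cod (cinc A (A Un B)) = cop (A Un B)" using h by (simp_all add: hom_iff)
 show ?thesis unfolding is_pushout_def ha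
 proof (intro conjI allI impI ha h refl)
  show "cinc A (A Un B) $$ cinc (A Int B) A = cinc B (A Un B) $$ cinc (A Int B) B"
  using cinc_cinc[of "A Int B" A "A Un B"] cinc_cinc[of "A Int B" B "A Un B"] AB by simp
  fix Z u v assume *: "u : Hom M (cop A) Z & v : Hom M (cop B) Z & u $$ cinc (A Int B) A = v $$ cinc (A Int B) B"
  hence u: "u : Hom M (cop A) Z" and v: "v : Hom M (cop B) Z" and uv: "u $$ cinc (A Int B) A = v $$ cinc (A Int B) B" by blast+
  have Z: "Z : Obj M" using u by (auto simp: hom_iff)
  define g where "g x = (if x : A then u $$ cin A x else v $$ cin B x)" for x
  have gA: "g x = u $$ cin A x" if "x : A" for x using that by (simp add: g_def)
  have gB: "g x = v $$ cin B x" if x: "x : B" for x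
  proof (cases "x : A")
  case True
  hence x: "x : A Int B" using x by simp
  have "u $$ cin A x = (u $$ cinc (A Int B) A) $$ cin (A Int B) x"
  using comp_assoc[of "cin (A Int B) x" "cinc (A Int B) A" u] ha u x s cinc_cin[of "A Int B" A x] by (simp add: hom_iff)
  also have "... = v $$ cin B x" unfolding uv
  using comp_assoc[of "cin (A Int B) x" "cinc (A Int B) B" v] ha v x s cinc_cin[of "A Int B" B x] by (simp add: hom_iff)
  finally show ?thesis using True by (simp add: g_def)
  qed (simp add: g_def)
  have g: "ALL x:A Un B. g x : Hom M P Z"
  using gA gB comp_hom[OF cin_hom[OF s(1)] u] comp_hom[OF cin_hom[OF s(2)] v] by auto
  note c = cdesc[OF AB Z g]
  have cA: "cdesc (A Un B) Z g $$ cinc A (A Un B) = u"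
  using cdesc_cinc[OF _ AB Z g, of A] cdesc_cong[of A g "%x. u $$ cin A x" Z] gA cdesc_cin[OF s(1) u] by simp
  have cB: "cdesc (A Un B) Z g $$ cinc B (A Un B) = v"
  using cdesc_cinc[OF _ AB Z g, of B] cdesc_cong[of B g "%x. v $$ cin B x" Z] gB cdesc_cin[OF s(2) v] by simp
  show "EX! h. h : Hom M (cop (A Un B)) Z & h $$ cinc A (A Un B) = u & h $$ cinc B (A Un B) = v"
  proof (rule ex1I)
  show "cdesc (A Un B) Z g : Hom M (cop (A Un B)) Z & cdesc (A Un B) Z g $$ cinc A (A Un B) = u & cdesc (A Un B) Z g $$ cinc B (A Un B) = v"
  using c(1) cA cB by blast
  fix k assume k: "k : Hom M (cop (A Un B)) Z & k $$ cinc A (A Un B) = u & k $$ cinc B (A Un B) = v"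
  have "k $$ cin (A Un B) x = g x" if "x : A Un B" for x
  proof (cases "x : A")
  case True
  thus ?thesis using comp_assoc[of "cin A x" "cinc A (A Un B)" k] k h s cinc_cin[OF _ AB, of A x] gA by (simp add: hom_iff)
  next
  case False
  hence "x : B" using that by simp
  thus ?thesis using comp_assoc[of "cin B x" "cinc B (A Un B)" k] k h s cinc_cin[OF _ AB, of B x] gB by (simp add: hom_iff)
  qed
  thus "k = cdesc (A Un B) Z g" using cdesc_eqI[OF AB, of k Z g] k by simp
  qed
 qed
qed

lemma cinc_Cof: assumes IJ: "I \<subseteq> J" "small TYPE('u) J" shows "cinc I J : Cof T"
proof (rule Cof_if_lifts)
 note h = cinc_hom[OF IJ]
 have ha: "arr (cinc I J)" "dom (cinc I J) = cop I" "cod (cinc I J) = cop J" using h by (simp_all add: hom_iff)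
 show "arr (cinc I J)" by (rule ha)
 fix p assume p: "p : Fib T" "p : W"
 have pa: "arr p" using p Fib_arr by blast
 show "lifts M (cinc I J) p" unfolding lifts_def ha
 proof (intro allI impI)
  fix u v assume *: "u : Hom M (cop I) (dom p) & v : Hom M (cop J) (cod p) & p $$ u = v $$ cinc I J"
  hence ua: "arr u" "dom u = cop I" "cod u = dom p" and va: "arr v" "dom v = cop J" "cod v = cod p"
  and e: "p $$ u = v $$ cinc I J" by (auto simp: hom_iff)
  have sI: "small TYPE('u) I" using small_sub[OF IJ] .
  have "EX w:Hom M P (dom p). p $$ w = v $$ cin J j" if "j : J" for j
  by (rule cofibrant_lift[OF P p]) (use that va IJ in \<open>simp add: hom_iff\<close>)
  then obtain w where w: "!!j. j : J ==> w j : Hom M P (dom p)" "!!j. j : J ==> p $$ w j = v $$ cin J j" by metis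
  define g where "g j = (if j : I then u $$ cin I j else w j)" for j
  have g: "ALL j:J. g j : Hom M P (dom p)"
  using w(1) comp_hom[OF cin_hom[OF sI], of _ u "dom p"] ua by (simp add: g_def hom_iff)
  have pg: "p $$ g j = v $$ cin J j" if "j : J" for j
  proof (cases "j : I")
  case True
  have "p $$ (u $$ cin I j) = (p $$ u) $$ cin I j" using True ua pa sI by (simp add: comp_assoc)
  also have "... = v $$ cin J j" unfolding e using True va ha sI cinc_cin[OF IJ True] by (simp add: comp_assoc)
  finally show ?thesis using True by (simp add: g_def)
  qed (simp add: g_def w(2)[OF that])
  have dp: "dom p : Obj M" using pa by simp
  note c = cdesc[OF IJ(2) dp g]
  have "cdesc J (dom p) g $$ cinc I J = u"
  proof -
  have "cdesc I (dom p) g = cdesc I (dom p) (%x. u $$ cin I x)" by (rule cdesc_cong) (simp add: g_def)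
  also have "... = u" using cdesc_cin[OF sI, of u "dom p"] ua by (simp add: hom_iff)
  finally show ?thesis using cdesc_cinc[OF IJ dp g] by simp
  qed
  moreover have "p $$ cdesc J (dom p) g = v"
  using comp_cdesc[OF IJ(2) _ g, of p "cod p"] cdesc_cong[of J "%i. p $$ g i" "%i. v $$ cin J i" "cod p"] pg cdesc_cin[OF IJ(2), of v "cod p"] pa va
  by (simp add: hom_iff)
  ultimately show "EX h:Hom M (cop J) (dom p). h $$ cinc I J = u & p $$ h = v" using c(1) by blast
 qed
qed

definition copower :: "'k sset => ('o, 'a) simplicial" where
 "copower K = \<lparr>Fo = (%n. cop (Simp K n)),
  Fa = restrict (%al. cdesc (Simp K (tgt al)) (cop (Simp K (src al))) (%x. cin (Simp K (src al)) (SAct K al x))) (Arr Delta)\<rparr>"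

lemma copower_simps [simp]: "Fo (copower K) n = cop (Simp K n)"
 "darr al ==> Fa (copower K) al = cdesc (Simp K (tgt al)) (cop (Simp K (src al))) (%x. cin (Simp K (src al)) (SAct K al x))"
 by (simp_all add: copower_def darr_def)

definition latch :: "'k sset => nat => ord_map => 'a" where
 "latch K n sg = cdesc (Simp K (tgt sg)) (cop (degs K n)) (%y. cin (degs K n) (SAct K sg y))"

context
 fixes K :: "'k sset" assumes K: "small_sset TYPE('u) K"
begin

lemma Ks: "is_sset K" "small TYPE('u) (Simp K n)" using K by (simp_all add: small_sset_def)

lemma act_cin: "darr al ==> ALL x:Simp K (tgt al). cin (Simp K (src al)) (SAct K al x) : Hom M P (cop (Simp K (src al)))"
 using cin_hom[OF Ks(2)] Ks(1) by simp

lemma copower_act: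
 assumes "darr al"
 shows "Fa (copower K) al : Hom M (cop (Simp K (tgt al))) (cop (Simp K (src al)))"
  "x : Simp K (tgt al) ==> Fa (copower K) al $$ cin (Simp K (tgt al)) x = cin (Simp K (src al)) (SAct K al x)"
 unfolding copower_simps(2)[OF assms]
 by (rule cdesc[OF Ks(2) cop_obj[OF Ks(2)] act_cin[OF assms]], assumption?)+

lemma copower_obj: "copower K : Obj sC"
 unfolding sobj_iff
proof (intro conjI allI impI)
 fix al bt assume a: "darr al" "darr bt" "src bt = tgt al"
 have ba: "darr (bt ## al)" "src (bt ## al) = src al" "tgt (bt ## al) = tgt bt" using a by simp_all
 have "Fa (copower K) al $$ Fa (copower K) bt = cdesc (Simp K (tgt bt)) (cop (Simp K (src al))) (%x. Fa (copower K) al $$ cin (Simp K (src bt)) (SAct K bt x))"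
  unfolding copower_simps(2)[OF a(2)] using copower_act(1)[OF a(1)] act_cin[OF a(2)] a(3) by (intro comp_cdesc Ks) simp_all
 also have "... = Fa (copower K) (bt ## al)" unfolding copower_simps(2)[OF ba(1)] ba(2,3)
 proof (rule cdesc_cong)
  fix x assume "x : Simp K (tgt bt)"
  thus "Fa (copower K) al $$ cin (Simp K (src bt)) (SAct K bt x) = cin (Simp K (src al)) (SAct K (bt ## al) x)"
  using copower_act(2)[OF a(1), of "SAct K bt x"] a Ks(1) by (simp del: copower_simps)
 qed
 finally show "Fa (copower K) (bt ## al) = Fa (copower K) al $$ Fa (copower K) bt" ..
next
 fix n
 have "cdesc (Simp K n) (cop (Simp K n)) (%x. cin (Simp K n) (SAct K (did n) x)) = Idt M (cop (Simp K n))"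
  using Ks by (intro cdesc_eqI) (auto simp: hom_iff)
 thus "Fa (copower K) (did n) = Idt M (Fo (copower K) n)" by simp
qed (use copower_act(1) Ks in simp_all, simp add: copower_def)

lemma family_arr:
 assumes H: "H : Obj sC" and f: "family P K H ph"
 shows "(copower K, %n. cdesc (Simp K n) (Fo H n) (ph n), H) : Arr sC"
 unfolding sarr_iff
proof (intro conjI allI impI copower_obj H)
 have fh: "ALL x:Simp K n. ph n x : Hom M P (Fo H n)" for n using f unfolding family_def by blast
 note c = cdesc[OF Ks(2) sobjD(1)[OF H] fh]
 show "cdesc (Simp K n) (Fo H n) (ph n) : Hom M (Fo (copower K) n) (Fo H n)" for n using c(1) by simp
 fix al assume a: "darr al"
 have "cdesc (Simp K (src al)) (Fo H (src al)) (ph (src al)) $$ Fa (copower K) al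
  = cdesc (Simp K (tgt al)) (Fo H (src al)) (%x. cdesc (Simp K (src al)) (Fo H (src al)) (ph (src al)) $$ cin (Simp K (src al)) (SAct K al x))"
  unfolding copower_simps(2)[OF a] using c(1) act_cin[OF a] by (intro comp_cdesc Ks)
 also have "... = cdesc (Simp K (tgt al)) (Fo H (src al)) (%x. Fa H al $$ ph (tgt al) x)"
 proof (rule cdesc_cong)
  fix x assume x: "x : Simp K (tgt al)"
  hence "SAct K al x : Simp K (src al)" using Ks(1) a by simp
  from c(2)[OF this] show "cdesc (Simp K (src al)) (Fo H (src al)) (ph (src al)) $$ cin (Simp K (src al)) (SAct K al x) = Fa H al $$ ph (tgt al) x"
  using f x a unfolding family_def by simp
 qed
 also have "... = Fa H al $$ cdesc (Simp K (tgt al)) (Fo H (tgt al)) (ph (tgt al))"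
  using comp_cdesc[OF Ks(2) sobjD(2)[OF H a] fh] by simp
 finally show "cdesc (Simp K (src al)) (Fo H (src al)) (ph (src al)) $$ Fa (copower K) al = Fa H al $$ cdesc (Simp K (tgt al)) (Fo H (tgt al)) (ph (tgt al))" .
qed

lemma arr_family:
 assumes f: "(copower K, tz, H) : Arr sC"
 shows "family P K H (%n x. tz n $$ cin (Simp K n) x)"
 unfolding family_def
proof (intro conjI allI ballI impI)
 have t: "tz n : Hom M (cop (Simp K n)) (Fo H n)" for n using f by (simp add: sarr_iff)
 have H: "H : Obj sC" using f by (simp add: sarr_iff)
 show "tz n $$ cin (Simp K n) x : Hom M P (Fo H n)" if "x : Simp K n" for n x using comp_hom[OF cin_hom[OF Ks(2) that] t] .
 fix al x assume a: "darr al" and x: "x : Simp K (tgt al)"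
 have n: "tz (src al) $$ Fa (copower K) al = Fa H al $$ tz (tgt al)" using f a unfolding sarr_iff by blast
 note ca = copower_act(1)[OF a] and cn = cin_hom[OF Ks(2) x]
 have "tz (src al) $$ cin (Simp K (src al)) (SAct K al x) = (tz (src al) $$ Fa (copower K) al) $$ cin (Simp K (tgt al)) x"
  using comp_assoc[of "cin (Simp K (tgt al)) x" "Fa (copower K) al" "tz (src al)"] t[of "src al"] ca cn copower_act(2)[OF a x] by (simp add: hom_iff del: copower_simps)
 also have "... = Fa H al $$ tz (tgt al) $$ cin (Simp K (tgt al)) x" unfolding n
  using comp_assoc[of "cin (Simp K (tgt al)) x" "tz (tgt al)" "Fa H al"] t[of "tgt al"] cn sobjD(2)[OF H a] by (simp add: hom_iff)
 finally show "tz (src al) $$ cin (Simp K (src al)) (SAct K al x) = Fa H al $$ tz (tgt al) $$ cin (Simp K (tgt al)) x" .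
qed

lemma degs_small: "small TYPE('u) (degs K n)" using small_sub[OF degs_subset Ks(2)] .

lemma latch:
 assumes "sg : Obj (latching_cat n)"
 shows "latch K n sg : Hom M (cop (Simp K (tgt sg))) (cop (degs K n))"
  "!!y. y : Simp K (tgt sg) ==> latch K n sg $$ cin (Simp K (tgt sg)) y = cin (degs K n) (SAct K sg y)"
proof -
 have "ALL y:Simp K (tgt sg). cin (degs K n) (SAct K sg y) : Hom M P (cop (degs K n))"
  using cin_hom[OF degs_small latching_degs[OF Ks(1) assms]] by blast
 note c = cdesc[OF Ks(2) cop_obj[OF degs_small] this, folded latch_def]
 show "latch K n sg : Hom M (cop (Simp K (tgt sg))) (cop (degs K n))" using c(1) .
 show "latch K n sg $$ cin (Simp K (tgt sg)) y = cin (degs K n) (SAct K sg y)" if "y : Simp K (tgt sg)" for y by (rule c(2)[OF that])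
qed

text \<open>The latching object of a copower is the copower by the degenerate simplices: a cocone is determined by its values at the
 nondegenerate roots, which are unique by the Eilenberg-Zilber lemma.\<close>

lemma copower_latching: "is_colimit (latching_cat n) M (latching_diagram (copower K)) (cop (degs K n)) (latch K n)"
proof -
 let ?J = "latching_cat n" and ?X = "copower K"
 have cone: "is_cocone ?J M (latching_diagram ?X) d kp \<longleftrightarrow> d : Obj M &
  (ALL sg:Obj ?J. kp sg : Hom M (cop (Simp K (tgt sg))) d) &
  (ALL tz ph. tz : Obj ?J --> darr ph --> src ph = tgt tz --> om_surj ph --> kp tz $$ Fa ?X ph = kp (ph ## tz))" for d kp
 proof -
  have "(ALL i j a. a : Hom ?J i j --> kp j $$ Fa (latching_diagram ?X) a = kp i) \<longleftrightarrow>
  (ALL tz ph. tz : Obj ?J --> darr ph --> src ph = tgt tz --> om_surj ph --> kp tz $$ Fa ?X ph = kp (ph ## tz))" (is "?l \<longleftrightarrow> ?r")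
  proof
  assume l: ?l
  show ?r
  proof (intro allI impI)
  fix tz ph assume d: "tz : Obj ?J" and p: "darr ph" "src ph = tgt tz" "om_surj ph"
  have dd: "darr tz" "src tz = n" "tgt tz < n" "om_surj tz" using d by (simp_all add: latching_cat_simps)
  hence "ph ## tz : Obj ?J" using om_surj_comp[of ph tz] om_surj_le[OF p(1,3)] p by (simp add: latching_cat_simps)
  hence "(ph ## tz, ph, tz) : Hom ?J (ph ## tz) tz" using d dd p by (simp add: latching_cat_simps)
  from l[rule_format, OF this] show "kp tz $$ Fa ?X ph = kp (ph ## tz)" by (simp add: latching_diagram_def)
  qed
  next
  assume r: ?r
  show ?l
  proof (intro allI impI)
  fix sg tz a assume "a : Hom ?J sg tz"
  then obtain ph where a: "a = (sg, ph, tz)" "tz : Obj ?J" "darr ph" "src ph = tgt tz" "om_surj ph" "ph ## tz = sg"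
  unfolding latching_cat_simps(2) by blast
  thus "kp tz $$ Fa (latching_diagram ?X) a = kp sg" using r by (auto simp: latching_diagram_def simp del: copower_simps)
  qed
  qed
  thus ?thesis unfolding is_cocone_def by (simp add: latching_diagram_def del: copower_simps(2))
 qed
 have c: "is_cocone ?J M (latching_diagram ?X) (cop (degs K n)) (latch K n)" unfolding cone
 proof (intro conjI ballI allI impI cop_obj degs_small latch(1))
  fix tz ph assume d: "tz : Obj ?J" and p: "darr ph" "src ph = tgt tz" "om_surj ph"
  have dd: "darr tz" "src tz = n" "tgt tz < n" "om_surj tz" using d by (simp_all add: latching_cat_simps)
  have "latch K n tz $$ Fa ?X ph = cdesc (Simp K (tgt ph)) (cop (degs K n)) (%x. latch K n tz $$ cin (Simp K (src ph)) (SAct K ph x))"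
  unfolding copower_simps(2)[OF p(1)] using latch(1)[OF d] act_cin[OF p(1)] p(2) by (intro comp_cdesc Ks) simp_all
  also have "... = latch K n (ph ## tz)"
  proof -
  have "latch K n tz $$ cin (Simp K (src ph)) (SAct K ph x) = cin (degs K n) (SAct K (ph ## tz) x)" if "x : Simp K (tgt ph)" for x
  using latch(2)[OF d, of "SAct K ph x"] p dd Ks(1) that by simp
  hence "cdesc (Simp K (tgt ph)) (cop (degs K n)) (%x. latch K n tz $$ cin (Simp K (src ph)) (SAct K ph x)) =
  cdesc (Simp K (tgt ph)) (cop (degs K n)) (%x. cin (degs K n) (SAct K (ph ## tz) x))" by (rule cdesc_cong)
  thus ?thesis using p dd by (simp add: latch_def)
  qed
  finally show "latch K n tz $$ Fa ?X ph = latch K n (ph ## tz)" .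
 qed
 show ?thesis unfolding is_colimit_def
 proof (intro conjI allI impI c)
  fix d kp assume "is_cocone ?J M (latching_diagram ?X) d kp"
  hence d: "d : Obj M" and k: "!!sg. sg : Obj ?J ==> kp sg : Hom M (cop (Simp K (tgt sg))) d"
  "!!tz ph. tz : Obj ?J ==> darr ph ==> src ph = tgt tz ==> om_surj ph ==> kp tz $$ Fa ?X ph = kp (ph ## tz)"
  unfolding cone by blast+
  let ?R = "%x z. darr (fst z) & om_surj (fst z) & src (fst z) = n & snd z : Simp K (tgt (fst z)) &
  \<not> degenerate K (tgt (fst z)) (snd z) & x = SAct K (fst z) (snd z)"
  define root where "root x = (SOME z. ?R x z)" for x
  define g where "g x = kp (fst (root x)) $$ cin (Simp K (tgt (fst (root x)))) (snd (root x))" for x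
  have g: "g (SAct K sg y) = kp sg $$ cin (Simp K (tgt sg)) y" if s: "sg : Obj ?J" and y: "y : Simp K (tgt sg)" for sg y
  proof -
  have dd: "darr sg" "src sg = n" "tgt sg < n" "om_surj sg" using s by (simp_all add: latching_cat_simps)
  obtain rh w where r: "darr rh" "om_surj rh" "src rh = tgt sg" "w : Simp K (tgt rh)" "\<not> degenerate K (tgt rh) w" "y = SAct K rh w"
  using nondegenerate_root[OF Ks(1) y] by blast
  have rs: "darr (rh ## sg)" "om_surj (rh ## sg)" "src (rh ## sg) = n" "tgt (rh ## sg) = tgt rh" "SAct K sg y = SAct K (rh ## sg) w"
  using om_surj_comp[OF r(1) dd(1) r(3,2) dd(4)] r dd Ks(1) by simp_all
  have "?R (SAct K sg y) (rh ## sg, w)" using rs r(4,5) by simp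
  hence z: "?R (SAct K sg y) (root (SAct K sg y))" unfolding root_def by (rule someI)
  have "fst (root (SAct K sg y)) = rh ## sg" "snd (root (SAct K sg y)) = w"
  using nondegenerate_unique[OF Ks(1), of "fst (root (SAct K sg y))" n "snd (root (SAct K sg y))" "rh ## sg" w] z rs r(4,5) by simp_all
  hence "g (SAct K sg y) = kp (rh ## sg) $$ cin (Simp K (tgt rh)) w" using rs(4) by (simp add: g_def)
  also have "... = (kp sg $$ Fa ?X rh) $$ cin (Simp K (tgt rh)) w" using k(2)[OF s r(1,3,2)] by simp
  also have "... = kp sg $$ (Fa ?X rh $$ cin (Simp K (tgt rh)) w)"
  using k(1)[OF s] copower_act(1)[OF r(1)] cin_hom[OF Ks(2) r(4)] r(3) by (intro comp_assoc) (simp_all add: hom_iff del: copower_simps)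
  also have "Fa ?X rh $$ cin (Simp K (tgt rh)) w = cin (Simp K (tgt sg)) y" using copower_act(2)[OF r(1,4)] r(3,6) by simp
  finally show ?thesis .
  qed
  have gh: "ALL x:degs K n. g x : Hom M P d"
  proof
  fix x assume x: "x : degs K n"
  obtain sg y where y: "sg : Obj ?J" "y : Simp K (tgt sg)" "x = SAct K sg y" using degs_latching[OF x] by blast
  thus "g x : Hom M P d" using g[OF y(1,2)] comp_hom[OF cin_hom[OF Ks(2) y(2)] k(1)[OF y(1)]] by simp
  qed
  note cd = cdesc[OF degs_small d gh]
  have cl: "(h $$ latch K n sg) $$ cin (Simp K (tgt sg)) y = h $$ cin (degs K n) (SAct K sg y)"
  if "h : Hom M (cop (degs K n)) d" "sg : Obj ?J" "y : Simp K (tgt sg)" for h sg y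
  using comp_assoc[of "cin (Simp K (tgt sg)) y" "latch K n sg" h] latch[OF that(2)] that cin_hom[OF Ks(2) that(3)] by (simp add: hom_iff)
  show "EX! h. h : Hom M (cop (degs K n)) d & (ALL sg:Obj ?J. h $$ latch K n sg = kp sg)"
  proof (rule ex1I[of _ "cdesc (degs K n) d g"], intro conjI ballI cd(1))
  fix sg assume s: "sg : Obj ?J"
  show "cdesc (degs K n) d g $$ latch K n sg = kp sg"
  proof (rule cop_ext[OF Ks(2) comp_hom[OF latch(1)[OF s] cd(1)] k(1)[OF s]])
  fix y assume y: "y : Simp K (tgt sg)"
  show "(cdesc (degs K n) d g $$ latch K n sg) $$ cin (Simp K (tgt sg)) y = kp sg $$ cin (Simp K (tgt sg)) y"
  using cl[OF cd(1) s y] cd(2)[OF latching_degs[OF Ks(1) s y]] g[OF s y] by simp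
  qed
  next
  fix h assume h: "h : Hom M (cop (degs K n)) d & (ALL sg:Obj ?J. h $$ latch K n sg = kp sg)"
  have "h $$ cin (degs K n) x = g x" if x: "x : degs K n" for x
  proof -
  obtain sg y where y: "sg : Obj ?J" "y : Simp K (tgt sg)" "x = SAct K sg y" using degs_latching[OF x] by blast
  thus ?thesis using cl[OF _ y(1,2), of h] h g[OF y(1,2)] by simp
  qed
  thus "h = cdesc (degs K n) d g" using cdesc_eqI[OF degs_small[of n], of h d g] h by simp
  qed
 qed
qed

end

text \<open>For a simplicial subset \<open>K \<subseteq> K'\<close> the relative latching map in dimension \<open>n\<close> is the inclusion of the summands given by
 \<open>K\<^sub>n\<close> and the degenerate simplices of \<open>K'\<close>.\<close>

lemma copower_reedy_cofibration:
 assumes K: "small_sset TYPE('u) K" and K': "small_sset TYPE('u) K'" and s: "sub_sset K K'"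
 shows "(copower K, %n. cinc (Simp K n) (Simp K' n), copower K') : reedy_cofibrations M T"
proof -
 note sub = sub_ssetD(3)[OF s] and act = sub_ssetD(4)[OF s]
 note S = Ks(2)[OF K] and S' = Ks(2)[OF K'] and KS = Ks(1)[OF K] and KS' = Ks(1)[OF K']
 note D = degs_small[OF K] and D' = degs_small[OF K']
 have dsub: "degs K n \<subseteq> degs K' n" for n using sub_sset_degs[OF s, of n] by blast
 have US: "Simp K n Un degs K' n \<subseteq> Simp K' n" for n using sub degs_subset by (rule Un_least)
 note U = small_sub[OF US S']
 have arrow: "(copower K, %n. cinc (Simp K n) (Simp K' n), copower K') : Arr sC"
 proof -
  have "family P K (copower K') (%n. cin (Simp K' n))"
  unfolding family_def
  proof (intro conjI allI impI ballI)
  show "cin (Simp K' n) x : Hom M P (Fo (copower K') n)" if "x : Simp K n" for n x using cin_hom[OF S'] sub that by auto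
  show "cin (Simp K' (src al)) (SAct K al x) = Fa (copower K') al $$ cin (Simp K' (tgt al)) x" if "darr al" "x : Simp K (tgt al)" for al x
  using copower_act(2)[OF K' that(1) subsetD[OF sub that(2)]] act[OF that] by (simp del: copower_simps)
  qed
  from family_arr[OF K copower_obj[OF K'] this] show ?thesis by (simp add: cinc_def)
 qed
 have "relative_latching_map M (copower K, %n. cinc (Simp K n) (Simp K' n), copower K') n (cinc (Simp K n Un degs K' n) (Simp K' n))" for n
  unfolding relative_latching_map_def prod.case corner_map_def Dom_Delta
 proof (intro exI conjI ballI)
  let ?l = "cinc (Simp K n Un degs K' n) (Simp K' n)"
  show "is_colimit (latching_cat n) M (latching_diagram (copower K)) (cop (degs K n)) (latch K n)" by (rule copower_latching[OF K])
  show "is_colimit (latching_cat n) M (latching_diagram (copower K')) (cop (degs K' n)) (latch K' n)" by (rule copower_latching[OF K'])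
  show "cinc (degs K n) (degs K' n) : Hom M (cop (degs K n)) (cop (degs K' n))" by (rule cinc_hom[OF dsub D'])
  show "cinc (degs K n) (Simp K n) : Hom M (cop (degs K n)) (Fo (copower K) n)" using cinc_hom[OF degs_subset S] by simp
  show "cinc (degs K' n) (Simp K' n) : Hom M (cop (degs K' n)) (Fo (copower K') n)" using cinc_hom[OF degs_subset S'] by simp
  show "is_pushout M (cinc (degs K n) (Simp K n)) (cinc (degs K n) (degs K' n)) (cinc (Simp K n) (Simp K n Un degs K' n)) (cinc (degs K' n) (Simp K n Un degs K' n))"
  using cinc_pushout[OF U[of n]] unfolding sub_sset_degs[OF s] .
  show "?l : Hom M (cod (cinc (Simp K n) (Simp K n Un degs K' n))) (Fo (copower K') n)"
  using cinc_hom[OF US S'] cinc_hom[of "Simp K n" "Simp K n Un degs K' n"] U[of n] by (simp add: hom_iff)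
  show "?l $$ cinc (Simp K n) (Simp K n Un degs K' n) = cinc (Simp K n) (Simp K' n)" by (rule cinc_cinc[OF _ US S']) simp
  show "?l $$ cinc (degs K' n) (Simp K n Un degs K' n) = cinc (degs K' n) (Simp K' n)" by (rule cinc_cinc[OF _ US S']) simp
  fix sg assume o: "sg : Obj (latching_cat n)"
  hence sg: "darr sg" "src sg = n" by (simp_all add: latching_cat_simps)
  note ld = latching_degs[OF KS o] latching_degs[OF KS' o]
  show "cinc (degs K n) (degs K' n) $$ latch K n sg = latch K' n sg $$ cinc (Simp K (tgt sg)) (Simp K' (tgt sg))"
  proof -
  have "cinc (degs K n) (degs K' n) $$ latch K n sg = cdesc (Simp K (tgt sg)) (cop (degs K' n)) (%y. cin (degs K' n) (SAct K sg y))"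
  unfolding latch_def by (rule cinc_cdesc[OF dsub S D']) (rule ld)
  also have "... = cdesc (Simp K (tgt sg)) (cop (degs K' n)) (%y. cin (degs K' n) (SAct K' sg y))" using act[OF sg(1)] by (intro cdesc_cong) simp
  also have "... = latch K' n sg $$ cinc (Simp K (tgt sg)) (Simp K' (tgt sg))"
  unfolding latch_def by (rule cdesc_cinc[symmetric, OF sub S' cop_obj[OF D']]) (use cin_hom[OF D'] ld in blast)
  finally show ?thesis .
  qed
  show "cinc (degs K n) (Simp K n) $$ latch K n sg = Fa (copower K) sg"
  unfolding latch_def copower_simps(2)[OF sg(1)] sg(2) by (rule cinc_cdesc[OF degs_subset S S]) (rule ld)
  show "cinc (degs K' n) (Simp K' n) $$ latch K' n sg = Fa (copower K') sg"
  unfolding latch_def copower_simps(2)[OF sg(1)] sg(2) by (rule cinc_cdesc[OF degs_subset S' S']) (rule ld)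
 qed
 note rel = this
 have cof: "cinc (Simp K n Un degs K' n) (Simp K' n) : Cof T" for n
  by (rule cinc_Cof[OF US S'])
 show ?thesis unfolding reedy_cofibrations_def by (rule CollectI, rule conjI[OF arrow], rule allI, rule bexI, rule rel, rule cof)
qed

end

section \<open>Extending a homotopy functor to mapping spaces\<close>

locale endofunctor = category C for C :: "('o, 'a) category" +
 fixes L :: "('o, 'a, 'o, 'a) cfunctor" and \<eta> :: "'o => 'a"
 assumes L: "is_functor C C L" and \<eta>: "nat_trans C C id_functor L \<eta>"
begin

lemma L_obj [simp]: "X : Obj C ==> Fo L X : Obj C" using L unfolding is_functor_def by blast

lemma L_hom: "f : Hom C X Y ==> Fa L f : Hom C (Fo L X) (Fo L Y)" using L unfolding is_functor_def by blast

lemma L_simps [simp]: assumes "arr f" shows "arr (Fa L f)" "dom (Fa L f) = Fo L (dom f)" "cod (Fa L f) = Fo L (cod f)"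
 using L_hom[of f "dom f" "cod f"] assms by (simp_all add: hom_iff)

lemma L_id [simp]: "X : Obj C ==> Fa L (Idt C X) = Idt C (Fo L X)" using L unfolding is_functor_def by blast

lemma L_comp:
 assumes "arr f" "arr g" "cod f = dom g" shows "Fa L (g $$ f) = Fa L g $$ Fa L f"
proof -
 have "ALL X Y Z f g. f : Hom C X Y & g : Hom C Y Z --> Fa L (g $$ f) = Fa L g $$ Fa L f" using L unfolding is_functor_def by blast
 from this[rule_format, of f "dom f" "cod f" g "cod g"] show ?thesis using assms by (simp add: hom_iff)
qed

lemma \<eta>_simps [simp]: assumes "X : Obj C" shows "arr (\<eta> X)" "dom (\<eta> X) = X" "cod (\<eta> X) = Fo L X"
 using \<eta> assms unfolding nat_trans_def by (simp_all add: hom_iff id_functor_def)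

lemma \<eta>_nat: assumes "arr f" shows "\<eta> (cod f) $$ f = Fa L f $$ \<eta> (dom f)"
 using \<eta>[unfolded nat_trans_def, THEN conjunct2, rule_format, of f "dom f" "cod f"] assms by (simp add: hom_iff id_functor_def)

end

lemma (in smc) tens_vertex:
 assumes c: "tens X K P al" and Y: "Y : Obj M" and X: "X : Obj M" and h: "sset_map K (Map X Y) h"
 shows "EX! g. g : Hom M P Y & (ALL m. ALL k:Simp K m. h m k = post X g m (al m k))"
proof -
 have P: "P : Obj M" using c by (simp add: tens_def)
 have "sset_map (sset_prod K (std_simplex 0)) (Map X Y) (%m z. h m (fst z))" using h unfolding sset_map_def by auto
 hence ex: "EX! sg. sg : Simp (Map P Y) 0 & (ALL m. ALL k:Simp K m. ALL tq:DHom m 0.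
  h m (fst (k, tq)) = SComp E m X P Y (SAct (Map P Y) tq sg) (al m k))"
  using c[unfolded tens_def, THEN conjunct2, THEN conjunct2, THEN bspec, OF Y, THEN spec, THEN spec, THEN mp] by blast
 have D0: "DHom m 0 = {dconst m 0 0}" for m
 proof -
  have "tq = dconst (src tq) 0 0" if "darr tq" "tgt tq = 0" for tq using that by (intro darr_eqI) auto
  thus ?thesis by auto
 qed
 have *: "(ALL m. ALL k:Simp K m. ALL tq:DHom m 0. h m (fst (k, tq)) = SComp E m X P Y (SAct (Map P Y) tq (SArr E g)) (al m k)) \<longleftrightarrow>
  (ALL m. ALL k:Simp K m. h m k = post X g m (al m k))" if "g : Hom M P Y" for g
  unfolding D0 using that by (auto simp: hom_iff smap_post_def simp flip: sdegenerate_eq)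
 obtain sg where sg: "sg : Simp (Map P Y) 0" "ALL m. ALL k:Simp K m. ALL tq:DHom m 0. h m (fst (k, tq)) = SComp E m X P Y (SAct (Map P Y) tq sg) (al m k)"
  using ex by (elim ex1E conjE)
 obtain g where g: "g : Hom M P Y" "sg = SArr E g" using SArr_surj[OF P Y sg(1)] by blast
 show ?thesis
 proof (rule ex1I[of _ g])
  show "g : Hom M P Y & (ALL m. ALL k:Simp K m. h m k = post X g m (al m k))" using g(1) iffD1[OF *[OF g(1)]] sg(2)[unfolded g(2)] by blast
  fix g' assume g': "g' : Hom M P Y & (ALL m. ALL k:Simp K m. h m k = post X g' m (al m k))"
  hence "SArr E g' : Simp (Map P Y) 0" "ALL m. ALL k:Simp K m. ALL tq:DHom m 0. h m (fst (k, tq)) = SComp E m X P Y (SAct (Map P Y) tq (SArr E g')) (al m k)"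
  using * by (auto simp: hom_iff)
  hence "SArr E g' = sg" using ex sg by (elim ex1E) metis
  thus "g' = g" using SArr_inj[of g' P Y g] g g' by blast
 qed
qed

text \<open>The tensor of a cofibrant object with the interval is a cylinder: it is cofibrant, edges of \<open>Map(P, Y)\<close> are maps out
 of it, and the two inclusions induce homotopic maps of mapping spaces.\<close>

lemma (in smc) cylinder:
 assumes P: "cofibrant_obj P"
 obtains C i0 i1 where "cofibrant_obj C" "i0 : Hom M P C" "i1 : Hom M P C"
  "!!Y y y' d. y : Hom M P Y ==> y' : Hom M P Y ==> edge (Map P Y) d (SArr E y) (SArr E y') ==> EX D:Hom M C Y. D $$ i0 = y & D $$ i1 = y'"
  "!!Z. Z : Obj M ==> elem_homotopy (Map C Z) (Map P Z) (smap_pre M E i0 Z) (smap_pre M E i1 Z)"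
proof -
 have PO: "P : Obj M" using P by (rule cofibrant_obj)
 let ?I = "std_simplex 1"
 have "EX C al. tens P ?I C al"
  by (rule tens_exists[OF PO std_simplex_sset]) (unfold std_simplex_simps, rule finite_DHom)
 then obtain C al where c: "tens P ?I C al" by blast
 have C: "C : Obj M" and al: "sset_map ?I (Map P C) al" using c by (simp_all add: tens_def)
 have a_in: "al m kp : Simp (Map P C) m" if "kp : DHom m 1" for m kp using sset_map_in[OF al, of kp m] that by simp
 have c01: "dconst 0 0 1 : DHom 0 1" "dconst 0 1 1 : DHom 0 1" by simp_all
 obtain i0 where i0: "i0 : Hom M P C" "al 0 (dconst 0 0 1) = SArr E i0" using SArr_surj[OF PO C a_in[OF c01(1)]] by blast
 obtain i1 where i1: "i1 : Hom M P C" "al 0 (dconst 0 1 1) = SArr E i1" using SArr_surj[OF PO C a_in[OF c01(2)]] by blast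
 have ia: "arr i0" "dom i0 = P" "cod i0 = C" "arr i1" "dom i1 = P" "cod i1 = C" using i0 i1 by (simp_all add: hom_iff)
 have ex: "EX D:Hom M C Y. ALL m. ALL kp:DHom m 1. SAct (Map P Y) kp d = post P D m (al m kp)"
  and un: "!!D D'. D : Hom M C Y ==> D' : Hom M C Y ==> (!!m kp. kp : DHom m 1 ==> SAct (Map P Y) kp d = post P D m (al m kp)) ==>
  (!!m kp. kp : DHom m 1 ==> SAct (Map P Y) kp d = post P D' m (al m kp)) ==> D = D'"
  if Y: "Y : Obj M" and d: "d : Simp (Map P Y) 1" for Y d
 proof -
  have e: "EX! g. g : Hom M C Y & (ALL m. ALL kp:DHom m 1. SAct (Map P Y) kp d = post P g m (al m kp))"
  using tens_vertex[OF c Y PO simplex_sset_map[OF Map_sset[OF PO Y] d]] unfolding std_simplex_simps .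
  thus "EX D:Hom M C Y. ALL m. ALL kp:DHom m 1. SAct (Map P Y) kp d = post P D m (al m kp)" by (elim ex1E conjE) (rule bexI)
  fix D D' assume D: "D : Hom M C Y" "D' : Hom M C Y" "!!m kp. kp : DHom m 1 ==> SAct (Map P Y) kp d = post P D m (al m kp)"
  "!!m kp. kp : DHom m 1 ==> SAct (Map P Y) kp d = post P D' m (al m kp)"
  have "D : Hom M C Y & (ALL m. ALL kp:DHom m 1. SAct (Map P Y) kp d = post P D m (al m kp))" using D by blast
  moreover have "D' : Hom M C Y & (ALL m. ALL kp:DHom m 1. SAct (Map P Y) kp d = post P D' m (al m kp))" using D by blast
  ultimately show "D = D'" using e by (elim ex1E) metis
 qed
 show ?thesis
 proof (rule that[OF _ i0(1) i1(1)])
  fix Y y y' d assume y: "y : Hom M P Y" "y' : Hom M P Y" and d: "edge (Map P Y) d (SArr E y) (SArr E y')"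
  have Y: "Y : Obj M" using y by (auto simp: hom_iff)
  have dS: "d : Simp (Map P Y) 1" and v: "vtx (Map P Y) 1 0 d = SArr E y" "vtx (Map P Y) 1 1 d = SArr E y'" using d by (auto simp: edge_def)
  obtain D where D: "D : Hom M C Y" "ALL m. ALL kp:DHom m 1. SAct (Map P Y) kp d = post P D m (al m kp)" using ex[OF Y dS] by blast
  have Da: "arr D" "dom D = C" "cod D = Y" using D by (simp_all add: hom_iff)
  have "SArr E y = SArr E (D $$ i0)"
  using bspec[OF spec[OF D(2), of 0] c01(1)] v(1) i0(2) post_SArr[of i0 D P] Da ia by (simp add: vtx_def)
  moreover have "SArr E y' = SArr E (D $$ i1)"
  using bspec[OF spec[OF D(2), of 0] c01(2)] v(2) i1(2) post_SArr[of i1 D P] Da ia by (simp add: vtx_def)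
  ultimately have "D $$ i0 = y" "D $$ i1 = y'"
  using SArr_inj[OF comp_hom[OF i0(1) D(1)] y(1)] SArr_inj[OF comp_hom[OF i1(1) D(1)] y(2)] by simp_all
  thus "EX D:Hom M C Y. D $$ i0 = y & D $$ i1 = y'" using D(1) by blast
 next
  fix Z assume Z: "Z : Obj M"
  have en: "al n (dconst n k 1) = sdegenerate (Map P C) n (al 0 (dconst 0 k 1))" if "k <= 1" for n k
  using sset_map_act[OF al, of "dconst n 0 0" n "dconst 0 k 1"] that by (simp add: sdegenerate_eq)
  show "elem_homotopy (Map C Z) (Map P Z) (smap_pre M E i0 Z) (smap_pre M E i1 Z)"
  proof (rule elem_homotopyI)
  show "sset_map (sset_prod (Map C Z) ?I) (Map P Z) (%n z. SComp E n P C Z (fst z) (al n (snd z)))"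
  unfolding sset_map_def
  proof (intro conjI allI ballI impI)
  show "SComp E n P C Z (fst z) (al n (snd z)) : Simp (Map P Z) n" if "z : Simp (sset_prod (Map C Z) ?I) n" for n z
  using that a_in[of "snd z" n] PO C Z by (cases z) simp
  fix m n tq z assume *: "tq : DHom m n & z : Simp (sset_prod (Map C Z) ?I) n"
  hence t: "darr tq" "src tq = m" "tgt tq = n" "fst z : Simp (Map C Z) n" "snd z : DHom n 1" by (cases z; simp)+
  have "al m (snd z ## tq) = SAct (Map P C) tq (al n (snd z))" using sset_map_act[OF al, of tq m "snd z"] t by simp
  thus "SComp E m P C Z (fst (SAct (sset_prod (Map C Z) ?I) tq z)) (al m (snd (SAct (sset_prod (Map C Z) ?I) tq z)))
  = SAct (Map P Z) tq (SComp E n P C Z (fst z) (al n (snd z)))"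
  using SComp_act[OF PO C Z t(1), of "al n (snd z)" "fst z"] t(2-4) a_in[OF t(5)] by simp
  qed
  next
  fix n x
  have "al n (dconst n 0 1) = sdegenerate (Map P C) n (SArr E i0)" "al n (dconst n 1 1) = sdegenerate (Map P C) n (SArr E i1)"
  using en[of 0 n] en[of 1 n] unfolding i0(2) i1(2) by simp_all
  thus "SComp E n P C Z (fst (x, dconst n 0 1)) (al n (snd (x, dconst n 0 1))) = pre i0 Z n x"
  "SComp E n P C Z (fst (x, dconst n 1 1)) (al n (snd (x, dconst n 1 1))) = pre i1 Z n x"
  unfolding fst_conv snd_conv using ia by (simp_all only: SComp_cst)
  qed
 next
  obtain t where t: "initial M t" using P by (auto simp: cofibrant_def)
  show "cofibrant_obj C"
  proof (rule cofibrant_if_lift[OF C t])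
  fix p v assume p: "p : Fib T" "p : W" "arr p" and v: "v : Hom M C (cod p)"
  have va: "arr v" "dom v = C" "cod v = cod p" using v by (simp_all add: hom_iff)
  have pO: "dom p : Obj M" "cod p : Obj M" using p by simp_all
  have did1: "did 1 : DHom 1 1" by simp
  define d where "d = post P v 1 (al 1 (did 1))"
  have d: "d : Simp (Map P (cod p)) 1" unfolding d_def using a_in[OF did1] va PO by simp
  have da: "SAct (Map P (cod p)) kp d = post P v m (al m kp)" if k: "kp : DHom m 1" for m kp
  using sset_map_act[OF post_map[OF va(1) PO], of kp m "al 1 (did 1)"] sset_map_act[OF al, of kp m "did 1"] a_in[OF did1] va k by (simp add: d_def)
  obtain u where u: "u : Hom M P (dom p)" "p $$ u = v $$ i0" using cofibrant_lift[OF P p(1,2), of "v $$ i0"] comp_hom[OF i0(1) v] by blast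
  have ua: "arr u" "dom u = P" "cod u = dom p" using u by (simp_all add: hom_iff)
  have "post P p 0 (SArr E u) = vtx (Map P (cod p)) 1 0 d"
  using da[OF c01(1)] i0(2) post_SArr[of i0 v P] post_SArr[of u p P] u(2) ua va ia p(3) by (simp add: vtx_def)
  then obtain e where e: "e : Simp (Map P (dom p)) 1" "post P p 1 e = d"
  using kan_lift_edge[OF kan_post[OF p(1) P] Map_sset[OF PO pO(1)] Map_sset[OF PO pO(2)] d, of 0 "SArr E u"] ua by auto
  obtain k where k: "k : Hom M C (dom p)" "ALL m. ALL kp:DHom m 1. SAct (Map P (dom p)) kp e = post P k m (al m kp)" using ex[OF pO(1) e(1)] by blast
  have ka: "arr k" "dom k = C" "cod k = dom p" using k by (simp_all add: hom_iff)
  have "p $$ k = v"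
  proof (rule un[OF pO(2) d _ v _ da])
  show "p $$ k : Hom M C (cod p)" using ka p(3) by (simp add: hom_iff)
  show "SAct (Map P (cod p)) kp d = post P (p $$ k) m (al m kp)" if x: "kp : DHom m 1" for m kp
  proof -
  have "SAct (Map P (cod p)) kp d = post P p m (SAct (Map P (dom p)) kp e)"
  using sset_map_act[OF post_map[OF p(3) PO], of kp m e] e x by simp
  also have "... = post P p m (post P k m (al m kp))" using k(2) x by simp
  also have "... = post P (p $$ k) m (al m kp)" using post_comp[of k p P "al m kp" m] a_in[OF x] ka p(3) PO by simp
  finally show ?thesis .
  qed
  qed
  thus "EX h:Hom M C (dom p). p $$ h = v" using k(1) by blast
  qed
 qed
qed

text \<open>The data used to extend \<open>L\<close> to mapping spaces into \<open>F\<close>: the simplicial path object of \<open>F\<close> is a retract of \<open>H\<close>, and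
 \<open>H\<close> maps to the result of applying \<open>L\<close> in each dimension by a map that lifts against Reedy cofibrations.\<close>

locale resolution = path_objects M T E F + endofunctor M L \<eta>
 for M :: "('o, 'a) category" and T :: "'a model_structure" and E :: "('o, 'a, 'u) simplicial_enrichment" and F
  and L :: "('o, 'a, 'o, 'a) cfunctor" and \<eta> :: "'o => 'a" +
 fixes H G :: "('o, 'a) simplicial" and c t rh :: "nat => 'a"
 assumes G: "Fo G n = Fo L (Pn n)" "darr al ==> Fa G al = Fa L (Pn_act al)"
  and c: "(path_simplicial, c, H) : Arr (simplicial_objects M)" and t: "(H, t, G) : Arr (simplicial_objects M)"
  and rh: "(H, rh, path_simplicial) : Arr (simplicial_objects M)"
  and tc: "t n $$ c n = \<eta> (Pn n)" and rhc: "rh n $$ c n = Idt M (Pn n)"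
  and t_lifts: "i : reedy_cofibrations M T ==> lifts (simplicial_objects M) i (H, t, G)"
begin

lemma H_obj: "H : Obj sC" and G_obj: "G : Obj sC" using t by (simp_all add: sarr_iff)

lemma c_hom: "c n : Hom M (Pn n) (Fo H n)" and t_hom: "t n : Hom M (Fo H n) (Fo L (Pn n))" and rh_hom: "rh n : Hom M (Fo H n) (Pn n)"
 using c t rh G(1) by (simp_all add: sarr_iff)

lemma family_post:
 assumes "(X, tz, Y) : Arr sC" "family P K X ph" shows "family P K Y (%n x. tz n $$ ph n x)"
 unfolding family_def
proof (intro conjI allI ballI impI)
 have t: "tz n : Hom M (Fo X n) (Fo Y n)" for n using assms(1) by (simp add: sarr_iff)
 have f: "ph n x : Hom M P (Fo X n)" if "x : Simp K n" for n x using assms(2) that by (simp add: family_def)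
 show "tz n $$ ph n x : Hom M P (Fo Y n)" if "x : Simp K n" for n x using comp_hom[OF f[OF that] t] .
 have XY: "X : Obj sC" "Y : Obj sC" using assms(1) by (simp_all add: sarr_iff)
 fix al x assume a: "darr al" and x: "x : Simp K (tgt al)"
 have n: "tz (src al) $$ Fa X al = Fa Y al $$ tz (tgt al)" using assms(1) a by (simp add: sarr_iff)
 have "ph (src al) (SAct K al x) = Fa X al $$ ph (tgt al) x" using assms(2) a x by (simp add: family_def)
 hence "tz (src al) $$ ph (src al) (SAct K al x) = (tz (src al) $$ Fa X al) $$ ph (tgt al) x"
  using t[of "src al"] sobjD(2)[OF XY(1) a] f[OF x] by (simp add: hom_iff comp_assoc)
 also have "... = Fa Y al $$ tz (tgt al) $$ ph (tgt al) x" unfolding n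
  using t[of "tgt al"] sobjD(2)[OF XY(2) a] f[OF x] by (simp add: hom_iff comp_assoc)
 finally show "tz (src al) $$ ph (src al) (SAct K al x) = Fa Y al $$ tz (tgt al) $$ ph (tgt al) x" .
qed

lemma lift_family:
 assumes P: "cofibrant_obj P" and K: "small_sset TYPE('u) K" and K': "small_sset TYPE('u) K'" and s: "sub_sset K K'"
  and f: "family P K H ph" and g: "family P K' G pw" and e: "!!n x. x : Simp K n ==> t n $$ ph n x = pw n x"
 shows "EX xi. family P K' H xi & (ALL n. ALL x:Simp K n. xi n x = ph n x) & (ALL n. ALL x:Simp K' n. t n $$ xi n x = pw n x)"
proof -
 interpret Q: copowers M T E P by unfold_locales (rule P)
 note sub = sub_ssetD(3)[OF s] and S = Q.Ks(2)[OF K] and S' = Q.Ks(2)[OF K']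
 let ?i = "(Q.copower K, %n. Q.cinc (Simp K n) (Simp K' n), Q.copower K')"
 let ?u = "(Q.copower K, %n. Q.cdesc (Simp K n) (Fo H n) (ph n), H)" and ?v = "(Q.copower K', %n. Q.cdesc (Simp K' n) (Fo G n) (pw n), G)"
 have fh: "ALL x:Simp K n. ph n x : Hom M P (Fo H n)" and gh: "ALL x:Simp K' n. pw n x : Hom M P (Fo G n)" for n
  using f g unfolding family_def by blast+
 note cf = Q.cdesc[OF S sobjD(1)[OF H_obj] fh] and cg = Q.cdesc[OF S' sobjD(1)[OF G_obj] gh]
 have u: "?u : Hom sC (Q.copower K) H" using Q.family_arr[OF K H_obj f] by (simp add: Hom_def)
 have v: "?v : Hom sC (Q.copower K') G" using Q.family_arr[OF K' G_obj g] by (simp add: Hom_def)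
 have tn: "t n : Hom M (Fo H n) (Fo G n)" for n using t_hom G(1) by simp
 have "t n $$ Q.cdesc (Simp K n) (Fo H n) (ph n) = Q.cdesc (Simp K' n) (Fo G n) (pw n) $$ Q.cinc (Simp K n) (Simp K' n)" for n
 proof -
  have "t n $$ Q.cdesc (Simp K n) (Fo H n) (ph n) = Q.cdesc (Simp K n) (Fo G n) (%x. t n $$ ph n x)" by (rule Q.comp_cdesc[OF S tn fh])
  also have "... = Q.cdesc (Simp K n) (Fo G n) (pw n)" by (rule Q.cdesc_cong) (rule e)
  also have "... = Q.cdesc (Simp K' n) (Fo G n) (pw n) $$ Q.cinc (Simp K n) (Simp K' n)"
  by (rule Q.cdesc_cinc[symmetric, OF sub S' sobjD(1)[OF G_obj] gh])
  finally show ?thesis .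
 qed
 hence "Cmp sC (H, t, G) ?u = Cmp sC ?v ?i" by simp
 hence "EX h:Hom sC (Q.copower K') H. Cmp sC h ?i = ?u & Cmp sC (H, t, G) h = ?v"
  using liftsD[OF t_lifts[OF Q.copower_reedy_cofibration[OF K K' s]], of ?u ?v] u v by simp
 then obtain h where h: "h : Hom sC (Q.copower K') H" "Cmp sC h ?i = ?u" "Cmp sC (H, t, G) h = ?v" by blast
 obtain tz where tz: "h = (Q.copower K', tz, H)" "(Q.copower K', tz, H) : Arr sC" using h(1) by (rule sarr_cases)
 have t1: "tz n $$ Q.cinc (Simp K n) (Simp K' n) = Q.cdesc (Simp K n) (Fo H n) (ph n)" and t2: "t n $$ tz n = Q.cdesc (Simp K' n) (Fo G n) (pw n)" for n
  using h(2,3) unfolding tz(1) by (simp_all add: fun_eq_iff)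
 have th: "tz n : Hom M (Q.cop (Simp K' n)) (Fo H n)" for n using tz(2) by (simp add: sarr_iff)
 show ?thesis
 proof (intro exI conjI allI ballI)
  show "family P K' H (%n x. tz n $$ Q.cin (Simp K' n) x)" by (rule Q.arr_family[OF K' tz(2)])
  fix n x assume x: "x : Simp K n"
  have "tz n $$ Q.cin (Simp K' n) x = (tz n $$ Q.cinc (Simp K n) (Simp K' n)) $$ Q.cin (Simp K n) x"
  using comp_assoc[of "Q.cin (Simp K n) x" "Q.cinc (Simp K n) (Simp K' n)" "tz n"] Q.cinc_hom[OF sub S'] Q.cinc_cin[OF sub S' x] Q.cin_simps[OF S x] th[of n]
  by (simp add: hom_iff)
  thus "tz n $$ Q.cin (Simp K' n) x = ph n x" unfolding t1 using cf(2)[OF x] by simp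
 next
  fix n x assume x: "x : Simp K' n"
  have "t n $$ tz n $$ Q.cin (Simp K' n) x = (t n $$ tz n) $$ Q.cin (Simp K' n) x"
  using Q.cin_simps[OF S' x] th[of n] tn[of n] by (simp add: hom_iff comp_assoc)
  thus "t n $$ tz n $$ Q.cin (Simp K' n) x = pw n x" unfolding t2 using cg(2)[OF x] by simp
 qed
qed

definition cl :: "'o => nat => 'u => 'a" where
 "cl Y n x = (SOME g. g : Hom M Y (Pn n) & pre g F n (us n) = x)"

lemma cl: assumes "Y : Obj M" "x : Simp (Map Y F) n" shows "cl Y n x : Hom M Y (Pn n)" "pre (cl Y n x) F n (us n) = x"
proof -
 have "EX g. g : Hom M Y (Pn n) & pre g F n (us n) = x" using classify[OF assms] by blast
 from someI_ex[OF this, folded cl_def] show "cl Y n x : Hom M Y (Pn n)" "pre (cl Y n x) F n (us n) = x" by blast+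
qed

lemma cl_act: assumes Y: "Y : Obj M" and a: "darr al" and x: "x : Simp (Map Y F) (tgt al)"
 shows "cl Y (src al) (SAct (Map Y F) al x) = Pn_act al $$ cl Y (tgt al) x"
proof (rule classify_unique[of _ Y "src al"])
 have y: "SAct (Map Y F) al x : Simp (Map Y F) (src al)" using Y a x by simp
 show "cl Y (src al) (SAct (Map Y F) al x) : Hom M Y (Pn (src al))" by (rule cl(1)[OF Y y])
 show "Pn_act al $$ cl Y (tgt al) x : Hom M Y (Pn (src al))" using comp_hom[OF cl(1)[OF Y x]] Pn_act[OF a] by (simp add: hom_iff)
 show "pre (cl Y (src al) (SAct (Map Y F) al x)) F (src al) (us (src al)) = pre (Pn_act al $$ cl Y (tgt al) x) F (src al) (us (src al))"
  using cl(2)[OF Y y] pre_Pn_act[OF a, of "cl Y (tgt al) x"] cl[OF Y x] by (simp add: hom_iff)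
qed

lemma cl_pre: assumes e: "e : Hom M A B" and x: "x : Simp (Map B F) n" shows "cl A n (pre e F n x) = cl B n x $$ e"
proof (rule classify_unique[of _ A n])
 have ea: "arr e" "dom e = A" "cod e = B" "A : Obj M" "B : Obj M" using e by (auto simp: hom_iff)
 have y: "pre e F n x : Simp (Map A F) n" using ea x by simp
 note b = cl[OF ea(5) x]
 show "cl A n (pre e F n x) : Hom M A (Pn n)" by (rule cl(1)[OF ea(4) y])
 show "cl B n x $$ e : Hom M A (Pn n)" by (rule comp_hom[OF e b(1)])
 show "pre (cl A n (pre e F n x)) F n (us n) = pre (cl B n x $$ e) F n (us n)"
  using cl(2)[OF ea(4) y] pre_comp[of e "cl B n x" F "us n" n] b ea by (simp add: hom_iff)
qed

lemma cl_family:
 assumes y: "y : Hom M P (Fo L A)" and A: "A : Obj M" shows "family P (Map A F) G (%n x. Fa L (cl A n x) $$ y)"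
 unfolding family_def
proof (intro conjI allI ballI impI)
 fix n x assume x: "x : Simp (Map A F) n"
 show "Fa L (cl A n x) $$ y : Hom M P (Fo G n)" using comp_hom[OF y L_hom[OF cl(1)[OF A x]]] G(1) by simp
next
 fix al x assume a: "darr al" and x: "x : Simp (Map A F) (tgt al)"
 note g = cl(1)[OF A x]
 have "Fa L (cl A (src al) (SAct (Map A F) al x)) $$ y = Fa L (Pn_act al $$ cl A (tgt al) x) $$ y" using cl_act[OF A a x] by simp
 also have "... = Fa G al $$ Fa L (cl A (tgt al) x) $$ y"
  using G(2)[OF a] L_comp[of "cl A (tgt al) x" "Pn_act al"] Pn_act[OF a] g y comp_assoc[of y "Fa L (cl A (tgt al) x)" "Fa L (Pn_act al)"] by (simp add: hom_iff)
 finally show "Fa L (cl A (src al) (SAct (Map A F) al x)) $$ y = Fa G al $$ Fa L (cl A (tgt al) x) $$ y" .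
qed

lemma family_sset_map: 
 assumes f: "family P K path_simplicial ph" shows "sset_map K (Map P F) (%n x. pre (ph n x) F n (us n))"
 unfolding sset_map_def
proof (intro conjI allI ballI impI)
 have fh: "ph n x : Hom M P (Pn n)" if "x : Simp K n" for n x using f that by (simp add: family_def)
 show "pre (ph n x) F n (us n) : Simp (Map P F) n" if "x : Simp K n" for n x using fh[OF that] by (simp add: hom_iff)
 fix m n al x assume *: "al : DHom m n & x : Simp K n"
 hence a: "darr al" "src al = m" "tgt al = n" and x: "x : Simp K (tgt al)" by auto
 have "ph m (SAct K al x) = Pn_act al $$ ph n x" using f a x unfolding family_def by auto
 thus "pre (ph m (SAct K al x)) F m (us m) = SAct (Map P F) al (pre (ph n x) F n (us n))"
  using pre_Pn_act[OF a(1), of "ph n x"] fh[of x n] x a by (simp add: hom_iff)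
qed

text \<open>\<open>extension P A y ow\<close>: the map \<open>ow : Map(A, F) \<rightarrow> Map(P, F)\<close> comes from a lift to \<open>H\<close> of \<open>f \<mapsto> L f \<cdot> y\<close>.\<close>

definition extension :: "'o => 'o => 'a => (nat => 'u => 'u) => bool" where
 "extension P A y ow \<longleftrightarrow> (EX xi. family P (Map A F) H xi & (ALL n. ALL x:Simp (Map A F) n. t n $$ xi n x = Fa L (cl A n x) $$ y) &
  (ALL n. ALL x:Simp (Map A F) n. ow n x = pre (rh n $$ xi n x) F n (us n)))"

lemma Map_small_sset: "X : Obj M ==> Y : Obj M ==> small_sset TYPE('u) (Map X Y)"
 using Map_small unfolding small_sset_def by simp

lemma extension_map: assumes e: "extension P A y ow" and A: "A : Obj M" shows "sset_map (Map A F) (Map P F) ow"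
proof -
 obtain xi where x: "family P (Map A F) H xi" "ALL n. ALL x:Simp (Map A F) n. ow n x = pre (rh n $$ xi n x) F n (us n)"
  using e unfolding extension_def by blast
 have f: "sset_map (Map A F) (Map P F) (%n x. pre (rh n $$ xi n x) F n (us n))" by (rule family_sset_map[OF family_post[OF rh x(1)]])
 show ?thesis unfolding sset_map_def
 proof (intro conjI allI ballI impI)
  show "ow n z : Simp (Map P F) n" if "z : Simp (Map A F) n" for n z using sset_map_in[OF f that] x(2) that by simp
  fix m n al z assume *: "al : DHom m n & z : Simp (Map A F) n"
  hence "SAct (Map A F) al z : Simp (Map A F) m" using A by auto
  thus "ow m (SAct (Map A F) al z) = SAct (Map P F) al (ow n z)" using sset_map_act[OF f, of al m z] * x(2) by simp
 qed
qed

lemma extension_exists: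
 assumes P: "cofibrant_obj P" and A: "A : Obj M" and y: "y : Hom M P (Fo L A)" shows "EX ow. extension P A y ow"
proof -
 let ?K = "\<lparr>Simp = (%_. {}), SAct = SAct (Map A F)\<rparr>"
 have e: "is_sset ?K" unfolding is_sset_def by (simp only: sset.simps empty_iff simp_thms)
 have K: "small_sset TYPE('u) ?K" using e small_finite[OF univ finite.emptyI] unfolding small_sset_def by (simp only: sset.simps simp_thms)
 have s: "sub_sset ?K (Map A F)" using e A unfolding sub_sset_def by (simp only: sset.simps empty_iff empty_subsetI simp_thms Map_sset F_obj)
 have f: "family P ?K H (%_ _. undefined)" by (simp add: family_def)
 have e0: "t n $$ undefined = Fa L (cl A n x) $$ y" if "x : Simp ?K n" for n x using that by simp
 obtain xi where x: "family P (Map A F) H xi" "ALL n. ALL x:Simp (Map A F) n. t n $$ xi n x = Fa L (cl A n x) $$ y"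
  using lift_family[OF P K Map_small_sset[OF A F_obj] s f cl_family[OF y A] e0] by blast
 show ?thesis unfolding extension_def by (intro exI[of _ "%n x. pre (rh n $$ xi n x) F n (us n)"] exI[of _ xi] conjI x) simp
qed

lemma extension_unique:
 assumes P: "cofibrant_obj P" and A: "A : Obj M" and y: "y : Hom M P (Fo L A)"
  and w: "extension P A y ow" and w': "extension P A y ow'"
 shows "simp_homotopic (Map A F) (Map P F) ow ow'"
proof -
 obtain xi where x: "family P (Map A F) H xi" "ALL n. ALL x:Simp (Map A F) n. t n $$ xi n x = Fa L (cl A n x) $$ y"
  "ALL n. ALL x:Simp (Map A F) n. ow n x = pre (rh n $$ xi n x) F n (us n)" using w unfolding extension_def by blast
 obtain xi' where x': "family P (Map A F) H xi'" "ALL n. ALL x:Simp (Map A F) n. t n $$ xi' n x = Fa L (cl A n x) $$ y"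
  "ALL n. ALL x:Simp (Map A F) n. ow' n x = pre (rh n $$ xi' n x) F n (us n)" using w' unfolding extension_def by blast
 let ?X = "Map A F"
 let ?K' = "sset_prod ?X (std_simplex 1)"
 let ?K = "\<lparr>Simp = (%n. Simp ?X n \<times> {dconst n 0 1, dconst n 1 1}), SAct = SAct ?K'\<rparr>"
 have XS: "is_sset ?X" using A by simp
 have ne: "dconst n 1 1 ~= dconst n 0 1" for n
 proof
  assume "dconst n 1 1 = dconst n 0 1"
  hence "ap (dconst n 1 1) 0 = ap (dconst n 0 1) 0" by simp
  thus False by simp
 qed
 have sK': "is_sset ?K'" by (rule sset_prod_sset[OF XS std_simplex_sset])
 have K': "small_sset TYPE('u) ?K'" unfolding small_sset_def
  using sK' small_Times_finite[OF univ Map_small[OF A F_obj] finite_DHom] by simp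
 have Kact: "SAct ?K' al z : Simp ?X (src al) \<times> {dconst (src al) 0 1, dconst (src al) 1 1}"
  if "darr al" "z : Simp ?X (tgt al) \<times> {dconst (tgt al) 0 1, dconst (tgt al) 1 1}" for al z
  using that XS by (cases z) auto
 have Ksub: "Simp ?X n \<times> {dconst n 0 1, dconst n 1 1} \<subseteq> Simp ?K' n" for n by auto
 have sK: "is_sset ?K"
 proof (subst is_sset_def, intro conjI allI impI)
  fix m n al x assume *: "al : DHom m n & x : Simp ?K n"
  thus "SAct ?K al x : Simp ?K m" using Kact[of al x] by simp
 next
  fix n x assume "x : Simp ?K n"
  hence "x : Simp ?K' n" using Ksub by auto
  thus "SAct ?K (Idt Delta n) x = x" using act_id[OF sK'] by (simp add: Idt_Delta)
 next
  fix l m n al bt x assume *: "al : DHom l m & bt : DHom m n & x : Simp ?K n"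
  hence "x : Simp ?K' (tgt bt)" using Ksub[of n] by auto
  thus "SAct ?K (bt ## al) x = SAct ?K al (SAct ?K bt x)" using act_act[OF sK', of bt al x] * by simp
 qed
 have "small TYPE('u) (Simp ?X n \<times> {dconst n 0 1, dconst n 1 1})" for n
  by (rule small_Times_finite[OF univ Map_small[OF A F_obj]]) simp
 hence K: "small_sset TYPE('u) ?K" unfolding small_sset_def using sK by simp
 have s: "sub_sset ?K ?K'" unfolding sub_sset_def using sK sK' Ksub by simp
 let ?ph = "%n z. if snd z = dconst n 0 1 then xi n (fst z) else xi' n (fst z)"
 have f: "family P ?K H ?ph" unfolding family_def
 proof (intro conjI allI ballI impI)
  show "?ph n z : Hom M P (Fo H n)" if "z : Simp ?K n" for n z using that x(1) x'(1) by (auto simp: family_def)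
  fix al z assume a: "darr al" and z: "z : Simp ?K (tgt al)"
  obtain v kp where vk: "z = (v, kp)" "v : Simp ?X (tgt al)" "kp = dconst (tgt al) 0 1 \<or> kp = dconst (tgt al) 1 1" using z by (cases z) auto
  have "xi (src al) (SAct ?X al v) = Fa H al $$ xi (tgt al) v" "xi' (src al) (SAct ?X al v) = Fa H al $$ xi' (tgt al) v"
  using x(1) x'(1) a vk(2) unfolding family_def by blast+
  thus "?ph (src al) (SAct ?K al z) = Fa H al $$ ?ph (tgt al) z" using vk a ne by (elim disjE) (simp_all add: ne[simplified])
 qed
 let ?pw = "%n z. Fa L (cl A n (fst z)) $$ y"
 have g: "family P ?K' G ?pw" unfolding family_def
 proof (intro conjI allI ballI impI)
  note c = cl_family[OF y A, unfolded family_def]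
  show "?pw n z : Hom M P (Fo G n)" if "z : Simp ?K' n" for n z using c that by (cases z) simp
  show "?pw (src al) (SAct ?K' al z) = Fa G al $$ ?pw (tgt al) z" if "darr al" "z : Simp ?K' (tgt al)" for al z using c that by (cases z) simp
 qed
 have e: "t n $$ ?ph n z = ?pw n z" if "z : Simp ?K n" for n z using that x(2) x'(2) by (cases z) auto
 obtain h where h: "family P ?K' H h" "ALL n. ALL z:Simp ?K n. h n z = ?ph n z"
  using lift_family[OF P K K' s f g e] by blast
 have "elem_homotopy ?X (Map P F) ow ow'"
 proof (rule elem_homotopyI)
  show "sset_map ?K' (Map P F) (%n z. pre (rh n $$ h n z) F n (us n))" by (rule family_sset_map[OF family_post[OF rh h(1)]])
  fix n z assume z: "z : Simp ?X n"
  hence "h n (z, dconst n 0 1) = xi n z" "h n (z, dconst n 1 1) = xi' n z" using h(2) ne[of n] by (simp_all add: ne[simplified])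
  thus "pre (rh n $$ h n (z, dconst n 0 1)) F n (us n) = ow n z" "pre (rh n $$ h n (z, dconst n 1 1)) F n (us n) = ow' n z"
  using x(3) x'(3) z by simp_all
 qed
 thus ?thesis by (rule elementary_imp_homotopic)
qed

lemma extension_pre:
 assumes w: "extension P A y ow" and z: "z : Hom M P' P" and y: "y : Hom M P (Fo L A)" and A: "A : Obj M"
 shows "extension P' A (y $$ z) (%n x. pre z F n (ow n x))"
proof -
 obtain xi where x: "family P (Map A F) H xi" "ALL n. ALL x:Simp (Map A F) n. t n $$ xi n x = Fa L (cl A n x) $$ y"
  "ALL n. ALL x:Simp (Map A F) n. ow n x = pre (rh n $$ xi n x) F n (us n)" using w unfolding extension_def by blast
 have xh: "xi n x : Hom M P (Fo H n)" if "x : Simp (Map A F) n" for n x using x(1) that by (simp add: family_def)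
 have za: "arr z" "dom z = P'" "cod z = P" and ya: "arr y" "dom y = P" "cod y = Fo L A" using z y by (simp_all add: hom_iff)
 note ta = t_hom[unfolded hom_iff] and ra = rh_hom[unfolded hom_iff]
 show ?thesis unfolding extension_def
 proof (intro exI[of _ "%n x. xi n x $$ z"] conjI allI ballI)
  show "family P' (Map A F) H (%n x. xi n x $$ z)" unfolding family_def
  proof (intro conjI allI ballI impI)
  show "xi n x $$ z : Hom M P' (Fo H n)" if "x : Simp (Map A F) n" for n x by (rule comp_hom[OF z xh[OF that]])
  fix al x assume a: "darr al" and x1: "x : Simp (Map A F) (tgt al)"
  have "xi (src al) (SAct (Map A F) al x) = Fa H al $$ xi (tgt al) x" using x(1) a x1 by (simp add: family_def)
  thus "xi (src al) (SAct (Map A F) al x) $$ z = Fa H al $$ xi (tgt al) x $$ z"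
  using comp_assoc[of z "xi (tgt al) x" "Fa H al"] za xh[OF x1] sobjD(2)[OF H_obj a] by (simp add: hom_iff)
  qed
  fix n x assume x1: "x : Simp (Map A F) n"
  note xa = xh[OF x1, unfolded hom_iff]
  show "t n $$ xi n x $$ z = Fa L (cl A n x) $$ y $$ z"
  using comp_assoc[of z "xi n x" "t n"] comp_assoc[of z y "Fa L (cl A n x)"] x(2) x1 xa za ya ta[of n] cl(1)[OF A x1] by (simp add: hom_iff)
  show "pre z F n (ow n x) = pre (rh n $$ xi n x $$ z) F n (us n)"
  using pre_comp[of z "rh n $$ xi n x" F "us n" n] comp_assoc[of z "xi n x" "rh n"] x(3) x1 xa za ra[of n] by simp
 qed
qed

lemma extension_comp:
 assumes w: "extension P A y ow" and e: "e : Hom M A B" and y: "y : Hom M P (Fo L A)"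
 shows "extension P B (Fa L e $$ y) (%n x. ow n (pre e F n x))"
proof -
 obtain xi where x: "family P (Map A F) H xi" "ALL n. ALL x:Simp (Map A F) n. t n $$ xi n x = Fa L (cl A n x) $$ y"
  "ALL n. ALL x:Simp (Map A F) n. ow n x = pre (rh n $$ xi n x) F n (us n)" using w unfolding extension_def by blast
 have ea: "arr e" "dom e = A" "cod e = B" "B : Obj M" using e by (auto simp: hom_iff)
 have pe: "pre e F n x : Simp (Map A F) n" if "x : Simp (Map B F) n" for n x using that ea by simp
 show ?thesis unfolding extension_def
 proof (intro exI[of _ "%n x. xi n (pre e F n x)"] conjI allI ballI)
  show "family P (Map B F) H (%n x. xi n (pre e F n x))" unfolding family_def
  proof (intro conjI allI ballI impI)
  show "xi n (pre e F n x) : Hom M P (Fo H n)" if "x : Simp (Map B F) n" for n x using x(1) pe[OF that] by (simp add: family_def)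
  show "xi (src al) (pre e F (src al) (SAct (Map B F) al x)) = Fa H al $$ xi (tgt al) (pre e F (tgt al) x)"
  if "darr al" "x : Simp (Map B F) (tgt al)" for al x using x(1) pe[OF that(2)] pre_act[of e B F al "src al" x] ea that by (simp add: family_def)
  qed
  fix n x assume x1: "x : Simp (Map B F) n"
  show "t n $$ xi n (pre e F n x) = Fa L (cl B n x) $$ Fa L e $$ y"
  using x(2) pe[OF x1] cl_pre[OF e x1] L_comp[of e "cl B n x"] comp_assoc[of y "Fa L e" "Fa L (cl B n x)"] cl(1)[OF ea(4) x1] ea y by (simp add: hom_iff)
  show "ow n (pre e F n x) = pre (rh n $$ xi n (pre e F n x)) F n (us n)" using x(3) pe[OF x1] by simp
 qed
qed

lemma extension_id: assumes A: "A : Obj M" shows "extension A A (\<eta> A) (%n x. x)"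
 unfolding extension_def
proof (intro exI[of _ "%n x. c n $$ cl A n x"] conjI allI ballI)
 have "family A (Map A F) path_simplicial (cl A)" unfolding family_def using cl(1)[OF A] cl_act[OF A] by simp
 from family_post[OF c this] show "family A (Map A F) H (%n x. c n $$ cl A n x)" .
 fix n x assume x: "x : Simp (Map A F) n"
 note k = cl[OF A x] and ca = c_hom[of n, unfolded hom_iff] and ta = t_hom[of n, unfolded hom_iff] and ra = rh_hom[of n, unfolded hom_iff]
 have "t n $$ c n $$ cl A n x = \<eta> (Pn n) $$ cl A n x" using comp_assoc[of "cl A n x" "c n" "t n"] k(1) ca ta tc[of n] by (simp add: hom_iff)
 thus "t n $$ c n $$ cl A n x = Fa L (cl A n x) $$ \<eta> A" using \<eta>_nat[of "cl A n x"] k(1) by (simp add: hom_iff)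
 have "rh n $$ c n $$ cl A n x = cl A n x" using comp_assoc[of "cl A n x" "c n" "rh n"] k(1) ca ra rhc[of n] by (simp add: hom_iff)
 thus "x = pre (rh n $$ c n $$ cl A n x) F n (us n)" using k(2) by simp
qed

lemma extension_homotopic:
 assumes P: "cofibrant_obj P" and A: "A : Obj M" and y: "y : Hom M P (Fo L A)" and y': "y' : Hom M P (Fo L A)"
  and s: "same_component (Map P (Fo L A)) (SArr E y) (SArr E y')" and w: "extension P A y ow" and w': "extension P A y' ow'"
 shows "simp_homotopic (Map A F) (Map P F) ow ow'"
proof -
 have PO: "P : Obj M" using P by (rule cofibrant_obj)
 have step: "simp_homotopic (Map A F) (Map P F) ow ow'"
  if y: "y : Hom M P (Fo L A)" "y' : Hom M P (Fo L A)" and d: "edge (Map P (Fo L A)) d (SArr E y) (SArr E y')"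
  and w: "extension P A y ow" "extension P A y' ow'" for y y' d ow ow'
 proof -
  obtain C i0 i1 where C: "cofibrant_obj C" "i0 : Hom M P C" "i1 : Hom M P C"
  "!!Y y y' d. y : Hom M P Y ==> y' : Hom M P Y ==> edge (Map P Y) d (SArr E y) (SArr E y') ==> EX D:Hom M C Y. D $$ i0 = y & D $$ i1 = y'"
  "!!Z. Z : Obj M ==> elem_homotopy (Map C Z) (Map P Z) (smap_pre M E i0 Z) (smap_pre M E i1 Z)"
  by (rule cylinder[OF P]) blast
  obtain D where D: "D : Hom M C (Fo L A)" "D $$ i0 = y" "D $$ i1 = y'" using C(4)[OF y d] by blast
  obtain owC where wC: "extension C A D owC" using extension_exists[OF C(1) A D(1)] by blast
  have "simp_homotopic (Map A F) (Map P F) ow (%n x. pre i0 F n (owC n x))"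
  using extension_unique[OF P A y(1) w(1)] extension_pre[OF wC C(2) D(1) A] D(2) by simp
  also have "simp_homotopic (Map A F) (Map P F) (%n x. pre i0 F n (owC n x)) (%n x. pre i1 F n (owC n x))"
  by (rule simp_homotopic_precomp[OF extension_map[OF wC A] elementary_imp_homotopic[OF C(5)[OF F_obj]]])
  also have "simp_homotopic (Map A F) (Map P F) (%n x. pre i1 F n (owC n x)) ow'"
  using extension_unique[OF P A y(2) _ w(2)] extension_pre[OF wC C(3) D(1) A] D(3) by simp
  finally show ?thesis .
 qed
 have "ALL z ow'. z : Hom M P (Fo L A) --> v = SArr E z --> extension P A z ow' --> simp_homotopic (Map A F) (Map P F) ow ow'"
  if "same_component (Map P (Fo L A)) (SArr E y) v" for v
  using that
 proof (induction rule: same_component_induct)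
  case refl
  show ?case
  proof (intro allI impI)
  fix z ow' assume z: "z : Hom M P (Fo L A)" "SArr E y = SArr E z" "extension P A z ow'"
  hence "z = y" using SArr_inj[OF z(1) y] by simp
  thus "simp_homotopic (Map A F) (Map P F) ow ow'" using extension_unique[OF P A y w] z(3) by simp
  qed
 next
  case (step c d)
  obtain e where e: "edge (Map P (Fo L A)) e c d \<or> edge (Map P (Fo L A)) e d c" using step(2) by blast
  have "c : Simp (Map P (Fo L A)) 0" using e edge_verts[OF Map_sset[OF PO L_obj[OF A]]] by blast
  then obtain u where u: "u : Hom M P (Fo L A)" "c = SArr E u" using SArr_surj[OF PO L_obj[OF A]] by blast
  obtain owu where wu: "extension P A u owu" using extension_exists[OF P A u(1)] by blast
  show ?case
  proof (intro allI impI)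
  fix z ow' assume z: "z : Hom M P (Fo L A)" "d = SArr E z" "extension P A z ow'"
  have "simp_homotopic (Map A F) (Map P F) ow owu" using step(3) u wu by blast
  also have "simp_homotopic (Map A F) (Map P F) owu ow'"
  using e \<open>!!y y' d ow ow'. y : Hom M P (Fo L A) ==> y' : Hom M P (Fo L A) ==> edge (Map P (Fo L A)) d (SArr E y) (SArr E y') ==>
  extension P A y ow ==> extension P A y' ow' ==> simp_homotopic (Map A F) (Map P F) ow ow'\<close>
  u z wu simp_homotopic_sym by metis
  finally show "simp_homotopic (Map A F) (Map P F) ow ow'" .
  qed
 qed
 thus ?thesis using s y' w' by blast
qed

text \<open>If \<open>b : B \<rightarrow> L A\<close> is an inverse of \<open>L e\<close> up to homotopy in the sense below, then \<open>e\<^sup>*\<close> is a homotopy equivalence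
 between mapping spaces into \<open>F\<close>, with the extension along \<open>b\<close> as inverse.\<close>

theorem pre_weq:
 assumes A: "cofibrant_obj A" and B: "cofibrant_obj B" and e: "e : Hom M A B" and b: "b : Hom M B (Fo L A)"
  and be: "same_component (Map A (Fo L A)) (SArr E (b $$ e)) (SArr E (\<eta> A))"
  and eb: "same_component (Map B (Fo L B)) (SArr E (Fa L e $$ b)) (SArr E (\<eta> B))"
 shows "sset_weq (Map B F) (Map A F) (smap_pre M E e F)"
proof -
 have O: "A : Obj M" "B : Obj M" using A B cofibrant_obj by blast+
 obtain ow where w: "extension B A b ow" using extension_exists[OF B O(1) b] by blast
 have ea: "arr e" "dom e = A" "cod e = B" using e by (simp_all add: hom_iff)
 have h: "\<eta> A : Hom M A (Fo L A)" "\<eta> B : Hom M B (Fo L B)" using O by (simp_all add: hom_iff)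
 show ?thesis
 proof (rule simplicial_homotopy_equivalence_weq[OF Map_sset[OF O(2) F_obj] Map_sset[OF O(1) F_obj] _ extension_map[OF w O(1)]])
  show "sset_map (Map B F) (Map A F) (smap_pre M E e F)" using pre_map[of e F] ea by simp
  have "extension B B (Fa L e $$ b) (%n x. ow n (pre e F n x))" by (rule extension_comp[OF w e b])
  from extension_homotopic[OF B O(2) comp_hom[OF b L_hom[OF e]] h(2) eb this extension_id[OF O(2)]]
  show "simp_homotopic (Map B F) (Map B F) (%n x. x) (%n x. ow n (pre e F n x))" by (rule simp_homotopic_sym)
  have "extension A A (b $$ e) (%n x. pre e F n (ow n x))" by (rule extension_pre[OF w e b O(1)])
  from extension_homotopic[OF A O(1) comp_hom[OF e b] h(1) be this extension_id[OF O(1)]]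
  show "simp_homotopic (Map A F) (Map A F) (%n x. x) (%n x. pre e F n (ow n x))" by (rule simp_homotopic_sym)
 qed
qed

end

lemma (in path_objects) vertex_iso: "EX g k. g : Hom M F (Pn 0) & g : W & k : Hom M (Pn 0) F & k : W & us 0 = SArr E k"
proof -
 obtain g where g: "g : Hom M F (Pn 0)" "pre g F 0 (us 0) = SArr E (Idt M F)"
  using classify[OF F_obj SArr_in, of "Idt M F"] by auto
 have ga: "arr g" "dom g = F" "cod g = Pn 0" using g by (simp_all add: hom_iff)
 obtain k where k: "k : Hom M (Pn 0) F" "us 0 = SArr E k" using SArr_surj[OF Pn_obj F_obj us_in] by blast
 have ka: "arr k" "dom k = Pn 0" "cod k = F" using k by (simp_all add: hom_iff)
 have kg: "k $$ g = Idt M F"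
  by (rule SArr_inj[OF comp_hom[OF g(1) k(1)]]) (use g(2) k(2) ga ka pre_SArr[of g k F] in \<open>simp_all add: hom_iff\<close>)
 have gk: "g $$ k = Idt M (Pn 0)"
  by (rule classify_unique[of _ "Pn 0" 0])
  (use g k ga ka pre_comp[of k g F "us 0" 0] pre_SArr[of k "Idt M F" F] pre_id[of "Pn 0" F "us 0" 0] in \<open>auto simp: hom_iff\<close>)
 have "is_retract M g (Idt M F)" unfolding is_retract_def
  by (rule conjI[OF _ conjI], rule ga(1), simp,
  rule exI[of _ "Idt M F"], rule exI[of _ k], rule exI[of _ "Idt M F"], rule exI[of _ g])
  (use ga ka kg gk in \<open>simp add: hom_iff\<close>)
 hence gW: "g : W" using retracts(1) id_W[OF F_obj] unfolding retract_closed_def by blast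
 hence "k : W" using W_cancel_right[of g k] ga ka kg id_W[OF F_obj] by simp
 thus ?thesis using g k gW by blast
qed

text \<open>The canonical model structure provides a resolution: factor the level equivalence from the simplicial path object of \<open>F\<close>
 to its image under \<open>L\<close> as a trivial fibration after a cofibration. The latter is a weak equivalence too, and its domain is
 fibrant, so it has a retraction.\<close>

theorem (in path_objects) pre_weq_canonical:
 fixes L :: "('o, 'a, 'o, 'a) cfunctor" and \<eta> :: "'o => 'a"
 assumes canon: "canonical_model_structure_exists TYPE('u) M T" and L: "is_functor M M L" and eta: "nat_trans M M id_functor L \<eta>"
  and Lw: "preserves_weq T L" and \<eta>F: "\<eta> F : W"
  and A: "cofibrant_obj A" and B: "cofibrant_obj B" and e: "e : Hom M A B" and b: "b : Hom M B (Fo L A)"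
  and be: "same_component (Map A (Fo L A)) (SArr E (b $$ e)) (SArr E (\<eta> A))"
  and eb: "same_component (Map B (Fo L B)) (SArr E (Fa L e $$ b)) (SArr E (\<eta> B))"
 shows "sset_weq (Map B F) (Map A F) (smap_pre M E e F)"
proof -
 interpret N: endofunctor M L \<eta> by unfold_locales (rule L eta)+
 have LW: "Fa L w : W" if "w : W" for w using Lw that by (simp add: preserves_weq_def)
 obtain g k where g: "g : Hom M F (Pn 0)" "g : W" and k: "k : Hom M (Pn 0) F" using vertex_iso by blast
 hence ga: "arr g" "dom g = F" "cod g = Pn 0" and gW: "g : W" by (simp_all add: hom_iff)
 have \<eta>W: "\<eta> (Pn n) : W" for n
 proof -
  let ?w = "Pn_act (dconst n 0 0) $$ g"
  have a: "arr (Pn_act (dconst n 0 0))" "dom (Pn_act (dconst n 0 0)) = Pn 0" "cod (Pn_act (dconst n 0 0)) = Pn n"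
  using Pn_act[of "dconst n 0 0"] by simp_all
  have w: "arr ?w" "dom ?w = F" "cod ?w = Pn n" "?w : W" using a ga W_comp[of g "Pn_act (dconst n 0 0)"] Pn_act_weq[of "dconst n 0 0"] gW by simp_all
  have "\<eta> (Pn n) $$ ?w = Fa L ?w $$ \<eta> F" using N.\<eta>_nat[of ?w] w by simp
  also have "... : W" using W_comp[of "\<eta> F" "Fa L ?w"] \<eta>F LW[OF w(4)] w by simp
  finally show ?thesis using W_cancel_right[of ?w "\<eta> (Pn n)"] w by simp
 qed
 obtain T' where T': "model_category TYPE('u) sC T'" "level_equivalences M T \<subseteq> Weq T'" "Cof T' = reedy_cofibrations M T"
  "ALL X:Obj sC. fibrant sC (Fib T') X \<longleftrightarrow> homotopically_constant T X & fibrant sC (reedy_fibrations M T) X"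
  using canon unfolding canonical_model_structure_exists_def by blast
 interpret S: model sC T' "TYPE('u)"
  by unfold_locales (use T'(1) in \<open>simp_all add: model_category_def\<close>)
 define G where "G = \<lparr>Fo = (%n. Fo L (Pn n)), Fa = restrict (%al. Fa L (Pn_act al)) (Arr Delta)\<rparr>"
 have G: "Fo G n = Fo L (Pn n)" "darr al ==> Fa G al = Fa L (Pn_act al)" for n al by (simp_all add: G_def darr_def)
 have GO: "G : Obj sC" unfolding sobj_iff
 proof (intro conjI allI impI)
  fix al bt assume a: "darr al" "darr bt" "src bt = tgt al"
  thus "Fa G (bt ## al) = Fa G al $$ Fa G bt" using N.L_comp[of "Pn_act bt" "Pn_act al"] Pn_act[OF a(1)] Pn_act[OF a(2)] Pn_act_comp[OF a] by (simp add: G)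
 qed (use Pn_act Pn_act_id in \<open>simp_all add: G hom_iff\<close>, simp add: G_def)
 let ?e = "(PS, %n. \<eta> (Pn n), G)"
 have earr: "?e : Arr sC" unfolding sarr_iff
 proof (intro conjI allI impI PS_obj GO)
  show "\<eta> (Pn n) : Hom M (Fo PS n) (Fo G n)" for n by (simp add: G hom_iff)
  show "\<eta> (Pn (src al)) $$ Fa PS al = Fa G al $$ \<eta> (Pn (tgt al))" if "darr al" for al using N.\<eta>_nat[of "Pn_act al"] Pn_act[OF that] that by (simp add: G)
 qed
 have eW: "?e : Weq T'" using T'(2) earr \<eta>W unfolding level_equivalences_def by auto
 obtain ci ti where f: "ci : Cof T'" "ti : Fib T'" "ti : Weq T'" "ci : Arr sC" "ti : Arr sC" "Dom sC ci = Dom sC ?e" "Cod sC ti = Cod sC ?e"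
  "Cod sC ci = Dom sC ti" "Cmp sC ti ci = ?e" by (rule S.factor_cof_tfib[OF earr])
 define H where "H = Cod sC ci"
 have "ci : Hom sC PS H" "ti : Hom sC H G" using f by (simp_all add: Hom_def H_def)
 then obtain c t where ct: "ci = (PS, c, H)" "(PS, c, H) : Arr sC" "ti = (H, t, G)" "(H, t, G) : Arr sC" by (metis sarr_cases)
 have cW: "ci : Weq T'" using S.W_cancel_left[of ci ti] f eW by simp
 have PF: "fibrant sC (Fib T') PS" using T'(4) PS_obj PS_homotopically_constant PS_reedy_fibrant by blast
 have "EX h:Hom sC (Cod sC ci) PS. Cmp sC h ci = Idt sC PS"
  by (rule S.fibrant_extend[OF PF f(1) cW]) (use S.id_hom[OF PS_obj] f(6) in simp)
 then obtain ri where r: "ri : Hom sC H PS" "Cmp sC ri ci = Idt sC PS" unfolding H_def by blast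
 obtain rh where rh: "ri = (H, rh, PS)" "(H, rh, PS) : Arr sC" using r(1) by (rule sarr_cases)
 interpret R: resolution M T E F L \<eta> H G c t rh
 proof
  show "t n $$ c n = \<eta> (Pn n)" "rh n $$ c n = Idt M (Pn n)" for n
  using f(9) r(2) unfolding ct(1,3) rh(1) by (simp_all add: fun_eq_iff)
  show "lifts sC i (H, t, G)" if "i : reedy_cofibrations M T" for i using S.lift_axiom[of i ti] f(2,3) that T'(3) ct(3) by simp
 qed (use G ct rh in simp_all)
 show ?thesis by (rule R.pre_weq[OF A B e b be eb])
qed

section \<open>The homotopy category\<close>

context smc
begin

abbreviation zz where "zz \<equiv> zigzag_eq M W"

lemma zigzag_append: "zigzag M W X zs Y ==> zigzag M W Y ys Z ==> zigzag M W X (zs @ ys) Z"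
 by (induction rule: zigzag.induct) (auto intro: zigzag.intros)

lemma zigzag_ends: "zigzag M W X zs Y ==> X : Obj M & Y : Obj M"
 by (induction rule: zigzag.induct) (auto simp: hom_iff)

lemma zigzag_single: "f : Hom M X Y ==> zigzag M W X [Fwd f] Y" "w : W ==> w : Hom M X Y ==> zigzag M W Y [Bwd w] X"
 by (auto simp: hom_iff intro!: zigzag.intros)

lemma zigzag_eq_typed: "zz X Y zs zs' ==> zigzag M W X zs Y & zigzag M W X zs' Y"
proof (induction rule: zigzag_eq.induct)
 case (zz_app X Y zs zs' Z ys ys')
 thus ?case using zigzag_append by blast
next
 case (zz_comp f X Y g Z)
 thus ?case using comp_hom by (auto simp: hom_iff intro!: zigzag.intros)
qed (auto simp: hom_iff intro!: zigzag.intros)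

lemma zz_context: "zz Y Z b b' ==> zigzag M W X a Y ==> zigzag M W Z c V ==> zz X V (a @ b @ c) (a @ b' @ c)"
 by (rule zz_app[OF zz_refl zz_app[OF _ zz_refl]])

lemmas [trans] = zz_trans

definition heq :: "'a => 'a => bool" where
 "heq f g \<longleftrightarrow> arr f & arr g & dom g = dom f & cod g = cod f & zz (dom f) (cod f) [Fwd f] [Fwd g]"

lemma heq_refl: "arr f ==> heq f f"
 unfolding heq_def using zz_refl[OF zigzag_single(1)[of f "dom f" "cod f"]] by (simp add: hom_iff)

lemma heq_sym: "heq f g ==> heq g f" unfolding heq_def using zz_sym by metis

lemma heq_trans [trans]: "heq f g ==> heq g h ==> heq f h" unfolding heq_def using zz_trans by metis

lemma zz_split: "arr f ==> arr g ==> cod f = dom g ==> zz (dom f) (cod g) [Fwd (g $$ f)] ([Fwd f] @ [Fwd g])"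
 using zz_sym[OF zz_comp[of f M "dom f" "cod f" g "cod g" W]] by (simp add: hom_iff)

lemma heq_comp:
 assumes f: "heq f f'" and g: "heq g g'" and fg: "cod f = dom g" shows "heq (g $$ f) (g' $$ f')"
proof -
 have a: "arr f" "arr f'" "arr g" "arr g'" "dom f' = dom f" "cod f' = cod f" "dom g' = dom g" "cod g' = cod g" using f g by (simp_all add: heq_def)
 have "zz (dom f) (cod g) [Fwd (g $$ f)] ([Fwd f] @ [Fwd g])" using zz_split[of f g] a fg by simp
 also have "zz (dom f) (cod g) ([Fwd f] @ [Fwd g]) ([Fwd f'] @ [Fwd g'])" using f g fg by (intro zz_app[of _ _ _ "cod f"]) (simp_all add: heq_def)
 also have "zz (dom f) (cod g) ([Fwd f'] @ [Fwd g']) [Fwd (g' $$ f')]" using zz_sym[OF zz_split[of f' g']] a fg by simp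
 finally show ?thesis using a fg by (simp add: heq_def)
qed

lemma heq_cancel_post:
 assumes v: "v : W" and f: "arr f" "arr g" "dom g = dom f" "cod f = dom v" "cod g = dom v" and e: "heq (v $$ f) (v $$ g)" shows "heq f g"
proof -
 have va: "arr v" "v : Hom M (dom v) (cod v)" using W_arr[OF v] by (simp_all add: hom_iff)
 have b: "zigzag M W (cod v) [Bwd v] (dom v)" by (rule zigzag_single(2)[OF v va(2)])
 have h: "zz (dom f) (dom v) [Fwd h] ([Fwd (v $$ h)] @ [Bwd v])" if h: "arr h" "dom h = dom f" "cod h = dom v" for h
 proof -
  have hz: "zigzag M W (dom f) [Fwd h] (dom v)" using zigzag_single(1)[of h] h by (simp add: hom_iff)
  have "zz (dom f) (dom v) ([Fwd h] @ []) ([Fwd h] @ [Fwd v, Bwd v])" by (rule zz_app[OF zz_refl[OF hz] zz_sym[OF zz_inv1[OF v va(2)]]])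
  also have "zz (dom f) (dom v) ([Fwd h] @ [Fwd v, Bwd v]) ([Fwd (v $$ h)] @ [Bwd v])"
  using zz_app[OF zz_sym[OF zz_split[of h v]] zz_refl[OF b]] h va by simp
  finally show ?thesis by simp
 qed
 have "zz (dom f) (dom v) ([Fwd (v $$ f)] @ [Bwd v]) ([Fwd (v $$ g)] @ [Bwd v])"
  using zz_app[OF _ zz_refl[OF b], of "dom f" "[Fwd (v $$ f)]" "[Fwd (v $$ g)]"] e f va by (simp add: heq_def)
 hence "zz (dom f) (dom v) [Fwd f] [Fwd g]" using h[of f] h[of g] f zz_trans zz_sym by metis
 thus ?thesis using f by (simp add: heq_def)
qed

lemma heq_cancel_pre:
 assumes v: "v : W" and f: "arr f" "arr g" "cod g = cod f" "dom f = cod v" "dom g = cod v" and e: "heq (f $$ v) (g $$ v)" shows "heq f g"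
proof -
 have va: "arr v" "v : Hom M (dom v) (cod v)" using W_arr[OF v] by (simp_all add: hom_iff)
 have b: "zigzag M W (cod v) [Bwd v] (dom v)" by (rule zigzag_single(2)[OF v va(2)])
 have h: "zz (cod v) (cod f) [Fwd h] ([Bwd v] @ [Fwd (h $$ v)])" if h: "arr h" "dom h = cod v" "cod h = cod f" for h
 proof -
  have hz: "zigzag M W (cod v) [Fwd h] (cod f)" using zigzag_single(1)[of h] h by (simp add: hom_iff)
  have "zz (cod v) (cod f) ([] @ [Fwd h]) ([Bwd v, Fwd v] @ [Fwd h])" by (rule zz_app[OF zz_sym[OF zz_inv2[OF v va(2)]] zz_refl[OF hz]])
  also have "zz (cod v) (cod f) ([Bwd v, Fwd v] @ [Fwd h]) ([Bwd v] @ [Fwd (h $$ v)])"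
  using zz_app[OF zz_refl[OF b] zz_sym[OF zz_split[of v h]]] h va by simp
  finally show ?thesis by simp
 qed
 have "zz (cod v) (cod f) ([Bwd v] @ [Fwd (f $$ v)]) ([Bwd v] @ [Fwd (g $$ v)])"
  using zz_app[OF zz_refl[OF b], of "cod f" "[Fwd (f $$ v)]" "[Fwd (g $$ v)]"] e f va by (simp add: heq_def)
 hence "zz (cod v) (cod f) [Fwd f] [Fwd g]" using h[of f] h[of g] f zz_trans zz_sym by metis
 thus ?thesis using f by (simp add: heq_def)
qed

definition hmt :: "'o => 'a => 'a => bool" where
 "hmt Y u u' \<longleftrightarrow> arr u & arr u' & dom u' = dom u & cod u = Y & cod u' = Y & same_component (Map (dom u) Y) (SArr E u) (SArr E u')"

lemma hmt_refl: "arr u ==> cod u = Y ==> hmt Y u u" by (simp add: hmt_def)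
lemma hmt_sym: "hmt Y u v ==> hmt Y v u" unfolding hmt_def using same_component_sym by metis
lemma hmt_trans: "hmt Y u v ==> hmt Y v w ==> hmt Y u w" unfolding hmt_def using same_component_trans by metis
lemma hmt_arr: "hmt Y u v ==> arr u & arr v & dom v = dom u & cod u = Y & cod v = Y" by (simp add: hmt_def)

lemma hmt_pre: assumes h: "hmt Y u v" and f: "arr f" "cod f = dom u" shows "hmt Y (u $$ f) (v $$ f)"
proof -
 have Y: "Y : Obj M" using h by (auto simp: hmt_def)
 show ?thesis using same_component_map[OF pre_map[OF f(1) Y], of "SArr E u" "SArr E v"] h f by (simp add: hmt_def pre_SArr)
qed

lemma hmt_post: assumes h: "hmt Y u v" and f: "arr f" "dom f = Y" shows "hmt (cod f) (f $$ u) (f $$ v)"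
proof -
 have A: "dom u : Obj M" using h by (auto simp: hmt_def)
 show ?thesis using same_component_map[OF post_map[OF f(1) A], of "SArr E u" "SArr E v"] h f by (simp add: hmt_def post_SArr)
qed

text \<open>Maps in the same component of a mapping space into a fibrant object factor through the two evaluations of its path
 object, which agree in the homotopy category since the degeneracy is a section of both.\<close>

lemma hmt_heq:
 assumes Y: "fibrant_obj Y" and h: "hmt Y u v" shows "heq u v & (u : W \<longleftrightarrow> v : W)"
proof -
 interpret path_objects M T E Y by unfold_locales (rule Y)
 obtain k where k: "k : Hom M (Pn 0) Y" "k : W" "us 0 = SArr E k" using vertex_iso by blast
 have ka: "arr k" "dom k = Pn 0" "cod k = Y" using k by (simp_all add: hom_iff)
 let ?ev = "%i. k $$ Pn_act (dconst 0 i 1)" and ?s = "Pn_act (dconst 1 0 0)"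
 have pa: "arr (Pn_act (dconst 0 i 1))" "dom (Pn_act (dconst 0 i 1)) = Pn 1" "cod (Pn_act (dconst 0 i 1)) = Pn 0" "Pn_act (dconst 0 i 1) : W" if "i <= 1" for i
  using Pn_act[of "dconst 0 i 1"] Pn_act_weq[of "dconst 0 i 1"] that by simp_all
 have sa: "arr ?s" "dom ?s = Pn 0" "cod ?s = Pn 1" "?s : W" using Pn_act[of "dconst 1 0 0"] Pn_act_weq[of "dconst 1 0 0"] by simp_all
 have ev: "arr (?ev i)" "dom (?ev i) = Pn 1" "cod (?ev i) = Y" "?ev i : W" "?ev i $$ ?s = k" if i: "i <= 1" for i
 proof -
  show "arr (?ev i)" "dom (?ev i) = Pn 1" "cod (?ev i) = Y" "?ev i : W"
  using pa[OF i] ka W_comp[of "Pn_act (dconst 0 i 1)" k] k(2) by simp_all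
  have "dconst 0 0 0 = did 0" by (rule darr_eqI) auto
  hence "Pn_act (dconst 0 i 1) $$ ?s = Idt M (Pn 0)" using Pn_act_comp[of "dconst 0 i 1" "dconst 1 0 0"] Pn_act_id[of 0] i by simp
  thus "?ev i $$ ?s = k" using comp_assoc[of ?s "Pn_act (dconst 0 i 1)" k] pa[OF i] sa ka by simp
 qed
 have e01: "heq (?ev 0) (?ev 1)" by (rule heq_cancel_pre[OF sa(4)]) (use ev[of 0] ev[of 1] sa heq_refl[OF ka(1)] in simp_all)
 have edge: "heq u v & (u : W \<longleftrightarrow> v : W)"
  if u: "u : Hom M P Y" "v : Hom M P Y" and d: "edge (Map P Y) d (SArr E u) (SArr E v)" for u v d P
 proof -
  have P: "P : Obj M" using u by (auto simp: hom_iff)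
  have dS: "d : Simp (Map P Y) 1" and dv: "vtx (Map P Y) 1 0 d = SArr E u" "vtx (Map P Y) 1 1 d = SArr E v" using d by (simp_all add: edge_def)
  obtain g where g: "g : Hom M P (Pn 1)" "pre g Y 1 (us 1) = d" using classify[OF P dS] by blast
  have ga: "arr g" "dom g = P" "cod g = Pn 1" using g by (simp_all add: hom_iff)
  have ends: "SArr E (?ev i $$ g) = vtx (Map P Y) 1 i d" if i: "i <= 1" for i
  proof -
  have "SArr E (?ev i $$ g) = pre (Pn_act (dconst 0 i 1) $$ g) Y 0 (us 0)"
  using k(3) pre_SArr[of "Pn_act (dconst 0 i 1) $$ g" k Y] comp_assoc[of g "Pn_act (dconst 0 i 1)" k] pa[OF i] ka ga by simp
  also have "... = vtx (Map P Y) 1 i d" using pre_Pn_act[of "dconst 0 i 1" g] ga g(2) i by (simp add: vtx_def)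
  finally show ?thesis .
  qed
  have ev0: "?ev 0 $$ g : Hom M P Y" "?ev 1 $$ g : Hom M P Y" using ev(1-3)[of 0] ev(1-3)[of 1] ga by (simp_all add: hom_iff)
  have uv: "u = ?ev 0 $$ g" "v = ?ev 1 $$ g"
  using SArr_inj[OF u(1) ev0(1)] SArr_inj[OF u(2) ev0(2)] ends[of 0] ends[of 1] dv by simp_all
  have "heq u v" unfolding uv by (rule heq_comp[OF heq_refl[OF ga(1)] e01]) (use ev(2)[of 0] ga in simp)
  moreover have "?ev i $$ g : W \<longleftrightarrow> g : W" if i: "i <= 1" for i
  using W_comp[of g "?ev i"] W_cancel_left[of g "?ev i"] ev[OF i] ga by auto
  hence "u : W \<longleftrightarrow> v : W" unfolding uv by simp
  ultimately show ?thesis ..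
 qed
 let ?P = "dom u"
 have O: "?P : Obj M" "Y : Obj M" using h by (auto simp: hmt_def)
 have u: "u : Hom M ?P Y" "v : Hom M ?P Y" and s: "same_component (Map ?P Y) (SArr E u) (SArr E v)" using h by (simp_all add: hmt_def hom_iff)
 have "ALL z. z : Hom M ?P Y --> x = SArr E z --> heq u z & (u : W \<longleftrightarrow> z : W)" if "same_component (Map ?P Y) (SArr E u) x" for x
  using that
 proof (induction rule: same_component_induct)
  case refl
  show ?case using SArr_inj[OF u(1)] heq_refl[of u] u(1) by (auto simp: hom_iff)
 next
  case (step c d)
  obtain e where e: "edge (Map ?P Y) e c d \<or> edge (Map ?P Y) e d c" using step(2) by blast
  have "c : Simp (Map ?P Y) 0" using e edge_verts[OF Map_sset[OF O]] by blast
  then obtain x where x: "x : Hom M ?P Y" "c = SArr E x" using SArr_surj[OF O] by blast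
  show ?case
  proof (intro allI impI)
  fix z assume z: "z : Hom M ?P Y" "d = SArr E z"
  have "heq x z & (x : W \<longleftrightarrow> z : W)" using e unfolding x(2) z(2) using edge[OF x(1) z(1)] edge[OF z(1) x(1)] heq_sym by blast
  thus "heq u z & (u : W \<longleftrightarrow> z : W)" using step(3) x heq_trans by blast
  qed
 qed
 thus ?thesis using s u(2) by blast
qed

text \<open>\<open>hbij w\<close>: composition with \<open>w\<close> is bijective on homotopy classes of maps into every fibrant object.\<close>

definition hbij :: "'a => bool" where
 "hbij w \<longleftrightarrow> arr w & (ALL Y. fibrant_obj Y -->
  (ALL u:Hom M (cod w) Y. ALL v:Hom M (cod w) Y. hmt Y (u $$ w) (v $$ w) --> hmt Y u v) &
  (ALL u:Hom M (dom w) Y. EX v:Hom M (cod w) Y. hmt Y (v $$ w) u))"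

lemma hbijD:
 assumes "hbij w" "fibrant_obj Y"
 shows "u : Hom M (cod w) Y ==> v : Hom M (cod w) Y ==> hmt Y (u $$ w) (v $$ w) ==> hmt Y u v"
  "u : Hom M (dom w) Y ==> EX v:Hom M (cod w) Y. hmt Y (v $$ w) u"
 using assms unfolding hbij_def by blast+

lemma hbij_tcof: assumes j: "j : Cof T" "j : W" shows "hbij j"
 unfolding hbij_def
proof (intro conjI allI impI ballI)
 show ja: "arr j" by (rule Cof_arr[OF j(1)])
 fix Y assume Y: "fibrant_obj Y"
 have YO: "Y : Obj M" using Y by (rule fibrant_obj)
 {
  fix u v assume u: "u : Hom M (cod j) Y" and v: "v : Hom M (cod j) Y" and h: "hmt Y (u $$ j) (v $$ j)"
  have ua: "arr u" "dom u = cod j" "cod u = Y" "arr v" "dom v = cod j" "cod v = Y" using u v by (simp_all add: hom_iff)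
  have "same_component (Map (dom j) Y) (pre j Y 0 (SArr E u)) (SArr E (v $$ j))" using h ua ja by (simp add: hmt_def pre_SArr)
  then obtain x where x: "x : Simp (Map (cod j) Y) 0" "same_component (Map (cod j) Y) (SArr E u) x" "pre j Y 0 x = SArr E (v $$ j)"
  using kan_lift_component[OF kan_pre(1)[OF j(1) Y] Map_sset Map_sset, of "SArr E u"] ua ja YO by auto
  have "same_component (Map (cod j) Y) x (SArr E v)"
  by (rule kan_pre(2)[OF j(1) Y j(2) x(1)]) (use x(3) ua ja in \<open>simp_all add: pre_SArr\<close>)
  thus "hmt Y u v" using same_component_trans[OF x(2)] ua by (simp add: hmt_def)
 next
  fix u assume u: "u : Hom M (dom j) Y"
  then obtain h where "h : Hom M (cod j) Y" "h $$ j = u" using fibrant_extend[OF Y j u] by blast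
  thus "EX v:Hom M (cod j) Y. hmt Y (v $$ j) u" using hmt_refl[of u Y] u by (auto simp: hom_iff)
 }
qed

lemma hbij_comp:
 assumes f: "hbij f" and g: "hbij g" and fg: "cod f = dom g" shows "hbij (g $$ f)"
 unfolding hbij_def
proof (intro conjI allI impI ballI)
 have a: "arr f" "arr g" using f g by (simp_all add: hbij_def)
 note d = comp_simps[OF a fg]
 show "arr (g $$ f)" by (rule d)
 fix Y assume Y: "fibrant_obj Y"
 have as: "u $$ g $$ f = (u $$ g) $$ f" "u $$ g : Hom M (cod f) Y" if "u : Hom M (cod g) Y" for u
  using that a fg by (simp_all add: hom_iff comp_assoc)
 {
  fix u v assume u: "u : Hom M (cod (g $$ f)) Y" "v : Hom M (cod (g $$ f)) Y" and h: "hmt Y (u $$ g $$ f) (v $$ g $$ f)"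
  hence u': "u : Hom M (cod g) Y" "v : Hom M (cod g) Y" using d by simp_all
  have "hmt Y (u $$ g) (v $$ g)" by (rule hbijD(1)[OF f Y as(2)[OF u'(1)] as(2)[OF u'(2)]]) (use h as(1)[OF u'(1)] as(1)[OF u'(2)] in simp)
  thus "hmt Y u v" by (rule hbijD(1)[OF g Y u'])
 next
  fix u assume "u : Hom M (dom (g $$ f)) Y"
  then obtain v where v: "v : Hom M (cod f) Y" "hmt Y (v $$ f) u" using hbijD(2)[OF f Y] d by auto
  obtain w where w: "w : Hom M (cod g) Y" "hmt Y (w $$ g) v" using hbijD(2)[OF g Y, of v] v(1) fg by auto
  have "hmt Y ((w $$ g) $$ f) (v $$ f)" by (rule hmt_pre[OF w(2) a(1)]) (use w(1) a fg in \<open>simp add: hom_iff\<close>)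
  hence "hmt Y (w $$ g $$ f) u" using hmt_trans v(2) as(1)[OF w(1)] by simp
  thus "EX v:Hom M (cod (g $$ f)) Y. hmt Y (v $$ g $$ f) u" using w(1) d by auto
 }
qed

lemma hbij_cancel:
 assumes f: "hbij f" and gf: "hbij (g $$ f)" and g: "arr g" "cod f = dom g" shows "hbij g"
 unfolding hbij_def
proof (intro conjI allI impI ballI g(1))
 have a: "arr f" using f by (simp add: hbij_def)
 note d = comp_simps[OF a g]
 fix Y assume Y: "fibrant_obj Y"
 have as: "u $$ g $$ f = (u $$ g) $$ f" if "u : Hom M (cod g) Y" for u using that a g by (simp add: hom_iff comp_assoc)
 {
  fix u v assume u: "u : Hom M (cod g) Y" "v : Hom M (cod g) Y" and h: "hmt Y (u $$ g) (v $$ g)"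
  have "hmt Y (u $$ g $$ f) (v $$ g $$ f)" unfolding as[OF u(1)] as[OF u(2)] by (rule hmt_pre[OF h a]) (use u g in \<open>simp add: hom_iff\<close>)
  thus "hmt Y u v" using hbijD(1)[OF gf Y, of u v] u d by simp
 next
  fix u assume u: "u : Hom M (dom g) Y"
  hence "u $$ f : Hom M (dom (g $$ f)) Y" using a g d by (simp add: hom_iff)
  from hbijD(2)[OF gf Y this] obtain v where v: "v : Hom M (cod g) Y" "hmt Y (v $$ g $$ f) (u $$ f)" using d by auto
  have "hmt Y (v $$ g) u" by (rule hbijD(1)[OF f Y]) (use v u g as[OF v(1)] in \<open>simp_all add: hom_iff\<close>)
  thus "EX v:Hom M (cod g) Y. hmt Y (v $$ g) u" using v(1) by blast
 }
qed

lemma hbij_id: assumes "X : Obj M" shows "hbij (Idt M X)"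
 unfolding hbij_def
proof (intro conjI allI impI ballI)
 fix Y u assume "u : Hom M (dom (Idt M X)) Y"
 thus "EX v:Hom M (cod (Idt M X)) Y. hmt Y (v $$ Idt M X) u" using assms hmt_refl[of u Y] by (intro bexI[of _ u]) (auto simp: hom_iff)
qed (use assms in \<open>auto simp: hom_iff\<close>)

text \<open>Ken Brown's lemma: the mapping cylinder factors a weak equivalence between cofibrant objects into a trivial cofibration and a
 retraction of a trivial cofibration.\<close>

lemma hbij_weq:
 assumes A: "cofibrant_obj (dom w)" and B: "cofibrant_obj (cod w)" and w: "w : W" shows "hbij w"
proof -
 have wa: "arr w" by (rule W_arr[OF w])
 let ?X = "%i. if i then dom w else cod w"
 have "EX c io. is_coproduct M (UNIV :: bool set) ?X c io"
  by (rule coproduct_exists[OF _ small_finite[OF univ]]) (use model wa in \<open>simp_all add: model_category_def\<close>)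
 then obtain c io where c: "is_coproduct M (UNIV :: bool set) ?X c io" by blast
 have io: "arr (io i)" "dom (io i) = ?X i" "cod (io i) = c" for i using coproductD(2)[OF c, of i] by (simp_all add: hom_iff)
 have "(if i then w else Idt M (cod w)) : Hom M (?X i) (cod w)" for i using wa by (simp add: hom_iff)
 hence "EX h:Hom M c (cod w). ALL i:UNIV. h $$ io i = (if i then w else Idt M (cod w))"
  by (intro coproductD(3)[OF c]) (use wa in simp_all)
 then obtain f where f0: "f : Hom M c (cod w)" "ALL i:UNIV. f $$ io i = (if i then w else Idt M (cod w))" by blast
 have f: "f : Hom M c (cod w)" "f $$ io True = w" "f $$ io False = Idt M (cod w)"
  using f0(1) bspec[OF f0(2), of True] bspec[OF f0(2), of False] by simp_all
 have fa: "arr f" "dom f = c" "cod f = cod w" using f by (simp_all add: hom_iff)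
 obtain j p where jp: "j : Cof T" "p : Fib T" "p : W" "arr j" "arr p" "dom j = dom f" "cod p = cod f" "cod j = dom p" "p $$ j = f"
  by (rule factor_cof_tfib[OF fa(1)])
 have leg: "j $$ io i : Cof T" for i
 proof (rule Cof_if_lifts)
  show "arr (j $$ io i)" using io jp fa by simp
  fix q assume q: "q : Fib T" "q : W"
  have qa: "arr q" by (rule Fib_arr[OF q(1)])
  have cofX: "cofibrant_obj (?X i)" for i using A B by simp
  have "lifts M (io i) q" unfolding lifts_def
  proof (intro allI impI)
  fix u v assume *: "u : Hom M (dom (io i)) (dom q) & v : Hom M (cod (io i)) (cod q) & q $$ u = v $$ io i"
  hence va: "arr v" "dom v = c" "cod v = cod q" using io by (simp_all add: hom_iff)
  have "EX w:Hom M (?X k) (dom q). q $$ w = v $$ io k" for k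
  by (rule cofibrant_lift[OF cofX q]) (use va io in \<open>simp add: hom_iff\<close>)
  then obtain l where l: "!!k. l k : Hom M (?X k) (dom q)" "!!k. q $$ l k = v $$ io k" by metis
  let ?g = "%k. if k = i then u else l k"
  have g: "?g k : Hom M (?X k) (dom q)" "q $$ ?g k = v $$ io k" for k using l[of k] * io(2)[of i] by (auto simp del: if_split_asm)
  obtain h where h: "h : Hom M c (dom q)" "ALL k:UNIV. h $$ io k = ?g k" using coproductD(3)[OF c, of "dom q" ?g] g(1) qa by auto
  have "q $$ h = v"
  by (rule coproduct_ext[OF c, of _ "cod q"]) (use h g(2) va qa io in \<open>simp_all add: hom_iff comp_assoc\<close>)
  moreover have "h $$ io i = u" using h(2) by simp
  ultimately show "EX h:Hom M (cod (io i)) (dom q). h $$ io i = u & q $$ h = v" using h(1) io(3) by auto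
  qed
  moreover have "lifts M j q" using lift_axiom[OF jp(1) q(1)] q(2) by blast
  ultimately show "lifts M (j $$ io i) q" using io jp fa qa by (intro lifts_comp) simp_all
 qed
 have pl: "p $$ j $$ io i = f $$ io i" for i using comp_assoc[of "io i" j p] io jp fa by simp
 have la: "arr (j $$ io i)" "dom (j $$ io i) = ?X i" "cod (j $$ io i) = dom p" for i using io jp fa by simp_all
 have lW: "j $$ io i : W" for i
  using W_cancel_left[of "j $$ io i" p] la[of i] jp pl[of i] f w id_W[of "cod w"] wa by (cases i) simp_all
 note lb = hbij_tcof[OF leg lW]
 have "hbij (p $$ j $$ io False)" unfolding pl f(3) using hbij_id[of "cod w"] wa by simp
 hence "hbij p" using hbij_cancel[OF lb[of False], of p] jp la[of False] by simp
 hence "hbij (p $$ j $$ io True)" using hbij_comp[OF lb[of True], of p] la[of True] by simp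
 thus ?thesis unfolding pl f(2) .
qed

text \<open>A map that is bijective on homotopy classes is a weak equivalence: after replacing it by a fibration between fibrant
 objects, it has a section up to homotopy, hence a section, and is a retract of a map homotopic to the identity.\<close>

lemma hbij_imp_weq:
 assumes t: "terminal M t" and B: "cofibrant_obj (cod g)" and g: "hbij g" shows "g : W"
proof -
 have fib: "k : W" if k: "hbij k" and Y: "cofibrant_obj (cod k)" "fibrant_obj (cod k)" for k
 proof -
  let ?Y = "cod k"
  have ka: "arr k" using k by (simp add: hbij_def)
  obtain i p where ip: "i : Cof T" "i : W" "p : Fib T" "arr i" "arr p" "dom i = dom k" "cod p = cod k" "cod i = dom p" "p $$ i = k"
  by (rule factor_tcof_fib[OF ka])
  let ?Z = "dom p"
  have Z: "fibrant_obj ?Z" by (rule fibrant_dom[OF Y(2) ip(3)]) (use ip in simp)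
  have O: "?Z : Obj M" "?Y : Obj M" using ip(5) ka by simp_all
  have p: "hbij p" using hbij_cancel[OF hbij_tcof[OF ip(1,2)], of p] k ip by simp
  obtain m where m: "m : Hom M ?Y ?Z" "hmt ?Z (m $$ p) (Idt M ?Z)" using hbijD(2)[OF p Z, of "Idt M ?Z"] O ip(7) by (auto simp: hom_iff)
  have ma: "arr m" "dom m = ?Y" "cod m = ?Z" using m by (simp_all add: hom_iff)
  have "hmt ?Y (p $$ (m $$ p)) (p $$ Idt M ?Z)" using hmt_post[OF m(2), of p] ip(5,7) by simp
  hence "hmt ?Y ((p $$ m) $$ p) (Idt M ?Y $$ p)" using ma ip(5,7) by (simp add: comp_assoc)
  hence pm: "hmt ?Y (p $$ m) (Idt M ?Y)" using hbijD(1)[OF p Y(2), of "p $$ m" "Idt M ?Y"] ma ip(5,7) O by (simp add: hom_iff)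
  hence "same_component (Map ?Y ?Y) (post ?Y p 0 (SArr E m)) (SArr E (Idt M ?Y))" using ma ip(5,7) by (simp add: hmt_def post_SArr)
  then obtain x where x: "x : Simp (Map ?Y ?Z) 0" "same_component (Map ?Y ?Z) (SArr E m) x" "post ?Y p 0 x = SArr E (Idt M ?Y)"
  using kan_lift_component[OF kan_post[OF ip(3) Y(1)] Map_sset Map_sset, of "SArr E m"] ma ip(7) O by auto
  obtain n where n: "n : Hom M ?Y ?Z" "x = SArr E n" using SArr_surj[OF O(2,1) x(1)] by blast
  have na: "arr n" "dom n = ?Y" "cod n = ?Z" using n by (simp_all add: hom_iff)
  have pn: "p $$ n = Idt M ?Y"
  by (rule SArr_inj[of _ ?Y ?Y]) (use x(3) n(2) na ip(5,7) O post_SArr[of n p ?Y] in \<open>simp_all add: hom_iff\<close>)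
  have "hmt ?Z m n" using x(2) n(2) ma na by (simp add: hmt_def)
  from hmt_pre[OF this ip(5)] have "hmt ?Z (m $$ p) (n $$ p)" using ma ip(7) by simp
  hence "hmt ?Z (Idt M ?Z) (n $$ p)" using m(2) hmt_sym hmt_trans by blast
  hence nW: "n $$ p : W" using hmt_heq[OF Z] id_W[OF O(1)] by blast
  have "is_retract M p (n $$ p)" unfolding is_retract_def
  by (rule conjI[OF _ conjI], rule ip(5), use na ip(5,7) in simp,
  rule exI[of _ "Idt M ?Z"], rule exI[of _ n], rule exI[of _ "Idt M ?Z"], rule exI[of _ p])
  (use na ip(5,7) O pn comp_assoc[of p n p] in \<open>simp add: hom_iff\<close>)
  hence "p : W" using retracts(1) nW unfolding retract_closed_def by blast
  thus ?thesis using W_comp[of i p] ip by simp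
 qed
 have ga: "arr g" using g by (simp add: hbij_def)
 have rep: "EX j. j : Cof T & j : W & arr j & dom j = X & fibrant_obj (cod j)" if X: "X : Obj M" for X
 proof -
  obtain f where f: "f : Hom M X t" using t X unfolding terminal_def by blast
  hence fa: "arr f" "dom f = X" "cod f = t" by (simp_all add: hom_iff)
  obtain i p where ip: "i : Cof T" "i : W" "p : Fib T" "arr i" "arr p" "dom i = dom f" "cod p = cod f" "cod i = dom p" "p $$ i = f"
  by (rule factor_tcof_fib[OF fa(1)])
  have "fibrant_obj (cod i)" unfolding fibrant_def using ip t fa by (auto simp: hom_iff intro!: exI[of _ t] bexI[of _ p])
  thus ?thesis using ip fa by blast
 qed
 obtain j where j: "j : Cof T" "j : W" "arr j" "dom j = dom g" "fibrant_obj (cod j)" using rep[of "dom g"] ga by auto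
 obtain l where l: "l : Cof T" "l : W" "arr l" "dom l = cod g" "fibrant_obj (cod l)" using rep[of "cod g"] ga by auto
 obtain k where k: "k : Hom M (cod j) (cod l)" "k $$ j = l $$ g"
  using fibrant_extend[OF l(5) j(1,2), of "l $$ g"] j l ga by (auto simp: hom_iff)
 have ka: "arr k" "dom k = cod j" "cod k = cod l" using k by (simp_all add: hom_iff)
 have "hbij (k $$ j)" unfolding k(2) using hbij_comp[OF g hbij_tcof[OF l(1,2)]] l by simp
 hence "hbij k" using hbij_cancel[OF hbij_tcof[OF j(1,2)], of k] ka by simp
 hence "k : W" using fib[of k] cofibrant_cod[OF B l(1,4)] l(5) ka by simp
 hence "l $$ g : W" using W_comp[of j k] j ka k(2) by simp
 thus ?thesis using W_cancel_left[of g l] l ga by simp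
qed

end

section \<open>Homotopy classes as a functor on the homotopy category\<close>

locale approximations = smc M T E
 for M :: "('o, 'a) category" and T :: "'a model_structure" and E :: "('o, 'a, 'u) simplicial_enrichment" +
 fixes Q R :: "('o, 'a, 'o, 'a) cfunctor" and q r :: "'o => 'a"
 assumes Q: "functorial_cofibrant_approximation M T Q q" and R: "functorial_fibrant_approximation M T R r"
begin

lemma Q_functor: "is_functor M M Q" using Q unfolding functorial_cofibrant_approximation_def by blast

lemma Q_hom: "f : Hom M X Y ==> Fa Q f : Hom M (Fo Q X) (Fo Q Y)" using Q_functor unfolding is_functor_def by blast

lemma Q_simps [simp]: assumes "arr f" shows "arr (Fa Q f)" "dom (Fa Q f) = Fo Q (dom f)" "cod (Fa Q f) = Fo Q (cod f)"
 using Q_hom[of f "dom f" "cod f"] assms by (simp_all add: hom_iff)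

lemma Q_id: "X : Obj M ==> Fa Q (Idt M X) = Idt M (Fo Q X)" using Q_functor unfolding is_functor_def by blast

lemma Q_comp: assumes "arr f" "arr g" "cod f = dom g" shows "Fa Q (g $$ f) = Fa Q g $$ Fa Q f"
proof -
 have "ALL X Y Z f g. f : Hom M X Y & g : Hom M Y Z --> Fa Q (g $$ f) = Fa Q g $$ Fa Q f" using Q_functor unfolding is_functor_def by blast
 from this[rule_format, of f "dom f" "cod f" g "cod g"] show ?thesis using assms by (simp add: hom_iff)
qed

lemma Q_cof: "X : Obj M ==> cofibrant_obj (Fo Q X)" and q_W: "X : Obj M ==> q X : W"
 using Q unfolding functorial_cofibrant_approximation_def by blast+

lemma q_simps [simp]: assumes "X : Obj M" shows "arr (q X)" "dom (q X) = Fo Q X" "cod (q X) = X" "Fo Q X : Obj M"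
proof -
 show "arr (q X)" "dom (q X) = Fo Q X" "cod (q X) = X"
  using Q assms unfolding functorial_cofibrant_approximation_def nat_trans_def by (simp_all add: hom_iff id_functor_def)
 show "Fo Q X : Obj M" using cofibrant_obj[OF Q_cof[OF assms]] .
qed

lemma q_nat: assumes "arr f" shows "q (cod f) $$ Fa Q f = f $$ q (dom f)"
proof -
 have "ALL X Y f. f : Hom M X Y --> q Y $$ Fa Q f = f $$ q X"
  using Q unfolding functorial_cofibrant_approximation_def nat_trans_def id_functor_def by (elim conjE) simp
 from this[rule_format, of f "dom f" "cod f"] show ?thesis using assms by (simp add: hom_iff id_functor_def)
qed

lemma Q_W: assumes w: "w : W" shows "Fa Q w : W"
proof -
 have wa: "arr w" by (rule W_arr[OF w])
 have "w $$ q (dom w) : W" using W_comp[of "q (dom w)" w] w wa q_W[of "dom w"] by simp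
 thus ?thesis using W_cancel_left[of "Fa Q w" "q (cod w)"] q_nat[OF wa] wa q_W[of "cod w"] by simp
qed

lemma Q_hbij: "w : W ==> hbij (Fa Q w)"
 using hbij_weq[OF _ _ Q_W] Q_cof W_arr[of w] by simp

lemma R_fib: "X : Obj M ==> fibrant_obj (Fo R X)" and r_W: "X : Obj M ==> r X : W"
 using R unfolding functorial_fibrant_approximation_def by blast+

text \<open>A zigzag from \<open>X\<close> to \<open>Z\<close> acts contravariantly on maps into a fibrant object \<open>Y\<close>, as a relation between maps \<open>Q Z \<rightarrow> Y\<close> and
 maps \<open>Q X \<rightarrow> Y\<close> that is bijective on homotopy classes on the backward steps. Equivalent zigzags act in the same way.\<close>

primrec zrel :: "'o => 'a zig list => 'a => 'a => bool" where
 "zrel Y [] u v = hmt Y u v"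
| "zrel Y (z # zs) u v = (EX x. zrel Y zs u x & (case z of
  Fwd f => arr f & dom x = Fo Q (cod f) & hmt Y v (x $$ Fa Q f)
  | Bwd w => w : W & arr v & cod v = Y & dom v = Fo Q (cod w) & hmt Y (v $$ Fa Q w) x))"

lemma zrel_arr: "zrel Y zs u v ==> arr u & arr v & cod u = Y & cod v = Y"
proof (induction zs arbitrary: v)
 case (Cons z zs)
 then obtain x where x: "zrel Y zs u x" "case z of Fwd f => arr f & dom x = Fo Q (cod f) & hmt Y v (x $$ Fa Q f)
  | Bwd w => w : W & arr v & cod v = Y & dom v = Fo Q (cod w) & hmt Y (v $$ Fa Q w) x" by auto
 thus ?case using Cons.IH[OF x(1)] hmt_arr by (cases z) (auto dest: hmt_arr)
qed (auto dest: hmt_arr)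

lemma zrel_dom: "zigzag M W X zs Z ==> zrel Y zs u v ==> dom u = Fo Q Z ==> dom v = Fo Q X"
proof (induction arbitrary: v rule: zigzag.induct)
 case (zigzag_Nil X)
 thus ?case using hmt_arr[of Y u v] by simp
next
 case (zigzag_Fwd f X X' zs Z)
 from zigzag_Fwd(4) obtain x where x: "zrel Y zs u x" "arr f" "dom x = Fo Q (cod f)" "hmt Y v (x $$ Fa Q f)" by auto
 thus ?case using zigzag_Fwd(1) hmt_arr[OF x(4)] zrel_arr[OF x(1)] by (simp add: hom_iff)
next
 case (zigzag_Bwd w X' X zs Z)
 thus ?case by (auto simp: hom_iff)
qed

lemma zrel_left: "zrel Y zs u v ==> hmt Y u u' ==> zrel Y zs u' v"
proof (induction zs arbitrary: v)
 case Nil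
 thus ?case using hmt_sym hmt_trans by (metis zrel.simps(1))
next
 case (Cons z zs)
 from Cons.prems(1) show ?case using Cons.IH[OF _ Cons.prems(2)] unfolding zrel.simps by blast
qed

lemma zrel_right: assumes "zrel Y zs u v" "hmt Y v v'" shows "zrel Y zs u v'"
proof (cases zs)
 case Nil
 thus ?thesis using assms hmt_trans by (metis zrel.simps(1))
next
 case (Cons z ys)
 from assms(1)[unfolded Cons] obtain x where x: "zrel Y ys u x" "case z of Fwd f => arr f & dom x = Fo Q (cod f) & hmt Y v (x $$ Fa Q f)
  | Bwd w => w : W & arr v & cod v = Y & dom v = Fo Q (cod w) & hmt Y (v $$ Fa Q w) x" by auto
 show ?thesis
 proof (cases z)
  case (Fwd f)
  hence "hmt Y v' (x $$ Fa Q f)" using x(2) hmt_trans[OF hmt_sym[OF assms(2)]] by simp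
  thus ?thesis unfolding Cons using x Fwd by auto
 next
  case (Bwd w)
  hence w: "w : W" "dom v = Fo Q (cod w)" "hmt Y (v $$ Fa Q w) x" using x(2) by simp_all
  have "hmt Y (v $$ Fa Q w) (v' $$ Fa Q w)" by (rule hmt_pre[OF assms(2)]) (use W_arr[OF w(1)] w(2) in simp_all)
  hence "hmt Y (v' $$ Fa Q w) x" using hmt_trans[OF hmt_sym] w(3) by blast
  thus ?thesis unfolding Cons using x(1) Bwd w hmt_arr[OF assms(2)] by auto
 qed
qed

lemma zrel_append: "zrel Y (zs @ ys) u v \<longleftrightarrow> (EX x. zrel Y ys u x & zrel Y zs x v)"
proof (induction zs arbitrary: v)
 case Nil
 thus ?case using zrel_right[of Y ys u] hmt_refl zrel_arr by (metis append_Nil zrel.simps(1))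
next
 case (Cons z zs)
 show ?case unfolding append_Cons zrel.simps Cons by blast
qed

lemma zrel_single: "zrel Y [Fwd f] u v \<longleftrightarrow> arr f & (EX x. hmt Y u x & dom x = Fo Q (cod f) & hmt Y v (x $$ Fa Q f))" by auto

lemma zrel_Fwd: "arr f ==> arr u ==> cod u = Y ==> dom u = Fo Q (cod f) ==> zrel Y [Fwd f] u v \<longleftrightarrow> hmt Y v (u $$ Fa Q f)"
proof
 assume f: "arr f" "arr u" "cod u = Y" "dom u = Fo Q (cod f)"
 show "hmt Y v (u $$ Fa Q f)" if v: "zrel Y [Fwd f] u v"
 proof -
  obtain x where x: "hmt Y u x" "hmt Y v (x $$ Fa Q f)" using v unfolding zrel_single by blast
  show ?thesis using hmt_trans[OF x(2) hmt_sym[OF hmt_pre[OF x(1), of "Fa Q f"]]] f by simp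
 qed
 show "zrel Y [Fwd f] u v" if "hmt Y v (u $$ Fa Q f)" using that f hmt_refl[of u Y] unfolding zrel_single by blast
qed

lemma zrel_sound:
 assumes Y: "fibrant_obj Y"
 shows "zz X Z zs zs' ==> dom u = Fo Q Z ==> zrel Y zs u v \<longleftrightarrow> zrel Y zs' u v"
proof (induction arbitrary: u v rule: zigzag_eq.induct)
 case (zz_app X Z zs zs' V ys ys')
 have ty: "zigzag M W Z ys V" using zigzag_eq_typed[OF zz_app.hyps(2)] by blast
 have "(zrel Y ys u x & zrel Y zs x v) \<longleftrightarrow> (zrel Y ys' u x & zrel Y zs' x v)" for x
  using zz_app.IH(2)[OF zz_app.prems, of x] zz_app.IH(1)[of x v] zrel_dom[OF ty _ zz_app.prems, of Y x] by blast
 thus ?case unfolding zrel_append by blast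
next
 case (zz_id X)
 show ?case
 proof
  assume "zrel Y [Fwd (Idt M X)] u v"
  then obtain x where x: "hmt Y u x" "dom x = Fo Q X" "hmt Y v (x $$ Fa Q (Idt M X))" using zz_id unfolding zrel_single by auto
  hence "hmt Y v x" using hmt_arr[OF x(1)] zz_id Q_id[of X] by simp
  from hmt_trans[OF x(1) hmt_sym[OF this]] show "zrel Y [] u v" by simp
 next
  assume h: "zrel Y [] u v"
  hence "arr u" "cod u = Y" using hmt_arr[of Y u v] by simp_all
  moreover have "hmt Y v u" using h hmt_sym by simp
  ultimately show "zrel Y [Fwd (Idt M X)] u v" using zrel_Fwd[of "Idt M X" u Y v] zz_id Q_id[of X] by simp
 qed
next
 case (zz_comp f X X' g Z)
 have a: "arr f" "dom f = X" "cod f = X'" "arr g" "dom g = X'" "cod g = Z" using zz_comp by (simp_all add: hom_iff)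
 show ?case
 proof (cases "arr u & cod u = Y")
  case True
  hence u: "arr u" "cod u = Y" "dom u = Fo Q (cod g)" using zz_comp.prems a(6) by simp_all
  have ug: "arr (u $$ Fa Q g)" "cod (u $$ Fa Q g) = Y" "dom (u $$ Fa Q g) = Fo Q (cod f)" using u a by simp_all
  have e: "(u $$ Fa Q g) $$ Fa Q f = u $$ Fa Q (g $$ f)"
  using comp_assoc[of "Fa Q f" "Fa Q g" u] Q_comp[of f g] u a by simp
  have "zrel Y ([Fwd f] @ [Fwd g]) u v \<longleftrightarrow> (EX x. hmt Y x (u $$ Fa Q g) & zrel Y [Fwd f] x v)"
  unfolding zrel_append zrel_Fwd[OF a(4) u] ..
  also have "... \<longleftrightarrow> zrel Y [Fwd f] (u $$ Fa Q g) v" using zrel_left hmt_refl[OF ug(1,2)] by blast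
  also have "... \<longleftrightarrow> hmt Y v (u $$ Fa Q (g $$ f))" unfolding zrel_Fwd[OF a(1) ug] e ..
  also have "... \<longleftrightarrow> zrel Y [Fwd (g $$ f)] u v" using zrel_Fwd[of "g $$ f" u Y v] u a by simp
  finally show ?thesis by simp
 next
  case False
  thus ?thesis using zrel_arr by blast
 qed
next
 case (zz_inv1 w X X')
 have a: "arr w" "dom w = X" "cod w = X'" using zz_inv1 by (simp_all add: hom_iff)
 show ?case
 proof
  assume "zrel Y [Fwd w, Bwd w] u v"
  then obtain x y where xy: "hmt Y u y" "hmt Y (x $$ Fa Q w) y" "hmt Y v (x $$ Fa Q w)" by auto
  show "zrel Y [] u v" using hmt_trans[OF hmt_trans[OF xy(1) hmt_sym[OF xy(2)]] hmt_sym[OF xy(3)]] by simp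
 next
  assume h: "zrel Y [] u v"
  hence u: "u : Hom M (dom (Fa Q w)) Y" using hmt_arr[of Y u v] zz_inv1(3) a by (simp add: hom_iff)
  obtain x where x: "x : Hom M (cod (Fa Q w)) Y" "hmt Y (x $$ Fa Q w) u" using hbijD(2)[OF Q_hbij[OF zz_inv1(1)] Y u] by blast
  have "hmt Y u v" using h by simp
  from hmt_trans[OF hmt_sym[OF this] hmt_sym[OF x(2)]] have "hmt Y u u" "hmt Y v (x $$ Fa Q w)" using hmt_refl[of u Y] u by (simp_all add: hom_iff)
  thus "zrel Y [Fwd w, Bwd w] u v" using x a zz_inv1(1) by (auto simp: hom_iff)
 qed
next
 case (zz_inv2 w X X')
 have a: "arr w" "dom w = X" "cod w = X'" using zz_inv2 by (simp_all add: hom_iff)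
 show ?case
 proof
  assume "zrel Y [Bwd w, Fwd w] u v"
  then obtain x y where xy: "hmt Y u y" "dom y = Fo Q (cod w)" "hmt Y x (y $$ Fa Q w)" "arr v" "cod v = Y" "dom v = Fo Q (cod w)" "hmt Y (v $$ Fa Q w) x" by auto
  have "hmt Y v y" by (rule hbijD(1)[OF Q_hbij[OF zz_inv2(1)] Y]) (use xy hmt_arr[OF xy(1)] hmt_trans[OF xy(7,3)] a in \<open>simp_all add: hom_iff\<close>)
  from hmt_trans[OF xy(1) hmt_sym[OF this]] show "zrel Y [] u v" by simp
 next
  assume h: "zrel Y [] u v"
  hence u: "hmt Y u v" "arr u" "cod u = Y" "dom u = Fo Q (cod w)" using hmt_arr[of Y u v] zz_inv2(3) a by simp_all
  have "hmt Y (v $$ Fa Q w) (u $$ Fa Q w)" by (rule hmt_sym, rule hmt_pre[OF u(1)]) (use u a in simp_all)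
  moreover have "zrel Y [Fwd w] u (u $$ Fa Q w)" using zrel_Fwd[OF a(1) u(2-4)] hmt_refl[of "u $$ Fa Q w" Y] u a by simp
  ultimately show "zrel Y [Bwd w, Fwd w] u v" unfolding zrel.simps(2)[of _ "Bwd w"] using zz_inv2(1) hmt_arr[OF u(1)] u(4) by auto
 qed
qed (auto simp: zigzag_ends)

lemma heq_hmt:
 assumes h: "heq f g" and B: "cofibrant_obj (dom f)" and Y: "fibrant_obj (cod f)" shows "hmt (cod f) f g"
proof -
 let ?Y = "cod f"
 have a: "arr f" "arr g" "dom g = dom f" "cod g = ?Y" "?Y : Obj M" "dom f : Obj M" and z: "zz (dom f) ?Y [Fwd f] [Fwd g]" using h by (simp_all add: heq_def)
 have "zrel ?Y [Fwd f] (q ?Y) (q ?Y $$ Fa Q f)" using zrel_Fwd[of f "q ?Y" ?Y] a hmt_refl[of "q ?Y $$ Fa Q f" ?Y] by simp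
 hence "zrel ?Y [Fwd g] (q ?Y) (q ?Y $$ Fa Q f)" using zrel_sound[OF Y z, of "q ?Y"] a by simp
 hence "hmt ?Y (q ?Y $$ Fa Q f) (q ?Y $$ Fa Q g)" using zrel_Fwd[of g "q ?Y" ?Y] a by simp
 hence "hmt ?Y (f $$ q (dom f)) (g $$ q (dom f))" using q_nat[of f] q_nat[of g] a by simp
 moreover have "hbij (q (dom f))" by (rule hbij_weq) (use a B Q_cof q_W in simp_all)
 ultimately show ?thesis using hbijD(1)[of "q (dom f)" ?Y f g] Y a by (simp add: hom_iff)
qed

text \<open>The model category is saturated: maps that become isomorphisms in the homotopy category are weak equivalences.\<close>

lemma saturated:
 assumes f: "f : Hom M A B" and k: "zz A A ([Fwd f] @ k) []" and k': "zz B B (k @ [Fwd f]) []" shows "f : W"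
proof -
 have fa: "arr f" "dom f = A" "cod f = B" "A : Obj M" "B : Obj M" using f by (auto simp: hom_iff)
 have "hbij (Fa Q f)" unfolding hbij_def
 proof (intro conjI allI impI ballI)
  show "arr (Fa Q f)" using fa by simp
  fix Y assume Y: "fibrant_obj Y"
  {
  fix u v assume "u : Hom M (cod (Fa Q f)) Y" "v : Hom M (cod (Fa Q f)) Y" and h: "hmt Y (u $$ Fa Q f) (v $$ Fa Q f)"
  hence ua: "arr u" "cod u = Y" "dom u = Fo Q (cod f)" "arr v" "cod v = Y" "dom v = Fo Q (cod f)" using fa by (simp_all add: hom_iff)
  have "zrel Y (k @ [Fwd f]) v v" using zrel_sound[OF Y k', of v v] ua fa hmt_refl[of v Y] by simp
  then obtain x where x: "zrel Y [Fwd f] v x" "zrel Y k x v" unfolding zrel_append by blast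
  have "hmt Y x (v $$ Fa Q f)" using x(1) zrel_Fwd[OF fa(1) ua(4-6)] by simp
  hence "hmt Y x (u $$ Fa Q f)" using h hmt_sym hmt_trans by blast
  hence "zrel Y [Fwd f] u x" using zrel_Fwd[OF fa(1) ua(1-3)] by simp
  hence "zrel Y (k @ [Fwd f]) u v" using x(2) unfolding zrel_append by blast
  thus "hmt Y u v" using zrel_sound[OF Y k', of u v] ua fa by simp
  next
  fix u assume "u : Hom M (dom (Fa Q f)) Y"
  hence ua: "arr u" "cod u = Y" "dom u = Fo Q A" using fa by (simp_all add: hom_iff)
  have "zrel Y ([Fwd f] @ k) u u" using zrel_sound[OF Y k, of u u] ua hmt_refl[of u Y] by simp
  then obtain x where x: "zrel Y k u x" "zrel Y [Fwd f] x u" unfolding zrel_append by blast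
  then obtain y where y: "hmt Y x y" "dom y = Fo Q (cod f)" "hmt Y u (y $$ Fa Q f)" unfolding zrel_single by blast
  thus "EX v:Hom M (cod (Fa Q f)) Y. hmt Y (v $$ Fa Q f) u" using hmt_sym[OF y(3)] hmt_arr[OF y(1)] fa by (intro bexI[of _ y]) (simp_all add: hom_iff)
  }
 qed
 moreover obtain t where "terminal M t" using R_fib[OF fa(4)] by (auto simp: fibrant_def)
 ultimately have "Fa Q f : W" using hbij_imp_weq[of t "Fa Q f"] Q_cof fa by simp
 hence "q B $$ Fa Q f : W" using W_comp[of "Fa Q f" "q B"] q_W fa by simp
 hence "f $$ q A : W" using q_nat[OF fa(1)] fa by simp
 thus ?thesis using W_cancel_right[of "q A" f] q_W fa by simp
qed

end

lemma (in smc) ho_arr_eq: assumes f: "f : Hom M X Y" and g: "g : Hom M X Y" and e: "ho_arr M W f = ho_arr M W g" shows "heq f g"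
proof -
 have a: "arr f" "dom f = X" "cod f = Y" "arr g" "dom g = X" "cod g = Y" using f g by (simp_all add: hom_iff)
 have s: "{zs'. zz X Y [Fwd f] zs'} = {zs'. zz X Y [Fwd g] zs'}" using e a by (simp add: ho_arr_def ho_class_def)
 have "[Fwd g] : {zs'. zz X Y [Fwd g] zs'}" using zz_refl[OF zigzag_single(1)[OF g]] by simp
 hence "zz X Y [Fwd f] [Fwd g]" unfolding s[symmetric] by simp
 thus ?thesis using a by (simp add: heq_def)
qed

lemma (in smc) ho_iso:
 assumes f: "f : Hom M X Y" and i: "is_iso (Ho M W) (ho_arr M W f)"
 shows "EX k. zz X X ([Fwd f] @ k) [] & zz Y Y (k @ [Fwd f]) []"
proof -
 have fa: "arr f" "dom f = X" "cod f = Y" using f by (simp_all add: hom_iff)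
 let ?f = "(X, {zs'. zz X Y [Fwd f] zs'}, Y)"
 have hf: "ho_arr M W f = ?f" using fa by (simp add: ho_arr_def ho_class_def)
 have ends: "Dom (Ho M W) ?f = X" "Cod (Ho M W) ?f = Y" by (simp_all add: Ho_def)
 obtain g where g: "g : Hom (Ho M W) Y X" "Cmp (Ho M W) g ?f = Idt (Ho M W) X" "Cmp (Ho M W) ?f g = Idt (Ho M W) Y"
  using i unfolding hf is_iso_def ends by blast
 have "g : Arr (Ho M W)" "Dom (Ho M W) g = Y" "Cod (Ho M W) g = X" using g(1) by (simp_all add: Hom_def)
 then obtain k where k: "g = (Y, {zs'. zz Y X k zs'}, X)" "zigzag M W Y k X" by (auto simp: Ho_def ho_class_def)
 have r: "zz X Y [Fwd f] [Fwd f]" "zz Y X k k" "zz X X ([Fwd f] @ k) ([Fwd f] @ k)" "zz Y Y (k @ [Fwd f]) (k @ [Fwd f])"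
  using zz_refl[OF zigzag_single(1)[OF f]] zz_refl[OF k(2)] zz_refl[OF zigzag_append[OF zigzag_single(1)[OF f] k(2)]]
  zz_refl[OF zigzag_append[OF k(2) zigzag_single(1)[OF f]]] by simp_all
 have "{zs''. EX zs:{zs'. zz X Y [Fwd f] zs'}. EX zs':{zs'. zz Y X k zs'}. zz X X (zs @ zs') zs''} = {zs'. zz X X [] zs'}"
  using g(2) unfolding k(1) by (simp add: Ho_def ho_class_def)
 hence "zz X X [] ([Fwd f] @ k)" using r(1-3) by blast
 moreover have "{zs''. EX zs:{zs'. zz Y X k zs'}. EX zs':{zs'. zz X Y [Fwd f] zs'}. zz Y Y (zs @ zs') zs''} = {zs'. zz Y Y [] zs'}"
  using g(3) unfolding k(1) by (simp add: Ho_def ho_class_def)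
 hence "zz Y Y [] (k @ [Fwd f])" using r(1,2,4) by blast
 ultimately show ?thesis by (intro exI[of _ k] conjI) (rule zz_sym, assumption)+
qed

section \<open>Homotopy idempotent functors are localizations\<close>

locale idempotent_functor = approximations M T E Q R q r + endofunctor M L \<eta>
 for M :: "('o, 'a) category" and T :: "'a model_structure" and E :: "('o, 'a, 'u) simplicial_enrichment"
  and Q R q r and L :: "('o, 'a, 'o, 'a) cfunctor" and \<eta> :: "'o => 'a" +
 assumes canon: "canonical_model_structure_exists TYPE('u) M T" and Lw: "preserves_weq T L" and idem: "idempotent_in_Ho M T L \<eta>"
begin

lemma L_W: "w : W ==> Fa L w : W" using Lw by (simp add: preserves_weq_def)

lemma \<eta>_hom: "X : Obj M ==> \<eta> X : Hom M X (Fo L X)" by (simp add: hom_iff)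

lemma idem_heq: "X : Obj M ==> heq (\<eta> (Fo L X)) (Fa L (\<eta> X))"
 using idem ho_arr_eq[OF \<eta>_hom[OF L_obj] L_hom[OF \<eta>_hom]] unfolding idempotent_in_Ho_def by blast

lemma \<eta>L_W: assumes X: "X : Obj M" shows "\<eta> (Fo L X) : W"
proof -
 have "is_iso (Ho M W) (ho_arr M W (\<eta> (Fo L X)))" using idem X unfolding idempotent_in_Ho_def by simp
 from ho_iso[OF \<eta>_hom[OF L_obj[OF X]] this] show ?thesis using saturated[OF \<eta>_hom[OF L_obj[OF X]]] by blast
qed

lemma \<eta>_W_iff: assumes w: "w : W" shows "\<eta> (dom w) : W \<longleftrightarrow> \<eta> (cod w) : W"
proof -
 have wa: "arr w" by (rule W_arr[OF w])
 have e: "\<eta> (cod w) $$ w = Fa L w $$ \<eta> (dom w)" by (rule \<eta>_nat[OF wa])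
 have "\<eta> (dom w) : W \<longleftrightarrow> Fa L w $$ \<eta> (dom w) : W" using W_comp[of "\<eta> (dom w)" "Fa L w"] W_cancel_left[of "\<eta> (dom w)" "Fa L w"] L_W[OF w] wa by auto
 also have "... \<longleftrightarrow> \<eta> (cod w) : W" unfolding e[symmetric] using W_comp[of w "\<eta> (cod w)"] W_cancel_right[of w "\<eta> (cod w)"] w wa by auto
 finally show ?thesis .
qed

lemma \<eta>_W_weakly_equivalent: assumes "weakly_equivalent M T X Y" shows "\<eta> X : W \<longleftrightarrow> \<eta> Y : W"
proof -
 have "equivclp (%A B. EX w:W. w : Hom M A B) X Y" using assms by (simp add: weakly_equivalent_def)
 thus ?thesis
 proof (induction rule: equivclp_induct)
  case (step A B)
  thus ?case using \<eta>_W_iff by (auto simp: hom_iff)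
 qed simp
qed

definition RL where "RL = \<lparr>Fo = (%X. Fo R (Fo L X)), Fa = (%f. Fa R (Fa L f))\<rparr>"
definition r\<eta> where "r\<eta> X = r (Fo L X) $$ \<eta> X"

sublocale R: endofunctor M R r
 by unfold_locales (use R in \<open>simp_all add: functorial_fibrant_approximation_def\<close>)

lemma RL_functor: "is_functor M M RL"
proof -
 have "Fa R (Fa L (Cmp M g f)) = Cmp M (Fa R (Fa L g)) (Fa R (Fa L f))" if "f : Hom M X Y" "g : Hom M Y Z" for X Y Z f g
  using that L_comp[of f g] R.L_comp[of "Fa L f" "Fa L g"] by (simp add: hom_iff)
 thus ?thesis unfolding is_functor_def RL_def by (auto intro!: R.L_hom L_hom)
qed

lemma R_W: assumes w: "w : W" shows "Fa R w : W"
proof -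
 have wa: "arr w" by (rule W_arr[OF w])
 have "r (cod w) $$ w : W" using W_comp[of w "r (cod w)"] w wa r_W[of "cod w"] by simp
 thus ?thesis using W_cancel_right[of "r (dom w)" "Fa R w"] R.\<eta>_nat[OF wa] wa r_W[of "dom w"] by simp
qed

lemma RL_W: "preserves_weq T RL" unfolding preserves_weq_def RL_def using L_W R_W by simp

lemma r\<eta>_nat_trans: "nat_trans M M id_functor RL r\<eta>"
 unfolding nat_trans_def
proof (intro conjI allI impI ballI)
 show "r\<eta> X : Hom M (Fo id_functor X) (Fo RL X)" if "X : Obj M" for X using that by (simp add: RL_def r\<eta>_def id_functor_def hom_iff)
 fix X Y f assume "f : Hom M X Y"
 hence f: "arr f" "dom f = X" "cod f = Y" "X : Obj M" "Y : Obj M" by (auto simp: hom_iff)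
 have "(r (Fo L Y) $$ \<eta> Y) $$ f = r (Fo L Y) $$ Fa L f $$ \<eta> X" using f comp_assoc[of f "\<eta> Y" "r (Fo L Y)"] \<eta>_nat[of f] by simp
 also have "... = (Fa R (Fa L f) $$ r (Fo L X)) $$ \<eta> X"
  using f comp_assoc[of "\<eta> X" "Fa L f" "r (Fo L Y)"] R.\<eta>_nat[of "Fa L f"] by simp
 also have "... = Fa R (Fa L f) $$ r (Fo L X) $$ \<eta> X" using f by (intro comp_assoc) simp_all
 finally show "r\<eta> Y $$ Fa id_functor f = Fa RL f $$ r\<eta> X" by (simp add: RL_def r\<eta>_def id_functor_def)
qed

sublocale N: endofunctor M RL r\<eta> by unfold_locales (rule RL_functor r\<eta>_nat_trans)+

text \<open>For \<open>e = Q \<eta>\<^sub>X\<close> an inverse of \<open>R L e\<close> as required by \<open>pre_weq\<close> is represented by an actual map: the composite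
 \<open>Q L X \<rightarrow> L X \<rightarrow> R L X\<close> is lifted through \<open>R L q\<^sub>X\<close>, which becomes a trivial fibration after a trivial cofibration with a
 retraction. Both conditions reduce to \<open>\<eta>\<^sub>L\<^sub>X = L \<eta>\<^sub>X\<close> in the homotopy category.\<close>

lemma eta_orthogonal:
 assumes X: "X : Obj M" and F: "fibrant_obj F" and \<eta>F: "\<eta> F : W"
 shows "sset_weq (Map (Fo Q (Fo L X)) F) (Map (Fo Q X) F) (smap_pre M E (Fa Q (\<eta> X)) F)"
proof -
 interpret path_objects M T E F by unfold_locales (rule F)
 let ?LX = "Fo L X"
 let ?A = "Fo Q X" and ?B = "Fo Q ?LX" and ?e = "Fa Q (\<eta> X)" and ?v = "Fa RL (q X)"
 have O: "?LX : Obj M" "?A : Obj M" "?B : Obj M" "Fo RL ?A : Obj M" using X by simp_all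
 have A: "cofibrant_obj ?A" and B: "cofibrant_obj ?B" using Q_cof X by simp_all
 have e: "?e : Hom M ?A ?B" using Q_hom[OF \<eta>_hom[OF X]] .
 have ea: "arr ?e" "dom ?e = ?A" "cod ?e = ?B" using e by (simp_all add: hom_iff)
 have RLf: "fibrant_obj (Fo RL Z)" if "Z : Obj M" for Z using R_fib[of "Fo L Z"] that by (simp add: RL_def)
 have va: "arr ?v" "dom ?v = Fo RL ?A" "cod ?v = Fo RL X" "?v : W" using X RL_W q_W[OF X] by (simp_all add: preserves_weq_def)
 have ww: "r ?LX : Hom M ?LX (Fo RL X)" using X by (simp add: RL_def hom_iff)
 have rw: "arr (r ?LX)" "dom (r ?LX) = ?LX" "cod (r ?LX) = Fo RL X" using ww by (simp_all add: hom_iff)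
 let ?w = "r ?LX $$ q ?LX"
 have wa: "arr ?w" "dom ?w = ?B" "cod ?w = Fo RL X" using rw O by simp_all
 obtain i p where ip: "i : Cof T" "i : W" "p : Fib T" "arr i" "arr p" "dom i = dom ?v" "cod p = cod ?v" "cod i = dom p" "p $$ i = ?v"
  by (rule factor_tcof_fib[OF va(1)])
 have pW: "p : W" using W_cancel_right[of i p] ip va by simp
 let ?Z = "dom p"
 have ZO: "?Z : Obj M" using ip(5) by simp
 obtain s where s: "s : Hom M ?Z (Fo RL ?A)" "s $$ i = Idt M (Fo RL ?A)"
  using fibrant_extend[OF RLf[OF O(2)] ip(1,2), of "Idt M (Fo RL ?A)"] ip(6,8) va O by (auto simp: hom_iff)
 have sa: "arr s" "dom s = ?Z" "cod s = Fo RL ?A" using s by (simp_all add: hom_iff)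
 obtain b0 where b0: "b0 : Hom M ?B ?Z" "p $$ b0 = ?w"
  using cofibrant_lift[OF B ip(3) pW, of ?w] wa ip(7) va by (auto simp: hom_iff)
 have b0a: "arr b0" "dom b0 = ?B" "cod b0 = ?Z" using b0 by (simp_all add: hom_iff)
 let ?b = "s $$ b0"
 have ba: "arr ?b" "dom ?b = ?B" "cod ?b = Fo RL ?A" using sa b0a by simp_all
 have is1: "heq (i $$ s) (Idt M ?Z)"
 proof (rule heq_cancel_pre[OF ip(2)])
  have "(i $$ s) $$ i = i" using comp_assoc[of i s i] s(2) sa ip(4,6,8) va by simp
  thus "heq ((i $$ s) $$ i) (Idt M ?Z $$ i)" using heq_refl ip(4,8) by simp
 qed (use sa ip(4,6,8) va ZO in simp_all)
 have vb: "heq (?v $$ ?b) ?w"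
 proof -
  have "?v $$ ?b = p $$ ((i $$ s) $$ b0)" unfolding ip(9)[symmetric] using ip(4-8) va sa b0a by (simp add: comp_assoc)
  moreover have "heq (p $$ ((i $$ s) $$ b0)) (p $$ (Idt M ?Z $$ b0))"
  by (intro heq_comp heq_refl is1) (use ip(4-8) va sa b0a in simp_all)
  ultimately show ?thesis using b0 b0a by simp
 qed
 have rn: "r\<eta> Z : Hom M Z (Fo RL Z)" if "Z : Obj M" for Z using that by (simp add: hom_iff)
 have 1: "heq (?b $$ ?e) (r\<eta> ?A)"
 proof (rule heq_cancel_post[OF va(4)])
  have "?v $$ (?b $$ ?e) = (?v $$ ?b) $$ ?e" using va ba ea by (simp add: comp_assoc)
  also have "heq ((?v $$ ?b) $$ ?e) (?w $$ ?e)" by (rule heq_comp[OF heq_refl[OF ea(1)] vb]) (use va ba ea in simp)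
  also have "?w $$ ?e = r ?LX $$ (\<eta> X $$ q X)" using comp_assoc[of ?e "q ?LX" "r ?LX"] q_nat[of "\<eta> X"] rw ea X O by simp
  also have "... = r\<eta> X $$ q X" unfolding r\<eta>_def using rw X by (simp add: comp_assoc)
  also have "... = ?v $$ r\<eta> ?A" using N.\<eta>_nat[of "q X"] X by simp
  finally show "heq (?v $$ (?b $$ ?e)) (?v $$ r\<eta> ?A)" .
 qed (use va ba ea O in simp_all)
 let ?v' = "Fa RL (q ?LX)"
 have va': "arr ?v'" "dom ?v' = Fo RL ?B" "cod ?v' = Fo RL ?LX" "?v' : W" using O RL_W q_W[OF O(1)] by (simp_all add: preserves_weq_def)
 have Le: "arr (Fa RL ?e)" "dom (Fa RL ?e) = Fo RL ?A" "cod (Fa RL ?e) = Fo RL ?B" using ea by simp_all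
 have Lh: "arr (Fa RL (\<eta> X))" "dom (Fa RL (\<eta> X)) = Fo RL X" "cod (Fa RL (\<eta> X)) = Fo RL ?LX" using X by simp_all
 have 2: "heq (Fa RL ?e $$ ?b) (r\<eta> ?B)"
 proof (rule heq_cancel_post[OF va'(4)])
  have "?v' $$ (Fa RL ?e $$ ?b) = (?v' $$ Fa RL ?e) $$ ?b" using va' Le ba by (simp add: comp_assoc)
  also have "?v' $$ Fa RL ?e = Fa RL (\<eta> X) $$ ?v"
  using N.L_comp[of ?e "q ?LX"] N.L_comp[of "q X" "\<eta> X"] q_nat[of "\<eta> X"] ea X O by simp
  also have "(Fa RL (\<eta> X) $$ ?v) $$ ?b = Fa RL (\<eta> X) $$ (?v $$ ?b)" using Lh va ba by (intro comp_assoc) simp_all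
  also have "heq (Fa RL (\<eta> X) $$ (?v $$ ?b)) (Fa RL (\<eta> X) $$ ?w)" by (rule heq_comp[OF vb heq_refl[OF Lh(1)]]) (use va ba Lh in simp)
  also have "Fa RL (\<eta> X) $$ ?w = r (Fo L ?LX) $$ (Fa L (\<eta> X) $$ q ?LX)"
  using R.\<eta>_nat[of "Fa L (\<eta> X)"] X O rw Lh comp_assoc[of "q ?LX" "r ?LX" "Fa RL (\<eta> X)"] comp_assoc[of "q ?LX" "Fa L (\<eta> X)" "r (Fo L ?LX)"]
  by (simp add: RL_def)
  also have "heq (r (Fo L ?LX) $$ (Fa L (\<eta> X) $$ q ?LX)) (r (Fo L ?LX) $$ (\<eta> ?LX $$ q ?LX))"
  by (intro heq_comp heq_refl heq_sym[OF idem_heq[OF X]]) (use X O in simp_all)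
  also have "r (Fo L ?LX) $$ (\<eta> ?LX $$ q ?LX) = r\<eta> ?LX $$ q ?LX" unfolding r\<eta>_def using O by (simp add: comp_assoc)
  also have "... = ?v' $$ r\<eta> ?B" using N.\<eta>_nat[of "q ?LX"] O by simp
  finally show "heq (?v' $$ (Fa RL ?e $$ ?b)) (?v' $$ r\<eta> ?B)" .
 qed (use va' Le ba O in simp_all)
 have h1: "hmt (Fo RL ?A) (?b $$ ?e) (r\<eta> ?A)" using heq_hmt[OF 1] A RLf[OF O(2)] ba ea by simp
 have h2: "hmt (Fo RL ?B) (Fa RL ?e $$ ?b) (r\<eta> ?B)" using heq_hmt[OF 2] B RLf[OF O(3)] ba Le by simp
 have FO: "F : Obj M" by simp
 have "r\<eta> F : W" unfolding r\<eta>_def using W_comp[of "\<eta> F" "r (Fo L F)"] \<eta>F r_W[of "Fo L F"] FO by simp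
 from pre_weq_canonical[OF canon RL_functor r\<eta>_nat_trans RL_W this A B e, of ?b] show ?thesis
  using h1 h2 ba ea Le by (simp add: hmt_def hom_iff)
qed

primrec Lzig :: "'a zig => 'a zig" where
 "Lzig (Fwd f) = Fwd (Fa L f)" | "Lzig (Bwd w) = Bwd (Fa L w)"

lemma zigzag_L: "zigzag M W X zs Y ==> zigzag M W (Fo L X) (map Lzig zs) (Fo L Y)"
 by (induction rule: zigzag.induct) (auto intro!: zigzag.intros L_hom L_W L_obj)

lemma zz_L: "zz X Y zs zs' ==> zz (Fo L X) (Fo L Y) (map Lzig zs) (map Lzig zs')"
proof (induction rule: zigzag_eq.induct)
 case (zz_refl X zs Y)
 thus ?case by (intro zigzag_eq.zz_refl zigzag_L)
next
 case (zz_sym X Y zs zs')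
 show ?case by (rule zigzag_eq.zz_sym[OF zz_sym.IH])
next
 case (zz_trans X Y zs zs' zs'')
 show ?case by (rule zigzag_eq.zz_trans[OF zz_trans.IH])
next
 case (zz_app X Y zs zs' Z ys ys')
 show ?case unfolding map_append by (rule zigzag_eq.zz_app[OF zz_app.IH])
next
 case (zz_comp f X Y g Z)
 thus ?case using zigzag_eq.zz_comp[OF L_hom[OF zz_comp(1)] L_hom[OF zz_comp(2)], of W] L_comp[of f g] by (simp add: hom_iff)
qed (use zigzag_eq.zz_id[OF L_obj, of _ W] zigzag_eq.zz_inv1[OF L_W L_hom] zigzag_eq.zz_inv2[OF L_W L_hom] in simp_all)

lemma zz_nat: "zigzag M W X zs Y ==> zz X (Fo L Y) (zs @ [Fwd (\<eta> Y)]) ([Fwd (\<eta> X)] @ map Lzig zs)"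
proof (induction rule: zigzag.induct)
 case (zigzag_Nil X)
 thus ?case using zz_refl[OF zigzag_single(1)[OF \<eta>_hom]] by simp
next
 case (zigzag_Fwd f X Y zs Z)
 have a: "arr f" "dom f = X" "cod f = Y" "X : Obj M" "Y : Obj M" using zigzag_Fwd by (auto simp: hom_iff)
 note Lz = zigzag_L[OF zigzag_Fwd(2)]
 have "zz X (Fo L Z) ([Fwd f] @ (zs @ [Fwd (\<eta> Z)])) ([Fwd f] @ ([Fwd (\<eta> Y)] @ map Lzig zs))"
  by (rule zz_app[OF zz_refl[OF zigzag_single(1)[OF zigzag_Fwd(1)]] zigzag_Fwd(3)])
 also have "zz X (Fo L Z) ([Fwd f] @ ([Fwd (\<eta> Y)] @ map Lzig zs)) ([Fwd (\<eta> X), Fwd (Fa L f)] @ map Lzig zs)"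
 proof -
  have "zz X (Fo L Y) [Fwd f, Fwd (\<eta> Y)] [Fwd (\<eta> Y $$ f)]" by (rule zz_comp[OF zigzag_Fwd(1) \<eta>_hom[OF a(5)]])
  also have "zz X (Fo L Y) [Fwd (\<eta> Y $$ f)] [Fwd (\<eta> X), Fwd (Fa L f)]"
  using zz_sym[OF zz_comp[OF \<eta>_hom[OF a(4)] L_hom[OF zigzag_Fwd(1)], of W]] \<eta>_nat[OF a(1)] a by simp
  finally show ?thesis using zz_app[OF _ zz_refl[OF Lz]] by fastforce
 qed
 finally show ?case by simp
next
 case (zigzag_Bwd w Y X zs Z)
 have a: "arr w" "dom w = Y" "cod w = X" "X : Obj M" "Y : Obj M" using zigzag_Bwd by (auto simp: hom_iff)
 note Lz = zigzag_L[OF zigzag_Bwd(3)] and b = zigzag_single(2)[OF zigzag_Bwd(1,2)]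
 note Lb = zigzag_single(2)[OF L_W[OF zigzag_Bwd(1)] L_hom[OF zigzag_Bwd(2)]]
 have bw: "zz X (Fo L Y) ([Bwd w] @ [Fwd (\<eta> Y)]) ([Fwd (\<eta> X)] @ [Bwd (Fa L w)])"
 proof -
  have yw: "zigzag M W X [Bwd w, Fwd (\<eta> Y)] (Fo L Y)" using zigzag_append[OF b zigzag_single(1)[OF \<eta>_hom[OF a(5)]]] by simp
  have "zz X (Fo L Y) ([Bwd w, Fwd (\<eta> Y)] @ []) ([Bwd w, Fwd (\<eta> Y)] @ [Fwd (Fa L w), Bwd (Fa L w)])"
  by (rule zz_app[OF zz_refl[OF yw] zz_sym[OF zz_inv1[OF L_W[OF zigzag_Bwd(1)] L_hom[OF zigzag_Bwd(2)]]]])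
  also have "zz X (Fo L Y) ([Bwd w, Fwd (\<eta> Y)] @ [Fwd (Fa L w), Bwd (Fa L w)]) ([Bwd w] @ [Fwd w, Fwd (\<eta> X)] @ [Bwd (Fa L w)])"
  proof -
  have "zz Y (Fo L X) [Fwd (\<eta> Y), Fwd (Fa L w)] [Fwd (\<eta> X $$ w)]"
  using zz_comp[OF \<eta>_hom[OF a(5)] L_hom[OF zigzag_Bwd(2)], of W] \<eta>_nat[OF a(1)] a by simp
  also have "zz Y (Fo L X) [Fwd (\<eta> X $$ w)] [Fwd w, Fwd (\<eta> X)]" by (rule zz_sym[OF zz_comp[OF zigzag_Bwd(2) \<eta>_hom[OF a(4)]]])
  finally have "zz X (Fo L Y) ([Bwd w] @ [Fwd (\<eta> Y), Fwd (Fa L w)] @ [Bwd (Fa L w)]) ([Bwd w] @ [Fwd w, Fwd (\<eta> X)] @ [Bwd (Fa L w)])"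
  by (rule zz_context[OF _ b Lb])
  thus ?thesis by simp
  qed
  also have "zz X (Fo L Y) ([Bwd w] @ [Fwd w, Fwd (\<eta> X)] @ [Bwd (Fa L w)]) ([Fwd (\<eta> X)] @ [Bwd (Fa L w)])"
  using zz_app[OF zz_inv2[OF zigzag_Bwd(1,2)] zz_refl[OF zigzag_append[OF zigzag_single(1)[OF \<eta>_hom[OF a(4)]] Lb]]] by simp
  finally show ?thesis by simp
 qed
 have "zz X (Fo L Z) ([Bwd w] @ (zs @ [Fwd (\<eta> Z)])) ([Bwd w] @ ([Fwd (\<eta> Y)] @ map Lzig zs))"
  by (rule zz_app[OF zz_refl[OF b] zigzag_Bwd(4)])
 also have "zz X (Fo L Z) ([Bwd w] @ ([Fwd (\<eta> Y)] @ map Lzig zs)) (([Fwd (\<eta> X)] @ [Bwd (Fa L w)]) @ map Lzig zs)"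
  using zz_app[OF bw zz_refl[OF Lz]] by simp
 finally show ?case by simp
qed

text \<open>A left inverse \<open>k\<close> of \<open>\<eta>\<^sub>F\<close> in the homotopy category is a right inverse as well:
 \<open>\<eta>\<^sub>F k = L k \<cdot> \<eta>\<^sub>L\<^sub>F = L k \<cdot> L \<eta>\<^sub>F = L (k \<eta>\<^sub>F) = 1\<close>.\<close>

lemma \<eta>_W_if_left_inverse:
 assumes F: "F : Obj M" and k: "zigzag M W (Fo L F) k F" and e: "zz F F ([Fwd (\<eta> F)] @ k) []" shows "\<eta> F : W"
proof (rule saturated[OF \<eta>_hom[OF F] e])
 have "zz (Fo L F) (Fo L F) (k @ [Fwd (\<eta> F)]) ([Fwd (\<eta> (Fo L F))] @ map Lzig k)" by (rule zz_nat[OF k])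
 also have "zz (Fo L F) (Fo L F) ([Fwd (\<eta> (Fo L F))] @ map Lzig k) ([Fwd (Fa L (\<eta> F))] @ map Lzig k)"
  by (rule zz_app[OF _ zz_refl[OF zigzag_L[OF k]]]) (use idem_heq[OF F] F in \<open>simp add: heq_def\<close>)
 also have "zz (Fo L F) (Fo L F) ([Fwd (Fa L (\<eta> F))] @ map Lzig k) []" using zz_L[OF e] by simp
 finally show "zz (Fo L F) (Fo L F) (k @ [Fwd (\<eta> F)]) []" .
qed

lemma \<eta>_W_if_local:
 assumes F: "fibrant_obj F" and l: "homotopy_orthogonal M E Q R (\<eta> F) F" shows "\<eta> F : W"
proof -
 have FO: "F : Obj M" using F by (rule fibrant_obj)
 let ?LF = "Fo L F" and ?e = "Fa Q (\<eta> F)" and ?RF = "Fo R F"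
 have O: "?LF : Obj M" "?RF : Obj M" "Fo Q F : Obj M" "Fo Q ?LF : Obj M" using FO by simp_all
 have e: "arr ?e" "dom ?e = Fo Q F" "cod ?e = Fo Q ?LF" using FO by simp_all
 have w: "sset_weq (Map (Fo Q ?LF) ?RF) (Map (Fo Q F) ?RF) (smap_pre M E ?e ?RF)" using l FO by (simp add: homotopy_orthogonal_def hmap_def)
 let ?rq = "r F $$ q F"
 have rq: "arr ?rq" "dom ?rq = Fo Q F" "cod ?rq = ?RF" using FO by simp_all
 obtain x where x: "x : Simp (Map (Fo Q ?LF) ?RF) 0" "same_component (Map (Fo Q F) ?RF) (pre ?e ?RF 0 x) (SArr E ?rq)"
  using sset_weq_component_surj[OF w Map_sset Map_sset, of "SArr E ?rq"] O rq by auto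
 obtain g where g: "g : Hom M (Fo Q ?LF) ?RF" "x = SArr E g" using SArr_surj[OF O(4,2) x(1)] by blast
 have ga: "arr g" "dom g = Fo Q ?LF" "cod g = ?RF" using g by (simp_all add: hom_iff)
 have "hmt ?RF (g $$ ?e) ?rq" using x(2) g(2) ga e rq by (simp add: hmt_def pre_SArr)
 hence h: "heq (g $$ ?e) ?rq" using hmt_heq[OF R_fib[OF FO]] by blast
 have qF: "q F : W" "q F : Hom M (Fo Q F) F" and qL: "q ?LF : W" "q ?LF : Hom M (Fo Q ?LF) ?LF" and rF: "r F : W" "r F : Hom M F ?RF"
  using q_W r_W FO O by (simp_all add: hom_iff)
 have eh: "?e : Hom M (Fo Q F) (Fo Q ?LF)" using e by (simp add: hom_iff)
 note Z = zigzag_single(1)[OF qF(2)] zigzag_single(2)[OF qF] zigzag_single(1)[OF qL(2)] zigzag_single(2)[OF qL]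
  zigzag_single(1)[OF rF(2)] zigzag_single(2)[OF rF] zigzag_single(1)[OF g(1)] zigzag_single(1)[OF eh] zigzag_single(1)[OF \<eta>_hom[OF FO]]
 let ?k = "[Bwd (q ?LF)] @ [Fwd g] @ [Bwd (r F)]"
 have k: "zigzag M W ?LF ?k F" by (intro zigzag_append[OF Z(4)] zigzag_append[OF Z(7)] Z(6))
 have gr: "zigzag M W (Fo Q ?LF) ([Fwd g] @ [Bwd (r F)]) F" by (rule zigzag_append[OF Z(7,6)])
 have "zz F F ([] @ ([Fwd (\<eta> F)] @ ?k)) ([Bwd (q F), Fwd (q F)] @ ([Fwd (\<eta> F)] @ ?k))"
  by (rule zz_app[OF zz_sym[OF zz_inv2[OF qF]] zz_refl[OF zigzag_append[OF Z(9) k]]])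
 also have "[Bwd (q F), Fwd (q F)] @ ([Fwd (\<eta> F)] @ ?k) = [Bwd (q F)] @ [Fwd (q F), Fwd (\<eta> F)] @ ?k" by simp
 also have "zz F F ([Bwd (q F)] @ [Fwd (q F), Fwd (\<eta> F)] @ ?k) ([Bwd (q F)] @ [Fwd ?e, Fwd (q ?LF)] @ ?k)"
 proof (rule zz_context[OF _ Z(2) k])
  have "zz (Fo Q F) ?LF [Fwd (q F), Fwd (\<eta> F)] [Fwd (\<eta> F $$ q F)]" by (rule zz_comp[OF qF(2) \<eta>_hom[OF FO]])
  also have "zz (Fo Q F) ?LF [Fwd (\<eta> F $$ q F)] [Fwd ?e, Fwd (q ?LF)]"
  using zz_sym[OF zz_comp[OF eh qL(2), of W]] q_nat[of "\<eta> F"] FO by simp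
  finally show "zz (Fo Q F) ?LF [Fwd (q F), Fwd (\<eta> F)] [Fwd ?e, Fwd (q ?LF)]" .
 qed
 also have "[Bwd (q F)] @ [Fwd ?e, Fwd (q ?LF)] @ ?k = ([Bwd (q F)] @ [Fwd ?e]) @ [Fwd (q ?LF), Bwd (q ?LF)] @ ([Fwd g] @ [Bwd (r F)])" by simp
 also have "zz F F ... (([Bwd (q F)] @ [Fwd ?e]) @ [] @ ([Fwd g] @ [Bwd (r F)]))"
  by (rule zz_context[OF zz_inv1[OF qL] zigzag_append[OF Z(2,8)] gr])
 also have "([Bwd (q F)] @ [Fwd ?e]) @ [] @ ([Fwd g] @ [Bwd (r F)]) = [Bwd (q F)] @ [Fwd ?e, Fwd g] @ [Bwd (r F)]" by simp
 also have "zz F F ... ([Bwd (q F)] @ [Fwd (q F), Fwd (r F)] @ [Bwd (r F)])"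
 proof (rule zz_context[OF _ Z(2,6)])
  have "zz (Fo Q F) ?RF [Fwd ?e, Fwd g] [Fwd (g $$ ?e)]" by (rule zz_comp[OF eh g(1)])
  also have "zz (Fo Q F) ?RF [Fwd (g $$ ?e)] [Fwd ?rq]" using h e ga by (simp add: heq_def)
  also have "zz (Fo Q F) ?RF [Fwd ?rq] [Fwd (q F), Fwd (r F)]" by (rule zz_sym[OF zz_comp[OF qF(2) rF(2)]])
  finally show "zz (Fo Q F) ?RF [Fwd ?e, Fwd g] [Fwd (q F), Fwd (r F)]" .
 qed
 also have "[Bwd (q F)] @ [Fwd (q F), Fwd (r F)] @ [Bwd (r F)] = [Bwd (q F), Fwd (q F)] @ [Fwd (r F), Bwd (r F)]" by simp
 also have "zz F F ... ([] @ [])" by (rule zz_app[OF zz_inv2[OF qF] zz_inv1[OF rF]])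
 finally have "zz F F ([Fwd (\<eta> F)] @ ?k) []" by simp
 thus ?thesis by (rule \<eta>_W_if_left_inverse[OF FO k])
qed

lemma localization:
 shows "X : Obj M ==> \<eta> X : orthogonal_maps M E Q R (local_objects M T E Q R (\<eta> ` Obj M))"
  and "X : Obj M ==> fibrant_obj F ==> weakly_equivalent M T F (Fo L X) ==> F : local_objects M T E Q R (\<eta> ` Obj M)"
  and "F : local_objects M T E Q R (\<eta> ` Obj M) ==> EX Y:Obj M. weakly_equivalent M T F (Fo L Y)"
proof -
 show "\<eta> X : orthogonal_maps M E Q R (local_objects M T E Q R (\<eta> ` Obj M))" if "X : Obj M"
  using that by (auto simp: orthogonal_maps_def local_objects_def)
 show "F : local_objects M T E Q R (\<eta> ` Obj M)" if X: "X : Obj M" and F: "fibrant_obj F" and w: "weakly_equivalent M T F (Fo L X)"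
 proof -
  have FO: "F : Obj M" using F by (rule fibrant_obj)
  have "\<eta> F : W" using \<eta>_W_weakly_equivalent[OF w] \<eta>L_W[OF X] by blast
  hence "\<eta> (Fo R F) : W" using \<eta>_W_iff[OF r_W[OF FO]] FO by simp
  note o = eta_orthogonal[OF _ R_fib[OF FO] this]
  have "homotopy_orthogonal M E Q R (\<eta> Z) F" if "Z : Obj M" for Z using o[OF that] that by (simp add: homotopy_orthogonal_def hmap_def)
  thus ?thesis using FO F unfolding local_objects_def by blast
 qed
 show "EX Y:Obj M. weakly_equivalent M T F (Fo L Y)" if "F : local_objects M T E Q R (\<eta> ` Obj M)"
 proof -
  have F: "F : Obj M" "fibrant_obj F" "homotopy_orthogonal M E Q R (\<eta> F) F" using that unfolding local_objects_def by blast+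
  have "\<eta> F : W" by (rule \<eta>_W_if_local[OF F(2,3)])
  hence "equivclp (%A B. EX w:W. w : Hom M A B) F (Fo L F)" using \<eta>_hom[OF F(1)] by (intro r_into_equivclp) blast
  hence "weakly_equivalent M T F (Fo L F)" using F(1) by (simp add: weakly_equivalent_def)
  thus ?thesis using F(1) by blast
 qed
qed

end

theorem theorem2p2:
  fixes M :: "('o, 'a) category"
    and T :: "'a model_structure"
    and E :: "('o, 'a, 'u) simplicial_enrichment"
    and L Q R :: "('o, 'a, 'o, 'a) cfunctor"
    and \<eta> q r :: "'o \<Rightarrow> 'a"
  assumes "universe TYPE('u)"
    and "simplicial_model_category M T E"
    and "cofibrantly_generated TYPE('u) M T"
    and "canonical_model_structure_exists TYPE('u) M T"
    and "functorial_cofibrant_approximation M T Q q"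
    and "functorial_fibrant_approximation M T R r"
    and "is_functor M M L"
    and "nat_trans M M id_functor L \<eta>"
    and "preserves_weq T L"
    and "idempotent_in_Ho M T L \<eta>"
  shows "\<exists>S\<subseteq>Arr M.
           (\<forall>X\<in>Obj M.
              \<eta> X \<in> orthogonal_maps M E Q R (local_objects M T E Q R S) \<and>
              (\<forall>F. fibrant M (Fib T) F \<and> weakly_equivalent M T F (Fo L X) \<longrightarrow>
                   F \<in> local_objects M T E Q R S)) \<and>
           (\<forall>F\<in>local_objects M T E Q R S. \<exists>Y\<in>Obj M. weakly_equivalent M T F (Fo L Y))"
proof -
 interpret smc M T E by (rule smcI) (rule assms)+
 interpret idempotent_functor M T E Q R q r L \<eta> by unfold_locales (rule assms)+
 have "\<eta> ` Obj M \<subseteq> Arr M" by auto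
 thus ?thesis using localization by (intro exI[of _ "\<eta> ` Obj M"]) blast
qed

end
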